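(* Assume (A1), (A2), (B1), (B2), (B3) and (C) (written out in the context), and assume that $f$ is not constant $\mu$-a.s. Suppose that $\bar\lambda(y)>\mu(f)$ for some $y\in E$. Then the function $\bar\lambda$ is constant on $E$. Moreover, there is a choice of $\eta\in(\mu(f),\|f\|)$ in the definition of $f_N$ such that for any $\varepsilon>0$ there is $N$ for which an optimal strategy for $\bar\lambda^{N,c}$ (i.e. a strategy $V$ with $J^{N,c}(x,V)=\bar\lambda^{N,c}(x)$) exists and is $\varepsilon$-optimal for $\bar\lambda$ (i.e. $J(x,V)\ge\bar\lambda(x)-\varepsilon$).
   Context: Setting. $(X_t)$ is a Feller-Markov process with right-continuous, left-limited paths and values in a locally compact space $E$ with metric $\rho$ and Borel $\sigma$-field $\mathcal E$; $(\mathcal F_t)$ is its filtration, $\mathbb P^x,\mathbb E^x$ the law and expectation when started at $x$, $P_t\phi(x)=\mathbb E^x\{\phi(X_t)\}$, $P_t(x,\cdot)=\mathbb P^x\{X_t\in\cdot\}$. $U\subseteq E$ is compact, $f:E\to\mathbb R$ is continuous and bounded, $\|\cdot\|$ is the supremum norm, and the impulse cost $c:E\times U\to\mathbb R$ is continuous, negative and bounded away from zero. A point $z\in U$ is fixed. Impulse strategies. A strategy $V=(\tau_i,\xi_i)_{i\ge1}$ is an increasing (non-decreasing) sequence of stopping times $\tau_i\in[0,\infty]$ and $U$-valued $\mathcal F_{\tau_i}$-measurable random variables $\xi_i$; it is admissible for $x$ if $\tau_i\to\infty$ $\mathbb P^x$-a.s. The controlled process (also denoted $X$, under $\mathbb P^x$)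 is realised on the countable product of the canonical path space $D(\mathbb R^+,E)$ with coordinates $x^1,x^2,\dots$: $x^1$ has the law of the uncontrolled process from $x$; $\tau_n$ is a stopping time, and $\xi_n$ is measurable, with respect to the filtration generated by $x^1,\dots,x^n$; after $\tau_n$ the coordinate $x^{n+1}$ evolves as the uncontrolled process restarted at time $\tau_n$ from $\xi_n$; $X_t=x^n_t$ for $t\in[\tau_{n-1},\tau_n)$, $\tau_0=0$. $X_{\tau_i-}:=x^i_{\tau_i}$ is the state just before the $i$-th impulse. Functionals. $J(x,V)=\liminf_{T\to\infty}\frac1T\mathbb E^x\{\int_0^Tf(X_s)ds+\sum_{i=1}^\infty1_{\tau_i\le T}c(X_{\tau_i-},\xi_i)\}$ and $\bar\lambda(x)=\sup_VJ(x,V)$ over admissible $V$. Let $B_{z,N}$ be the ball with centre $z$ and radius $N$, and for $\eta\in(\mu(f),\|f\|)$, where $\mu(f)=\int f\,d\mu$, put $f_N(x)=f(x)(1-\rho(x,B_{z,N}))^++\eta(1-\rho(x,B_{z,N+1}^c))^+$ ($\rho(x,A)$ is the distance from $x$ to $A$). $J^{N,c}$ is the functional $J$ with $f$ replaced by $f_N$, and $\bar\lambda^{N,c}(x)=\sup_VJ^{N,c}(x,V)$ over admissible $V$. Notation. $\underline c(x)=\inf_{a\in U}c(x,a)$; $D_U=\inf\{s\ge0:X_s\in U\}$ (uncontrolled process). Assumptions. (A1) $P_t\mathcal C_0\subseteq\mathcal C_0$, where $\mathcal C_0$ is the space of continuous bounded functions on $E$ vanishing at infinity. (A2) There are a unique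 probability measure $\mu$ on $\mathcal E$, a function $K:E\to(0,\infty)$ bounded on compacts and $h:[0,\infty)\to\mathbb R_+$ with $\int_0^\infty h(t)dt<\infty$ such that $\|P_t(x,\cdot)-\mu\|_{TV}\le K(x)h(t)$ for all $x\in E$ (total variation norm). Furthermore $\mathbb E^x\{K(X_T)\}<\infty$ for each $T\ge0$, and for any compact $\Gamma\subset E$ and any sets $A_T\in\mathcal F_T$, $\lim_{T\to\infty}\sup_{x\in\Gamma}\mathbb P^x\{A_T\}=0$ implies $\lim_{T\to\infty}\sup_{x\in\Gamma}\mathbb E^x\{1_{A_T}K(X_T)\}=0$. (B1) There is a constant $c_0<0$ with $c(x,x')\le c_0$ for $(x,x')\in E\times U$, and $c(x,y)\ge c(x,y')+c(y',y)$ for $x\in E$, $y,y'\in U$. (B2) For any compact $\Gamma\subset E$ and $T>0$, with $\zeta_T=\sup_{t\in[0,T]}|\underline c(X_t)|$, $\lim_{n\to\infty}\sup_{y\in\Gamma}\mathbb E^y\{\zeta_T1_{\zeta_T>n}\}=0$. (B3) $\sup_{x\in\Gamma}\mathbb E^x\{D_U\}<\infty$ for any compact $\Gamma\subset E$. (C) $\sup_{x\in U}\sup_\tau\dfrac{\mathbb E^x\{\int_0^\tau1_{B_{z,N}^c}(X_s)ds\}}{\mathbb E^x\{\tau\}}\to0$ as $N\to\infty$ (uncontrolled process; $\tau$ ranges over stopping times with $0<\mathbb E^x\{\tau\}<\infty$). *)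

theory Defs
  imports "HOL-Probability.Probability"
begin

section \<open>Path space and Feller--Markov process\<close>

text \<open>Paths are indexed by \<^typ>\<open>real\<close>; they are extensional outside \<open>[0,\<infinity>)\<close>, so that they
  are determined by their values at nonnegative times.\<close>

definition cadlag_paths :: "(real \<Rightarrow> 'a::topological_space) set" where
  "cadlag_paths = {\<omega> \<in> extensional {0..}.
     (\<forall>t\<ge>0. (\<omega> \<longlongrightarrow> \<omega> t) (at_right t)) \<and> (\<forall>t>0. \<exists>l. (\<omega> \<longlongrightarrow> l) (at_left t))}"

definition path_space :: "(real \<Rightarrow> 'a::topological_space) measure" where
  "path_space = restrict_space (PiM {0..} (\<lambda>_. borel)) cadlag_paths"

text \<open>The filtration is indexed by \<open>[0,\<infinity>]\<close> (the index \<open>\<infinity>\<close> gives the whole \<open>\<sigma>\<close>-algebra of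
  \<^const>\<open>path_space\<close>), so that \<^const>\<open>stopping_time\<close> covers \<open>[0,\<infinity>]\<close>-valued stopping times.\<close>

definition path_filtration :: "ennreal \<Rightarrow> (real \<Rightarrow> 'a::topological_space) measure" where
  "path_filtration t = sigma cadlag_paths
     {{\<omega> \<in> cadlag_paths. \<omega> s \<in> A} | s A. 0 \<le> s \<and> ennreal s \<le> t \<and> A \<in> sets borel}"

text \<open>\<open>P x\<close> is the law on path space of the process started at \<open>x\<close>.  The last clause is the
  (simple, time-homogeneous) Markov property.\<close>

definition markov_process :: "('a::topological_space \<Rightarrow> (real \<Rightarrow> 'a) measure) \<Rightarrow> bool" where
  "markov_process P \<longleftrightarrow>
     P \<in> borel \<rightarrow>\<^sub>M prob_algebra path_space \<and>
     (\<forall>x. AE \<omega> in P x. \<omega> 0 = x) \<and>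
     (\<forall>x. \<forall>s\<ge>0. \<forall>t\<ge>0. \<forall>A \<in> sets (path_filtration (ennreal s)). \<forall>B \<in> sets borel.
        emeasure (P x) (A \<inter> {\<omega> \<in> cadlag_paths. \<omega> (s + t) \<in> B}) =
        (\<integral>\<^sup>+\<omega>\<in>A. emeasure (P (\<omega> s)) {\<omega>' \<in> cadlag_paths. \<omega>' t \<in> B} \<partial>P x))"

definition trans_kernel ::
  "('a::topological_space \<Rightarrow> (real \<Rightarrow> 'a) measure) \<Rightarrow> real \<Rightarrow> 'a \<Rightarrow> 'a measure" where
  "trans_kernel P t x = distr (P x) borel (\<lambda>\<omega>. \<omega> t)"

definition semigroup_op ::
  "('a::topological_space \<Rightarrow> (real \<Rightarrow> 'a) measure) \<Rightarrow> real \<Rightarrow> ('a \<Rightarrow> real) \<Rightarrow> 'a \<Rightarrow> real" where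
  "semigroup_op P t \<phi> x = (\<integral>\<omega>. \<phi> (\<omega> t) \<partial>P x)"

definition C0 :: "('a::topological_space \<Rightarrow> real) set" where
  "C0 = {\<phi>. continuous_on UNIV \<phi> \<and> bounded (range \<phi>) \<and>
     (\<forall>\<epsilon>>0. \<exists>\<Gamma>. compact \<Gamma> \<and> (\<forall>x. x \<notin> \<Gamma> \<longrightarrow> \<bar>\<phi> x\<bar> < \<epsilon>))}"

definition total_variation :: "'a measure \<Rightarrow> 'a measure \<Rightarrow> real" where
  "total_variation M N = Sup {(\<Sum>A\<in>\<A>. \<bar>measure M A - measure N A\<bar>) | \<A>.
     finite \<A> \<and> disjoint \<A> \<and> \<A> \<subseteq> sets M \<and> \<Union>\<A> = space M}"

definition hitting_time :: "'a set \<Rightarrow> (real \<Rightarrow> 'a) \<Rightarrow> ennreal" where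
  "hitting_time U \<omega> = Inf {ennreal s | s. 0 \<le> s \<and> \<omega> s \<in> U}"

definition lower_cost :: "('a \<Rightarrow> 'a \<Rightarrow> real) \<Rightarrow> 'a set \<Rightarrow> 'a \<Rightarrow> real" where
  "lower_cost c U x = (INF a\<in>U. c x a)"

section \<open>Assumptions\<close>

definition cond_A1 :: "('a::topological_space \<Rightarrow> (real \<Rightarrow> 'a) measure) \<Rightarrow> bool" where
  "cond_A1 P \<longleftrightarrow> (\<forall>t\<ge>0. semigroup_op P t ` C0 \<subseteq> C0)"

definition ergodic_bound ::
  "('a::topological_space \<Rightarrow> (real \<Rightarrow> 'a) measure) \<Rightarrow> 'a measure \<Rightarrow> ('a \<Rightarrow> real) \<Rightarrow> (real \<Rightarrow> real) \<Rightarrow> bool"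
where
  "ergodic_bound P \<mu> K h \<longleftrightarrow>
     prob_space \<mu> \<and> sets \<mu> = sets borel \<and>
     K \<in> borel_measurable borel \<and> (\<forall>x. 0 < K x) \<and> (\<forall>\<Gamma>. compact \<Gamma> \<longrightarrow> bounded (K ` \<Gamma>)) \<and>
     (\<forall>t\<ge>0. 0 \<le> h t) \<and> set_integrable lborel {0..} h \<and>
     (\<forall>x. \<forall>t\<ge>0. total_variation (trans_kernel P t x) \<mu> \<le> K x * h t)"

definition cond_A2 ::
  "('a::topological_space \<Rightarrow> (real \<Rightarrow> 'a) measure) \<Rightarrow> 'a measure \<Rightarrow> bool" where
  "cond_A2 P \<mu> \<longleftrightarrow>
     (\<exists>K h. ergodic_bound P \<mu> K h \<and>
        (\<forall>x. \<forall>T\<ge>0. (\<integral>\<^sup>+\<omega>. ennreal (K (\<omega> T)) \<partial>P x) < \<infinity>) \<and>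
        (\<forall>\<Gamma> A. compact \<Gamma> \<longrightarrow> (\<forall>T\<ge>0. A T \<in> sets (path_filtration (ennreal T))) \<longrightarrow>
           ((\<lambda>T::real. SUP x\<in>\<Gamma>. emeasure (P x) (A T)) \<longlongrightarrow> 0) at_top \<longrightarrow>
           ((\<lambda>T. SUP x\<in>\<Gamma>. \<integral>\<^sup>+\<omega>\<in>A T. ennreal (K (\<omega> T)) \<partial>P x) \<longlongrightarrow> 0) at_top)) \<and>
     (\<forall>\<nu> K h. ergodic_bound P \<nu> K h \<longrightarrow> \<nu> = \<mu>)"

definition cond_B1 :: "('a \<Rightarrow> 'a \<Rightarrow> real) \<Rightarrow> 'a set \<Rightarrow> bool" where
  "cond_B1 c U \<longleftrightarrow>
     (\<exists>c0<0. \<forall>x. \<forall>x'\<in>U. c x x' \<le> c0) \<and>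
     (\<forall>x. \<forall>y\<in>U. \<forall>y'\<in>U. c x y \<ge> c x y' + c y' y)"

definition cond_B2 ::
  "('a::topological_space \<Rightarrow> (real \<Rightarrow> 'a) measure) \<Rightarrow> ('a \<Rightarrow> 'a \<Rightarrow> real) \<Rightarrow> 'a set \<Rightarrow> bool" where
  "cond_B2 P c U \<longleftrightarrow>
     (\<forall>\<Gamma> T. compact \<Gamma> \<longrightarrow> 0 < T \<longrightarrow>
        (let \<zeta> = (\<lambda>\<omega>. SUP t\<in>{0..T}. ennreal \<bar>lower_cost c U (\<omega> t)\<bar>) in
         (\<lambda>n::nat. SUP y\<in>\<Gamma>. \<integral>\<^sup>+\<omega>. \<zeta> \<omega> * indicator {\<omega>. \<zeta> \<omega> > of_nat n} \<omega> \<partial>P y) \<longlonglongrightarrow> 0))"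

text \<open>The hitting time of a compact set is in general measurable only with respect to the
  completion of \<open>P x\<close>; by \<open>nn_integral_completion\<close> the integral below is then the
  integral with respect to that completion.\<close>

definition cond_B3 :: "('a::topological_space \<Rightarrow> (real \<Rightarrow> 'a) measure) \<Rightarrow> 'a set \<Rightarrow> bool" where
  "cond_B3 P U \<longleftrightarrow>
     (\<forall>\<Gamma>. compact \<Gamma> \<longrightarrow> (SUP x\<in>\<Gamma>. \<integral>\<^sup>+\<omega>. hitting_time U \<omega> \<partial>P x) < \<infinity>)"

definition occupation_time :: "'a set \<Rightarrow> ennreal \<Rightarrow> (real \<Rightarrow> 'a) \<Rightarrow> ennreal" where
  "occupation_time A t \<omega> =
     (\<integral>\<^sup>+s. indicator {s. 0 \<le> s \<and> ennreal s \<le> t \<and> \<omega> s \<in> A} s \<partial>lborel)"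

definition cond_C :: "('a::metric_space \<Rightarrow> (real \<Rightarrow> 'a) measure) \<Rightarrow> 'a set \<Rightarrow> 'a \<Rightarrow> bool" where
  "cond_C P U z \<longleftrightarrow>
     (\<lambda>N::nat. SUP x\<in>U.
        SUP \<tau>\<in>{\<tau>. stopping_time path_filtration \<tau> \<and>
                   0 < (\<integral>\<^sup>+\<omega>. \<tau> \<omega> \<partial>P x) \<and> (\<integral>\<^sup>+\<omega>. \<tau> \<omega> \<partial>P x) < \<infinity>}.
          (\<integral>\<^sup>+\<omega>. occupation_time (- ball z (real N)) (\<tau> \<omega>) \<omega> \<partial>P x) / (\<integral>\<^sup>+\<omega>. \<tau> \<omega> \<partial>P x))
     \<longlonglongrightarrow> 0"

section \<open>Impulse control\<close>

text \<open>The coordinates \<open>x\<^sup>1, x\<^sup>2, \<dots>\<close> and the impulses \<open>(\<tau>\<^sub>1,\<xi>\<^sub>1), (\<tau>\<^sub>2,\<xi>\<^sub>2), \<dots>\<close> are both numbered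
  from 0 here, so that impulse \<open>i\<close> may use the coordinates \<open>0, \<dots>, i\<close>.\<close>

definition control_space :: "(nat \<Rightarrow> real \<Rightarrow> 'a::topological_space) measure" where
  "control_space = PiM UNIV (\<lambda>_. path_space)"

text \<open>The filtration generated by the first \<open>n\<close> coordinates.\<close>

definition control_filtration ::
  "nat \<Rightarrow> ennreal \<Rightarrow> (nat \<Rightarrow> real \<Rightarrow> 'a::topological_space) measure" where
  "control_filtration n t = sigma (space control_space)
     {{w \<in> space control_space. w i s \<in> A} | i s A.
        i < n \<and> 0 \<le> s \<and> ennreal s \<le> t \<and> A \<in> sets borel}"

type_synonym 'a strategy =
  "(nat \<Rightarrow> (nat \<Rightarrow> real \<Rightarrow> 'a) \<Rightarrow> ennreal) \<times> (nat \<Rightarrow> (nat \<Rightarrow> real \<Rightarrow> 'a) \<Rightarrow> 'a)"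

definition is_strategy :: "'a::topological_space set \<Rightarrow> 'a strategy \<Rightarrow> bool" where
  "is_strategy U V \<longleftrightarrow> (case V of (\<tau>, \<xi>) \<Rightarrow>
     (\<forall>i. stopping_time (control_filtration (Suc i)) (\<tau> i)) \<and>
     (\<forall>i. \<xi> i \<in> filtration.pre_sigma (space control_space) (control_filtration (Suc i)) (\<tau> i)
                  \<rightarrow>\<^sub>M borel) \<and>
     (\<forall>i. \<forall>w \<in> space control_space. \<xi> i w \<in> U) \<and>
     (\<forall>i. \<forall>w \<in> space control_space. \<tau> i w \<le> \<tau> (Suc i) w))"

text \<open>The path that follows \<open>\<omega>\<close> before time \<open>t\<close> and is restarted with \<open>\<omega>'\<close> at time \<open>t\<close>.\<close>

definition paste :: "real \<Rightarrow> (real \<Rightarrow> 'a) \<Rightarrow> (real \<Rightarrow> 'a) \<Rightarrow> real \<Rightarrow> 'a" where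
  "paste t \<omega> \<omega>' = (\<lambda>s\<in>{0..}. if s < t then \<omega> s else \<omega>' (s - t))"

text \<open>Conditional law of coordinate \<open>n\<close> given the coordinates below \<open>n\<close>.  A coordinate coincides
  with its predecessor before the impulse, and forever if the impulse does not take place.
  A strategy is a function on the full product, but impulse \<open>n\<close> depends only on the coordinates
  \<open>0, \<dots>, n\<close>; hence the coordinates above \<open>n\<close> may be filled up arbitrarily.\<close>

fun control_kernel ::
  "('a::topological_space \<Rightarrow> (real \<Rightarrow> 'a) measure) \<Rightarrow> 'a \<Rightarrow> 'a strategy \<Rightarrow>
   nat \<Rightarrow> (nat \<Rightarrow> real \<Rightarrow> 'a) \<Rightarrow> (real \<Rightarrow> 'a) measure" where
  "control_kernel P x V 0 w = P x"
| "control_kernel P x (\<tau>, \<xi>) (Suc n) w =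
    (let w' = (\<lambda>i. w (min i n)) in
     if \<tau> n w' = \<infinity> then return path_space (w n)
     else distr (P (\<xi> n w')) path_space (paste (enn2real (\<tau> n w')) (w n)))"

text \<open>The law of the sequence of coordinates, by the theorem of Ionescu-Tulcea.\<close>

definition control_law ::
  "('a::topological_space \<Rightarrow> (real \<Rightarrow> 'a) measure) \<Rightarrow> 'a \<Rightarrow> 'a strategy \<Rightarrow>
   (nat \<Rightarrow> real \<Rightarrow> 'a) measure" where
  "control_law P x V =
     projective_family.lim UNIV
       (Ionescu_Tulcea.CI (control_kernel P x V) (\<lambda>_. path_space)) (\<lambda>_. path_space)"

definition admissible ::
  "('a::topological_space \<Rightarrow> (real \<Rightarrow> 'a) measure) \<Rightarrow> 'a set \<Rightarrow> 'a \<Rightarrow> 'a strategy \<Rightarrow> bool" where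
  "admissible P U x V \<longleftrightarrow>
     is_strategy U V \<and> (AE w in control_law P x V. (\<lambda>i. fst V i w) \<longlonglongrightarrow> \<infinity>)"

definition controlled_process ::
  "'a strategy \<Rightarrow> (nat \<Rightarrow> real \<Rightarrow> 'a) \<Rightarrow> real \<Rightarrow> 'a" where
  "controlled_process V w t = w (LEAST n. ennreal t < fst V n w) t"

definition total_cost ::
  "('a \<Rightarrow> 'a \<Rightarrow> real) \<Rightarrow> 'a strategy \<Rightarrow> real \<Rightarrow> (nat \<Rightarrow> real \<Rightarrow> 'a) \<Rightarrow> ennreal" where
  "total_cost c V T w =
     (\<Sum>i. ennreal (- c (w i (enn2real (fst V i w))) (snd V i w)) *
           indicator {w. fst V i w \<le> ennreal T} w)"

text \<open>As \<open>c\<close> is negative and possibly unbounded, the expected impulse cost is the negative of an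
  integral in \<open>[0,\<infinity>]\<close>, and the functional takes values in \<open>[-\<infinity>,\<infinity>)\<close>.\<close>

definition reward ::
  "('a::topological_space \<Rightarrow> (real \<Rightarrow> 'a) measure) \<Rightarrow> ('a \<Rightarrow> 'a \<Rightarrow> real) \<Rightarrow> ('a \<Rightarrow> real) \<Rightarrow>
   'a \<Rightarrow> 'a strategy \<Rightarrow> ereal" where
  "reward P c f x V = Liminf at_top (\<lambda>T::real. ereal (1 / T) *
     (ereal (\<integral>w. (LINT s:{0..T}|lborel. f (controlled_process V w s)) \<partial>control_law P x V)
      - enn2ereal (\<integral>\<^sup>+w. total_cost c V T w \<partial>control_law P x V)))"

definition opt_value ::
  "('a::topological_space \<Rightarrow> (real \<Rightarrow> 'a) measure) \<Rightarrow> 'a set \<Rightarrow> ('a \<Rightarrow> 'a \<Rightarrow> real) \<Rightarrow> ('a \<Rightarrow> real) \<Rightarrow>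
   'a \<Rightarrow> ereal" where
  "opt_value P U c f x = (SUP V\<in>{V. admissible P U x V}. reward P c f x V)"

text \<open>\<open>(1 - \<rho>(x,A))\<^sup>+\<close>, with \<open>\<rho>(x,{}) = \<infinity>\<close> (whereas \<^term>\<open>infdist x {} = 0\<close>); the case \<open>A = {}\<close>
  arises when the whole space is contained in a ball.\<close>

definition proximity :: "'a::metric_space set \<Rightarrow> 'a \<Rightarrow> real" where
  "proximity A x = (if A = {} then 0 else max 0 (1 - infdist x A))"

definition truncated ::
  "('a::metric_space \<Rightarrow> real) \<Rightarrow> 'a \<Rightarrow> real \<Rightarrow> nat \<Rightarrow> 'a \<Rightarrow> real" where
  "truncated f z \<eta> N x =
     f x * proximity (ball z (real N)) x + \<eta> * proximity (- ball z (real N + 1)) x"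

end

theory Submission
  imports Defs
begin

text \<open>Let \<open>\<Lambda>\<close> be the supremum of the values of a bounded payoff \<open>g\<close> over all initial states, and suppose
  that \<open>\<Lambda> > \<mu>(g)\<close>.  Waiting never earns more than \<open>\<mu>(g)\<close> per unit of time, up to a vanishing error,
  uniformly over stopping times.  Hence a strategy with value above \<open>\<kappa> > \<mu>(g)\<close> contains, once it is
  conditioned on the path before its first impulse, a long block of some length \<open>S\<close> that earns at least
  \<open>\<kappa> S\<close> when the cost of the first impulse is not counted.  By ergodicity, a short wait after
  the block leads to a state from which the impulse that opens the next block costs at most \<open>\<epsilon> S\<close>.
  A strategy that jumps at time 0 and then plays such blocks with \<open>\<kappa> \<rightarrow> \<Lambda>\<close> and \<open>\<epsilon> \<rightarrow> 0\<close>, the lengths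
  growing slowly compared with the elapsed time, has value \<open>\<Lambda>\<close> from every initial state, so that the
  optimal value is constant and attained.

  For a strategy whose first impulse takes place at time 0, condition (C) holds segment by segment, so
  that the controlled process spends at most the proportion \<open>\<epsilon>\<^sub>N\<close> of its time outside the ball of
  radius \<open>N\<close>, where \<open>\<epsilon>\<^sub>N \<rightarrow> 0\<close>.  The values of such a strategy for \<open>f\<close> and \<open>f\<^sub>N\<close> differ
  by at most a multiple of \<open>\<epsilon>\<^sub>N\<close>; applied to the optimal strategies for \<open>f\<close> and for \<open>f\<^sub>N\<close> this gives
  the approximation.\<close>

section \<open>Paths and filtrations\<close>

text \<open>Freezing the path before the first impulse is what makes a strategy reusable: the time
  and target of that impulse become constants, and everything later is driven by fresh randomness
  started in \<open>U\<close>. A jump to the constant target therefore replays the block from any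
  state at any time. The price is that the opening jump is made from a state which the original
  strategy never saw, so its cost has to be bounded separately. This is the purpose of the wait, and
  the expected length of the wait is the main obstacle: the ergodic bound carries the factor
  \<open>K\<close> of the current state, and the state at the end of a block is arbitrary. The wait
  is therefore estimated from the last impulse, whose target lies in the compact set
  \<open>U\<close>, uniformly in the time elapsed since then. Not knowing which impulse is the last
  one costs a factor equal to the expected number of impulses in the block. This number is of order
  \<open>S\<close> because every impulse costs a fixed positive amount, so recheck times with a
  small enough tail make the wait small compared with \<open>S\<close>.\<close>

lemma space_path_space: "space path_space = cadlag_paths"
  by (auto simp: path_space_def space_restrict_space space_PiM cadlag_paths_def PiE_def)

lemma cadlag_extensional: "\<omega> \<in> cadlag_paths \<Longrightarrow> s < 0 \<Longrightarrow> \<omega> s = undefined"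
  by (auto simp: cadlag_paths_def extensional_def)

lemma measurable_path_eval_const:
  "0 \<le> s \<Longrightarrow> (\<lambda>\<omega>. \<omega> s) \<in> path_space \<rightarrow>\<^sub>M borel"
  unfolding path_space_def by (intro measurable_restrict_space1 measurable_component_singleton) auto

lemma measurable_path_spaceI:
  assumes "\<And>x. x \<in> space M \<Longrightarrow> F x \<in> cadlag_paths"
    and "\<And>s. 0 \<le> s \<Longrightarrow> (\<lambda>x. F x s) \<in> M \<rightarrow>\<^sub>M borel"
  shows "F \<in> M \<rightarrow>\<^sub>M path_space"
  unfolding path_space_def
proof (rule measurable_restrict_space2)
  show "F \<in> space M \<rightarrow> cadlag_paths" using assms(1) by auto
  show "F \<in> M \<rightarrow>\<^sub>M Pi\<^sub>M {0..} (\<lambda>_. borel)"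
    using assms by (intro measurable_PiM_single') (auto simp: cadlag_paths_def PiE_def)
qed

text \<open>Right-continuity reduces a random time to dyadic times \<open>q n\<close>, rounded
  strictly upwards because \<open>at_right\<close> excludes the point itself; at each level only
  countably many coordinates occur. At negative times an extensional path is constantly
  \<open>undefined\<close>, so these are split off.\<close>

lemma measurable_path_eval:
  fixes X :: "'b \<Rightarrow> real \<Rightarrow> 'a::metric_space"
  assumes X: "X \<in> M \<rightarrow>\<^sub>M path_space" and t[measurable]: "t \<in> borel_measurable M"
  shows "(\<lambda>x. X x (t x)) \<in> M \<rightarrow>\<^sub>M borel"
proof -
  define q :: "nat \<Rightarrow> real \<Rightarrow> real" where "q n r = (of_int \<lfloor>r * 2^n\<rfloor> + 1) / 2^n" for n r
  have q_gt: "r < q n r" "q n r \<le> r + 1/2^n" for n r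
  proof -
    have "r * 2^n < of_int \<lfloor>r * 2^n\<rfloor> + 1" "of_int \<lfloor>r * 2^n\<rfloor> \<le> r * 2^n" by linarith+
    then show "r < q n r" "q n r \<le> r + 1/2^n"
      by (auto simp: q_def field_simps)
  qed
  have lim: "(\<lambda>n. \<omega> (q n r)) \<longlonglongrightarrow> \<omega> r" if "\<omega> \<in> cadlag_paths" "0 \<le> r" for \<omega> :: "real \<Rightarrow> 'a" and r
  proof -
    have "filterlim (\<lambda>n. q n r) (at_right r) sequentially"
      unfolding filterlim_at
    proof (intro conjI)
      show "\<forall>\<^sub>F n in sequentially. q n r \<in> {r<..} \<and> q n r \<noteq> r" using q_gt(1) by (auto simp: less_imp_neq[symmetric])
      have "(\<lambda>n. r + 1/2^n) \<longlonglongrightarrow> r + 0"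
        by (intro tendsto_intros LIMSEQ_divide_realpow_zero) simp_all
      then show "(\<lambda>n. q n r) \<longlonglongrightarrow> r"
        by (intro tendsto_sandwich[of "\<lambda>_. r" "\<lambda>n. q n r" sequentially "\<lambda>n. r + 1/2^n"])
           (use q_gt in \<open>auto intro!: always_eventually less_imp_le\<close>)
    qed
    then show ?thesis
      using that by (auto simp: cadlag_paths_def intro: filterlim_compose)
  qed
  have meas: "(\<lambda>x. X x (q n (max 0 (t x)))) \<in> M \<rightarrow>\<^sub>M borel" for n
  proof -
    have "(\<lambda>x. (\<lambda>i x. X x (max 0 ((of_int i + 1) / 2^n))) \<lfloor>max 0 (t x) * 2^n\<rfloor> x) \<in> M \<rightarrow>\<^sub>M borel"
    proof (rule measurable_compose_countable[where f="\<lambda>i x. X x (max 0 ((of_int i + 1) / 2^n))"])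
      show "(\<lambda>x. X x (max 0 ((of_int i + 1) / 2 ^ n))) \<in> M \<rightarrow>\<^sub>M borel" for i :: int
        by (intro measurable_compose[OF X measurable_path_eval_const]) auto
    qed measurable
    then have "(\<lambda>x. X x (max 0 (q n (max 0 (t x))))) \<in> M \<rightarrow>\<^sub>M borel" by (simp add: q_def)
    moreover have "max 0 (q n (max 0 r)) = q n (max 0 r)" for r
      using q_gt(1)[of "max 0 r" n] by linarith
    ultimately show ?thesis by simp
  qed
  have "(\<lambda>x. X x (max 0 (t x))) \<in> M \<rightarrow>\<^sub>M borel"
    by (rule borel_measurable_LIMSEQ_metric[where f="\<lambda>n x. X x (q n (max 0 (t x)))", OF meas])
       (use lim X in \<open>auto simp: space_path_space[symmetric] dest: measurable_space\<close>)
  then have "(\<lambda>x. if t x < 0 then undefined else X x (max 0 (t x))) \<in> M \<rightarrow>\<^sub>M borel"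
    by measurable
  also have "?this \<longleftrightarrow> ?thesis"
    by (intro measurable_cong)
       (use X in \<open>auto simp: cadlag_extensional max_def space_path_space[symmetric] dest: measurable_space\<close>)
  finally show ?thesis .
qed

lemma cadlagI:
  assumes "\<And>t. t < 0 \<Longrightarrow> \<omega> t = undefined"
    "\<And>t. 0 \<le> t \<Longrightarrow> (\<omega> \<longlongrightarrow> \<omega> t) (at_right t)"
    "\<And>t. 0 < t \<Longrightarrow> \<exists>l. (\<omega> \<longlongrightarrow> l) (at_left t)"
  shows "\<omega> \<in> cadlag_paths"
  using assms by (auto simp: cadlag_paths_def extensional_def)

lemma cadlag_rightD: "\<omega> \<in> cadlag_paths \<Longrightarrow> 0 \<le> t \<Longrightarrow> (\<omega> \<longlongrightarrow> \<omega> t) (at_right t)"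
  by (auto simp: cadlag_paths_def)

lemma cadlag_leftD: "\<omega> \<in> cadlag_paths \<Longrightarrow> 0 < t \<Longrightarrow> \<exists>l. (\<omega> \<longlongrightarrow> l) (at_left t)"
  by (auto simp: cadlag_paths_def)

lemma cadlag_const: "(\<lambda>s\<in>{0..}. x) \<in> cadlag_paths"
proof (rule cadlagI)
  show "((\<lambda>s\<in>{0..}. x) \<longlongrightarrow> (\<lambda>s\<in>{0..}. x) t) (at_right t)" if "0 \<le> t" for t :: real
    using that by (intro tendsto_eventually) (auto simp: eventually_at_filter)
  show "\<exists>l. ((\<lambda>s\<in>{0..}. x) \<longlongrightarrow> l) (at_left t)" if "0 < t" for t :: real
    using that by (intro exI[of _ x] tendsto_eventually eventually_at_leftI[of 0]) auto
qed auto

lemma filterlim_shift_right: "filterlim (\<lambda>s. s + c) (at_right (t + c)) (at_right (t::real))"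
  by (auto simp: filterlim_at eventually_at_filter intro!: tendsto_eq_intros)

lemma filterlim_shift_left: "filterlim (\<lambda>s. s + c) (at_left (t + c)) (at_left (t::real))"
  by (auto simp: filterlim_at eventually_at_filter intro!: tendsto_eq_intros)

lemma paste_cadlag:
  assumes "0 \<le> t" "\<omega> \<in> cadlag_paths" "\<omega>' \<in> cadlag_paths"
  shows "paste t \<omega> \<omega>' \<in> cadlag_paths"
proof (rule cadlagI)
  show "paste t \<omega> \<omega>' s = undefined" if "s < 0" for s using that by (simp add: paste_def)
  show "(paste t \<omega> \<omega>' \<longlongrightarrow> paste t \<omega> \<omega>' s) (at_right s)" if s: "0 \<le> s" for s
  proof (cases "s < t")
    case True
    have "\<forall>\<^sub>F x in at_right s. \<omega> x = paste t \<omega> \<omega>' x"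
      using True s by (intro eventually_at_rightI[of s t]) (auto simp: paste_def)
    then show ?thesis
      using cadlag_rightD[OF assms(2) s] True s
      by (subst tendsto_cong[symmetric]) (auto simp: paste_def)
  next
    case False
    have "\<forall>\<^sub>F x in at_right s. \<omega>' (x + -t) = paste t \<omega> \<omega>' x"
      using False s by (intro eventually_at_rightI[of s "s+1"]) (auto simp: paste_def)
    moreover have "((\<lambda>x. \<omega>' (x + -t)) \<longlongrightarrow> \<omega>' (s + -t)) (at_right s)"
      using False by (intro filterlim_compose[OF cadlag_rightD[OF assms(3)] filterlim_shift_right]) auto
    ultimately show ?thesis
      using False s by (subst tendsto_cong[symmetric]) (auto simp: paste_def)
  qed
  show "\<exists>l. (paste t \<omega> \<omega>' \<longlongrightarrow> l) (at_left s)" if s: "0 < s" for s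
  proof (cases "s \<le> t")
    case True
    obtain l where l: "(\<omega> \<longlongrightarrow> l) (at_left s)" using cadlag_leftD[OF assms(2) s] by auto
    have "\<forall>\<^sub>F x in at_left s. \<omega> x = paste t \<omega> \<omega>' x"
      using True s by (intro eventually_at_leftI[of 0]) (auto simp: paste_def)
    then show ?thesis using l tendsto_cong by metis
  next
    case False
    then obtain l where l: "(\<omega>' \<longlongrightarrow> l) (at_left (s + -t))" using cadlag_leftD[OF assms(3), of "s + -t"] by auto
    have "\<forall>\<^sub>F x in at_left s. \<omega>' (x + -t) = paste t \<omega> \<omega>' x"
      using False s assms(1) by (intro eventually_at_leftI[of t]) (auto simp: paste_def)
    moreover have "((\<lambda>x. \<omega>' (x + -t)) \<longlongrightarrow> l) (at_left s)"
      by (rule filterlim_compose[OF l filterlim_shift_left])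
    ultimately show ?thesis using tendsto_cong by metis
  qed
qed

definition shift :: "real \<Rightarrow> (real \<Rightarrow> 'a) \<Rightarrow> real \<Rightarrow> 'a" where
  "shift t \<omega> = (\<lambda>s\<in>{0..}. \<omega> (s + t))"

lemma shift_cadlag:
  assumes "0 \<le> t" "\<omega> \<in> cadlag_paths"
  shows "shift t \<omega> \<in> cadlag_paths"
proof (rule cadlagI)
  show "shift t \<omega> s = undefined" if "s < 0" for s using that by (simp add: shift_def)
  show "(shift t \<omega> \<longlongrightarrow> shift t \<omega> s) (at_right s)" if s: "0 \<le> s" for s
  proof -
    have "\<forall>\<^sub>F x in at_right s. \<omega> (x + t) = shift t \<omega> x"
      using s by (intro eventually_at_rightI[of s "s+1"]) (auto simp: shift_def)
    moreover have "((\<lambda>x. \<omega> (x + t)) \<longlongrightarrow> \<omega> (s + t)) (at_right s)"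
      using s assms(1) by (intro filterlim_compose[OF cadlag_rightD[OF assms(2)] filterlim_shift_right]) auto
    ultimately show ?thesis
      using s by (subst tendsto_cong[symmetric]) (auto simp: shift_def)
  qed
  show "\<exists>l. (shift t \<omega> \<longlongrightarrow> l) (at_left s)" if s: "0 < s" for s
  proof -
    obtain l where l: "(\<omega> \<longlongrightarrow> l) (at_left (s + t))" using cadlag_leftD[OF assms(2), of "s + t"] s assms(1) by auto
    have "\<forall>\<^sub>F x in at_left s. \<omega> (x + t) = shift t \<omega> x"
      using s by (intro eventually_at_leftI[of 0]) (auto simp: shift_def)
    then show ?thesis using filterlim_compose[OF l filterlim_shift_left] tendsto_cong by metis
  qed
qed

text \<open>Together with \<open>shift_paste_same\<close> and \<open>paste_paste\<close> this turns
  a restart of the concatenated process into a restart inside a block, with time translated.\<close>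

lemma shift_paste:
  assumes "0 \<le> B" "0 \<le> t"
  shows "shift B (paste (B + t) \<omega> \<omega>') = paste t (shift B \<omega>) \<omega>'"
  using assms by (auto simp: shift_def paste_def fun_eq_iff restrict_def)

lemma shift_paste_same:
  assumes "0 \<le> t" "\<omega>' \<in> cadlag_paths"
  shows "shift t (paste t \<omega> \<omega>') = \<omega>'"
  using assms cadlag_extensional[OF assms(2)] by (auto simp: shift_def paste_def fun_eq_iff restrict_def)

lemma paste_paste:
  assumes "0 \<le> t" "0 \<le> s"
  shows "paste t \<omega> (paste s \<omega>' \<omega>'') = paste (t + s) (paste t \<omega> \<omega>') \<omega>''"
  using assms by (auto simp: paste_def fun_eq_iff restrict_def algebra_simps)

lemma measurable_paste:
  fixes X Y :: "'b \<Rightarrow> real \<Rightarrow> 'a::metric_space"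
  assumes t[measurable]: "t \<in> borel_measurable M" and nn: "\<And>x. x \<in> space M \<Longrightarrow> 0 \<le> t x"
    and X: "X \<in> M \<rightarrow>\<^sub>M path_space" and Y: "Y \<in> M \<rightarrow>\<^sub>M path_space"
  shows "(\<lambda>x. paste (t x) (X x) (Y x)) \<in> M \<rightarrow>\<^sub>M path_space"
proof (rule measurable_path_spaceI)
  show "paste (t x) (X x) (Y x) \<in> cadlag_paths" if "x \<in> space M" for x
    using measurable_space[OF X that] measurable_space[OF Y that] nn[OF that]
    by (simp add: paste_cadlag space_path_space)
  fix s :: real assume s: "0 \<le> s"
  have [measurable]: "(\<lambda>x. X x s) \<in> M \<rightarrow>\<^sub>M borel" "(\<lambda>x. Y x (s - t x)) \<in> M \<rightarrow>\<^sub>M borel"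
    by (rule measurable_path_eval[OF X] measurable_path_eval[OF Y]; simp)+
  have "(\<lambda>x. if s < t x then X x s else Y x (s - t x)) \<in> M \<rightarrow>\<^sub>M borel" by measurable
  then show "(\<lambda>x. paste (t x) (X x) (Y x) s) \<in> M \<rightarrow>\<^sub>M borel" using s by (simp add: paste_def)
qed

lemma measurable_shift:
  fixes X :: "'b \<Rightarrow> real \<Rightarrow> 'a::metric_space"
  assumes t[measurable]: "t \<in> borel_measurable M" and nn: "\<And>x. x \<in> space M \<Longrightarrow> 0 \<le> t x"
    and X: "X \<in> M \<rightarrow>\<^sub>M path_space"
  shows "(\<lambda>x. shift (t x) (X x)) \<in> M \<rightarrow>\<^sub>M path_space"
proof (rule measurable_path_spaceI)
  show "shift (t x) (X x) \<in> cadlag_paths" if "x \<in> space M" for x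
    using measurable_space[OF X that] nn[OF that] by (simp add: shift_cadlag space_path_space)
  fix s :: real assume s: "0 \<le> s"
  have "(\<lambda>x. X x (s + t x)) \<in> M \<rightarrow>\<^sub>M borel"
    by (rule measurable_path_eval[OF X]) simp
  then show "(\<lambda>x. shift (t x) (X x) s) \<in> M \<rightarrow>\<^sub>M borel" using s by (simp add: shift_def)
qed

section \<open>Galmarino's test for the filtrations\<close>

definition stopped :: "ennreal \<Rightarrow> (real \<Rightarrow> 'a) \<Rightarrow> real \<Rightarrow> 'a" where
  "stopped t \<omega> = (if t = \<infinity> then \<omega> else paste (enn2real t) \<omega> (\<lambda>s\<in>{0..}. \<omega> (enn2real t)))"

lemma stopped_cadlag: "\<omega> \<in> cadlag_paths \<Longrightarrow> stopped t \<omega> \<in> cadlag_paths"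
  by (auto simp: stopped_def intro!: paste_cadlag cadlag_const)

lemma stopped_before: "0 \<le> s \<Longrightarrow> ennreal s \<le> t \<Longrightarrow> stopped t \<omega> s = \<omega> s"
  by (cases t) (auto simp: stopped_def paste_def)

lemma stopped_value:
  assumes "0 \<le> s"
  shows "\<exists>r\<ge>0. ennreal r \<le> t \<and> (\<forall>\<omega> :: real \<Rightarrow> 'a. stopped t \<omega> s = \<omega> r)"
proof (cases t)
  case (real r)
  then show ?thesis
    using assms by (intro exI[of _ "if s < r then s else r"]) (auto simp: stopped_def paste_def)
next
  case top
  then show ?thesis using assms by (auto simp: stopped_def)
qed

lemma space_path_filtration: "space (path_filtration t) = cadlag_paths"
  by (auto simp: path_filtration_def intro!: space_measure_of)

lemma measurable_path_filtration_eval: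
  assumes "0 \<le> s" "ennreal s \<le> t"
  shows "(\<lambda>\<omega>. \<omega> s) \<in> path_filtration t \<rightarrow>\<^sub>M borel"
proof (rule measurableI)
  fix A :: "'a set" assume "A \<in> sets borel"
  then have "{\<omega> \<in> cadlag_paths. \<omega> s \<in> A} \<in> sets (path_filtration t)"
    unfolding path_filtration_def using assms by (subst sets_measure_of) auto
  moreover have "(\<lambda>\<omega>. \<omega> s) -` A \<inter> space (path_filtration t) = {\<omega> \<in> cadlag_paths. \<omega> s \<in> A}"
    by (auto simp: space_path_filtration)
  ultimately show "(\<lambda>\<omega>. \<omega> s) -` A \<inter> space (path_filtration t) \<in> sets (path_filtration t)" by simp
qed auto

lemma sets_path_filtration_subset:
  "sets (path_filtration t :: (real \<Rightarrow> 'a::topological_space) measure) \<subseteq> sets path_space"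
proof -
  have "sigma_sets (space path_space) {{\<omega> \<in> cadlag_paths :: (real \<Rightarrow> 'a) set. \<omega> s \<in> A} | s A. 0 \<le> s \<and> ennreal s \<le> t \<and> A \<in> sets borel}
    \<subseteq> sets path_space"
  proof (rule sets.sigma_sets_subset, safe)
    fix s :: real and A :: "'a set" assume "0 \<le> s" "A \<in> sets borel"
    from measurable_sets[OF measurable_path_eval_const[OF this(1)] this(2)]
    show "{\<omega> \<in> cadlag_paths. \<omega> s \<in> A} \<in> sets path_space"
      by (simp add: vimage_def Int_def conj_commute space_path_space)
  qed
  then show ?thesis
    unfolding path_filtration_def by (subst sets_measure_of) (auto simp: space_path_space)
qed

text \<open>The map \<open>stopped t\<close> reads only times up to \<open>t\<close>, hence is
  measurable from \<open>path_filtration t\<close> into the full path space, and an invariant set is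
  its own preimage under this map.\<close>

lemma path_filtrationI:
  fixes A :: "(real \<Rightarrow> 'a::topological_space) set"
  assumes A: "A \<in> sets path_space"
    and inv: "\<And>\<omega> \<omega>'. \<omega> \<in> A \<Longrightarrow> \<omega>' \<in> cadlag_paths \<Longrightarrow> (\<And>s. 0 \<le> s \<Longrightarrow> ennreal s \<le> t \<Longrightarrow> \<omega> s = \<omega>' s) \<Longrightarrow> \<omega>' \<in> A"
  shows "A \<in> sets (path_filtration t)"
proof -
  have "(stopped t :: (real \<Rightarrow> 'a) \<Rightarrow> _) \<in> path_filtration t \<rightarrow>\<^sub>M path_space"
  proof (rule measurable_path_spaceI)
    fix s :: real assume "0 \<le> s"
    then obtain r where "0 \<le> r" "ennreal r \<le> t" "\<And>\<omega> :: real \<Rightarrow> 'a. stopped t \<omega> s = \<omega> r"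
      using stopped_value[of s t, where 'a='a] by auto
    then show "(\<lambda>\<omega> :: real \<Rightarrow> 'a. stopped t \<omega> s) \<in> path_filtration t \<rightarrow>\<^sub>M borel"
      by (simp add: measurable_path_filtration_eval)
  qed (simp add: space_path_filtration stopped_cadlag)
  from measurable_sets[OF this A] have "stopped t -` A \<inter> cadlag_paths \<in> sets (path_filtration t)"
    by (simp add: space_path_filtration)
  also have "stopped t -` A \<inter> cadlag_paths = A"
  proof (intro equalityI subsetI)
    fix \<omega> assume "\<omega> \<in> stopped t -` A \<inter> cadlag_paths"
    then show "\<omega> \<in> A" using inv[of "stopped t \<omega>" \<omega>] by (simp add: stopped_before)
  next
    fix \<omega> assume \<omega>: "\<omega> \<in> A"
    then have "\<omega> \<in> cadlag_paths" using sets.sets_into_space[OF A] by (auto simp: space_path_space)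
    then show "\<omega> \<in> stopped t -` A \<inter> cadlag_paths"
      using inv[OF \<omega> stopped_cadlag[of \<omega> t]] by (simp add: stopped_before)
  qed
  finally show ?thesis .
qed

lemma stopping_time_pathI:
  fixes \<tau> :: "(real \<Rightarrow> 'a::topological_space) \<Rightarrow> ennreal"
  assumes [measurable]: "\<tau> \<in> path_space \<rightarrow>\<^sub>M borel"
    and inv: "\<And>\<omega> \<omega>' t. \<omega> \<in> cadlag_paths \<Longrightarrow> \<omega>' \<in> cadlag_paths \<Longrightarrow> \<tau> \<omega> \<le> t \<Longrightarrow>
       (\<And>s. 0 \<le> s \<Longrightarrow> ennreal s \<le> t \<Longrightarrow> \<omega> s = \<omega>' s) \<Longrightarrow> \<tau> \<omega>' \<le> t"
  shows "stopping_time path_filtration \<tau>"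
proof (rule stopping_timeI)
  fix t
  have "{\<omega> \<in> space path_space. \<tau> \<omega> \<le> t} \<in> sets path_space" by measurable
  then have "{\<omega> \<in> space path_space. \<tau> \<omega> \<le> t} \<in> sets (path_filtration t)"
  proof (rule path_filtrationI)
    fix \<omega> \<omega>' assume *: "\<omega> \<in> {\<omega> \<in> space path_space. \<tau> \<omega> \<le> t}" "\<omega>' \<in> cadlag_paths"
      "\<And>s. 0 \<le> s \<Longrightarrow> ennreal s \<le> t \<Longrightarrow> \<omega> s = \<omega>' s"
    show "\<omega>' \<in> {\<omega> \<in> space path_space. \<tau> \<omega> \<le> t}"
      using inv[OF _ *(2) _ *(3)] *(1,2) by (simp add: space_path_space)
  qed
  then show "Measurable.pred (path_filtration t) (\<lambda>\<omega>. \<tau> \<omega> \<le> t)"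
    by (simp add: pred_def space_path_space space_path_filtration)
qed

lemma space_control_space: "space control_space = {w. \<forall>i. w i \<in> cadlag_paths}"
  by (auto simp: control_space_def space_PiM space_path_space PiE_def Pi_def)

lemma measurable_control_coord: "(\<lambda>w. w i) \<in> control_space \<rightarrow>\<^sub>M path_space"
  unfolding control_space_def by (rule measurable_component_singleton) simp

lemma measurable_control_spaceI:
  assumes "\<And>i. (\<lambda>x. F x i) \<in> M \<rightarrow>\<^sub>M path_space"
  shows "F \<in> M \<rightarrow>\<^sub>M control_space"
  unfolding control_space_def using assms
  by (intro measurable_PiM_single') (auto simp: PiE_def Pi_def dest: measurable_space)

lemma space_control_filtration: "space (control_filtration n t) = space control_space"
  by (auto simp: control_filtration_def intro!: space_measure_of)

definition agree :: "nat \<Rightarrow> ennreal \<Rightarrow> (nat \<Rightarrow> real \<Rightarrow> 'a) \<Rightarrow> (nat \<Rightarrow> real \<Rightarrow> 'a) \<Rightarrow> bool" where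
  "agree n t w w' \<longleftrightarrow> (\<forall>i<n. \<forall>s\<ge>0. ennreal s \<le> t \<longrightarrow> w i s = w' i s)"

text \<open>Converse of Galmarino's test: the generators do not separate configurations that agree
  up to \<open>t\<close>, and this survives complements and countable unions.\<close>

lemma control_filtrationD:
  assumes "A \<in> sets (control_filtration n t)" "agree n t w w'"
    "w \<in> space control_space" "w' \<in> space control_space"
  shows "w \<in> A \<longleftrightarrow> w' \<in> A"
proof -
  from assms(1) have "A \<in> sigma_sets (space control_space)
     {{w \<in> space control_space. w i s \<in> A} | i s A. i < n \<and> 0 \<le> s \<and> ennreal s \<le> t \<and> A \<in> sets borel}"
    unfolding control_filtration_def by (subst (asm) sets_measure_of) auto
  then show ?thesis
  proof induction
    case (Basic a) then show ?case using assms(2-4) by (auto simp: agree_def)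
  qed (use assms(3,4) in auto)
qed

lemma sets_control_filtration_subset:
  "sets (control_filtration n t :: (nat \<Rightarrow> real \<Rightarrow> 'a::topological_space) measure) \<subseteq> sets control_space"
proof -
  have "sigma_sets (space control_space) {{w \<in> space control_space :: (nat \<Rightarrow> real \<Rightarrow> 'a) set. w i s \<in> A} | i s A.
     i < n \<and> 0 \<le> s \<and> ennreal s \<le> t \<and> A \<in> sets borel} \<subseteq> sets control_space"
  proof (rule sets.sigma_sets_subset, safe)
    fix i and s :: real and A :: "'a set" assume "0 \<le> s" "A \<in> sets borel"
    from measurable_sets[OF measurable_compose[OF measurable_control_coord[of i] measurable_path_eval_const[OF this(1)]] this(2)]
    show "{w \<in> space control_space. w i s \<in> A} \<in> sets control_space"
      by (simp add: vimage_def Int_def conj_commute)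
  qed
  then show ?thesis
    unfolding control_filtration_def by (subst sets_measure_of) auto
qed

text \<open>As in \<open>path_filtrationI\<close>, but with the coordinates above \<open>n\<close>
  overwritten by coordinate \<open>n\<close>. This needs at least one visible coordinate, hence
  \<open>Suc n\<close>.\<close>

lemma control_filtrationI:
  fixes A :: "(nat \<Rightarrow> real \<Rightarrow> 'a::topological_space) set"
  assumes A: "A \<in> sets control_space"
    and inv: "\<And>w w'. w \<in> A \<Longrightarrow> w' \<in> space control_space \<Longrightarrow> agree (Suc n) t w w' \<Longrightarrow> w' \<in> A"
  shows "A \<in> sets (control_filtration (Suc n) t)"
proof -
  have ev: "(\<lambda>w :: nat \<Rightarrow> real \<Rightarrow> 'a. w i s) \<in> control_filtration (Suc n) t \<rightarrow>\<^sub>M borel"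
    if "i \<le> n" "0 \<le> s" "ennreal s \<le> t" for i and s :: real
  proof (rule measurableI)
    fix A :: "'a set" assume "A \<in> sets borel"
    then have "{w \<in> space control_space. w i s \<in> A} \<in> sets (control_filtration (Suc n) t)"
      unfolding control_filtration_def using that by (subst sets_measure_of) (auto simp: less_Suc_eq_le)
    moreover have "(\<lambda>w. w i s) -` A \<inter> space (control_filtration (Suc n) t) = {w \<in> space control_space. w i s \<in> A}"
      by (auto simp: space_control_filtration)
    ultimately show "(\<lambda>w. w i s) -` A \<inter> space (control_filtration (Suc n) t) \<in> sets (control_filtration (Suc n) t)"
      by simp
  qed auto
  have "(\<lambda>(w :: nat \<Rightarrow> real \<Rightarrow> 'a) i. stopped t (w (min i n))) \<in> control_filtration (Suc n) t \<rightarrow>\<^sub>M control_space"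
  proof (intro measurable_control_spaceI measurable_path_spaceI)
    fix s :: real and i assume "0 \<le> s"
    then obtain r where "0 \<le> r" "ennreal r \<le> t" "\<And>\<omega> :: real \<Rightarrow> 'a. stopped t \<omega> s = \<omega> r"
      using stopped_value[of s t, where 'a='a] by auto
    then show "(\<lambda>w :: nat \<Rightarrow> real \<Rightarrow> 'a. stopped t (w (min i n)) s) \<in> control_filtration (Suc n) t \<rightarrow>\<^sub>M borel"
      using ev[of "min i n"] by simp
  qed (simp add: space_control_filtration space_control_space stopped_cadlag)
  from measurable_sets[OF this A]
  have "(\<lambda>(w :: nat \<Rightarrow> real \<Rightarrow> 'a) i. stopped t (w (min i n))) -` A \<inter> space control_space \<in> sets (control_filtration (Suc n) t)"
    by (simp add: space_control_filtration)
  also have "(\<lambda>(w :: nat \<Rightarrow> real \<Rightarrow> 'a) i. stopped t (w (min i n))) -` A \<inter> space control_space = A"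
  proof (intro equalityI subsetI)
    fix w assume "w \<in> (\<lambda>w i. stopped t (w (min i n))) -` A \<inter> space control_space"
    then show "w \<in> A" using inv[of "\<lambda>i. stopped t (w (min i n))" w]
      by (simp add: agree_def stopped_before min_absorb1 less_Suc_eq_le)
  next
    fix w assume w: "w \<in> A"
    then have "w \<in> space control_space" using sets.sets_into_space[OF A] by auto
    moreover from this have "(\<lambda>i. stopped t (w (min i n))) \<in> space control_space"
      by (simp add: space_control_space stopped_cadlag)
    moreover note inv[OF w this]
    ultimately show "w \<in> (\<lambda>w i. stopped t (w (min i n))) -` A \<inter> space control_space"
      by (simp add: agree_def stopped_before min_absorb1 less_Suc_eq_le)
  qed
  finally show ?thesis .
qed

section \<open>Markov processes\<close>

lemma integrable_dyadic_grid:
  fixes h :: "real \<Rightarrow> real"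
  assumes h: "set_integrable lborel {0..} h" and nn: "\<And>t. 0 \<le> t \<Longrightarrow> 0 \<le> h t"
  obtains e g :: "nat \<Rightarrow> real" where "summable e" "\<And>j. 0 \<le> e j"
    "\<And>j. 2^j \<le> g j" "\<And>j. g j \<le> 2^Suc j" "\<And>j. 2^j * h (g j) \<le> e j"
proof -
  let ?h = "\<lambda>s. ennreal (indicator {0..} s * h s)"
  let ?B = "\<lambda>j. {2^j ..< 2^Suc j :: real}"
  have [measurable]: "(\<lambda>s. indicator {0..} s * h s) \<in> borel_measurable lborel"
    using h by (auto simp: set_integrable_def dest: borel_measurable_integrable)
  define I where "I j = (\<integral>\<^sup>+s. ?h s * indicator (?B j) s \<partial>lborel)" for j
  have disj: "disjoint_family ?B"
    unfolding disjoint_family_on_def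
  proof (intro ballI impI)
    have "?B i \<inter> ?B j = {}" if "i < j" for i j
      using power_increasing[of "Suc i" j "2::real"] that by auto
    then show "?B i \<inter> ?B j = {}" if "i \<noteq> j" for i j
      using that by (metis Int_commute nat_neq_iff)
  qed
  have "(\<Sum>j. I j) = (\<integral>\<^sup>+s. (\<Sum>j. ?h s * indicator (?B j) s) \<partial>lborel)"
    unfolding I_def by (subst nn_integral_suminf) auto
  also have "\<dots> = (\<integral>\<^sup>+s. ?h s * indicator (\<Union>j. ?B j) s \<partial>lborel)"
    by (simp only: ennreal_suminf_cmult suminf_indicator[OF disj])
  also have "\<dots> \<le> (\<integral>\<^sup>+s. ?h s \<partial>lborel)"
    by (intro nn_integral_mono) (auto simp: indicator_def)
  also have "\<dots> < \<infinity>"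
    using h nn integrableD(2)[of lborel "\<lambda>s. indicator {0..} s * h s"]
    unfolding set_integrable_def real_scaleR_def by (auto simp: top.not_eq_extremum[symmetric])
  finally have fin: "(\<Sum>j. I j) < \<infinity>" .
  have I_fin: "I j \<noteq> \<infinity>" for j
    using ennreal_suminf_lessD[OF fin, of j] by simp
  \<comment> \<open>The term \<open>(1/2)^j\<close> makes \<open>e j\<close> strictly larger than
    the integral of \<open>h\<close> over the interval, so \<open>h\<close> cannot exceed
    \<open>e j / 2^j\<close> on all of it.\<close>
  define e where "e j = enn2real (I j) + (1/2)^j" for j
  have "summable (\<lambda>j. enn2real (I j))"
    using fin I_fin
    by (intro summable_suminf_not_top) (simp_all add: less_top[symmetric] ennreal_enn2real_if)
  then have "summable e" unfolding e_def by (intro summable_add summable_geometric) auto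
  moreover have "\<exists>g. 2^j \<le> g \<and> g \<le> 2^Suc j \<and> 2^j * h g \<le> e j" for j
  proof (rule ccontr)
    assume "\<not> ?thesis"
    then have *: "e j / 2^j \<le> h g" if "g \<in> ?B j" for g
      using that by (auto simp: field_simps not_le) (meson less_imp_le not_le)
    have "ennreal (e j) = (\<integral>\<^sup>+s. ennreal (e j / 2^j) * indicator (?B j) s \<partial>lborel)"
      by (simp add: nn_integral_cmult_indicator e_def ennreal_mult[symmetric])
    also have "\<dots> \<le> I j"
      unfolding I_def
    proof (intro nn_integral_mono)
      fix s
      show "ennreal (e j / 2^j) * indicator (?B j) s \<le> ?h s * indicator (?B j) s"
        using *[of s] order_trans[OF zero_le_power[of "2::real" j], of s] by (auto simp: indicator_def intro!: ennreal_leI)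
    qed
    also have "\<dots> = ennreal (enn2real (I j))" using I_fin by (simp add: ennreal_enn2real_if)
    finally have "e j \<le> enn2real (I j)" by simp
    then show False using zero_less_power[of "1/2::real" j] unfolding e_def by linarith
  qed
  then obtain g where "\<And>j. 2^j \<le> g j \<and> g j \<le> 2^Suc j \<and> 2^j * h (g j) \<le> e j" by metis
  ultimately show thesis using that[of e g] by (auto simp: e_def)
qed

text \<open>An integrable \<open>h\<close> may have arbitrarily late peaks, so the ergodic bound is
  useful only at selected times; this provides them.\<close>

lemma integrable_small_value:
  fixes h :: "real \<Rightarrow> real"
  assumes h: "set_integrable lborel {0..} h" and nn: "\<And>t. 0 \<le> t \<Longrightarrow> 0 \<le> h t" and "0 < \<epsilon>"
  obtains t where "a \<le> t" "0 \<le> t" "h t \<le> \<epsilon>"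
proof -
  obtain e g where e: "summable e" "\<And>j. 0 \<le> e j" and
    g: "\<And>j. 2^j \<le> g j" "\<And>j. 2^j * h (g j) \<le> e j"
    using integrable_dyadic_grid[OF h nn] by metis
  have "e \<longlonglongrightarrow> 0" using e(1) by (rule summable_LIMSEQ_zero)
  then have "\<forall>\<^sub>F j in sequentially. e j < \<epsilon>" using \<open>0 < \<epsilon>\<close> by (rule order_tendstoD(2))
  moreover obtain n where n: "a \<le> real n" using real_arch_simple by blast
  have "a \<le> 2^j" if "n \<le> j" for j
    using n that of_nat_less_two_power[of j, where 'a=real] by linarith
  then have "\<forall>\<^sub>F j in sequentially. a \<le> 2^j"
    using eventually_sequentially by blast
  ultimately have "\<forall>\<^sub>F j in sequentially. e j < \<epsilon> \<and> a \<le> 2^j" by (rule eventually_conj)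
  then obtain j where j: "e j < \<epsilon>" "a \<le> 2^j" by (auto simp: eventually_sequentially)
  have "0 \<le> g j" using g(1)[of j] zero_le_power[of "2::real" j] by linarith
  moreover have "h (g j) \<le> \<epsilon>"
  proof -
    have "h (g j) \<le> 2^j * h (g j)" using nn[OF \<open>0 \<le> g j\<close>] by (simp add: mult_le_cancel_right1)
    then show ?thesis using g(2)[of j] j by linarith
  qed
  ultimately show thesis using that[of "g j"] j g(1)[of j] by linarith
qed

text \<open>Layer cake: the integral of \<open>\<phi>\<close> is the integral over the levels
  \<open>u\<close> in \<open>(0,1)\<close> of the measure of \<open>{x. u < \<phi> x}\<close>, and
  the setwise error \<open>\<delta>\<close> is integrated over an interval of length 1.\<close>

lemma nn_integral_le_of_setwise:
  assumes M: "finite_measure M" and N: "finite_measure N" and sets: "sets N = sets M"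
    and le: "\<And>B. B \<in> sets M \<Longrightarrow> emeasure M B \<le> emeasure N B + ennreal \<delta>"
    and [measurable]: "\<phi> \<in> borel_measurable M" and bd: "\<And>x. 0 \<le> \<phi> x" "\<And>x. \<phi> x \<le> (1::real)"
  shows "(\<integral>\<^sup>+x. ennreal (\<phi> x) \<partial>M) \<le> (\<integral>\<^sup>+x. ennreal (\<phi> x) \<partial>N) + ennreal \<delta>"
proof -
  have layer: "(\<integral>\<^sup>+x. ennreal (\<phi> x) \<partial>L) = (\<integral>\<^sup>+u. emeasure L {x \<in> space L. u < \<phi> x} * indicator {0<..<1} u \<partial>lborel)"
    if L: "finite_measure L" and sL: "sets L = sets M" for L
  proof -
    interpret finite_measure L by fact
    interpret pair_sigma_finite L lborel ..
    have [measurable]: "\<phi> \<in> borel_measurable L" using sL by (simp cong: measurable_cong_sets)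
    have "ennreal (\<phi> x) = (\<integral>\<^sup>+u. indicator {x. u < \<phi> x} x * indicator {0<..<1} u \<partial>lborel)" for x
    proof -
      have "(\<integral>\<^sup>+u. indicator {x. u < \<phi> x} x * indicator {0<..<1::real} u \<partial>lborel)
          = (\<integral>\<^sup>+u. indicator {0<..<\<phi> x} u \<partial>lborel)"
        using bd[of x] by (intro nn_integral_cong_AE AE_I[where N="{1}"]) (auto simp: indicator_def)
      then show ?thesis using bd[of x] by simp
    qed
    then have "(\<integral>\<^sup>+x. ennreal (\<phi> x) \<partial>L) = (\<integral>\<^sup>+x. \<integral>\<^sup>+u. indicator {x. u < \<phi> x} x * indicator {0<..<1} u \<partial>lborel \<partial>L)"
      by simp
    also have "\<dots> = (\<integral>\<^sup>+u. \<integral>\<^sup>+x. indicator {x. u < \<phi> x} x * indicator {0<..<1} u \<partial>L \<partial>lborel)"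
      by (rule Fubini'[symmetric]) (auto simp: indicator_def[abs_def] split_beta' intro!: measurable_If)
    also have "\<dots> = (\<integral>\<^sup>+u. emeasure L {x \<in> space L. u < \<phi> x} * indicator {0<..<1} u \<partial>lborel)"
    proof (rule nn_integral_cong)
      fix u :: real
      have "(\<integral>\<^sup>+x. indicator {x. u < \<phi> x} x * indicator {0<..<1} u \<partial>L)
        = (\<integral>\<^sup>+x. indicator {x \<in> space L. u < \<phi> x} x * indicator {0<..<1} u \<partial>L)"
        by (intro nn_integral_cong) (auto simp: indicator_def)
      also have "\<dots> = emeasure L {x \<in> space L. u < \<phi> x} * indicator {0<..<1} u"
        by (subst nn_integral_multc) auto
      finally show "(\<integral>\<^sup>+x. indicator {x. u < \<phi> x} x * indicator {0<..<1} u \<partial>L) = \<dots>" .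
    qed
    finally show ?thesis .
  qed
  have sp: "space N = space M" using sets by (rule sets_eq_imp_space_eq)
  have [measurable]: "\<phi> \<in> borel_measurable N" using sets by (simp cong: measurable_cong_sets)
  interpret N: finite_measure N by fact
  have "(\<integral>\<^sup>+x. ennreal (\<phi> x) \<partial>M) \<le> (\<integral>\<^sup>+u. (emeasure N {x \<in> space N. u < \<phi> x} + ennreal \<delta>) * indicator {0<..<1} u \<partial>lborel)"
    unfolding layer[OF M refl] sp by (intro nn_integral_mono mult_right_mono le) auto
  also have "\<dots> = (\<integral>\<^sup>+u. emeasure N {x \<in> space N. u < \<phi> x} * indicator {0<..<1} u \<partial>lborel)
      + (\<integral>\<^sup>+u. ennreal \<delta> * indicator {0<..<1::real} u \<partial>lborel)"
    unfolding distrib_right by (intro nn_integral_add) measurable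
  also have "(\<integral>\<^sup>+u. ennreal \<delta> * indicator {0<..<1::real} u \<partial>lborel) = ennreal \<delta>"
    by (simp add: nn_integral_cmult_indicator)
  finally show ?thesis by (simp add: layer[OF N sets])
qed

text \<open>The partition \<open>{B, space M - B}\<close> yields one of the sums. The bound 2 on all
  sums is needed because the supremum is taken in the reals.\<close>

lemma total_variation_setwise:
  assumes "prob_space M" "prob_space N" and sets: "sets N = sets M" and B: "B \<in> sets M"
  shows "\<bar>measure M B - measure N B\<bar> \<le> total_variation M N"
proof -
  interpret M: prob_space M by fact
  interpret N: prob_space N by fact
  let ?S = "{(\<Sum>A\<in>\<A>. \<bar>measure M A - measure N A\<bar>) | \<A>.
     finite \<A> \<and> disjoint \<A> \<and> \<A> \<subseteq> sets M \<and> \<Union>\<A> = space M}"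
  have "bdd_above ?S"
  proof (rule bdd_aboveI[of _ 2], safe)
    fix \<A> assume \<A>: "finite \<A>" "disjoint \<A>" "\<A> \<subseteq> sets M"
    have "disjoint_family_on (\<lambda>A. A) \<A>" using \<A>(2) by (auto simp: disjoint_family_on_def disjoint_def)
    then have "(\<Sum>A\<in>\<A>. measure M A) = measure M (\<Union>A\<in>\<A>. A)" "(\<Sum>A\<in>\<A>. measure N A) = measure N (\<Union>A\<in>\<A>. A)"
      using \<A> sets by (intro M.finite_measure_finite_Union[symmetric] N.finite_measure_finite_Union[symmetric]; auto)+
    moreover have "(\<Sum>A\<in>\<A>. \<bar>measure M A - measure N A\<bar>) \<le> (\<Sum>A\<in>\<A>. measure M A + measure N A)"
      by (intro sum_mono) (smt (verit) measure_nonneg)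
    ultimately have "(\<Sum>A\<in>\<A>. \<bar>measure M A - measure N A\<bar>) \<le> M.prob (\<Union>\<A>) + N.prob (\<Union>\<A>)"
      by (simp add: sum.distrib)
    also have "\<dots> \<le> 1 + 1" by (intro add_mono M.prob_le_1 N.prob_le_1)
    finally show "(\<Sum>A\<in>\<A>. \<bar>measure M A - measure N A\<bar>) \<le> 2" by simp
  qed
  moreover have "(\<Sum>A\<in>{B, space M - B}. \<bar>measure M A - measure N A\<bar>) \<in> ?S"
    using B sets.sets_into_space[OF B]
    by (intro CollectI exI[of _ "{B, space M - B}"]) (auto simp: disjoint_def)
  ultimately have "(\<Sum>A\<in>{B, space M - B}. \<bar>measure M A - measure N A\<bar>) \<le> total_variation M N"
    unfolding total_variation_def by (rule cSup_upper[rotated])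
  moreover have "\<bar>measure M B - measure N B\<bar> \<le> (\<Sum>A\<in>{B, space M - B}. \<bar>measure M A - measure N A\<bar>)"
    by (rule member_le_sum) auto
  ultimately show ?thesis by linarith
qed

locale markov =
  fixes P :: "'a::metric_space \<Rightarrow> (real \<Rightarrow> 'a) measure"
  assumes mp: "markov_process P"
begin

lemma measurable_P: "P \<in> borel \<rightarrow>\<^sub>M prob_algebra path_space"
  using mp by (simp add: markov_process_def)

lemma measurable_P_subprob: "P \<in> borel \<rightarrow>\<^sub>M subprob_algebra path_space"
  using measurable_P by (rule measurable_prob_algebraD)

lemma prob_space_P: "prob_space (P x)" and sets_P: "sets (P x) = sets path_space"
  using measurable_space[OF measurable_P, of x] by (simp_all add: space_prob_algebra)

lemma space_P: "space (P x) = cadlag_paths"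
  using sets_eq_imp_space_eq[OF sets_P] by (simp add: space_path_space)

lemma start_P: "AE \<omega> in P x. \<omega> 0 = x"
  using mp by (simp add: markov_process_def)

lemma measurable_from_P: "f \<in> path_space \<rightarrow>\<^sub>M N \<Longrightarrow> f \<in> P x \<rightarrow>\<^sub>M N"
  by (simp add: measurable_cong_sets[OF sets_P refl])

lemma measurable_eval_P: "0 \<le> t \<Longrightarrow> (\<lambda>\<omega>. \<omega> t) \<in> P x \<rightarrow>\<^sub>M borel"
  by (intro measurable_from_P measurable_path_eval_const)

lemma measurable_P_nn_integral:
  assumes "f \<in> borel_measurable path_space"
  shows "(\<lambda>x. \<integral>\<^sup>+\<omega>. f \<omega> \<partial>P x) \<in> borel_measurable borel"
  using measurable_compose[OF measurable_P_subprob nn_integral_measurable_subprob_algebra[OF assms]] .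

lemma markov_nn_integral:
  assumes s: "0 \<le> s" and t: "0 \<le> t" and A: "A \<in> sets (path_filtration (ennreal s))"
    and \<phi>: "\<phi> \<in> borel_measurable borel"
  shows "(\<integral>\<^sup>+\<omega>\<in>A. \<phi> (\<omega> (s + t)) \<partial>P x) = (\<integral>\<^sup>+\<omega>\<in>A. (\<integral>\<^sup>+\<omega>'. \<phi> (\<omega>' t) \<partial>P (\<omega> s)) \<partial>P x)"
proof -
  note [measurable] = measurable_eval_P[OF s] measurable_eval_P[OF t]
    measurable_eval_P[OF add_nonneg_nonneg[OF s t]]
  have A'[measurable]: "A \<in> sets (P x)" using A sets_path_filtration_subset sets_P by blast
  have st: "0 \<le> s + t" using s t by simp
  have inner: "(\<lambda>y. \<integral>\<^sup>+\<omega>'. f (\<omega>' t) \<partial>P y) \<in> borel_measurable borel" if "f \<in> borel_measurable borel" for f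
    using that by (intro measurable_P_nn_integral measurable_compose[OF measurable_path_eval_const[OF t]])
  then have inner': "(\<lambda>\<omega>. \<integral>\<^sup>+\<omega>'. f (\<omega>' t) \<partial>P (\<omega> s)) \<in> borel_measurable (P x)" if "f \<in> borel_measurable borel" for f
    using that by (intro measurable_compose[OF measurable_eval_P[OF s]]) auto
  show ?thesis
    using \<phi>
  proof induction
    case (cong f g) then show ?case by simp
  next
    case (set B)
    then have B[measurable]: "B \<in> sets borel" by simp
    have B': "{\<omega> \<in> cadlag_paths. \<omega> t \<in> B} \<in> sets path_space" if "0 \<le> t" for t
      using measurable_sets[OF measurable_path_eval_const[OF that] B]
      by (simp add: vimage_def Int_def conj_commute space_path_space)
    have "(\<integral>\<^sup>+\<omega>\<in>A. indicator B (\<omega> (s + t)) \<partial>P x) = (\<integral>\<^sup>+\<omega>. indicator (A \<inter> {\<omega> \<in> cadlag_paths. \<omega> (s + t) \<in> B}) \<omega> \<partial>P x)"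
      by (intro nn_integral_cong) (auto simp: indicator_def space_P)
    also have "\<dots> = emeasure (P x) (A \<inter> {\<omega> \<in> cadlag_paths. \<omega> (s + t) \<in> B})"
      using A' B'[OF st] by (intro nn_integral_indicator) (auto simp: sets_P)
    also have "\<dots> = (\<integral>\<^sup>+\<omega>\<in>A. emeasure (P (\<omega> s)) {\<omega>' \<in> cadlag_paths. \<omega>' t \<in> B} \<partial>P x)"
      using mp s t A B by (simp add: markov_process_def)
    also have "\<dots> = (\<integral>\<^sup>+\<omega>\<in>A. (\<integral>\<^sup>+\<omega>'. indicator B (\<omega>' t) \<partial>P (\<omega> s)) \<partial>P x)"
    proof -
      have "emeasure (P y) {\<omega>' \<in> cadlag_paths. \<omega>' t \<in> B} = (\<integral>\<^sup>+\<omega>'. indicator B (\<omega>' t) \<partial>P y)" for y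
      proof -
        have "(\<integral>\<^sup>+\<omega>'. indicator B (\<omega>' t) \<partial>P y) = (\<integral>\<^sup>+\<omega>'. indicator {\<omega>' \<in> cadlag_paths. \<omega>' t \<in> B} \<omega>' \<partial>P y)"
          by (intro nn_integral_cong) (auto simp: indicator_def space_P)
        then show ?thesis using B'[OF t] by (simp add: sets_P)
      qed
      then show ?thesis by simp
    qed
    finally show ?case .
  next
    case (mult u c)
    have "(\<integral>\<^sup>+\<omega>\<in>A. c * u (\<omega> (s + t)) \<partial>P x) = c * (\<integral>\<^sup>+\<omega>\<in>A. u (\<omega> (s + t)) \<partial>P x)"
      using mult st by (subst nn_integral_cmult[symmetric]) (auto simp: mult_ac intro!: nn_integral_cong)
    also have "\<dots> = c * (\<integral>\<^sup>+\<omega>\<in>A. (\<integral>\<^sup>+\<omega>'. u (\<omega>' t) \<partial>P (\<omega> s)) \<partial>P x)"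
      using mult by simp
    also have "\<dots> = (\<integral>\<^sup>+\<omega>\<in>A. c * (\<integral>\<^sup>+\<omega>'. u (\<omega>' t) \<partial>P (\<omega> s)) \<partial>P x)"
      using mult inner' by (subst nn_integral_cmult[symmetric]) (auto simp: mult_ac intro!: nn_integral_cong)
    also have "\<dots> = (\<integral>\<^sup>+\<omega>\<in>A. (\<integral>\<^sup>+\<omega>'. c * u (\<omega>' t) \<partial>P (\<omega> s)) \<partial>P x)"
      using mult by (subst nn_integral_cmult) auto
    finally show ?case .
  next
    case (add u v)
    then have [measurable]: "u \<in> borel_measurable borel" "v \<in> borel_measurable borel" by auto
    then have [measurable]: "(\<lambda>\<omega>. u (\<omega> (s + t))) \<in> borel_measurable (P x)" "(\<lambda>\<omega>. v (\<omega> (s + t))) \<in> borel_measurable (P x)"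
      "(\<lambda>\<omega>. u (\<omega> t)) \<in> borel_measurable (P y)" "(\<lambda>\<omega>. v (\<omega> t)) \<in> borel_measurable (P y)"
      "(\<lambda>\<omega>. \<integral>\<^sup>+\<omega>'. u (\<omega>' t) \<partial>P (\<omega> s)) \<in> borel_measurable (P x)"
      "(\<lambda>\<omega>. \<integral>\<^sup>+\<omega>'. v (\<omega>' t) \<partial>P (\<omega> s)) \<in> borel_measurable (P x)" for y
      using inner' by (auto intro!: measurable_compose[OF measurable_eval_P[OF st]] measurable_compose[OF measurable_eval_P[OF t]])
    have "(\<integral>\<^sup>+\<omega>\<in>A. v (\<omega> (s + t)) + u (\<omega> (s + t)) \<partial>P x)
       = (\<integral>\<^sup>+\<omega>\<in>A. v (\<omega> (s + t)) \<partial>P x) + (\<integral>\<^sup>+\<omega>\<in>A. u (\<omega> (s + t)) \<partial>P x)"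
      unfolding distrib_right by (intro nn_integral_add) measurable
    also have "\<dots> = (\<integral>\<^sup>+\<omega>\<in>A. (\<integral>\<^sup>+\<omega>'. v (\<omega>' t) \<partial>P (\<omega> s)) \<partial>P x) + (\<integral>\<^sup>+\<omega>\<in>A. (\<integral>\<^sup>+\<omega>'. u (\<omega>' t) \<partial>P (\<omega> s)) \<partial>P x)"
      using add by simp
    also have "\<dots> = (\<integral>\<^sup>+\<omega>\<in>A. (\<integral>\<^sup>+\<omega>'. v (\<omega>' t) \<partial>P (\<omega> s)) + (\<integral>\<^sup>+\<omega>'. u (\<omega>' t) \<partial>P (\<omega> s)) \<partial>P x)"
      unfolding distrib_right by (intro nn_integral_add[symmetric]) measurable
    also have "\<dots> = (\<integral>\<^sup>+\<omega>\<in>A. (\<integral>\<^sup>+\<omega>'. v (\<omega>' t) + u (\<omega>' t) \<partial>P (\<omega> s)) \<partial>P x)"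
      by (subst nn_integral_add) measurable
    finally show ?case .
  next
    case (seq U)
    have 1: "(SUP i. U i) y = (SUP i. U i y)" for y by (rule SUP_apply)
    have inc: "incseq (\<lambda>i. U i y)" for y using seq by (auto simp: incseq_def le_fun_def)
    have "(\<integral>\<^sup>+\<omega>\<in>A. (SUP i. U i) (\<omega> (s + t)) \<partial>P x) = (SUP i. \<integral>\<^sup>+\<omega>\<in>A. U i (\<omega> (s + t)) \<partial>P x)"
      unfolding 1 SUP_mult_right_ennreal using seq st inc
      by (intro nn_integral_monotone_convergence_SUP)
         (auto simp: incseq_def le_fun_def intro!: mult_right_mono)
    also have "\<dots> = (SUP i. \<integral>\<^sup>+\<omega>\<in>A. (\<integral>\<^sup>+\<omega>'. U i (\<omega>' t) \<partial>P (\<omega> s)) \<partial>P x)"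
      using seq by simp
    also have "\<dots> = (\<integral>\<^sup>+\<omega>\<in>A. (SUP i. \<integral>\<^sup>+\<omega>'. U i (\<omega>' t) \<partial>P (\<omega> s)) \<partial>P x)"
      unfolding SUP_mult_right_ennreal using seq inner'
      by (intro nn_integral_monotone_convergence_SUP[symmetric])
         (auto simp: incseq_def le_fun_def intro!: mult_right_mono nn_integral_mono)
    also have "\<dots> = (\<integral>\<^sup>+\<omega>\<in>A. (\<integral>\<^sup>+\<omega>'. (SUP i. U i) (\<omega>' t) \<partial>P (\<omega> s)) \<partial>P x)"
    proof -
      have "(SUP i. \<integral>\<^sup>+\<omega>'. U i (\<omega>' t) \<partial>P y) = (\<integral>\<^sup>+\<omega>'. (SUP i. U i) (\<omega>' t) \<partial>P y)" for y
        unfolding 1 using seq by (intro nn_integral_monotone_convergence_SUP[symmetric])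
           (auto simp: incseq_def le_fun_def)
      then show ?thesis by simp
    qed
    finally show ?case .
  qed
qed

end

section \<open>Ergodicity\<close>

locale ergodic = markov P for P :: "'a::metric_space \<Rightarrow> (real \<Rightarrow> 'a) measure" +
  fixes \<mu> :: "'a measure" and K :: "'a \<Rightarrow> real" and h :: "real \<Rightarrow> real"
  assumes eb: "ergodic_bound P \<mu> K h"
    and uniform_K: "\<And>\<Gamma> A. compact \<Gamma> \<Longrightarrow> (\<And>T. 0 \<le> T \<Longrightarrow> A T \<in> sets (path_filtration (ennreal T))) \<Longrightarrow>
           ((\<lambda>T::real. SUP x\<in>\<Gamma>. emeasure (P x) (A T)) \<longlongrightarrow> 0) at_top \<Longrightarrow>
           ((\<lambda>T. SUP x\<in>\<Gamma>. \<integral>\<^sup>+\<omega>\<in>A T. ennreal (K (\<omega> T)) \<partial>P x) \<longlongrightarrow> 0) at_top"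
begin

sublocale \<mu>: prob_space \<mu> using eb by (simp add: ergodic_bound_def)

lemma sets_\<mu>: "sets \<mu> = sets borel" using eb by (simp add: ergodic_bound_def)
lemma space_\<mu>: "space \<mu> = UNIV" using sets_eq_imp_space_eq[OF sets_\<mu>] by simp
lemma measurable_K[measurable]: "K \<in> borel_measurable borel" using eb by (simp add: ergodic_bound_def)
lemma K_pos: "0 < K x" using eb by (simp add: ergodic_bound_def)
lemma h_nonneg: "0 \<le> t \<Longrightarrow> 0 \<le> h t" using eb by (simp add: ergodic_bound_def)
lemma h_integrable: "set_integrable lborel {0..} h" using eb by (simp add: ergodic_bound_def)

lemma K_bounded:
  assumes "compact \<Gamma>" obtains b where "0 \<le> b" "\<And>y. y \<in> \<Gamma> \<Longrightarrow> K y \<le> b"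
proof -
  have "bounded (K ` \<Gamma>)" using eb assms by (simp add: ergodic_bound_def)
  then obtain b where "\<And>y. y \<in> \<Gamma> \<Longrightarrow> \<bar>K y\<bar> \<le> b" by (auto simp: bounded_iff)
  then show thesis using that[of "max 0 b"] by (metis abs_ge_self max.cobounded1 max.coboundedI2 order_trans)
qed

lemma prob_space_trans: "0 \<le> t \<Longrightarrow> prob_space (trans_kernel P t x)"
  unfolding trans_kernel_def by (intro prob_space.prob_space_distr prob_space_P measurable_eval_P)

lemma sets_trans: "sets (trans_kernel P t x) = sets borel"
  by (simp add: trans_kernel_def)

lemma emeasure_trans:
  assumes "0 \<le> t" "B \<in> sets borel"
  shows "emeasure (trans_kernel P t x) B = emeasure (P x) {\<omega> \<in> cadlag_paths. \<omega> t \<in> B}"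
  unfolding trans_kernel_def
  by (subst emeasure_distr[OF measurable_eval_P[OF assms(1)] assms(2)]) (auto simp: space_P intro!: arg_cong2[where f=emeasure])

lemma nn_integral_trans:
  assumes "0 \<le> t" "\<phi> \<in> borel_measurable borel"
  shows "(\<integral>\<^sup>+y. \<phi> y \<partial>trans_kernel P t x) = (\<integral>\<^sup>+\<omega>. \<phi> (\<omega> t) \<partial>P x)"
  unfolding trans_kernel_def using assms by (subst nn_integral_distr[OF measurable_eval_P]) auto

lemma tv_set:
  assumes "0 \<le> t" "B \<in> sets borel"
  shows "\<bar>measure (trans_kernel P t x) B - measure \<mu> B\<bar> \<le> K x * h t"
  using total_variation_setwise[OF prob_space_trans[OF assms(1)] \<mu>.prob_space_axioms, of x B] assms eb
  by (auto simp: sets_trans sets_\<mu> ergodic_bound_def intro: order_trans)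

lemma tv_emeasure:
  assumes "0 \<le> t" "B \<in> sets borel"
  shows "emeasure (trans_kernel P t x) B \<le> emeasure \<mu> B + ennreal (K x * h t)"
    and "emeasure \<mu> B \<le> emeasure (trans_kernel P t x) B + ennreal (K x * h t)"
proof -
  interpret T: prob_space "trans_kernel P t x" by (rule prob_space_trans) fact
  have "0 \<le> K x * h t" using K_pos[of x] h_nonneg[OF assms(1)] by simp
  then show "emeasure (trans_kernel P t x) B \<le> emeasure \<mu> B + ennreal (K x * h t)"
    and "emeasure \<mu> B \<le> emeasure (trans_kernel P t x) B + ennreal (K x * h t)"
    using tv_set[OF assms, of x]
    by (simp_all add: T.emeasure_eq_measure \<mu>.emeasure_eq_measure ennreal_plus[symmetric] abs_le_iff del: ennreal_plus)
qed

lemma tv_nn_integral: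
  assumes t: "0 \<le> t" and [measurable]: "\<phi> \<in> borel_measurable borel"
    and bd: "\<And>y. 0 \<le> \<phi> y" "\<And>y. \<phi> y \<le> (1::real)"
  shows "(\<integral>\<^sup>+\<omega>. ennreal (\<phi> (\<omega> t)) \<partial>P x) \<le> (\<integral>\<^sup>+y. ennreal (\<phi> y) \<partial>\<mu>) + ennreal (K x * h t)"
    and "(\<integral>\<^sup>+y. ennreal (\<phi> y) \<partial>\<mu>) \<le> (\<integral>\<^sup>+\<omega>. ennreal (\<phi> (\<omega> t)) \<partial>P x) + ennreal (K x * h t)"
proof -
  interpret T: prob_space "trans_kernel P t x" by (rule prob_space_trans) fact
  have eq: "(\<integral>\<^sup>+\<omega>. ennreal (\<phi> (\<omega> t)) \<partial>P x) = (\<integral>\<^sup>+y. ennreal (\<phi> y) \<partial>trans_kernel P t x)"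
    using t by (subst nn_integral_trans) auto
  have m: "\<phi> \<in> borel_measurable (trans_kernel P t x)" "\<phi> \<in> borel_measurable \<mu>"
    by (simp_all add: measurable_cong_sets[OF sets_trans refl] measurable_cong_sets[OF sets_\<mu> refl])
  show "(\<integral>\<^sup>+\<omega>. ennreal (\<phi> (\<omega> t)) \<partial>P x) \<le> (\<integral>\<^sup>+y. ennreal (\<phi> y) \<partial>\<mu>) + ennreal (K x * h t)"
    unfolding eq using tv_emeasure(1)[OF t, of _ x] m bd
    by (intro nn_integral_le_of_setwise) (auto simp: sets_trans sets_\<mu> T.finite_measure_axioms \<mu>.finite_measure_axioms)
  show "(\<integral>\<^sup>+y. ennreal (\<phi> y) \<partial>\<mu>) \<le> (\<integral>\<^sup>+\<omega>. ennreal (\<phi> (\<omega> t)) \<partial>P x) + ennreal (K x * h t)"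
    unfolding eq using tv_emeasure(2)[OF t, of _ x] m bd
    by (intro nn_integral_le_of_setwise) (auto simp: sets_trans sets_\<mu> T.finite_measure_axioms \<mu>.finite_measure_axioms)
qed

lemma cadlag_in_filtration: "cadlag_paths \<in> sets (path_filtration t)"
  using sets.top[of "path_filtration t"] by (simp add: space_path_filtration)

lemma chapman_kolmogorov:
  assumes "0 \<le> s" "0 \<le> t" "\<phi> \<in> borel_measurable borel"
  shows "(\<integral>\<^sup>+\<omega>. \<phi> (\<omega> (s + t)) \<partial>P x) = (\<integral>\<^sup>+\<omega>. (\<integral>\<^sup>+\<omega>'. \<phi> (\<omega>' t) \<partial>P (\<omega> s)) \<partial>P x)"
proof -
  have *: "(\<integral>\<^sup>+\<omega>. f \<omega> \<partial>P x) = (\<integral>\<^sup>+\<omega>\<in>cadlag_paths. f \<omega> \<partial>P x)" for f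
    by (intro nn_integral_cong) (simp add: space_P)
  show ?thesis
    using markov_nn_integral[OF assms(1,2) cadlag_in_filtration assms(3), of x] by (simp add: *[symmetric])
qed

lemma emeasure_trans_nn:
  assumes "0 \<le> t" "B \<in> sets borel"
  shows "emeasure (trans_kernel P t x) B = (\<integral>\<^sup>+\<omega>. indicator B (\<omega> t) \<partial>P x)"
  using nn_integral_trans[OF assms(1), of "indicator B" x] assms by (simp add: sets_trans)

lemma trans_kernel_semigroup:
  assumes "0 \<le> s" "0 \<le> t" and B[measurable]: "B \<in> sets borel"
  shows "emeasure (trans_kernel P (s + t) x) B = (\<integral>\<^sup>+\<omega>. ennreal (measure (trans_kernel P t (\<omega> s)) B) \<partial>P x)"
proof -
  have eq: "(\<integral>\<^sup>+\<omega>. indicator B (\<omega> t) \<partial>P y) = ennreal (measure (trans_kernel P t y) B)" for y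
    unfolding emeasure_trans_nn[OF assms(2,3), symmetric]
    using prob_space_trans[OF assms(2), of y]
    by (intro finite_measure.emeasure_eq_measure prob_space.axioms(1))
  then show ?thesis
    using chapman_kolmogorov[OF assms(1,2), of "indicator B" x]
      emeasure_trans_nn[OF add_nonneg_nonneg[OF assms(1,2)] B, of x] by (simp only: eq) simp
qed

lemma measurable_trans_measure:
  assumes "0 \<le> t" and B[measurable]: "B \<in> sets borel"
  shows "(\<lambda>x. measure (trans_kernel P t x) B) \<in> borel_measurable borel"
proof -
  have "(\<lambda>x. enn2real (\<integral>\<^sup>+\<omega>. indicator B (\<omega> t) \<partial>P x)) \<in> borel_measurable borel"
    using assms
    by (intro borel_measurable_enn2real measurable_P_nn_integral measurable_compose[OF measurable_path_eval_const]) auto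
  then show ?thesis using assms by (simp add: measure_def emeasure_trans_nn)
qed

text \<open>Seen from a fixed state, the laws at times \<open>s\<close> and \<open>s + t\<close> are
  both close to \<open>\<mu>\<close> when \<open>h s\<close> and \<open>h (s + t)\<close> are small.
  By complements, the inequality for all sets amounts to invariance of \<open>\<mu>\<close>.\<close>

lemma invariant_le:
  assumes t: "0 \<le> t" and B: "B \<in> sets borel"
  shows "(\<integral>\<^sup>+y. ennreal (measure (trans_kernel P t y) B) \<partial>\<mu>) \<le> emeasure \<mu> B"
proof (rule ennreal_le_epsilon)
  fix e :: real assume "0 < e"
  define x0 :: 'a where "x0 = undefined"
  \<comment> \<open>Both values have to be small at the same \<open>s\<close>; their sum is
    integrable again, so \<open>integrable_small_value\<close> applies to it.\<close>
  let ?h = "\<lambda>s. h s + h (s + t)"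
  have shifted: "set_integrable lborel {0..} (\<lambda>s. h (s + t))"
  proof -
    have "integrable lborel (\<lambda>s. indicator {0..} s *\<^sub>R h s)" using h_integrable by (simp add: set_integrable_def)
    then have "integrable lborel (\<lambda>s. indicator {0..} (t + 1 * s) *\<^sub>R h (t + 1 * s))"
      by (intro lborel_integrable_real_affine) auto
    then have "set_integrable lborel {-t..} (\<lambda>s. h (s + t))"
      unfolding set_integrable_def
      by (rule Bochner_Integration.integrable_cong[THEN iffD1, rotated 2]) (auto simp: indicator_def ac_simps)
    then show ?thesis by (rule set_integrable_subset) (use t in auto)
  qed
  have "set_integrable lborel {0..} ?h" using h_integrable shifted by (rule set_integral_add(1))
  moreover have "0 \<le> ?h s" if "0 \<le> s" for s using that t h_nonneg by simp
  moreover have "0 < e / K x0" using \<open>0 < e\<close> K_pos by simp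
  ultimately obtain s where s: "0 \<le> s" "?h s \<le> e / K x0"
    using integrable_small_value[of ?h "e / K x0" 0] by blast
  have st: "0 \<le> s + t" using s t by simp
  have bd: "0 \<le> measure (trans_kernel P t y) B" "measure (trans_kernel P t y) B \<le> 1" for y
    using prob_space.prob_le_1[OF prob_space_trans[OF t]] by simp_all
  have "(\<integral>\<^sup>+y. ennreal (measure (trans_kernel P t y) B) \<partial>\<mu>)
     \<le> (\<integral>\<^sup>+\<omega>. ennreal (measure (trans_kernel P t (\<omega> s)) B) \<partial>P x0) + ennreal (K x0 * h s)"
    by (rule tv_nn_integral(2)[OF s(1) measurable_trans_measure[OF t B] bd])
  also have "\<dots> = emeasure (trans_kernel P (s + t) x0) B + ennreal (K x0 * h s)"
    using trans_kernel_semigroup[OF s(1) t B] by simp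
  also have "\<dots> \<le> emeasure \<mu> B + ennreal (K x0 * h (s + t)) + ennreal (K x0 * h s)"
    using tv_emeasure(1)[OF st B] by (intro add_mono) auto
  also have "\<dots> = emeasure \<mu> B + ennreal (K x0 * ?h s)"
    using K_pos[of x0] h_nonneg s(1) st
    by (simp add: add.assoc ennreal_plus[symmetric] algebra_simps del: ennreal_plus)
  also have "\<dots> \<le> emeasure \<mu> B + ennreal e"
    using s(2) K_pos[of x0] by (intro add_mono ennreal_leI) (auto simp: field_simps)
  finally show "(\<integral>\<^sup>+y. ennreal (measure (trans_kernel P t y) B) \<partial>\<mu>) \<le> emeasure \<mu> B + ennreal e" .
qed

text \<open>Unlike \<open>tv_emeasure\<close>, this bound is uniform in the time \<open>T\<close>; \<open>h\<close> need not be monotone.\<close>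

lemma marginal_le:
  assumes g: "0 \<le> g" "g \<le> T" and B: "B \<in> sets borel"
  shows "emeasure (trans_kernel P T y) B \<le> emeasure \<mu> B + ennreal (K y * h g)"
proof -
  \<comment> \<open>Only the first \<open>g\<close> units of time are used for mixing; the remaining
    \<open>T - g\<close> units keep \<open>\<mu>\<close> invariant.\<close>
  have t: "0 \<le> T - g" using g by simp
  have bd: "0 \<le> measure (trans_kernel P (T - g) y) B" "measure (trans_kernel P (T - g) y) B \<le> 1" for y
    using prob_space.prob_le_1[OF prob_space_trans[OF t]] by simp_all
  have "emeasure (trans_kernel P T y) B = (\<integral>\<^sup>+\<omega>. ennreal (measure (trans_kernel P (T - g) (\<omega> g)) B) \<partial>P y)"
    using trans_kernel_semigroup[OF g(1) t B, of y] by simp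
  also have "\<dots> \<le> (\<integral>\<^sup>+x. ennreal (measure (trans_kernel P (T - g) x) B) \<partial>\<mu>) + ennreal (K y * h g)"
    by (rule tv_nn_integral(1)[OF g(1) measurable_trans_measure[OF t B] bd])
  also have "\<dots> \<le> emeasure \<mu> B + ennreal (K y * h g)"
    by (intro add_mono invariant_le t B order_refl)
  finally show ?thesis .
qed

text \<open>If the bound fails, there are times \<open>t n \<ge> n\<close> and states in
  \<open>\<Gamma>\<close> from which the mean of \<open>K\<close> exceeds \<open>n + 1\<close>. The
  events \<open>A T\<close> collect the large values of \<open>K\<close> at these times. Their
  probabilities tend to 0 uniformly, because late marginals exceed \<open>\<mu>\<close> by little,
  so the last clause of (A2) makes the part of the mean on \<open>A (t n)\<close> less than 1 for
  large \<open>n\<close>. Off that event \<open>K\<close> is at most \<open>n\<close>, a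
  contradiction.\<close>

lemma uniform_K_bound:
  assumes \<Gamma>: "compact \<Gamma>"
  shows "\<exists>T1\<ge>0. \<exists>C\<ge>0. \<forall>t\<ge>T1. \<forall>y\<in>\<Gamma>. (\<integral>\<^sup>+\<omega>. ennreal (K (\<omega> t)) \<partial>P y) \<le> ennreal C"
proof (rule ccontr)
  assume "\<not> ?thesis"
  then have neg: "\<exists>t y. T1 \<le> t \<and> y \<in> \<Gamma> \<and> \<not> (\<integral>\<^sup>+\<omega>. ennreal (K (\<omega> t)) \<partial>P y) \<le> ennreal C"
    if "0 \<le> T1" "0 \<le> C" for T1 C using that by blast
  have "\<exists>t y. real n \<le> t \<and> y \<in> \<Gamma> \<and> ennreal (real n + 1) < (\<integral>\<^sup>+\<omega>. ennreal (K (\<omega> t)) \<partial>P y)" for n :: nat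
    using neg[of "real n" "real n + 1"] by (auto simp: not_le)
  then obtain t y where t: "\<And>n. real n \<le> t n" and y: "\<And>n. y n \<in> \<Gamma>"
    and big: "\<And>n. ennreal (real n + 1) < (\<integral>\<^sup>+\<omega>. ennreal (K (\<omega> (t n))) \<partial>P (y n))" by metis
  \<comment> \<open>Several \<open>n\<close> may share the same time, hence the union.\<close>
  define A where "A T = (\<Union>n\<in>{n. t n = T}. {\<omega> \<in> cadlag_paths. real n < K (\<omega> T)})" for T
  have lev: "{\<omega> \<in> cadlag_paths. r < K (\<omega> T)} \<in> sets (path_filtration (ennreal T))" if "0 \<le> T" for T r
  proof -
    have "(\<lambda>\<omega>. K (\<omega> T)) \<in> borel_measurable (path_filtration (ennreal T))"
      using that by (intro measurable_compose[OF measurable_path_filtration_eval measurable_K]) auto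
    then show ?thesis by (simp add: borel_measurable_iff_greater space_path_filtration)
  qed
  have A_sets: "A T \<in> sets (path_filtration (ennreal T))" if "0 \<le> T" for T
    unfolding A_def using lev[OF that] by (intro sets.countable_UN') auto
  obtain Kb where Kb: "0 \<le> Kb" "\<And>y. y \<in> \<Gamma> \<Longrightarrow> K y \<le> Kb" by (rule K_bounded[OF \<Gamma>]) blast
  have "((\<lambda>T. SUP x\<in>\<Gamma>. emeasure (P x) (A T)) \<longlongrightarrow> 0) at_top"
  proof (rule order_tendstoI)
    fix a :: ennreal assume "0 < a"
    then obtain e where e: "0 < e" "ennreal e < a"
    proof (cases a)
      case (real r)
      then show ?thesis using \<open>0 < a\<close> that[of "r/2"] by (auto simp: ennreal_less_iff)
    next
      case top
      then show ?thesis using that[of 1] by simp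
    qed
    have [measurable]: "{x. r < K x} \<in> sets borel" for r by measurable
    have "(\<lambda>n. measure \<mu> {x \<in> space \<mu>. real n < K x}) \<longlonglongrightarrow> measure \<mu> (\<Inter>n. {x \<in> space \<mu>. real n < K x})"
      by (intro \<mu>.finite_Lim_measure_decseq)
         (auto simp: decseq_def sets_\<mu> space_\<mu>)
    also have "(\<Inter>n. {x \<in> space \<mu>. real n < K x}) = {}"
      by (auto simp: not_less) (meson real_arch_simple not_less)
    finally have "(\<lambda>n. measure \<mu> {x \<in> space \<mu>. real n < K x}) \<longlonglongrightarrow> 0" by simp
    then have "\<forall>\<^sub>F n in sequentially. measure \<mu> {x \<in> space \<mu>. real n < K x} < e / 2"
      using e by (intro order_tendstoD(2)) auto
    then obtain m where m: "measure \<mu> {x \<in> space \<mu>. real m < K x} < e / 2"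
      by (auto simp: eventually_sequentially)
    have "0 < e / (2 * (Kb + 1))" using e Kb by (intro divide_pos_pos) auto
    then obtain g where g: "0 \<le> g" "h g \<le> e / (2 * (Kb + 1))"
      using integrable_small_value[OF h_integrable h_nonneg] by metis
    have "emeasure (P x) (A T) \<le> ennreal e"
      if x: "x \<in> \<Gamma>" and T: "Max (t ` {..m}) < T" "g \<le> T" for x T
    proof -
      \<comment> \<open>After the times \<open>t 0, ..., t m\<close> only levels
        \<open>n > m\<close> can occur in \<open>A T\<close>.\<close>
      have "A T \<subseteq> {\<omega> \<in> cadlag_paths. \<omega> T \<in> {x. real m < K x}}"
      proof -
        have "m < n" if "t n = T" for n
        proof (rule ccontr)
          assume "\<not> m < n"
          then have "t n \<le> Max (t ` {..m})" by (intro Max_ge) auto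
          then show False using T(1) that by simp
        qed
        then show ?thesis by (force simp: A_def)
      qed
      then have "emeasure (P x) (A T) \<le> emeasure (P x) {\<omega> \<in> cadlag_paths. \<omega> T \<in> {x. real m < K x}}"
        using g T lev[of T "real m"] sets_path_filtration_subset[of "ennreal T", where 'a='a]
        by (intro emeasure_mono) (auto simp: sets_P)
      also have "\<dots> = emeasure (trans_kernel P T x) {x. real m < K x}"
        using g T by (subst emeasure_trans) auto
      also have "\<dots> \<le> emeasure \<mu> {x. real m < K x} + ennreal (K x * h g)"
        using g T by (intro marginal_le) auto
      also have "\<dots> \<le> ennreal (e/2) + ennreal (e/2)"
      proof (intro add_mono ennreal_leI)
        show "emeasure \<mu> {x. real m < K x} \<le> ennreal (e/2)"
          using m by (auto simp: \<mu>.emeasure_eq_measure space_\<mu> intro!: ennreal_leI)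
        have "K x * h g \<le> (Kb + 1) * (e / (2 * (Kb + 1)))"
          using g Kb x K_pos[of x] h_nonneg[OF g(1)] by (intro mult_mono) (auto intro: order_trans[OF Kb(2)])
        moreover have "k * (e / (2 * k)) = e / 2" if "0 < k" for k using that by simp
        ultimately show "K x * h g \<le> e / 2" using Kb(1) by (metis add_nonneg_pos zero_less_one)
      qed
      also have "\<dots> = ennreal e" using e by (simp add: ennreal_plus[symmetric] del: ennreal_plus)
      finally show ?thesis .
    qed
    then have "(SUP x\<in>\<Gamma>. emeasure (P x) (A T)) < a" if "max (Max (t ` {..m})) g < T" for T
      using that e by (intro le_less_trans[OF SUP_least]) auto
    then show "\<forall>\<^sub>F T in at_top. (SUP x\<in>\<Gamma>. emeasure (P x) (A T)) < a"
      using eventually_gt_at_top[of "max (Max (t ` {..m})) g"] by (auto elim: eventually_mono)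
  qed auto
  then have "((\<lambda>T. SUP x\<in>\<Gamma>. \<integral>\<^sup>+\<omega>\<in>A T. ennreal (K (\<omega> T)) \<partial>P x) \<longlongrightarrow> 0) at_top"
    by (intro uniform_K[OF \<Gamma>] A_sets)
  then have "\<forall>\<^sub>F T in at_top. (SUP x\<in>\<Gamma>. \<integral>\<^sup>+\<omega>\<in>A T. ennreal (K (\<omega> T)) \<partial>P x) < 1"
    by (rule order_tendstoD(2)) (rule zero_less_one)
  then obtain T0 where T0: "\<And>T. T0 \<le> T \<Longrightarrow> (SUP x\<in>\<Gamma>. \<integral>\<^sup>+\<omega>\<in>A T. ennreal (K (\<omega> T)) \<partial>P x) < 1"
    by (auto simp: eventually_at_top_linorder)
  obtain n :: nat where n: "T0 \<le> real n" using real_arch_simple by blast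
  have tn: "0 \<le> t n" using t[of n] by (smt (verit) of_nat_0_le_iff)
  have AS: "A (t n) \<in> sets (P (y n))" using A_sets[OF tn] sets_path_filtration_subset sets_P by blast
  have [measurable]: "(\<lambda>\<omega>. K (\<omega> (t n))) \<in> borel_measurable (P (y n))"
    by (intro measurable_compose[OF measurable_eval_P[OF tn] measurable_K])
  have "(\<integral>\<^sup>+\<omega>. ennreal (K (\<omega> (t n))) \<partial>P (y n))
      \<le> (\<integral>\<^sup>+\<omega>. ennreal (K (\<omega> (t n))) * indicator (A (t n)) \<omega> + ennreal (real n) \<partial>P (y n))"
    by (intro nn_integral_mono) (auto simp: A_def indicator_def space_P not_less intro!: ennreal_leI)
  also have "\<dots> = (\<integral>\<^sup>+\<omega>\<in>A (t n). ennreal (K (\<omega> (t n))) \<partial>P (y n)) + ennreal (real n)"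
    using AS prob_space.emeasure_space_1[OF prob_space_P] by (subst nn_integral_add) auto
  also have "\<dots> \<le> 1 + ennreal (real n)"
  proof (intro add_mono order_refl)
    have "(\<integral>\<^sup>+\<omega>\<in>A (t n). ennreal (K (\<omega> (t n))) \<partial>P (y n)) \<le> (SUP x\<in>\<Gamma>. \<integral>\<^sup>+\<omega>\<in>A (t n). ennreal (K (\<omega> (t n))) \<partial>P x)"
      using y by (intro SUP_upper)
    also have "\<dots> < 1" using n t[of n] by (intro T0) linarith
    finally show "(\<integral>\<^sup>+\<omega>\<in>A (t n). ennreal (K (\<omega> (t n))) \<partial>P (y n)) \<le> 1" by simp
  qed
  also have "\<dots> = ennreal (real n + 1)" by (subst ennreal_plus) (auto simp: add.commute)
  finally show False using big[of n] by simp
qed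

end

section \<open>Time averages up to stopping times; recheck times\<close>

lemma nn_integral_lborel_translate:
  fixes f :: "real \<Rightarrow> ennreal"
  assumes "f \<in> borel_measurable borel"
  shows "(\<integral>\<^sup>+s. f (s - u) \<partial>lborel) = (\<integral>\<^sup>+s. f s \<partial>lborel)"
  using nn_integral_real_affine[OF assms, of 1 "-u"] by (simp add: algebra_simps)

context ergodic
begin

text \<open>Rescaling \<open>\<phi> + a\<close> to values between 0 and 1 makes
  \<open>tv_nn_integral\<close> applicable, at the price of the factor \<open>2 * a\<close>.\<close>

lemma semigroup_le_mean:
  assumes t: "0 \<le> t" and [measurable]: "\<phi> \<in> borel_measurable borel" and bd: "\<And>y. \<bar>\<phi> y\<bar> \<le> (a::real)" and a: "0 < a"
  shows "(\<integral>\<^sup>+\<omega>. ennreal (\<phi> (\<omega> t) + a) \<partial>P x) \<le> ennreal ((\<integral>y. \<phi> y \<partial>\<mu>) + a) + ennreal (2 * a * K x * h t)"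
proof -
  define \<psi> where "\<psi> y = (\<phi> y + a) / (2 * a)" for y
  have nn: "0 \<le> \<phi> y + a" and le: "\<phi> y + a \<le> 2 * a" for y using bd[of y] by linarith+
  have \<psi>: "0 \<le> \<psi> y" "\<psi> y \<le> 1" "\<phi> y + a = 2 * a * \<psi> y" for y
    using nn[of y] le[of y] a by (auto simp: \<psi>_def field_simps)
  have [measurable]: "\<psi> \<in> borel_measurable borel" unfolding \<psi>_def by measurable
  have m\<mu>: "\<phi> \<in> borel_measurable \<mu>" "\<psi> \<in> borel_measurable \<mu>"
    by (simp_all add: measurable_cong_sets[OF sets_\<mu> refl])
  have [measurable]: "(\<lambda>\<omega>. \<psi> (\<omega> t)) \<in> borel_measurable (P x)"
    by (rule measurable_compose[OF measurable_eval_P[OF t]]) measurable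
  have "(\<integral>\<^sup>+\<omega>. ennreal (\<phi> (\<omega> t) + a) \<partial>P x) = ennreal (2 * a) * (\<integral>\<^sup>+\<omega>. ennreal (\<psi> (\<omega> t)) \<partial>P x)"
    using a \<psi> by (subst nn_integral_cmult[symmetric]) (auto simp: ennreal_mult)
  also have "\<dots> \<le> ennreal (2 * a) * ((\<integral>\<^sup>+y. ennreal (\<psi> y) \<partial>\<mu>) + ennreal (K x * h t))"
    by (intro mult_left_mono tv_nn_integral(1)[OF t]) (auto simp: \<psi>)
  also have "\<dots> = (\<integral>\<^sup>+y. ennreal (\<phi> y + a) \<partial>\<mu>) + ennreal (2 * a * K x * h t)"
  proof -
    have "ennreal (2 * a) * (\<integral>\<^sup>+y. ennreal (\<psi> y) \<partial>\<mu>) = (\<integral>\<^sup>+y. ennreal (\<phi> y + a) \<partial>\<mu>)"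
      using a \<psi> m\<mu> by (subst nn_integral_cmult[symmetric]) (auto simp: ennreal_mult)
    moreover have "ennreal (2 * a) * ennreal (K x * h t) = ennreal (2 * a * K x * h t)"
      using a K_pos[of x] h_nonneg[OF t] by (subst ennreal_mult[symmetric]) (auto simp: mult_ac)
    ultimately show ?thesis by (simp add: distrib_left)
  qed
  also have "(\<integral>\<^sup>+y. ennreal (\<phi> y + a) \<partial>\<mu>) = ennreal (\<integral>y. \<phi> y + a \<partial>\<mu>)"
    using m\<mu> nn bd a by (intro nn_integral_eq_integral Bochner_Integration.integrable_add \<mu>.integrable_const_bound[where B=a]) auto
  also have "(\<integral>y. \<phi> y + a \<partial>\<mu>) = (\<integral>y. \<phi> y \<partial>\<mu>) + a"
    using m\<mu> bd a by (subst Bochner_Integration.integral_add) (auto intro!: \<mu>.integrable_const_bound[where B=a] simp: \<mu>.prob_space)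
  finally show ?thesis .
qed

text \<open>A lag \<open>u\<close> replaces the event \<open>{s < \<tau>}\<close> by \<open>{s - u < \<tau>}\<close>, on which the Markov property at
  time \<open>s - u\<close> brings the mean within \<open>h u\<close> of its stationary value.\<close>

lemma stopped_integral_le_mean:
  assumes [measurable]: "\<phi> \<in> borel_measurable borel" and bd: "\<And>y. \<bar>\<phi> y\<bar> \<le> (a::real)" and a: "0 < a" and \<epsilon>: "0 < \<epsilon>"
  shows "\<exists>T0. \<forall>T\<ge>T0. \<forall>\<tau>. stopping_time path_filtration \<tau> \<longrightarrow>
    (\<integral>\<^sup>+\<omega>. (\<integral>\<^sup>+s. ennreal (\<phi> (\<omega> s) + a) * indicator {s. 0 \<le> s \<and> s \<le> T \<and> ennreal s < \<tau> \<omega>} s \<partial>lborel) \<partial>P x)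
    \<le> (\<integral>\<^sup>+\<omega>. (\<integral>\<^sup>+s. ennreal ((\<integral>y. \<phi> y \<partial>\<mu>) + a) * indicator {s. 0 \<le> s \<and> s \<le> T \<and> ennreal s < \<tau> \<omega>} s \<partial>lborel) \<partial>P x)
      + ennreal (\<epsilon> * T)"
proof -
  define m where "m = (\<integral>y. \<phi> y \<partial>\<mu>) + a"
  obtain T1 C where T1: "0 \<le> T1" and C: "0 \<le> C"
    and KC: "\<And>t. T1 \<le> t \<Longrightarrow> (\<integral>\<^sup>+\<omega>. ennreal (K (\<omega> t)) \<partial>P x) \<le> ennreal C"
    using uniform_K_bound[of "{x}"] by auto
  \<comment> \<open>With this bound on \<open>h u\<close> the error caused by the lag is at most
    \<open>\<epsilon> / 2\<close> per unit of time; \<open>C + 1\<close> avoids a division by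
    0.\<close>
  have "0 < \<epsilon> / (4 * a * (C + 1))" using a C \<epsilon> by (intro divide_pos_pos mult_pos_pos) auto
  then obtain u where u: "0 \<le> u" "h u \<le> \<epsilon> / (4 * a * (C + 1))"
    using integrable_small_value[OF h_integrable h_nonneg] by metis
  have hu: "2 * a * C * h u \<le> \<epsilon> / 2"
  proof -
    have "2 * a * C * h u \<le> 2 * a * (C + 1) * (\<epsilon> / (4 * a * (C + 1)))"
      using u a C h_nonneg[OF u(1)] by (intro mult_mono) auto
    also have "\<dots> = \<epsilon> / 2"
    proof -
      have "2 * a * k * (\<epsilon> / (4 * a * k)) = \<epsilon> / 2" if "0 < k" for k using that a by (simp add: field_simps)
      from this[of "C + 1"] show ?thesis using C by simp
    qed
    finally show ?thesis .
  qed
  \<comment> \<open>The initial stretch of length \<open>T1 + u\<close>, where only the trivial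
    bound \<open>2 * a\<close> is available, contributes at most \<open>\<epsilon> * T / 2\<close>
    once \<open>T0 \<le> T\<close>.\<close>
  define T0 where "T0 = max 0 (2 * (T1 + u) * (2 * a) / \<epsilon>)"
  have main: "(\<integral>\<^sup>+\<omega>. (\<integral>\<^sup>+s. ennreal (\<phi> (\<omega> s) + a) * indicator {s. 0 \<le> s \<and> s \<le> T \<and> ennreal s < \<tau> \<omega>} s \<partial>lborel) \<partial>P x)
    \<le> (\<integral>\<^sup>+\<omega>. (\<integral>\<^sup>+s. ennreal m * indicator {s. 0 \<le> s \<and> s \<le> T \<and> ennreal s < \<tau> \<omega>} s \<partial>lborel) \<partial>P x)
      + ennreal (\<epsilon> * T)"
    if T: "T0 \<le> T" and st: "stopping_time path_filtration \<tau>" for T \<tau>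
  proof -
    have T_nn: "0 \<le> T" using T by (simp add: T0_def)
    interpret Px: prob_space "P x" by (rule prob_space_P)
    interpret pair_sigma_finite "P x" lborel ..
    have [measurable]: "\<tau> \<in> borel_measurable (P x)"
      by (intro measurable_from_P measurable_stopping_time[OF st])
         (auto simp: sets_path_filtration_subset space_path_filtration space_path_space)
    have [measurable]: "(\<lambda>p. fst p (snd p)) \<in> borel_measurable (P x \<Otimes>\<^sub>M lborel)"
      by (rule measurable_path_eval) (auto intro!: measurable_compose[OF measurable_fst] simp: measurable_cong_sets[OF sets_P refl])
    define D where "D s = {\<omega> \<in> cadlag_paths. ennreal s < \<tau> \<omega>}" for s
    have D_filt: "D s \<in> sets (path_filtration (ennreal s))" for s
      using stopping_timeD2[OF st, of "ennreal s"] by (simp add: D_def pred_def space_path_filtration)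
    have D_P: "D s \<in> sets (P x)" for s using D_filt sets_path_filtration_subset sets_P by blast
    define E where "E s = emeasure (P x) (D s)" for s
    have [measurable]: "E \<in> borel_measurable lborel"
    proof -
      have "(\<lambda>s. \<integral>\<^sup>+\<omega>. indicator {p. ennreal (snd p) < \<tau> (fst p)} (\<omega>, s) \<partial>P x) \<in> borel_measurable lborel"
        by (intro Px.borel_measurable_nn_integral) (simp add: indicator_def[abs_def] split_beta')
      also have "(\<lambda>s. \<integral>\<^sup>+\<omega>. indicator {p. ennreal (snd p) < \<tau> (fst p)} (\<omega>, s) \<partial>P x) = E"
        unfolding E_def using D_P
        by (auto simp: fun_eq_iff D_def nn_integral_indicator[symmetric] indicator_def space_P simp del: nn_integral_indicator intro!: nn_integral_cong)
      finally show ?thesis .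
    qed
    have E1: "E s \<le> 1" for s unfolding E_def using Px.emeasure_le_1 by simp
    have swap: "(\<integral>\<^sup>+\<omega>. (\<integral>\<^sup>+s. F (\<omega> s) * indicator {s. 0 \<le> s \<and> s \<le> T \<and> ennreal s < \<tau> \<omega>} s \<partial>lborel) \<partial>P x)
      = (\<integral>\<^sup>+s. (\<integral>\<^sup>+\<omega>\<in>D s. F (\<omega> s) \<partial>P x) * indicator {0..T} s \<partial>lborel)"
      if [measurable]: "F \<in> borel_measurable borel" for F :: "'a \<Rightarrow> ennreal"
    proof -
      have "(\<integral>\<^sup>+\<omega>. (\<integral>\<^sup>+s. F (\<omega> s) * indicator {s. 0 \<le> s \<and> s \<le> T \<and> ennreal s < \<tau> \<omega>} s \<partial>lborel) \<partial>P x)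
        = (\<integral>\<^sup>+\<omega>. (\<integral>\<^sup>+s. F (\<omega> s) * (indicator {p. ennreal (snd p) < \<tau> (fst p)} (\<omega>, s) * indicator {0..T} s) \<partial>lborel) \<partial>P x)"
        by (intro nn_integral_cong) (auto simp: indicator_def)
      also have "\<dots> = (\<integral>\<^sup>+s. (\<integral>\<^sup>+\<omega>. F (\<omega> s) * (indicator {p. ennreal (snd p) < \<tau> (fst p)} (\<omega>, s) * indicator {0..T} s) \<partial>P x) \<partial>lborel)"
      proof (rule Fubini'[symmetric])
        have "(\<lambda>p. F (fst p (snd p)) * (indicator {p. ennreal (snd p) < \<tau> (fst p)} p * indicator {0..T} (snd p)))
            \<in> borel_measurable (P x \<Otimes>\<^sub>M lborel)"
          by measurable
        then show "(\<lambda>(\<omega>, s). F (\<omega> s) * (indicator {p. ennreal (snd p) < \<tau> (fst p)} (\<omega>, s) * indicator {0..T} s))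
            \<in> borel_measurable (P x \<Otimes>\<^sub>M lborel)"
          by (simp add: split_beta')
      qed
      also have "\<dots> = (\<integral>\<^sup>+s. (\<integral>\<^sup>+\<omega>\<in>D s. F (\<omega> s) \<partial>P x) * indicator {0..T} s \<partial>lborel)"
      proof (intro nn_integral_cong)
        fix s
        show "(\<integral>\<^sup>+\<omega>. F (\<omega> s) * (indicator {p. ennreal (snd p) < \<tau> (fst p)} (\<omega>, s) * indicator {0..T} s) \<partial>P x)
          = (\<integral>\<^sup>+\<omega>\<in>D s. F (\<omega> s) \<partial>P x) * indicator {0..T} s"
          by (cases "s \<in> {0..T}") (auto simp: D_def indicator_def space_P intro!: nn_integral_cong)
      qed
      finally show ?thesis .
    qed
    have step: "(\<integral>\<^sup>+\<omega>\<in>D s. ennreal (\<phi> (\<omega> s) + a) \<partial>P x) \<le> ennreal m * E (s - u) + ennreal (\<epsilon> / 2)"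
      if s: "T1 + u \<le> s" for s
    proof -
      have su: "0 \<le> s - u" using s T1 by simp
      have [measurable]: "(\<lambda>\<omega>. K (\<omega> (s - u))) \<in> borel_measurable (P x)"
        by (intro measurable_compose[OF measurable_eval_P[OF su]]) simp
      note [measurable] = D_P[of "s - u"]
      \<comment> \<open>Since the shifted payoff is nonnegative, the event may be enlarged to one
        that is known already at time \<open>s - u\<close>.\<close>
      have "D s \<subseteq> D (s - u)"
        using u su by (auto simp: D_def intro!: le_less_trans[of "ennreal (s - u)" "ennreal s"] ennreal_leI)
      then have "(\<integral>\<^sup>+\<omega>\<in>D s. ennreal (\<phi> (\<omega> s) + a) \<partial>P x) \<le> (\<integral>\<^sup>+\<omega>\<in>D (s - u). ennreal (\<phi> (\<omega> (s - u + u)) + a) \<partial>P x)"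
        by (intro nn_integral_mono) (auto simp: indicator_def)
      also have "\<dots> = (\<integral>\<^sup>+\<omega>\<in>D (s - u). (\<integral>\<^sup>+\<omega>'. ennreal (\<phi> (\<omega>' u) + a) \<partial>P (\<omega> (s - u))) \<partial>P x)"
        by (rule markov_nn_integral[OF su u(1) D_filt]) measurable
      also have "\<dots> \<le> (\<integral>\<^sup>+\<omega>. ennreal m * indicator (D (s - u)) \<omega> + ennreal (2 * a * h u) * ennreal (K (\<omega> (s - u))) \<partial>P x)"
      proof (intro nn_integral_mono)
        fix \<omega>
        have "(\<integral>\<^sup>+\<omega>'. ennreal (\<phi> (\<omega>' u) + a) \<partial>P (\<omega> (s - u))) \<le> ennreal m + ennreal (2 * a * K (\<omega> (s - u)) * h u)"
          unfolding m_def by (rule semigroup_le_mean[OF u(1) _ bd a]) measurable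
        also have "ennreal (2 * a * K (\<omega> (s - u)) * h u) = ennreal (2 * a * h u) * ennreal (K (\<omega> (s - u)))"
          using a K_pos[of "\<omega> (s - u)"] h_nonneg[OF u(1)] by (subst ennreal_mult[symmetric]) (auto simp: mult_ac)
        finally show "(\<integral>\<^sup>+\<omega>'. ennreal (\<phi> (\<omega>' u) + a) \<partial>P (\<omega> (s - u))) * indicator (D (s - u)) \<omega>
          \<le> ennreal m * indicator (D (s - u)) \<omega> + ennreal (2 * a * h u) * ennreal (K (\<omega> (s - u)))"
          by (auto simp: indicator_def)
      qed
      also have "\<dots> = ennreal m * E (s - u) + ennreal (2 * a * h u) * (\<integral>\<^sup>+\<omega>. ennreal (K (\<omega> (s - u))) \<partial>P x)"
        by (simp add: nn_integral_add nn_integral_cmult E_def)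
      also have "\<dots> \<le> ennreal m * E (s - u) + ennreal (2 * a * h u) * ennreal C"
        using s by (intro add_mono mult_left_mono KC) auto
      also have "ennreal (2 * a * h u) * ennreal C = ennreal (2 * a * C * h u)"
        using a C h_nonneg[OF u(1)] by (subst ennreal_mult[symmetric]) (auto simp: mult_ac)
      also have "ennreal m * E (s - u) + \<dots> \<le> ennreal m * E (s - u) + ennreal (\<epsilon> / 2)"
        using hu by (intro add_mono ennreal_leI) auto
      finally show ?thesis .
    qed
    have early: "(\<integral>\<^sup>+\<omega>\<in>D s. ennreal (\<phi> (\<omega> s) + a) \<partial>P x) \<le> ennreal (2 * a)" for s
    proof -
      have "(\<integral>\<^sup>+\<omega>\<in>D s. ennreal (\<phi> (\<omega> s) + a) \<partial>P x) \<le> (\<integral>\<^sup>+\<omega>. ennreal (2 * a) \<partial>P x)"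
      proof (intro nn_integral_mono)
        fix \<omega> :: "real \<Rightarrow> 'a"
        show "ennreal (\<phi> (\<omega> s) + a) * indicator (D s) \<omega> \<le> ennreal (2 * a)"
          using bd[of "\<omega> s"] by (auto simp: indicator_def intro!: ennreal_leI)
      qed
      then show ?thesis by (simp add: Px.emeasure_space_1)
    qed
    have "(\<integral>\<^sup>+s. (\<integral>\<^sup>+\<omega>\<in>D s. ennreal (\<phi> (\<omega> s) + a) \<partial>P x) * indicator {0..T} s \<partial>lborel)
      \<le> (\<integral>\<^sup>+s. (ennreal (2 * a) * indicator {0..T1 + u} s
           + (ennreal m * (E (s - u) * indicator {0..T} (s - u)) + ennreal (\<epsilon> / 2) * indicator {0..T} s)) \<partial>lborel)"
    proof (intro nn_integral_mono)
      fix s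
      show "(\<integral>\<^sup>+\<omega>\<in>D s. ennreal (\<phi> (\<omega> s) + a) \<partial>P x) * indicator {0..T} s
        \<le> ennreal (2 * a) * indicator {0..T1 + u} s
           + (ennreal m * (E (s - u) * indicator {0..T} (s - u)) + ennreal (\<epsilon> / 2) * indicator {0..T} s)"
      proof (cases "s \<in> {0..T}")
        case True
        show ?thesis
        proof (cases "s \<le> T1 + u")
          case s: True
          then show ?thesis using True early[of s] by (auto simp: add_increasing2)
        next
          case False
          then have "s - u \<in> {0..T}" using True T1 u by auto
          then show ?thesis using True step[of s] False by (simp add: add_increasing)
        qed
      qed simp
    qed
    also have "\<dots> = ennreal (2 * a) * ennreal (T1 + u)
        + (ennreal m * (\<integral>\<^sup>+s. E (s - u) * indicator {0..T} (s - u) \<partial>lborel) + ennreal (\<epsilon> / 2) * ennreal T)"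
      using T1 u T_nn by (simp add: nn_integral_add nn_integral_cmult nn_integral_cmult_indicator)
    also have "(\<integral>\<^sup>+s. E (s - u) * indicator {0..T} (s - u) \<partial>lborel) = (\<integral>\<^sup>+s. E s * indicator {0..T} s \<partial>lborel)"
      by (rule nn_integral_lborel_translate[of "\<lambda>s. E s * indicator {0..T} s"]) measurable
    also have "ennreal m * \<dots> = (\<integral>\<^sup>+s. (\<integral>\<^sup>+\<omega>\<in>D s. ennreal m \<partial>P x) * indicator {0..T} s \<partial>lborel)"
    proof -
      have "(\<integral>\<^sup>+\<omega>\<in>D s. ennreal m \<partial>P x) = ennreal m * E s" for s
        using D_P by (simp add: nn_integral_cmult_indicator E_def)
      then show ?thesis by (simp add: nn_integral_cmult[symmetric] mult.assoc)
    qed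
    also have "\<dots> = (\<integral>\<^sup>+\<omega>. (\<integral>\<^sup>+s. ennreal m * indicator {s. 0 \<le> s \<and> s \<le> T \<and> ennreal s < \<tau> \<omega>} s \<partial>lborel) \<partial>P x)"
      by (rule swap[symmetric]) measurable
    also have "ennreal (2 * a) * ennreal (T1 + u) + (\<dots> + ennreal (\<epsilon> / 2) * ennreal T)
      \<le> (\<integral>\<^sup>+\<omega>. (\<integral>\<^sup>+s. ennreal m * indicator {s. 0 \<le> s \<and> s \<le> T \<and> ennreal s < \<tau> \<omega>} s \<partial>lborel) \<partial>P x) + ennreal (\<epsilon> * T)"
    proof -
      have "2 * (T1 + u) * (2 * a) / \<epsilon> \<le> T" using T by (simp add: T0_def)
      then have "2 * a * (T1 + u) + \<epsilon> / 2 * T \<le> \<epsilon> * T" using \<epsilon> by (simp add: field_simps)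
      moreover have "ennreal (2 * a) * ennreal (T1 + u) + ennreal (\<epsilon> / 2) * ennreal T = ennreal (2 * a * (T1 + u) + \<epsilon> / 2 * T)"
        using a T1 u \<epsilon> T_nn by (simp add: ennreal_mult[symmetric] ennreal_plus[symmetric] del: ennreal_plus)
      ultimately have "ennreal (2 * a) * ennreal (T1 + u) + ennreal (\<epsilon> / 2) * ennreal T \<le> ennreal (\<epsilon> * T)"
        by (auto intro: ennreal_leI)
      then show ?thesis by (simp add: add.left_commute add_left_mono)
    qed
    finally show ?thesis
      by (subst swap) measurable
  qed
  then show ?thesis unfolding m_def by blast
qed

text \<open>The gaps between the times \<open>n i\<close> grow geometrically, and each is chosen in a dyadic interval at a
  point where \<open>h\<close> is at most its mean.  The chance of a bad state at all the times so far then decays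
  faster than the gaps grow.\<close>

lemma recheck_times:
  assumes \<Gamma>: "compact \<Gamma>" and \<epsilon>: "0 < \<epsilon>"
  shows "\<exists>(n :: nat \<Rightarrow> real) \<delta>. n 0 = 0 \<and> strict_mono n \<and> (\<forall>k. real k \<le> n k) \<and> 0 < \<delta> \<and>
    (\<forall>B\<in>sets borel. emeasure \<mu> B \<le> ennreal \<delta> \<longrightarrow> (\<forall>y\<in>\<Gamma>. \<forall>s\<ge>0.
      (\<Sum>k. ennreal (n (k + 2) - n (k + 1)) *
         emeasure (P y) {\<omega> \<in> cadlag_paths. \<forall>i\<in>{1..k + 1}. \<omega> (s + n i) \<in> B}) \<le> ennreal \<epsilon>))"
proof -
  obtain T1 C0 where T1: "0 \<le> T1" and C0: "0 \<le> C0"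
    and KC0: "\<And>t y. T1 \<le> t \<Longrightarrow> y \<in> \<Gamma> \<Longrightarrow> (\<integral>\<^sup>+\<omega>. ennreal (K (\<omega> t)) \<partial>P y) \<le> ennreal C0"
    using uniform_K_bound[OF \<Gamma>] by auto
  obtain Kb where Kb: "0 \<le> Kb" "\<And>y. y \<in> \<Gamma> \<Longrightarrow> K y \<le> Kb" by (rule K_bounded[OF \<Gamma>]) blast
  define C where "C = max C0 Kb + 1"
  have C: "0 < C" "C0 \<le> C" "Kb \<le> C" using C0 by (auto simp: C_def)
  obtain e g :: "nat \<Rightarrow> real" where e: "summable e" "\<And>j. 0 \<le> e j" and
    g: "\<And>j. 2^j \<le> g j" "\<And>j. g j \<le> 2^Suc j" and hg: "\<And>j. 2^j * h (g j) \<le> e j"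
    using integrable_dyadic_grid[OF h_integrable h_nonneg] by metis
  have g1: "1 \<le> g j" for j using g(1)[of j] one_le_power[of "2::real" j] by linarith
  have "0 < \<epsilon> / (16 * C)" using \<epsilon> C by simp
  \<comment> \<open>The gaps start at dyadic level \<open>J\<close>, beyond which the errors
    \<open>e\<close> add up to less than \<open>\<epsilon> / (16 * C)\<close>.\<close>
  then obtain J where J0: "norm (\<Sum>i. e (i + J)) < \<epsilon> / (16 * C)"
    using suminf_exist_split[of "\<epsilon> / (16 * C)" e] e(1) by blast
  define E where "E = (\<Sum>i. e (i + J))"
  have sumE: "summable (\<lambda>i. e (i + J))" using e(1) by (simp add: summable_iff_shift)
  have E: "8 * C * E \<le> \<epsilon> / 2" using J0 C by (simp add: E_def field_simps abs_less_iff)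
  \<comment> \<open>With \<open>\<delta> \<le> 1/4\<close> the probability that all checks fail
    shrinks by the factor 4 per check, up to errors, while the gaps only double. The other bound
    keeps the contribution of the first check below \<open>\<epsilon> / 2\<close>.\<close>
  define \<delta> where "\<delta> = min (1/4) (\<epsilon> / 2^(J + 4))"
  have \<delta>: "0 < \<delta>" "\<delta> \<le> 1/4" "2^(J + 3) * \<delta> \<le> \<epsilon> / 2"
  proof -
    show "0 < \<delta>" using \<epsilon> by (simp add: \<delta>_def)
    show "\<delta> \<le> 1/4" unfolding \<delta>_def by (rule min.cobounded1)
    have "2^(J + 3) * \<delta> \<le> 2^(J + 3) * (\<epsilon> / 2^(J + 4))" by (intro mult_left_mono) (auto simp: \<delta>_def)
    also have "\<dots> = \<epsilon> / 2" by (simp add: power_add)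
    finally show "2^(J + 3) * \<delta> \<le> \<epsilon> / 2" .
  qed
  \<comment> \<open>From index 1 on all times are at least \<open>T1\<close>, where the mean of
    \<open>K\<close> is bounded; index 0 does not enter the estimate.\<close>
  define n where "n k = (if k = 0 then 0 else T1 + (\<Sum>i<k. g (J + i)))" for k :: nat
  have n_step: "n (Suc k) - n k = g (J + k)" if "0 < k" for k using that by (simp add: n_def)
  have n1: "n 1 = T1 + g J" by (simp add: n_def)
  have n_strict: "strict_mono n"
    unfolding strict_mono_Suc_iff
  proof
    fix k show "n k < n (Suc k)"
    proof (cases "k = 0")
      case True then show ?thesis using n1 T1 g1[of J] by (simp add: n_def)
    next
      case False then show ?thesis using n_step[of k] g1[of "J + k"] by simp
    qed
  qed
  have n_ge: "real k \<le> n k" for k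
  proof (induction k)
    case (Suc k)
    show ?case
    proof (cases "k = 0")
      case True then show ?thesis using n1 T1 g1[of J] by simp
    next
      case False then show ?thesis using n_step[of k] g1[of "J + k"] Suc by simp
    qed
  qed (simp add: n_def)
  have n_T1: "T1 \<le> n (Suc k)" for k
  proof -
    have "n 1 \<le> n (Suc k)" using n_strict by (simp add: strict_mono_less_eq)
    then show ?thesis using n1 g1[of J] by simp
  qed
  have main: "(\<Sum>k. ennreal (n (k + 2) - n (k + 1)) *
         emeasure (P y) {\<omega> \<in> cadlag_paths. \<forall>i\<in>{1..k + 1}. \<omega> (s + n i) \<in> B}) \<le> ennreal \<epsilon>"
    if B[measurable]: "B \<in> sets borel" and \<mu>B: "emeasure \<mu> B \<le> ennreal \<delta>" and y: "y \<in> \<Gamma>" and s: "0 \<le> s" for B y s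
  proof -
    interpret Py: prob_space "P y" by (rule prob_space_P)
    define Ev where "Ev k = {\<omega> \<in> cadlag_paths. \<forall>i\<in>{1..k + 1}. \<omega> (s + n i) \<in> B}" for k
    have sn: "0 \<le> s + n i" for i using s n_ge[of i] by (smt (verit) of_nat_0_le_iff)
    have Ev_filt: "Ev k \<in> sets (path_filtration (ennreal (s + n (Suc k))))" for k
    proof -
      have "(\<lambda>\<omega>. \<omega> (s + n i)) \<in> path_filtration (ennreal (s + n (Suc k))) \<rightarrow>\<^sub>M borel" if "i \<in> {1..k + 1}" for i
        using that sn n_strict by (intro measurable_path_filtration_eval ennreal_leI) (auto simp: strict_mono_less_eq)
      from measurable_sets[OF this B]
      have "{\<omega> \<in> space (path_filtration (ennreal (s + n (Suc k)))). \<omega> (s + n i) \<in> B}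
          \<in> sets (path_filtration (ennreal (s + n (Suc k))))" if "i \<in> {1..k + 1}" for i
        using that by (simp add: vimage_def Int_def conj_commute)
      then have "{\<omega> \<in> space (path_filtration (ennreal (s + n (Suc k)))). \<forall>i\<in>{1..k + 1}. \<omega> (s + n i) \<in> B}
          \<in> sets (path_filtration (ennreal (s + n (Suc k))))"
        by (intro sets.sets_Collect_finite_All finite_atLeastAtMost)
      then show ?thesis by (simp add: Ev_def space_path_filtration)
    qed
    have Ev_P: "Ev k \<in> sets (P y)" for k using Ev_filt sets_path_filtration_subset sets_P by blast
    define p where "p k = measure (P y) (Ev k)" for k
    have p0: "p 0 \<le> \<delta> + C * h (g J)"
    proof -
      have "emeasure (P y) (Ev 0) = emeasure (trans_kernel P (s + n 1) y) B"
        using sn by (subst emeasure_trans) (auto simp: Ev_def)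
      also have "\<dots> \<le> emeasure \<mu> B + ennreal (K y * h (g J))"
        using s n1 T1 g1[of J] by (intro marginal_le) auto
      also have "\<dots> \<le> ennreal \<delta> + ennreal (C * h (g J))"
        using \<mu>B Kb(2)[OF y] C g1[of J] h_nonneg[of "g J"] by (intro add_mono ennreal_leI mult_right_mono) auto
      also have "\<dots> = ennreal (\<delta> + C * h (g J))"
        using \<delta>(1) C g1[of J] h_nonneg[of "g J"] by simp
      finally have "ennreal (p 0) \<le> ennreal (\<delta> + C * h (g J))"
        by (simp only: p_def Py.emeasure_eq_measure)
      moreover have "0 \<le> \<delta> + C * h (g J)" using \<delta>(1) C g1[of J] h_nonneg[of "g J"] by simp
      ultimately show ?thesis by (simp only: ennreal_le_iff)
    qed
    have p_Suc: "p (Suc k) \<le> \<delta> * p k + C * h (g (J + Suc k))" for k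
    proof -
      let ?t = "s + n (Suc k)" and ?g = "g (J + Suc k)"
      have t0: "0 \<le> ?t" and g0: "0 \<le> ?g" using sn g1[of "J + Suc k"] by auto
      have hg0: "0 \<le> h ?g" using h_nonneg[OF g0] .
      have tg: "s + n (Suc (Suc k)) = ?t + ?g" using n_step[of "Suc k"] by simp
      have [measurable]: "(\<lambda>\<omega>. K (\<omega> ?t)) \<in> borel_measurable (P y)"
        by (intro measurable_compose[OF measurable_eval_P[OF t0]]) simp
      note [measurable] = Ev_P[of k]
      have "{1..Suc k + 1} = insert (Suc (Suc k)) {1..k + 1}" by auto
      then have "emeasure (P y) (Ev (Suc k)) = (\<integral>\<^sup>+\<omega>\<in>Ev k. indicator B (\<omega> (?t + ?g)) \<partial>P y)"
        using Ev_P[of "Suc k"] unfolding nn_integral_indicator[OF Ev_P, symmetric] tg[symmetric]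
        by (intro nn_integral_cong) (auto simp: Ev_def indicator_def simp del: atLeastAtMost_iff)
      also have "\<dots> = (\<integral>\<^sup>+\<omega>\<in>Ev k. (\<integral>\<^sup>+\<omega>'. indicator B (\<omega>' ?g) \<partial>P (\<omega> ?t)) \<partial>P y)"
        by (rule markov_nn_integral[OF t0 g0 Ev_filt]) measurable
      also have "\<dots> \<le> (\<integral>\<^sup>+\<omega>. ennreal \<delta> * indicator (Ev k) \<omega> + ennreal (h ?g) * ennreal (K (\<omega> ?t)) \<partial>P y)"
      proof (intro nn_integral_mono)
        fix \<omega>
        have "(\<integral>\<^sup>+\<omega>'. indicator B (\<omega>' ?g) \<partial>P (\<omega> ?t)) = emeasure (trans_kernel P ?g (\<omega> ?t)) B"
          using g0 by (simp add: emeasure_trans_nn)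
        also have "\<dots> \<le> emeasure \<mu> B + ennreal (K (\<omega> ?t) * h ?g)" by (rule tv_emeasure(1)[OF g0 B])
        also have "\<dots> \<le> ennreal \<delta> + ennreal (h ?g) * ennreal (K (\<omega> ?t))"
          using \<mu>B hg0 K_pos[of "\<omega> ?t"] by (intro add_mono) (auto simp: ennreal_mult[symmetric] mult.commute)
        finally show "(\<integral>\<^sup>+\<omega>'. indicator B (\<omega>' ?g) \<partial>P (\<omega> ?t)) * indicator (Ev k) \<omega>
          \<le> ennreal \<delta> * indicator (Ev k) \<omega> + ennreal (h ?g) * ennreal (K (\<omega> ?t))"
          by (auto simp: indicator_def)
      qed
      also have "\<dots> = ennreal \<delta> * emeasure (P y) (Ev k) + ennreal (h ?g) * (\<integral>\<^sup>+\<omega>. ennreal (K (\<omega> ?t)) \<partial>P y)"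
        by (simp add: nn_integral_add nn_integral_cmult)
      also have "\<dots> \<le> ennreal \<delta> * emeasure (P y) (Ev k) + ennreal (h ?g) * ennreal C"
      proof (intro add_mono mult_left_mono order_refl)
        have "T1 \<le> ?t" using n_T1[of k] s by simp
        then have "(\<integral>\<^sup>+\<omega>. ennreal (K (\<omega> ?t)) \<partial>P y) \<le> ennreal C0" using y by (rule KC0)
        also have "\<dots> \<le> ennreal C" using C by (intro ennreal_leI)
        finally show "(\<integral>\<^sup>+\<omega>. ennreal (K (\<omega> ?t)) \<partial>P y) \<le> ennreal C" .
      qed simp_all
      also have "\<dots> = ennreal (\<delta> * p k + C * h ?g)"
        using \<delta>(1) C hg0 by (simp add: Py.emeasure_eq_measure p_def ennreal_mult[symmetric] mult.commute)
      finally have "ennreal (p (Suc k)) \<le> ennreal (\<delta> * p k + C * h ?g)"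
        by (simp only: p_def Py.emeasure_eq_measure)
      moreover have "0 \<le> \<delta> * p k + C * h ?g" using \<delta>(1) C hg0 by (simp add: p_def)
      ultimately show ?thesis by (simp only: ennreal_le_iff)
    qed
    \<comment> \<open>The power \<open>2^(J + k + 2)\<close> bounds the gap from
      \<open>n (k + 1)\<close> to \<open>n (k + 2)\<close>, so \<open>b\<close> dominates the
      summands of the claim.\<close>
    define b where "b k = 2^(J + k + 2) * p k" for k
    have p_nn: "0 \<le> p k" for k by (simp add: p_def)
    have b_nn: "0 \<le> b k" for k by (simp add: b_def p_nn)
    have b0: "b 0 \<le> 2^(J + 2) * \<delta> + 4 * C * e J"
    proof -
      have "b 0 \<le> 2^(J + 2) * (\<delta> + C * h (g J))" unfolding b_def add_0_right using p0 by (intro mult_left_mono) auto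
      also have "\<dots> = 2^(J + 2) * \<delta> + 4 * C * (2^J * h (g J))" by (simp add: algebra_simps power_add)
      also have "\<dots> \<le> 2^(J + 2) * \<delta> + 4 * C * e J" using hg[of J] C by (intro add_mono mult_left_mono) auto
      finally show ?thesis .
    qed
    have b_Suc: "b (Suc k) \<le> b k / 2 + 4 * C * e (J + Suc k)" for k
    proof -
      have "b (Suc k) \<le> 2^(J + Suc k + 2) * (\<delta> * p k + C * h (g (J + Suc k)))"
        unfolding b_def using p_Suc by (intro mult_left_mono) auto
      also have "\<dots> = 2 * \<delta> * b k + 4 * C * (2^(J + Suc k) * h (g (J + Suc k)))"
        by (simp add: algebra_simps power_add b_def)
      also have "\<dots> \<le> 2 * (1/4) * b k + 4 * C * e (J + Suc k)"
        using hg[of "J + Suc k"] C \<delta>(2) b_nn[of k] by (intro add_mono mult_left_mono mult_right_mono) auto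
      finally show ?thesis by simp
    qed
    \<comment> \<open>The recursion halves \<open>b\<close> at each step, so its sum is at most
      twice the sum of the initial value and the errors.\<close>
    have S: "(\<Sum>k<N. b k) \<le> 2 * (2^(J + 2) * \<delta> + 4 * C * E)" for N
    proof (induction N)
      case 0
      have "0 \<le> E" unfolding E_def using e by (intro suminf_nonneg sumE) auto
      then show ?case using \<delta>(1) C by simp
    next
      case (Suc N)
      have "(\<Sum>k<Suc N. b k) = b 0 + (\<Sum>k<N. b (Suc k))" by (rule sum.lessThan_Suc_shift)
      also have "\<dots> \<le> (2^(J + 2) * \<delta> + 4 * C * e J) + (\<Sum>k<N. b k / 2 + 4 * C * e (J + Suc k))"
        by (intro add_mono b0 sum_mono b_Suc)
      also have "\<dots> = 2^(J + 2) * \<delta> + 4 * C * (\<Sum>k<Suc N. e (k + J)) + (\<Sum>k<N. b k) / 2"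
        unfolding sum.lessThan_Suc_shift by (simp add: sum.distrib sum_distrib_left sum_divide_distrib algebra_simps)
      also have "(\<Sum>k<Suc N. e (k + J)) \<le> E" unfolding E_def using e sumE by (intro sum_le_suminf) auto
      finally show ?case using Suc C by (simp add: mult_left_mono)
    qed
    have "ennreal (n (k + 2) - n (k + 1)) * emeasure (P y) (Ev k) \<le> ennreal (b k)" for k
    proof -
      have "n (k + 2) - n (k + 1) = g (J + Suc k)" using n_step[of "Suc k"] by simp
      also have "\<dots> \<le> 2^(J + k + 2)" using g(2)[of "J + Suc k"] by simp
      finally show ?thesis
        unfolding b_def Py.emeasure_eq_measure p_def[symmetric] using p_nn
        by (simp add: ennreal_mult''[symmetric] ennreal_leI mult_right_mono)
    qed
    then have "(\<Sum>k. ennreal (n (k + 2) - n (k + 1)) * emeasure (P y) (Ev k)) \<le> (\<Sum>k. ennreal (b k))"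
      by (intro suminf_le) auto
    also have "\<dots> \<le> ennreal \<epsilon>"
    proof (rule suminf_le_const)
      fix N
      have "(\<Sum>k<N. ennreal (b k)) = ennreal (\<Sum>k<N. b k)" using b_nn by (simp add: sum_ennreal)
      also have "(\<Sum>k<N. b k) \<le> \<epsilon>" using S[of N] E \<delta>(3) by (simp add: algebra_simps power_add)
      finally show "(\<Sum>k<N. ennreal (b k)) \<le> ennreal \<epsilon>" by (auto intro: ennreal_leI)
    qed simp
    finally show ?thesis by (simp add: Ev_def)
  qed
  have "n 0 = 0" by (simp add: n_def)
  then show ?thesis using n_strict n_ge \<delta>(1) main by blast
qed

end

section \<open>The law of a controlled process\<close>

text \<open>Dependence on finitely many coordinates is what reduces integrals over the infinite
  product to iterated kernels. It is required only on the control space, since a strategy is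
  unconstrained elsewhere.\<close>

definition depends_upto :: "nat \<Rightarrow> ((nat \<Rightarrow> real \<Rightarrow> 'a::topological_space) \<Rightarrow> 'b) \<Rightarrow> bool" where
  "depends_upto n F \<longleftrightarrow>
     (\<forall>w\<in>space control_space. \<forall>w'\<in>space control_space. (\<forall>i\<le>n. w i = w' i) \<longrightarrow> F w = F w')"

lemma depends_uptoD:
  "depends_upto n F \<Longrightarrow> w \<in> space control_space \<Longrightarrow> w' \<in> space control_space \<Longrightarrow> (\<And>i. i \<le> n \<Longrightarrow> w i = w' i) \<Longrightarrow> F w = F w'"
  unfolding depends_upto_def by blast

lemma control_space_upd:
  "w \<in> space control_space \<Longrightarrow> \<omega> \<in> cadlag_paths \<Longrightarrow> w(n := \<omega>) \<in> space control_space"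
  by (auto simp: space_control_space)

lemma measurable_control_upd:
  assumes w: "f \<in> M \<rightarrow>\<^sub>M control_space" and x: "g \<in> M \<rightarrow>\<^sub>M path_space"
  shows "(\<lambda>x. (f x)(n := g x)) \<in> M \<rightarrow>\<^sub>M control_space"
proof (rule measurable_control_spaceI)
  fix i show "(\<lambda>x. ((f x)(n := g x)) i) \<in> M \<rightarrow>\<^sub>M path_space"
    using x measurable_compose[OF w measurable_control_coord[of i]] by (cases "i = n") simp_all
qed

lemma control_filtration_locale: "filtration (space control_space) (control_filtration n)"
proof
  show "space (control_filtration n i) = space control_space" for i by (rule space_control_filtration)
  fix i j :: ennreal assume "i \<le> j"
  then show "sets (control_filtration n i :: (nat \<Rightarrow> real \<Rightarrow> 'a) measure) \<le> sets (control_filtration n j)"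
    unfolding control_filtration_def
    by (subst (1 2) sets_measure_of) (auto intro!: sigma_sets_mono' intro: order_trans)
qed

locale strategy = markov P for P :: "'a::metric_space \<Rightarrow> (real \<Rightarrow> 'a) measure" +
  fixes U :: "'a set" and V :: "'a strategy"
  assumes strat: "is_strategy U V"
begin

abbreviation "\<tau> \<equiv> fst V"
abbreviation "\<xi> \<equiv> snd V"

lemma stopping_\<tau>: "stopping_time (control_filtration (Suc i)) (\<tau> i)"
  using strat by (cases V) (auto simp: is_strategy_def)

lemma \<tau>_mono: "w \<in> space control_space \<Longrightarrow> \<tau> i w \<le> \<tau> (Suc i) w"
  using strat by (cases V) (auto simp: is_strategy_def)

lemma \<tau>_incr: "w \<in> space control_space \<Longrightarrow> i \<le> j \<Longrightarrow> \<tau> i w \<le> \<tau> j w"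
  by (rule lift_Suc_mono_le[of "\<lambda>i. \<tau> i w"]) (simp_all add: \<tau>_mono)

lemma \<xi>_in_U: "w \<in> space control_space \<Longrightarrow> \<xi> i w \<in> U"
  using strat by (cases V) (auto simp: is_strategy_def)

lemma \<xi>_preimage:
  assumes "B \<in> sets borel"
  shows "{w \<in> space control_space. \<xi> i w \<in> B \<and> \<tau> i w \<le> t} \<in> sets (control_filtration (Suc i) t)"
proof -
  interpret filtration "space control_space" "control_filtration (Suc i)" by (rule control_filtration_locale)
  have "\<xi> i \<in> pre_sigma (\<tau> i) \<rightarrow>\<^sub>M borel"
    using strat by (cases V) (auto simp: is_strategy_def)
  from measurable_sets[OF this assms]
  have "\<xi> i -` B \<inter> space control_space \<in> sets (pre_sigma (\<tau> i))" by (simp add: space_pre_sigma)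
  from sets_pre_sigmaD[OF stopping_\<tau> this, of t] show ?thesis
    by (simp add: vimage_def Int_def conj_ac)
qed

lemma measurable_\<tau>: "\<tau> i \<in> borel_measurable control_space"
  by (rule measurable_stopping_time[OF stopping_\<tau>])
     (auto simp: sets_control_filtration_subset space_control_filtration)

lemma measurable_\<xi>: "\<xi> i \<in> control_space \<rightarrow>\<^sub>M borel"
proof (rule measurableI)
  fix B :: "'a set" assume "B \<in> sets borel"
  from \<xi>_preimage[OF this, of i top] sets_control_filtration_subset
  show "\<xi> i -` B \<inter> space control_space \<in> sets control_space"
    by (force simp: vimage_def Int_def conj_ac)
qed simp

text \<open>The sets \<open>{w. \<tau> i w \<le> s}\<close> with \<open>s \<le> t\<close> do not
  separate \<open>w\<close> from \<open>w'\<close>; this is used for \<open>s = \<tau> i w\<close>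
  and then for \<open>s = \<tau> i w'\<close>.\<close>

lemma \<tau>_nonanticipating:
  assumes w: "w \<in> space control_space" "w' \<in> space control_space"
    and ag: "agree (Suc i) t w w'" and le: "\<tau> i w \<le> t"
  shows "\<tau> i w' = \<tau> i w"
proof -
  have set: "{w \<in> space control_space. \<tau> i w \<le> s} \<in> sets (control_filtration (Suc i) s)" for s
    using stopping_timeD[OF stopping_\<tau>, of i s] by (simp add: pred_def space_control_filtration)
  have ag': "agree (Suc i) s w w'" if "s \<le> t" for s using ag that by (auto simp: agree_def)
  have 1: "\<tau> i w' \<le> \<tau> i w"
    using control_filtrationD[OF set ag'[OF le] w] w by auto
  then have "\<tau> i w' \<le> t" using le by simp
  then have "\<tau> i w \<le> \<tau> i w'"
    using control_filtrationD[OF set ag' w, of "\<tau> i w'"] w by auto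
  with 1 show ?thesis by simp
qed

text \<open>In a metric space the singleton \<open>{\<xi> i w}\<close> is a Borel set, so
  \<open>\<xi>_preimage\<close> applies to it.\<close>

lemma \<xi>_nonanticipating:
  assumes w: "w \<in> space control_space" "w' \<in> space control_space"
    and ag: "agree (Suc i) t w w'" and le: "\<tau> i w \<le> t"
  shows "\<xi> i w' = \<xi> i w"
  using control_filtrationD[OF \<xi>_preimage[of "{\<xi> i w}"] ag w] le w by auto

lemma \<tau>_depends: "depends_upto i (\<tau> i)"
  unfolding depends_upto_def
proof (intro ballI impI)
  fix w w' :: "nat \<Rightarrow> real \<Rightarrow> 'a"
  assume *: "w \<in> space control_space" "w' \<in> space control_space" "\<forall>j\<le>i. w j = w' j"
  then show "\<tau> i w = \<tau> i w'"
    using \<tau>_nonanticipating[OF *(2,1), of i top] by (simp add: agree_def)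
qed

lemma \<xi>_depends: "depends_upto i (\<xi> i)"
  unfolding depends_upto_def
proof (intro ballI impI)
  fix w w' :: "nat \<Rightarrow> real \<Rightarrow> 'a"
  assume *: "w \<in> space control_space" "w' \<in> space control_space" "\<forall>j\<le>i. w j = w' j"
  then show "\<xi> i w = \<xi> i w'"
    using \<xi>_nonanticipating[OF *(2,1), of i top] by (simp add: agree_def)
qed

definition kern :: "nat \<Rightarrow> (nat \<Rightarrow> real \<Rightarrow> 'a) \<Rightarrow> (real \<Rightarrow> 'a) measure" where
  "kern n w = (if \<tau> n w = \<infinity> then return path_space (w n)
     else distr (P (\<xi> n w)) path_space (paste (enn2real (\<tau> n w)) (w n)))"

lemma control_kernel_Suc: "control_kernel P x V (Suc n) w = kern n (\<lambda>i. w (min i n))"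
  using control_kernel.simps(2)[of P x "fst V" "snd V" n w] by (simp add: kern_def Let_def)

lemma measurable_kern: "kern n \<in> control_space \<rightarrow>\<^sub>M subprob_algebra path_space"
proof -
  note [measurable] = measurable_\<tau> measurable_\<xi> measurable_control_coord
  have "(\<lambda>w. distr (P (\<xi> n w)) path_space (paste (enn2real (\<tau> n w)) (w n))) \<in> control_space \<rightarrow>\<^sub>M subprob_algebra path_space"
  proof (rule measurable_distr2)
    have "(\<lambda>p. paste (enn2real (\<tau> n (fst p))) (fst p n) (snd p)) \<in> control_space \<Otimes>\<^sub>M path_space \<rightarrow>\<^sub>M path_space"
    proof (rule measurable_paste)
      show "(\<lambda>p. fst p n) \<in> control_space \<Otimes>\<^sub>M path_space \<rightarrow>\<^sub>M path_space"
        by (rule measurable_compose[OF measurable_fst measurable_control_coord])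
      show "(\<lambda>p. enn2real (\<tau> n (fst p))) \<in> borel_measurable (control_space \<Otimes>\<^sub>M path_space)"
        by (intro borel_measurable_enn2real measurable_compose[OF measurable_fst measurable_\<tau>])
    qed simp_all
    then show "(\<lambda>(w, \<omega>'). paste (enn2real (\<tau> n w)) (w n) \<omega>') \<in> control_space \<Otimes>\<^sub>M path_space \<rightarrow>\<^sub>M path_space"
      by (simp add: split_beta')
    show "(\<lambda>w. P (\<xi> n w)) \<in> control_space \<rightarrow>\<^sub>M subprob_algebra path_space"
      by (rule measurable_compose[OF measurable_\<xi> measurable_P_subprob])
  qed
  moreover have "(\<lambda>w. return path_space (w n)) \<in> control_space \<rightarrow>\<^sub>M subprob_algebra path_space"
    by (rule measurable_compose[OF measurable_control_coord return_measurable])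
  ultimately show ?thesis
    unfolding kern_def[abs_def] by measurable
qed

lemma measurable_paste_P:
  assumes "0 \<le> t" "\<omega> \<in> cadlag_paths"
  shows "paste t \<omega> \<in> P x \<rightarrow>\<^sub>M path_space"
  by (intro measurable_from_P measurable_paste) (use assms in \<open>auto simp: space_path_space\<close>)

lemma prob_space_kern: "w \<in> space control_space \<Longrightarrow> prob_space (kern n w)"
  by (auto simp: kern_def space_path_space space_control_space
      intro!: prob_space_return prob_space.prob_space_distr prob_space_P measurable_paste_P)

lemma nn_integral_kern:
  assumes w: "w \<in> space control_space" and f[measurable]: "f \<in> borel_measurable path_space"
  shows "(\<integral>\<^sup>+\<omega>. f \<omega> \<partial>kern n w) = (if \<tau> n w = \<infinity> then f (w n)
     else (\<integral>\<^sup>+\<omega>. f (paste (enn2real (\<tau> n w)) (w n) \<omega>) \<partial>P (\<xi> n w)))"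
  using w by (auto simp: kern_def nn_integral_return space_path_space space_control_space
      intro!: nn_integral_distr measurable_paste_P)

lemma kern_depends: "depends_upto n (kern n)"
  unfolding depends_upto_def
proof (intro ballI impI)
  fix w w' :: "nat \<Rightarrow> real \<Rightarrow> 'a"
  assume *: "w \<in> space control_space" "w' \<in> space control_space" "\<forall>i\<le>n. w i = w' i"
  then have "\<tau> n w = \<tau> n w'" "\<xi> n w = \<xi> n w'"
    by (auto intro: depends_uptoD[OF \<tau>_depends] depends_uptoD[OF \<xi>_depends])
  then show "kern n w = kern n w'" using * by (simp add: kern_def)
qed

text \<open>This is \<open>control_kernel\<close> with an arbitrary initial law in place of
  \<open>P x\<close>.\<close>

definition full_kernel :: "(real \<Rightarrow> 'a) measure \<Rightarrow> nat \<Rightarrow> (nat \<Rightarrow> real \<Rightarrow> 'a) \<Rightarrow> (real \<Rightarrow> 'a) measure" where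
  "full_kernel \<nu> n w = (case n of 0 \<Rightarrow> \<nu> | Suc k \<Rightarrow> kern k (\<lambda>i. w (min i k)))"

text \<open>With a point mass for \<open>\<nu>\<close> this is the law conditioned on the first coordinate.\<close>

definition law :: "(real \<Rightarrow> 'a) measure \<Rightarrow> (nat \<Rightarrow> real \<Rightarrow> 'a) measure" where
  "law \<nu> = projective_family.lim UNIV (Ionescu_Tulcea.CI (full_kernel \<nu>) (\<lambda>_. path_space)) (\<lambda>_. path_space)"

lemma control_law_eq: "control_law P x V = law (P x)"
proof -
  have "control_kernel P x V = full_kernel (P x)"
  proof (intro ext)
    fix n w show "control_kernel P x V n w = full_kernel (P x) n w"
    proof (cases n)
      case 0 then show ?thesis by (simp add: full_kernel_def)
    next
      case (Suc k) then show ?thesis by (simp only: full_kernel_def control_kernel_Suc nat.case)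
    qed
  qed
  then show ?thesis by (simp add: control_law_def law_def)
qed

end

section \<open>The Ionescu-Tulcea law of the coordinates\<close>

locale strategy_law = strategy P U V
  for P :: "'a::metric_space \<Rightarrow> (real \<Rightarrow> 'a) measure" and U :: "'a set" and V :: "'a strategy" +
  fixes \<nu> :: "(real \<Rightarrow> 'a) measure"
  assumes \<nu>: "prob_space \<nu>" "sets \<nu> = sets path_space"
begin

lemma extend_measurable:
  "(\<lambda>w i. w (min i k)) \<in> PiM {0..<Suc k} (\<lambda>_. path_space) \<rightarrow>\<^sub>M control_space"
  by (intro measurable_control_spaceI measurable_component_singleton) auto

lemma measurable_full_kernel:
  "full_kernel \<nu> i \<in> PiM {0..<i} (\<lambda>_. path_space) \<rightarrow>\<^sub>M subprob_algebra path_space"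
proof (cases i)
  case 0
  have "\<nu> \<in> space (subprob_algebra path_space)"
    using \<nu> by (auto simp: space_subprob_algebra intro: prob_space_imp_subprob_space)
  then show ?thesis using 0 by (simp add: full_kernel_def[abs_def])
next
  case (Suc k)
  then show ?thesis
    using measurable_compose[OF extend_measurable measurable_kern, of k] by (simp add: full_kernel_def[abs_def])
qed

lemma prob_space_full_kernel:
  assumes "x \<in> space (PiM {0..<i} (\<lambda>_. path_space))"
  shows "prob_space (full_kernel \<nu> i x)"
proof (cases i)
  case 0 then show ?thesis using \<nu> by (simp add: full_kernel_def)
next
  case (Suc k)
  then show ?thesis
    using measurable_space[OF extend_measurable, of x k] assms by (simp add: full_kernel_def prob_space_kern)
qed

sublocale IT: Ionescu_Tulcea "full_kernel \<nu>" "\<lambda>_. path_space"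
  by (rule Ionescu_Tulcea.intro[OF measurable_full_kernel prob_space_full_kernel])

lemma sets_law: "sets (law \<nu>) = sets control_space"
  by (simp add: law_def control_space_def)

lemma space_law: "space (law \<nu>) = space control_space"
  using sets_law by (rule sets_eq_imp_space_eq)

lemma measurable_from_law: "f \<in> control_space \<rightarrow>\<^sub>M N \<Longrightarrow> f \<in> law \<nu> \<rightarrow>\<^sub>M N"
  by (simp add: measurable_cong_sets[OF sets_law refl])

text \<open>The marginal of the law on the first \<open>n + 1\<close> coordinates is the iterated
  kernel \<open>C 0 (Suc n)\<close>: the index set \<open>{0..<Suc n}\<close> is already an initial
  segment, so no further projection takes place.\<close>

lemma nn_integral_law_C:
  assumes F[measurable]: "F \<in> borel_measurable control_space" and dep: "depends_upto n F"
  shows "(\<integral>\<^sup>+w. F w \<partial>law \<nu>) = (\<integral>\<^sup>+v. F (\<lambda>i. v (min i n)) \<partial>IT.C 0 (Suc n) (\<lambda>_. undefined))"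
proof -
  let ?J = "{0..<Suc n}"
  have up: "IT.up_to ?J = Suc n"
    by (rule antisym) (auto simp: IT.up_to_iff, metis IT.up_to_less finite_atLeastLessThan atLeastLessThan_iff lessI not_less_eq_eq le0 Suc_leI)
  have r: "(\<lambda>w. restrict w ?J) \<in> control_space \<rightarrow>\<^sub>M PiM ?J (\<lambda>_. path_space)"
    unfolding control_space_def by (intro measurable_restrict_subset) simp
  have Fm[measurable]: "(\<lambda>v. F (\<lambda>i. v (min i n))) \<in> borel_measurable (PiM ?J (\<lambda>_. path_space))"
    by (rule measurable_compose[OF extend_measurable F])
  have C_sets: "sets (IT.C 0 (Suc n) (\<lambda>_. undefined)) = sets (PiM ?J (\<lambda>_. path_space))"
    using IT.sets_C[of "\<lambda>_. undefined" 0 "Suc n"] by (auto simp: space_PiM PiE_def extensional_def)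
  have "(\<integral>\<^sup>+w. F w \<partial>law \<nu>) = (\<integral>\<^sup>+w. F (\<lambda>i. restrict w ?J (min i n)) \<partial>law \<nu>)"
  proof (rule nn_integral_cong)
    fix w assume "w \<in> space (law \<nu>)"
    then show "F w = F (\<lambda>i. restrict w ?J (min i n))"
      by (intro depends_uptoD[OF dep]) (auto simp: space_law space_control_space)
  qed
  also have "\<dots> = (\<integral>\<^sup>+v. F (\<lambda>i. v (min i n)) \<partial>distr (law \<nu>) (PiM ?J (\<lambda>_. path_space)) (\<lambda>w. restrict w ?J))"
    by (rule nn_integral_distr[symmetric, OF measurable_from_law[OF r]]) (simp add: Fm)
  also have "distr (law \<nu>) (PiM ?J (\<lambda>_. path_space)) (\<lambda>w. restrict w ?J) = IT.CI ?J"
    unfolding law_def by (rule IT.distr_lim) simp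
  also have "(\<integral>\<^sup>+v. F (\<lambda>i. v (min i n)) \<partial>IT.CI ?J) = (\<integral>\<^sup>+v. F (\<lambda>i. restrict v ?J (min i n)) \<partial>IT.C 0 (Suc n) (\<lambda>_. undefined))"
    unfolding IT.CI_def up
    by (rule nn_integral_distr) (simp_all add: measurable_cong_sets[OF C_sets refl] Fm del: IT.C.simps)
  also have "\<dots> = (\<integral>\<^sup>+v. F (\<lambda>i. v (min i n)) \<partial>IT.C 0 (Suc n) (\<lambda>_. undefined))"
  proof (rule nn_integral_cong)
    fix v assume "v \<in> space (IT.C 0 (Suc n) (\<lambda>_. undefined))"
    have "restrict v ?J (min i n) = v (min i n)" for i by (simp add: less_Suc_eq_le)
    then show "F (\<lambda>i. restrict v ?J (min i n)) = F (\<lambda>i. v (min i n))" by simp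
  qed
  finally show ?thesis .
qed

lemma prob_space_law: "prob_space (law \<nu>)"
proof
  let ?C = "IT.C 0 (Suc 0) (\<lambda>_. undefined)"
  have "prob_space ?C" by (rule IT.prob_space_C) (simp add: space_PiM PiE_def extensional_def)
  then have "emeasure ?C (space ?C) = 1" by (rule prob_space.emeasure_space_1)
  moreover have "(\<integral>\<^sup>+w. 1 \<partial>law \<nu>) = (\<integral>\<^sup>+v. 1 \<partial>?C)"
    by (rule nn_integral_law_C) (simp_all add: depends_upto_def)
  ultimately show "emeasure (law \<nu>) (space (law \<nu>)) = 1" by simp
qed

lemma measurable_step:
  assumes F[measurable]: "F \<in> borel_measurable control_space"
  shows "(\<lambda>w. \<integral>\<^sup>+\<omega>. F (w(Suc n := \<omega>)) \<partial>kern n w) \<in> borel_measurable control_space"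
proof (rule nn_integral_measurable_subprob_algebra2[OF _ measurable_kern])
  have "(\<lambda>p. F ((fst p)(Suc n := snd p))) \<in> borel_measurable (control_space \<Otimes>\<^sub>M path_space)"
    by (rule measurable_compose[OF measurable_control_upd F]) measurable
  then show "(\<lambda>(w, \<omega>). F (w(Suc n := \<omega>))) \<in> borel_measurable (control_space \<Otimes>\<^sub>M path_space)"
    by (simp add: split_beta')
qed

lemma sets_kern: "w \<in> space control_space \<Longrightarrow> sets (kern n w) = sets path_space"
  by (simp add: kern_def)

lemma step_depends:
  assumes dep: "depends_upto (Suc n) F"
  shows "depends_upto n (\<lambda>w. \<integral>\<^sup>+\<omega>. F (w(Suc n := \<omega>)) \<partial>kern n w)"
  unfolding depends_upto_def
proof (intro ballI impI)
  fix w w' :: "nat \<Rightarrow> real \<Rightarrow> 'a"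
  assume *: "w \<in> space control_space" "w' \<in> space control_space" "\<forall>i\<le>n. w i = w' i"
  have "kern n w = kern n w'" using * by (intro depends_uptoD[OF kern_depends]) auto
  moreover have "(\<integral>\<^sup>+\<omega>. F (w(Suc n := \<omega>)) \<partial>kern n w') = (\<integral>\<^sup>+\<omega>. F (w'(Suc n := \<omega>)) \<partial>kern n w')"
  proof (rule nn_integral_cong)
    fix \<omega> assume "\<omega> \<in> space (kern n w')"
    then have "\<omega> \<in> cadlag_paths" using sets_eq_imp_space_eq[OF sets_kern[OF *(2)], of n] by (simp add: space_path_space)
    then show "F (w(Suc n := \<omega>)) = F (w'(Suc n := \<omega>))"
      using * by (intro depends_uptoD[OF dep] control_space_upd) (auto simp: le_Suc_eq)
  qed
  ultimately show "(\<integral>\<^sup>+\<omega>. F (w(Suc n := \<omega>)) \<partial>kern n w) = (\<integral>\<^sup>+\<omega>. F (w'(Suc n := \<omega>)) \<partial>kern n w')" by simp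
qed

text \<open>Peels off the last coordinate; together with \<open>law_start\<close> this computes
  expectations without returning to the Ionescu-Tulcea construction.\<close>

lemma law_step:
  assumes F[measurable]: "F \<in> borel_measurable control_space" and dep: "depends_upto (Suc n) F"
  shows "(\<integral>\<^sup>+w. F w \<partial>law \<nu>) = (\<integral>\<^sup>+w. (\<integral>\<^sup>+\<omega>. F (w(Suc n := \<omega>)) \<partial>kern n w) \<partial>law \<nu>)"
proof -
  let ?C = "\<lambda>n. IT.C 0 n (\<lambda>_. undefined)"
  have sp0: "(\<lambda>_. undefined) \<in> space (PiM {0..<0::nat} (\<lambda>_. path_space :: (real \<Rightarrow> 'a) measure))"
    by (auto simp: space_PiM PiE_def extensional_def)
  have spC: "space (?C (Suc n)) = space (PiM {0..<Suc n} (\<lambda>_. path_space))"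
    using IT.space_C[OF sp0, of "Suc n"] by simp
  have Fm: "(\<lambda>v. F (\<lambda>i. v (min i (Suc n)))) \<in> borel_measurable (PiM {0..<Suc (Suc n)} (\<lambda>_. path_space))"
    by (rule measurable_compose[OF extend_measurable F])
  have "(\<integral>\<^sup>+w. F w \<partial>law \<nu>) = (\<integral>\<^sup>+v. F (\<lambda>i. v (min i (Suc n))) \<partial>(?C (Suc n) \<bind> IT.eP (Suc n)))"
    using nn_integral_law_C[OF F dep] by simp
  also have "\<dots> = (\<integral>\<^sup>+v. (\<integral>\<^sup>+u. F (\<lambda>i. u (min i (Suc n))) \<partial>IT.eP (Suc n) v) \<partial>?C (Suc n))"
  proof (rule nn_integral_bind[OF Fm])
    show "IT.eP (Suc n) \<in> ?C (Suc n) \<rightarrow>\<^sub>M subprob_algebra (PiM {0..<Suc (Suc n)} (\<lambda>_. path_space))"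
      using IT.measurable_eP[of "Suc n"] IT.sets_C[OF sp0, of "Suc n"]
      by (simp cong: measurable_cong_sets)
  qed
  also have "\<dots> = (\<integral>\<^sup>+v. (\<integral>\<^sup>+\<omega>. F ((\<lambda>i. v (min i n))(Suc n := \<omega>)) \<partial>kern n (\<lambda>i. v (min i n))) \<partial>?C (Suc n))"
  proof (rule nn_integral_cong)
    fix v assume "v \<in> space (?C (Suc n))"
    then have v: "v \<in> space (PiM {0..<Suc n} (\<lambda>_. path_space))" by (simp only: spC)
    then have v': "(\<lambda>i. v (min i n)) \<in> space control_space" by (rule measurable_space[OF extend_measurable])
    have "(\<integral>\<^sup>+u. F (\<lambda>i. u (min i (Suc n))) \<partial>IT.eP (Suc n) v)
      = (\<integral>\<^sup>+\<omega>. F (\<lambda>i. (fun_upd v (Suc n) \<omega>) (min i (Suc n))) \<partial>kern n (\<lambda>i. v (min i n)))"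
      using IT.nn_integral_eP[OF v Fm] by (simp add: full_kernel_def)
    also have "\<dots> = (\<integral>\<^sup>+\<omega>. F ((\<lambda>i. v (min i n))(Suc n := \<omega>)) \<partial>kern n (\<lambda>i. v (min i n)))"
    proof (rule nn_integral_cong)
      fix \<omega> assume "\<omega> \<in> space (kern n (\<lambda>i. v (min i n)))"
      then have \<omega>: "\<omega> \<in> cadlag_paths"
        using sets_eq_imp_space_eq[OF sets_kern[OF v'], of n] by (simp add: space_path_space)
      have vi: "v i \<in> cadlag_paths" if "i \<le> n" for i
        using v that by (auto simp: space_PiM PiE_def Pi_def space_path_space)
      show "F (\<lambda>i. (fun_upd v (Suc n) \<omega>) (min i (Suc n))) = F ((\<lambda>i. v (min i n))(Suc n := \<omega>))"
      proof (rule depends_uptoD[OF dep])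
        show "(\<lambda>i. (fun_upd v (Suc n) \<omega>) (min i (Suc n))) \<in> space control_space"
          using vi \<omega> by (auto simp: space_control_space min_def le_Suc_eq)
        show "(\<lambda>i. v (min i n))(Suc n := \<omega>) \<in> space control_space" using v' \<omega> by (rule control_space_upd)
      qed (auto simp: min_def)
    qed
    finally show "(\<integral>\<^sup>+u. F (\<lambda>i. u (min i (Suc n))) \<partial>IT.eP (Suc n) v)
      = (\<integral>\<^sup>+\<omega>. F ((\<lambda>i. v (min i n))(Suc n := \<omega>)) \<partial>kern n (\<lambda>i. v (min i n)))" .
  qed
  also have "\<dots> = (\<integral>\<^sup>+w. (\<integral>\<^sup>+\<omega>. F (w(Suc n := \<omega>)) \<partial>kern n w) \<partial>law \<nu>)"
    by (rule nn_integral_law_C[symmetric, OF measurable_step[OF F] step_depends[OF dep]])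
  finally show ?thesis .
qed

lemma law_start:
  assumes F[measurable]: "F \<in> borel_measurable control_space" and dep: "depends_upto 0 F"
  shows "(\<integral>\<^sup>+w. F w \<partial>law \<nu>) = (\<integral>\<^sup>+\<omega>. F (\<lambda>_. \<omega>) \<partial>\<nu>)"
proof -
  let ?u = "\<lambda>_ :: nat. undefined :: real \<Rightarrow> 'a"
  have sp0: "?u \<in> space (PiM {0..<0::nat} (\<lambda>_. path_space :: (real \<Rightarrow> 'a) measure))"
    by (auto simp: space_PiM PiE_def extensional_def)
  have Fm: "(\<lambda>v. F (\<lambda>i. v (min i 0))) \<in> borel_measurable (PiM {0..<Suc 0} (\<lambda>_. path_space))"
    by (rule measurable_compose[OF extend_measurable F])
  have "(\<integral>\<^sup>+w. F w \<partial>law \<nu>) = (\<integral>\<^sup>+v. F (\<lambda>i. v (min i 0)) \<partial>IT.eP 0 ?u)"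
    using nn_integral_law_C[OF F dep] sp0 IT.measurable_eP[of 0] by (simp add: bind_return)
  also have "\<dots> = (\<integral>\<^sup>+\<omega>. F (\<lambda>_. \<omega>) \<partial>\<nu>)"
    using IT.nn_integral_eP[OF sp0 Fm] by (simp add: full_kernel_def)
  finally show ?thesis .
qed

end

section \<open>Segments between impulses\<close>

context strategy
begin

lemma strategy_law_return:
  assumes "\<omega> \<in> cadlag_paths"
  shows "strategy_law P U V (return path_space \<omega>)"
  using assms by (intro strategy_law.intro strategy_law_axioms.intro strategy_axioms prob_space_return)
    (simp_all add: space_path_space)

lemma strategy_law_P: "strategy_law P U V (P x)"
  by (intro strategy_law.intro strategy_law_axioms.intro prob_space_P sets_P strategy_axioms)

end

context strategy_law
begin

text \<open>The kernels after coordinate 0 do not depend on the initial law, so peeling off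
  coordinates one by one ends with a mixture of point masses. Conditioning on the first path is
  thereby done by construction, without regular conditional probabilities.\<close>

lemma law_disintegrate:
  assumes "F \<in> borel_measurable control_space" and "depends_upto n F"
  shows "(\<integral>\<^sup>+w. F w \<partial>law \<nu>) = (\<integral>\<^sup>+\<omega>. (\<integral>\<^sup>+w. F w \<partial>law (return path_space \<omega>)) \<partial>\<nu>)"
  using assms
proof (induction n arbitrary: F)
  have sp: "\<omega> \<in> cadlag_paths" if "\<omega> \<in> space \<nu>" for \<omega>
    using that sets_eq_imp_space_eq[OF \<nu>(2)] by (simp add: space_path_space)
  {
    case 0
    have "(\<integral>\<^sup>+w. F w \<partial>law (return path_space \<omega>)) = F (\<lambda>_. \<omega>)" if "\<omega> \<in> space \<nu>" for \<omega>
    proof -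
      interpret D: strategy_law P U V "return path_space \<omega>" by (rule strategy_law_return[OF sp[OF that]])
      have "(\<lambda>\<omega>. F (\<lambda>_. \<omega>)) \<in> borel_measurable path_space"
        by (rule measurable_compose[OF measurable_control_spaceI 0(1)]) simp
      then show ?thesis
        using D.law_start[OF 0] sp[OF that] by (simp add: nn_integral_return space_path_space)
    qed
    then show ?case unfolding law_start[OF 0] by (intro nn_integral_cong) simp
  next
    case (Suc n)
    have "(\<integral>\<^sup>+w. F w \<partial>law (return path_space \<omega>))
        = (\<integral>\<^sup>+w. (\<integral>\<^sup>+\<omega>'. F (w(Suc n := \<omega>')) \<partial>kern n w) \<partial>law (return path_space \<omega>))" if "\<omega> \<in> space \<nu>" for \<omega>
      using strategy_law.law_step[OF strategy_law_return[OF sp[OF that]] Suc.prems] .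
    then have "(\<integral>\<^sup>+\<omega>. (\<integral>\<^sup>+w. F w \<partial>law (return path_space \<omega>)) \<partial>\<nu>)
       = (\<integral>\<^sup>+\<omega>. (\<integral>\<^sup>+w. (\<integral>\<^sup>+\<omega>'. F (w(Suc n := \<omega>')) \<partial>kern n w) \<partial>law (return path_space \<omega>)) \<partial>\<nu>)"
      by (rule nn_integral_cong)
    also have "\<dots> = (\<integral>\<^sup>+w. (\<integral>\<^sup>+\<omega>'. F (w(Suc n := \<omega>')) \<partial>kern n w) \<partial>law \<nu>)"
      by (rule Suc.IH[symmetric, OF measurable_step[OF Suc.prems(1)] step_depends[OF Suc.prems(2)]])
    finally show ?case unfolding law_step[OF Suc.prems] by simp
  }
qed

end

definition seg_start :: "'a strategy \<Rightarrow> nat \<Rightarrow> (nat \<Rightarrow> real \<Rightarrow> 'a) \<Rightarrow> ennreal" where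
  "seg_start V n w = (if n = 0 then 0 else fst V (n - 1) w)"

text \<open>Half-open, so that all segments are disjoint and a segment between simultaneous impulses
  is empty.\<close>

definition in_seg :: "'a strategy \<Rightarrow> nat \<Rightarrow> (nat \<Rightarrow> real \<Rightarrow> 'a) \<Rightarrow> real \<Rightarrow> bool" where
  "in_seg V n w s \<longleftrightarrow> 0 \<le> s \<and> seg_start V n w \<le> ennreal s \<and> ennreal s < fst V n w"

definition seg :: "'a strategy \<Rightarrow> ('a \<Rightarrow> ennreal) \<Rightarrow> real \<Rightarrow> nat \<Rightarrow> (nat \<Rightarrow> real \<Rightarrow> 'a) \<Rightarrow> ennreal" where
  "seg V F T n w = (\<integral>\<^sup>+s. (if s < T \<and> in_seg V n w s then F (w n s) else 0) \<partial>lborel)"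

definition imp_cost :: "('a \<Rightarrow> 'a \<Rightarrow> real) \<Rightarrow> 'a strategy \<Rightarrow> real \<Rightarrow> nat \<Rightarrow> (nat \<Rightarrow> real \<Rightarrow> 'a) \<Rightarrow> ennreal" where
  "imp_cost c V T n w = (if fst V n w \<le> ennreal T
     then ennreal (- c (w n (enn2real (fst V n w))) (snd V n w)) else 0)"

lemma total_cost_eq: "total_cost c V T w = (\<Sum>n. imp_cost c V T n w)"
  unfolding total_cost_def imp_cost_def by (intro suminf_cong) (simp add: indicator_def)

section \<open>Measurability of costs and segments\<close>

lemma compact_countable_dense:
  fixes U :: "'a::metric_space set"
  assumes "compact U" "U \<noteq> {}"
  obtains d :: "nat \<Rightarrow> 'a" where "\<And>i. d i \<in> U" "\<And>x e. x \<in> U \<Longrightarrow> 0 < e \<Longrightarrow> \<exists>i. dist x (d i) < e"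
proof -
  have "\<exists>k. finite k \<and> k \<subseteq> U \<and> U \<subseteq> (\<Union>x\<in>k. ball x (1 / real (Suc n)))" for n
  proof -
    have "U \<subseteq> (\<Union>x\<in>U. ball x (1 / real (Suc n)))" by force
    from compactE_image[OF assms(1) _ this] obtain k where
      "k \<subseteq> U" "finite k" "U \<subseteq> (\<Union>x\<in>k. ball x (1 / real (Suc n)))" by auto
    then show ?thesis by blast
  qed
  then obtain k where k: "\<And>n. finite (k n)" "\<And>n. k n \<subseteq> U" "\<And>n. U \<subseteq> (\<Union>x\<in>k n. ball x (1 / real (Suc n)))"
    by metis
  define D where "D = (\<Union>n. k n)"
  have "countable D" unfolding D_def using k(1) by (intro countable_UN) (simp_all add: countable_finite)
  moreover have "D \<subseteq> U" using k(2) by (auto simp: D_def)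
  moreover have "D \<noteq> {}" using k(3)[of 0] assms(2) by (force simp: D_def)
  ultimately have D: "countable D" "D \<subseteq> U" "D \<noteq> {}" .
  have dense: "\<exists>y\<in>D. dist x y < e" if "x \<in> U" "0 < e" for x e
  proof -
    obtain n where n: "1 / real (Suc n) < e" using \<open>0 < e\<close> nat_approx_posE by blast
    obtain y where "y \<in> k n" "dist y x < 1 / real (Suc n)" using k(3)[of n] \<open>x \<in> U\<close> by auto
    then have "dist x y < e" "y \<in> D" using n by (auto simp: D_def dist_commute)
    then show ?thesis by blast
  qed
  show thesis
  proof (rule that[of "from_nat_into D"])
    show "from_nat_into D i \<in> U" for i using from_nat_into[OF D(3)] D(2) by auto
    fix x e assume "x \<in> U" "0 < (e :: real)"
    then obtain y where "y \<in> D" "dist x y < e" using dense by blast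
    then show "\<exists>i. dist x (from_nat_into D i) < e" using from_nat_into_surj[OF D(1)] by metis
  qed
qed

text \<open>Without a countable base, continuity on the product does not give measurability for the
  product \<open>\<sigma>\<close>-algebra. The compact set \<open>U\<close> is separable, so the
  second argument is rounded to a countable dense subset; for each fixed target \<open>c\<close> is
  a continuous function of the first argument.\<close>

lemma measurable_cost:
  fixes X Y :: "'b \<Rightarrow> 'a::metric_space"
  assumes U: "compact U" and c: "continuous_on (UNIV \<times> U) (\<lambda>(x, a). c x a :: real)"
    and X: "X \<in> M \<rightarrow>\<^sub>M borel" and Y: "Y \<in> M \<rightarrow>\<^sub>M borel" and YU: "\<And>x. x \<in> space M \<Longrightarrow> Y x \<in> U"
  shows "(\<lambda>x. c (X x) (Y x)) \<in> borel_measurable M"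
proof (cases "U = {}")
  case True
  then have "space M = {}" using YU by auto
  then show ?thesis by (auto simp: measurable_def)
next
  case False
  obtain d :: "nat \<Rightarrow> 'a" where d: "\<And>i. d i \<in> U" "\<And>x e. x \<in> U \<Longrightarrow> 0 < e \<Longrightarrow> \<exists>i. dist x (d i) < e"
    using compact_countable_dense[OF U False] by metis
  define r where "r n x = (LEAST i. dist x (d i) < 1 / real (Suc n))" for n x
  have r: "dist x (d (r n x)) < 1 / real (Suc n)" if "x \<in> U" for n x
    unfolding r_def using d(2)[OF that, of "1 / real (Suc n)"] by (auto intro: LeastI_ex)
  have [measurable]: "(\<lambda>x. dist (Y x) (d i)) \<in> borel_measurable M" for i
    by (rule measurable_compose[OF Y]) (intro borel_measurable_continuous_onI continuous_intros)
  have rm: "(\<lambda>x. r n (Y x)) \<in> M \<rightarrow>\<^sub>M count_space UNIV" for n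
    unfolding r_def by measurable
  have cm: "(\<lambda>x. c (X x) (d i)) \<in> borel_measurable M" for i
  proof (rule measurable_compose[OF X])
    have "continuous_on UNIV (\<lambda>x. (\<lambda>(x, a). c x a) (x, d i))"
      by (rule continuous_on_compose2[OF c]) (use d in \<open>auto intro!: continuous_intros\<close>)
    then show "(\<lambda>x. c x (d i)) \<in> borel_measurable borel" by (intro borel_measurable_continuous_onI) simp
  qed
  have "(\<lambda>x. (\<lambda>i x. c (X x) (d i)) (r n (Y x)) x) \<in> borel_measurable M" for n
    by (rule measurable_compose_countable[OF cm rm])
  then show ?thesis
  proof (rule borel_measurable_LIMSEQ_real[rotated])
    fix x assume "x \<in> space M"
    then have y: "Y x \<in> U" by (rule YU)
    have "(\<lambda>n. d (r n (Y x))) \<longlonglongrightarrow> Y x"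
    proof (rule metric_LIMSEQ_I)
      fix e :: real assume "0 < e"
      then obtain N where N: "1 / real (Suc N) < e" using nat_approx_posE by blast
      have "dist (d (r n (Y x))) (Y x) < e" if "N \<le> n" for n
      proof -
        have "1 / real (Suc n) \<le> 1 / real (Suc N)" using that by (simp add: frac_le)
        then show ?thesis using r[OF y, of n] N by (simp add: dist_commute)
      qed
      then show "\<exists>N. \<forall>n\<ge>N. dist (d (r n (Y x))) (Y x) < e" by blast
    qed
    then have "(\<lambda>n. (X x, d (r n (Y x)))) \<longlonglongrightarrow> (X x, Y x)" by (intro tendsto_intros)
    then have "(\<lambda>n. (\<lambda>(x, a). c x a) (X x, d (r n (Y x)))) \<longlonglongrightarrow> (\<lambda>(x, a). c x a) (X x, Y x)"
      by (rule continuous_on_tendsto_compose[OF c]) (use y d in auto)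
    then show "(\<lambda>n. c (X x) (d (r n (Y x)))) \<longlonglongrightarrow> c (X x) (Y x)" by simp
  qed
qed

context strategy
begin

lemma measurable_seg_start: "seg_start V n \<in> borel_measurable control_space"
  unfolding seg_start_def[abs_def] by (cases "n = 0") (simp_all add: measurable_\<tau>)

lemma measurable_in_seg:
  "Measurable.pred (control_space \<Otimes>\<^sub>M borel) (\<lambda>p. in_seg V n (fst p) (snd p))"
proof -
  have [measurable]: "(\<lambda>p. \<tau> n (fst p)) \<in> borel_measurable (control_space \<Otimes>\<^sub>M borel)"
    "(\<lambda>p. seg_start V n (fst p)) \<in> borel_measurable (control_space \<Otimes>\<^sub>M borel)"
    by (intro measurable_compose[OF measurable_fst] measurable_\<tau> measurable_seg_start)+
  show ?thesis unfolding in_seg_def by measurable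
qed

lemma measurable_coord_eval:
  "(\<lambda>p. (fst p :: nat \<Rightarrow> real \<Rightarrow> 'a) n (snd p)) \<in> control_space \<Otimes>\<^sub>M borel \<rightarrow>\<^sub>M borel"
  by (rule measurable_path_eval[where X="\<lambda>p. fst p n" and t=snd])
     (simp_all add: measurable_compose[OF measurable_fst measurable_control_coord])

lemma measurable_seg:
  assumes F: "F \<in> borel_measurable borel"
  shows "seg V F T n \<in> borel_measurable control_space"
proof -
  note [measurable] = measurable_in_seg[of n] measurable_compose[OF measurable_coord_eval[of n] F]
  have "(\<lambda>p. if snd p < T \<and> in_seg V n (fst p) (snd p) then F (fst p n (snd p)) else 0)
      \<in> borel_measurable (control_space \<Otimes>\<^sub>M lborel)"
    by measurable
  then show ?thesis
    unfolding seg_def[abs_def] by (intro lborel.borel_measurable_nn_integral) (simp add: split_beta')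
qed

lemma seg_start_depends:
  assumes "w \<in> space control_space" "w' \<in> space control_space" "\<And>i. i \<le> n \<Longrightarrow> w i = w' i"
  shows "seg_start V n w = seg_start V n w'"
  using assms by (auto simp: seg_start_def intro!: depends_uptoD[OF \<tau>_depends])

lemma in_seg_depends:
  assumes "w \<in> space control_space" "w' \<in> space control_space" "\<And>i. i \<le> n \<Longrightarrow> w i = w' i"
  shows "in_seg V n w = in_seg V n w'"
  by (intro ext) (simp only: in_seg_def seg_start_depends[OF assms] depends_uptoD[OF \<tau>_depends assms])

lemma seg_depends: "depends_upto n (seg V F T n)"
  unfolding depends_upto_def
proof (intro ballI impI)
  fix w w' :: "nat \<Rightarrow> real \<Rightarrow> 'a"
  assume *: "w \<in> space control_space" "w' \<in> space control_space" "\<forall>i\<le>n. w i = w' i"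
  have "in_seg V n w = in_seg V n w'" using * by (intro in_seg_depends) auto
  moreover have "w n = w' n" using * by blast
  ultimately show "seg V F T n w = seg V F T n w'" unfolding seg_def by (simp only:)
qed

lemma in_seg_unique:
  assumes w: "w \<in> space control_space" and "in_seg V n w s" "in_seg V m w s"
  shows "n = m"
proof -
  have *: "\<not> n < m" if "in_seg V n w s" "in_seg V m w s" for n m
  proof
    assume "n < m"
    then have "\<tau> n w \<le> seg_start V m w" using \<tau>_incr[OF w, of n "m - 1"] by (auto simp: seg_start_def)
    then show False using that by (auto simp: in_seg_def not_less[symmetric] dest: le_less_trans)
  qed
  from *[OF assms(2,3)] *[OF assms(3,2)] show ?thesis by simp
qed

lemma controlled_in_seg:
  assumes w: "w \<in> space control_space" and "in_seg V n w s"
  shows "controlled_process V w s = w n s"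
proof -
  have "(LEAST n. ennreal s < \<tau> n w) = n"
  proof (rule Least_equality)
    show "ennreal s < \<tau> n w" using assms by (simp add: in_seg_def)
    fix m assume m: "ennreal s < \<tau> m w"
    show "n \<le> m"
    proof (rule ccontr)
      assume "\<not> n \<le> m"
      then have "\<tau> m w \<le> seg_start V n w" using \<tau>_incr[OF w, of m "n - 1"] by (auto simp: seg_start_def)
      with m assms show False by (auto simp: in_seg_def dest: less_le_trans)
    qed
  qed
  then show ?thesis by (simp add: controlled_process_def)
qed

lemma in_seg_exists:
  assumes "0 \<le> s" "ennreal s < \<tau> k w"
  shows "\<exists>n\<le>k. in_seg V n w s"
proof -
  let ?n = "LEAST n. ennreal s < \<tau> n w"
  have 1: "ennreal s < \<tau> ?n w" "?n \<le> k" using assms(2) by (auto intro: LeastI Least_le)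
  have "seg_start V ?n w \<le> ennreal s"
    using not_less_Least[of "?n - 1" "\<lambda>n. ennreal s < \<tau> n w"] by (auto simp: seg_start_def not_less)
  then show ?thesis using 1 assms(1) by (auto simp: in_seg_def)
qed

lemma suminf_segwise:
  fixes f :: "nat \<Rightarrow> real \<Rightarrow> ennreal"
  assumes w: "w \<in> space control_space" and f: "\<And>n. (\<lambda>s. f n s) \<in> borel_measurable borel"
    and le: "\<And>n s. in_seg V n w s \<Longrightarrow> f n s \<le> G s" and G: "G \<in> borel_measurable borel"
  shows "(\<Sum>n. \<integral>\<^sup>+s. (if in_seg V n w s then f n s else 0) \<partial>lborel) \<le> (\<integral>\<^sup>+s. G s \<partial>lborel)"
proof -
  have [measurable]: "Measurable.pred borel (in_seg V n w)" for n
    unfolding in_seg_def[abs_def] by measurable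
  note [measurable] = f
  have "(\<Sum>n. \<integral>\<^sup>+s. (if in_seg V n w s then f n s else 0) \<partial>lborel)
      = (\<integral>\<^sup>+s. (\<Sum>n. if in_seg V n w s then f n s else 0) \<partial>lborel)"
    by (intro nn_integral_suminf[symmetric]) measurable
  also have "\<dots> \<le> (\<integral>\<^sup>+s. G s \<partial>lborel)"
  proof (intro nn_integral_mono)
    fix s
    show "(\<Sum>n. if in_seg V n w s then f n s else 0) \<le> G s"
    proof (cases "\<exists>n. in_seg V n w s")
      case True
      then obtain n where n: "in_seg V n w s" ..
      then have "(if in_seg V m w s then f m s else 0) = (if m = n then f n s else 0)" for m
        using in_seg_unique[OF w] by auto
      then have "(\<Sum>m. if in_seg V m w s then f m s else 0) = (\<Sum>m. if m = n then f n s else 0)" by simp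
      also have "\<dots> = f n s" by (subst suminf_finite[of "{n}"]) auto
      finally show ?thesis using le[OF n] by simp
    qed simp
  qed
  finally show ?thesis .
qed

lemma suminf_seg_eq:
  assumes w: "w \<in> space control_space" and F[measurable]: "F \<in> borel_measurable borel"
    and cover: "\<And>s. 0 \<le> s \<Longrightarrow> s < T \<Longrightarrow> \<exists>n. ennreal s < \<tau> n w"
  shows "(\<Sum>n. seg V F T n w) = (\<integral>\<^sup>+s. (if 0 \<le> s \<and> s < T then F (controlled_process V w s) else 0) \<partial>lborel)"
proof -
  have [measurable]: "Measurable.pred borel (in_seg V n w)" for n
    unfolding in_seg_def[abs_def] by measurable
  have [measurable]: "w n \<in> borel_measurable borel" for n
    using measurable_path_eval[of "\<lambda>_. w n" borel "\<lambda>s. s"] w by (simp add: space_control_space space_path_space)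
  have "(\<Sum>n. seg V F T n w) = (\<integral>\<^sup>+s. (\<Sum>n. if s < T \<and> in_seg V n w s then F (w n s) else 0) \<partial>lborel)"
    unfolding seg_def by (intro nn_integral_suminf[symmetric]) measurable
  also have "\<dots> = (\<integral>\<^sup>+s. (if 0 \<le> s \<and> s < T then F (controlled_process V w s) else 0) \<partial>lborel)"
  proof (intro nn_integral_cong)
    fix s
    show "(\<Sum>n. if s < T \<and> in_seg V n w s then F (w n s) else 0)
      = (if 0 \<le> s \<and> s < T then F (controlled_process V w s) else 0)"
    proof (cases "0 \<le> s \<and> s < T")
      case True
      then obtain n where n: "in_seg V n w s" using cover in_seg_exists by blast
      then have "(if s < T \<and> in_seg V m w s then F (w m s) else 0) = (if m = n then F (w n s) else 0)" for m
        using in_seg_unique[OF w] True by auto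
      then have "(\<Sum>m. if s < T \<and> in_seg V m w s then F (w m s) else 0) = (\<Sum>m. if m = n then F (w n s) else 0)" by simp
      also have "\<dots> = F (w n s)" by (subst suminf_finite[of "{n}"]) auto
      finally show ?thesis using True controlled_in_seg[OF w n] by simp
    qed (auto simp: in_seg_def)
  qed
  finally show ?thesis .
qed

lemma measurable_controlled:
  "(\<lambda>p. controlled_process V (fst p) (snd p)) \<in> control_space \<Otimes>\<^sub>M borel \<rightarrow>\<^sub>M borel"
proof -
  have [measurable]: "(\<lambda>p. \<tau> n (fst p)) \<in> borel_measurable (control_space \<Otimes>\<^sub>M borel)" for n
    by (rule measurable_compose[OF measurable_fst measurable_\<tau>])
  have "(\<lambda>p. LEAST n. ennreal (snd p) < \<tau> n (fst p)) \<in> control_space \<Otimes>\<^sub>M borel \<rightarrow>\<^sub>M count_space UNIV"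
    by measurable
  from measurable_compose_countable[OF measurable_coord_eval this]
  show ?thesis by (simp add: controlled_process_def)
qed

lemma measurable_imp_cost:
  assumes "compact U" "continuous_on (UNIV \<times> U) (\<lambda>(x, a). c x a)"
  shows "imp_cost c V T n \<in> borel_measurable control_space"
proof -
  note [measurable] = measurable_\<tau>[of n]
  have "(\<lambda>w. w n (enn2real (\<tau> n w))) \<in> control_space \<rightarrow>\<^sub>M borel"
    by (rule measurable_path_eval[OF measurable_control_coord]) (intro borel_measurable_enn2real measurable_\<tau>)
  then have [measurable]: "(\<lambda>w. c (w n (enn2real (\<tau> n w))) (\<xi> n w)) \<in> borel_measurable control_space"
    by (rule measurable_cost[OF assms]) (auto intro: measurable_\<xi> \<xi>_in_U)
  show ?thesis unfolding imp_cost_def[abs_def] by measurable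
qed

lemma imp_cost_depends: "depends_upto n (imp_cost c V T n)"
  unfolding depends_upto_def
proof (intro ballI impI)
  fix w w' :: "nat \<Rightarrow> real \<Rightarrow> 'a"
  assume *: "w \<in> space control_space" "w' \<in> space control_space" "\<forall>i\<le>n. w i = w' i"
  then have "\<tau> n w = \<tau> n w'" "\<xi> n w = \<xi> n w'"
    by (auto intro: depends_uptoD[OF \<tau>_depends] depends_uptoD[OF \<xi>_depends])
  then show "imp_cost c V T n w = imp_cost c V T n w'" using * by (simp add: imp_cost_def)
qed

end

section \<open>Expected gain and cost of a strategy\<close>

context strategy_law
begin

text \<open>The shift by \<open>a \<ge> \<bar>g\<bar>\<close> makes the integrand nonnegative.\<close>

definition gain :: "('a \<Rightarrow> real) \<Rightarrow> real \<Rightarrow> real \<Rightarrow> ennreal" where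
  "gain g a T = (\<integral>\<^sup>+w. (\<integral>\<^sup>+s. (if 0 \<le> s \<and> s < T then ennreal (g (controlled_process V w s) + a) else 0) \<partial>lborel) \<partial>law \<nu>)"

definition cost :: "('a \<Rightarrow> 'a \<Rightarrow> real) \<Rightarrow> real \<Rightarrow> ennreal" where
  "cost c T = (\<integral>\<^sup>+w. total_cost c V T w \<partial>law \<nu>)"

lemma measurable_path_gain:
  assumes g: "g \<in> borel_measurable borel"
  shows "(\<lambda>w. \<integral>\<^sup>+s. (if 0 \<le> s \<and> s < T then ennreal (g (controlled_process V w s) + a) else 0) \<partial>lborel)
    \<in> borel_measurable (law \<nu>)"
proof (rule measurable_from_law, rule lborel.borel_measurable_nn_integral)
  have [measurable]: "(\<lambda>p. g (controlled_process V (fst p) (snd p))) \<in> borel_measurable (control_space \<Otimes>\<^sub>M borel)"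
    by (rule measurable_compose[OF measurable_controlled g])
  have "(\<lambda>p. if 0 \<le> snd p \<and> snd p < T then ennreal (g (controlled_process V (fst p) (snd p)) + a) else 0)
     \<in> borel_measurable (control_space \<Otimes>\<^sub>M lborel)"
    by measurable
  then show "(\<lambda>(w, s). if 0 \<le> s \<and> s < T then ennreal (g (controlled_process V w s) + a) else 0)
     \<in> borel_measurable (control_space \<Otimes>\<^sub>M lborel)"
    by (simp add: split_beta')
qed

lemma gain_le:
  assumes bd: "\<And>y. \<bar>g y\<bar> \<le> a" and T: "0 \<le> T"
  shows "gain g a T \<le> ennreal (2 * a * T)"
proof -
  interpret prob_space "law \<nu>" by (rule prob_space_law)
  have a: "0 \<le> a" using bd[of undefined] by linarith
  have "(\<integral>\<^sup>+s. (if 0 \<le> s \<and> s < T then ennreal (g (X s) + a) else 0) \<partial>lborel)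
      \<le> (\<integral>\<^sup>+s. ennreal (2 * a) * indicator {0..<T} s \<partial>lborel)" for X
  proof (intro nn_integral_mono)
    fix s
    show "(if 0 \<le> s \<and> s < T then ennreal (g (X s) + a) else 0) \<le> ennreal (2 * a) * indicator {0..<T} s"
      using bd[of "X s"] by (auto simp: indicator_def intro!: ennreal_leI)
  qed
  also have "\<dots> = ennreal (2 * a * T)"
    using T a by (simp add: nn_integral_cmult_indicator ennreal_mult)
  finally have "gain g a T \<le> (\<integral>\<^sup>+w. ennreal (2 * a * T) \<partial>law \<nu>)"
    unfolding gain_def by (intro nn_integral_mono)
  then show ?thesis by (simp add: emeasure_space_1)
qed

text \<open>Links the signed integral in \<open>reward\<close> to the nonnegative
  \<open>gain\<close>. The closed interval there and the half-open one in \<open>gain\<close> differ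
  by a null set.\<close>

lemma integral_controlled:
  assumes g: "g \<in> borel_measurable borel" and bd: "\<And>y. \<bar>g y\<bar> \<le> a" and T: "0 \<le> T"
  shows "(\<integral>w. (LINT s:{0..T}|lborel. g (controlled_process V w s)) \<partial>law \<nu>) = enn2real (gain g a T) - a * T"
proof -
  interpret prob_space "law \<nu>" by (rule prob_space_law)
  let ?Y = "\<lambda>w. \<integral>\<^sup>+s. (if 0 \<le> s \<and> s < T then ennreal (g (controlled_process V w s) + a) else 0) \<partial>lborel"
  have a: "0 \<le> a" using bd[of undefined] by linarith
  have nn: "0 \<le> g y + a" and le2: "g y + a \<le> 2 * a" for y using bd[of y] by linarith+
  have bound: "?Y w \<le> ennreal (2 * a * T)" for w
  proof -
    have "?Y w \<le> (\<integral>\<^sup>+s. ennreal (2 * a) * indicator {0..<T} s \<partial>lborel)"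
      using le2 by (intro nn_integral_mono) (auto simp: indicator_def intro!: ennreal_leI)
    also have "\<dots> = ennreal (2 * a * T)"
      using T a by (simp add: nn_integral_cmult_indicator ennreal_mult)
    finally show ?thesis .
  qed
  have "(LINT s:{0..T}|lborel. g (controlled_process V w s)) = enn2real (?Y w) - a * T" if "w \<in> space (law \<nu>)" for w
  proof -
    have [measurable]: "(\<lambda>s. g (controlled_process V w s)) \<in> borel_measurable borel"
      using measurable_compose[OF measurable_compose[OF measurable_Pair1' measurable_controlled] g, of w] that
      by (simp add: space_law)
    have int: "integrable lborel (\<lambda>s. indicator {0..T} s *\<^sub>R f s)"
      if [measurable]: "f \<in> borel_measurable borel" and "\<And>s. \<bar>f s\<bar> \<le> b" for f :: "real \<Rightarrow> real" and b
    proof (rule Bochner_Integration.integrable_bound[of lborel "\<lambda>s. b * indicator {0..T} s"])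
      show "AE s in lborel. norm (indicator {0..T} s *\<^sub>R f s) \<le> norm (b * indicator {0..T} s)"
      proof (rule AE_I2)
        fix s
        have "\<bar>f s\<bar> \<le> \<bar>b\<bar>" using that(2)[of s] by linarith
        then show "norm (indicator {0..T} s *\<^sub>R f s) \<le> norm (b * indicator {0..T} s)" by (simp add: indicator_def)
      qed
      show "integrable lborel (\<lambda>s. b * indicator {0..T} s)"
        using T by (intro integrable_mult_right integrable_real_indicator) auto
    qed measurable
    have "(\<integral>s. indicator {0..T} s *\<^sub>R (g (controlled_process V w s) + a) \<partial>lborel)
        = enn2real (\<integral>\<^sup>+s. ennreal (indicator {0..T} s *\<^sub>R (g (controlled_process V w s) + a)) \<partial>lborel)"
      using nn by (intro integral_eq_nn_integral) auto
    also have "(\<integral>\<^sup>+s. ennreal (indicator {0..T} s *\<^sub>R (g (controlled_process V w s) + a)) \<partial>lborel) = ?Y w"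
      by (intro nn_integral_cong_AE AE_I[where N="{T}"]) (auto simp: indicator_def)
    finally have 1: "(\<integral>s. indicator {0..T} s *\<^sub>R (g (controlled_process V w s) + a) \<partial>lborel) = enn2real (?Y w)" .
    have "(\<integral>s. indicator {0..T} s *\<^sub>R (g (controlled_process V w s) + a) \<partial>lborel)
       = (\<integral>s. indicator {0..T} s *\<^sub>R g (controlled_process V w s) + indicator {0..T} s *\<^sub>R a \<partial>lborel)"
      by (simp only: scaleR_add_right)
    also have "\<dots> = (\<integral>s. indicator {0..T} s *\<^sub>R g (controlled_process V w s) \<partial>lborel) + (\<integral>s. indicator {0..T} s *\<^sub>R a \<partial>lborel)"
    proof (rule Bochner_Integration.integral_add)
      show "integrable lborel (\<lambda>s. indicator {0..T} s *\<^sub>R g (controlled_process V w s))"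
        by (rule int) (measurable, rule bd)
      show "integrable lborel (\<lambda>s. indicator {0..T} s *\<^sub>R a)"
        by (rule int) (measurable, rule order_refl)
    qed
    also have "(\<integral>s. indicator {0..T} s *\<^sub>R a \<partial>lborel) = a * T" using T by simp
    finally show ?thesis using 1 unfolding set_lebesgue_integral_def by simp
  qed
  then have "(\<integral>w. (LINT s:{0..T}|lborel. g (controlled_process V w s)) \<partial>law \<nu>) = (\<integral>w. enn2real (?Y w) - a * T \<partial>law \<nu>)"
    by (intro Bochner_Integration.integral_cong) auto
  also have "\<dots> = (\<integral>w. enn2real (?Y w) \<partial>law \<nu>) - a * T"
  proof -
    have "enn2real (?Y w) \<le> 2 * a * T" for w
      using enn2real_mono[OF bound[of w]] a T by simp
    then have "integrable (law \<nu>) (\<lambda>w. enn2real (?Y w))"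
      using measurable_path_gain[OF g, of T a] by (intro integrable_const_bound[where B="2 * a * T"]) auto
    then show ?thesis by (simp add: prob_space)
  qed
  also have "(\<integral>w. enn2real (?Y w) \<partial>law \<nu>) = enn2real (\<integral>\<^sup>+w. ennreal (enn2real (?Y w)) \<partial>law \<nu>)"
    using measurable_path_gain[OF g, of T a] by (intro integral_eq_nn_integral) auto
  also have "(\<integral>\<^sup>+w. ennreal (enn2real (?Y w)) \<partial>law \<nu>) = gain g a T"
    unfolding gain_def
  proof (rule nn_integral_cong)
    fix w
    have "?Y w < top" using bound[of w] by (rule le_less_trans) simp
    then show "ennreal (enn2real (?Y w)) = ?Y w" by simp
  qed
  finally show ?thesis .
qed

end

section \<open>Good blocks\<close>

lemma suminf_ennreal_Suc: "(\<Sum>n. f n) = f 0 + (\<Sum>n. f (Suc n) :: ennreal)"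
  using suminf_offset[OF summableI, of f 1] by (simp add: add.commute)

context strategy
begin

lemma measurable_law_return:
  assumes "F \<in> borel_measurable control_space" and "depends_upto n F"
  shows "(\<lambda>\<omega>. \<integral>\<^sup>+w. F w \<partial>law (return path_space \<omega>)) \<in> borel_measurable path_space"
  using assms
proof (induction n arbitrary: F)
  case 0
  have Fm: "(\<lambda>\<omega>. F (\<lambda>_. \<omega>)) \<in> borel_measurable path_space"
    by (rule measurable_compose[OF measurable_control_spaceI 0(1)]) simp
  have "(\<integral>\<^sup>+w. F w \<partial>law (return path_space \<omega>)) = F (\<lambda>_. \<omega>)" if "\<omega> \<in> space path_space" for \<omega>
  proof -
    interpret D: strategy_law P U V "return path_space \<omega>"
      by (rule strategy_law_return) (use that in \<open>simp add: space_path_space\<close>)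
    show ?thesis using D.law_start[OF 0] Fm that by (simp add: nn_integral_return)
  qed
  then show ?case using Fm by (simp cong: measurable_cong)
next
  case (Suc n)
  have *: "(\<integral>\<^sup>+w. F w \<partial>law (return path_space \<omega>))
      = (\<integral>\<^sup>+w. (\<integral>\<^sup>+\<omega>'. F (w(Suc n := \<omega>')) \<partial>kern n w) \<partial>law (return path_space \<omega>))" if "\<omega> \<in> space path_space" for \<omega>
  proof -
    have "\<omega> \<in> cadlag_paths" using that by (simp add: space_path_space)
    from strategy_law.law_step[OF strategy_law_return[OF this] Suc.prems] show ?thesis .
  qed
  interpret D: strategy_law P U V "P undefined" by (rule strategy_law_P)
  have "(\<lambda>\<omega>. \<integral>\<^sup>+w. (\<integral>\<^sup>+\<omega>'. F (w(Suc n := \<omega>')) \<partial>kern n w) \<partial>law (return path_space \<omega>)) \<in> borel_measurable path_space"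
    by (rule Suc.IH[OF D.measurable_step[OF Suc.prems(1)] D.step_depends[OF Suc.prems(2)]])
  then show ?case using * by (simp cong: measurable_cong)
qed

text \<open>The first impulse depends on coordinate 0 only, and this coordinate is frozen.\<close>

lemma law_return_start:
  assumes \<omega>: "\<omega> \<in> cadlag_paths"
  shows "AE w in law (return path_space \<omega>). \<tau> 0 w = \<tau> 0 (\<lambda>_. \<omega>) \<and> \<xi> 0 w = \<xi> 0 (\<lambda>_. \<omega>)"
proof -
  interpret D: strategy_law P U V "return path_space \<omega>" by (rule strategy_law_return[OF \<omega>])
  let ?A = "{w \<in> space control_space. \<not> (\<tau> 0 w = \<tau> 0 (\<lambda>_. \<omega>) \<and> \<xi> 0 w = \<xi> 0 (\<lambda>_. \<omega>))}"
  have A: "?A \<in> sets control_space"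
  proof -
    have "{w \<in> space control_space. \<tau> 0 w \<in> {\<tau> 0 (\<lambda>_. \<omega>)}} \<in> sets control_space"
      using measurable_sets[OF measurable_\<tau>[of 0], of "{\<tau> 0 (\<lambda>_. \<omega>)}"] by (simp add: vimage_def Int_def conj_commute)
    moreover have "{w \<in> space control_space. \<xi> 0 w \<in> {\<xi> 0 (\<lambda>_. \<omega>)}} \<in> sets control_space"
      using measurable_sets[OF measurable_\<xi>[of 0], of "{\<xi> 0 (\<lambda>_. \<omega>)}"] by (simp add: vimage_def Int_def conj_commute)
    ultimately have "space control_space - ({w \<in> space control_space. \<tau> 0 w \<in> {\<tau> 0 (\<lambda>_. \<omega>)}}
        \<inter> {w \<in> space control_space. \<xi> 0 w \<in> {\<xi> 0 (\<lambda>_. \<omega>)}}) \<in> sets control_space" by blast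
    also have "space control_space - ({w \<in> space control_space. \<tau> 0 w \<in> {\<tau> 0 (\<lambda>_. \<omega>)}}
        \<inter> {w \<in> space control_space. \<xi> 0 w \<in> {\<xi> 0 (\<lambda>_. \<omega>)}}) = ?A" by auto
    finally show ?thesis .
  qed
  have dep: "depends_upto 0 (indicator ?A :: _ \<Rightarrow> ennreal)"
    unfolding depends_upto_def
  proof (intro ballI impI)
    fix w w' :: "nat \<Rightarrow> real \<Rightarrow> 'a"
    assume *: "w \<in> space control_space" "w' \<in> space control_space" "\<forall>i\<le>0. w i = w' i"
    then have "\<tau> 0 w = \<tau> 0 w'" "\<xi> 0 w = \<xi> 0 w'"
      by (auto intro: depends_uptoD[OF \<tau>_depends] depends_uptoD[OF \<xi>_depends])
    then show "indicator ?A w = (indicator ?A w' :: ennreal)" using *(1,2) by (simp add: indicator_def)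
  qed
  have Am: "(indicator ?A :: _ \<Rightarrow> ennreal) \<in> borel_measurable control_space" using A by simp
  have "emeasure (law (return path_space \<omega>)) ?A = (\<integral>\<^sup>+w. indicator ?A w \<partial>law (return path_space \<omega>))"
    using A by (subst nn_integral_indicator) (simp_all add: D.sets_law)
  also have "\<dots> = (\<integral>\<^sup>+\<omega>'. indicator ?A (\<lambda>_. \<omega>') \<partial>return path_space \<omega>)"
    by (rule D.law_start[OF Am dep])
  also have "\<dots> = indicator ?A (\<lambda>_. \<omega>)"
  proof (rule nn_integral_return)
    show "\<omega> \<in> space path_space" using \<omega> by (simp add: space_path_space)
    show "(\<lambda>\<omega>'. indicator ?A (\<lambda>_. \<omega>') :: ennreal) \<in> borel_measurable path_space"
      by (rule measurable_compose[OF measurable_control_spaceI Am]) simp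
  qed
  also have "\<dots> = 0" by simp
  finally show ?thesis
    using A by (intro AE_I[where N="?A"]) (auto simp: D.sets_law D.space_law)
qed

lemma stopping_time_first:
  "stopping_time path_filtration (\<lambda>\<omega>. \<tau> 0 (\<lambda>_. \<omega>))"
proof (rule stopping_time_pathI)
  show "(\<lambda>\<omega>. \<tau> 0 (\<lambda>_. \<omega>)) \<in> borel_measurable path_space"
    by (rule measurable_compose[OF measurable_control_spaceI measurable_\<tau>]) simp
  fix \<omega> \<omega>' :: "real \<Rightarrow> 'a" and t
  assume "\<omega> \<in> cadlag_paths" "\<omega>' \<in> cadlag_paths" "\<tau> 0 (\<lambda>_. \<omega>) \<le> t"
    and "\<And>s. 0 \<le> s \<Longrightarrow> ennreal s \<le> t \<Longrightarrow> \<omega> s = \<omega>' s"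
  then show "\<tau> 0 (\<lambda>_. \<omega>') \<le> t"
    using \<tau>_nonanticipating[of "\<lambda>_. \<omega>" "\<lambda>_. \<omega>'" 0 t] by (simp add: space_control_space agree_def)
qed

text \<open>The segments after the first impulse are disjoint and lie between
  \<open>\<tau> 0 w\<close> and \<open>T\<close>.\<close>

lemma later_segs_le:
  assumes w: "w \<in> space control_space" and F[measurable]: "F \<in> borel_measurable borel"
    and bd: "\<And>y. F y \<le> ennreal b" and b: "0 \<le> b" and T: "0 \<le> T"
  shows "(\<Sum>n. seg V F T (Suc n) w) \<le> ennreal b * (ennreal T - \<tau> 0 w)"
proof -
  have wm: "w n \<in> borel_measurable borel" for n
    using measurable_path_eval[of "\<lambda>_. w n" borel "\<lambda>s. s"] w by (simp add: space_control_space space_path_space)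
  define f where "f n s = (if s < T \<and> n \<noteq> 0 then F (w n s) else 0)" for n s
  define G where "G s = ennreal b * indicator {s. 0 \<le> s \<and> s < T \<and> \<tau> 0 w \<le> ennreal s} s" for s
  have segf: "(\<integral>\<^sup>+s. (if in_seg V n w s then f n s else 0) \<partial>lborel) = (if n = 0 then 0 else seg V F T n w)" for n
  proof (cases "n = 0")
    case True then show ?thesis by (simp add: f_def cong: if_cong)
  next
    case False then show ?thesis unfolding seg_def f_def by (auto intro!: nn_integral_cong)
  qed
  have "(\<Sum>n. seg V F T (Suc n) w) = (\<Sum>n. \<integral>\<^sup>+s. (if in_seg V n w s then f n s else 0) \<partial>lborel)"
    unfolding segf suminf_ennreal_Suc[of "\<lambda>n. if n = 0 then 0 else seg V F T n w"] by simp
  also have "\<dots> \<le> (\<integral>\<^sup>+s. G s \<partial>lborel)"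
  proof (rule suminf_segwise[OF w])
    note [measurable] = measurable_compose[OF wm F]
    show "(\<lambda>s. f n s) \<in> borel_measurable borel" for n unfolding f_def by measurable
    show "G \<in> borel_measurable borel" unfolding G_def by measurable
    show "f n s \<le> G s" if "in_seg V n w s" for n s
    proof (cases "n = 0")
      case False
      then have "\<tau> 0 w \<le> ennreal s" using that \<tau>_incr[OF w, of 0 "n - 1"] by (auto simp: in_seg_def seg_start_def)
      then show ?thesis using that bd by (auto simp: f_def G_def in_seg_def)
    qed (simp add: f_def)
  qed
  also have "\<dots> = ennreal b * emeasure lborel {s. 0 \<le> s \<and> s < T \<and> \<tau> 0 w \<le> ennreal s}"
    unfolding G_def by (intro nn_integral_cmult_indicator) measurable
  also have "\<dots> \<le> ennreal b * (ennreal T - \<tau> 0 w)"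
  proof (intro mult_left_mono)
    show "emeasure lborel {s. 0 \<le> s \<and> s < T \<and> \<tau> 0 w \<le> ennreal s} \<le> ennreal T - \<tau> 0 w"
    proof (cases "\<tau> 0 w")
      case (real t)
      then have "{s. 0 \<le> s \<and> s < T \<and> \<tau> 0 w \<le> ennreal s} \<subseteq> {t..<T}" by auto
      then have "emeasure lborel {s. 0 \<le> s \<and> s < T \<and> \<tau> 0 w \<le> ennreal s} \<le> emeasure lborel {t..<T}"
        by (intro emeasure_mono) auto
      also have "\<dots> \<le> ennreal T - \<tau> 0 w"
        using real by (cases "t \<le> T") (simp_all add: ennreal_minus)
      finally show ?thesis .
    next
      case top
      then have "{s. 0 \<le> s \<and> s < T \<and> \<tau> 0 w \<le> ennreal s} = {}" by (auto simp: top_unique)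
      then show ?thesis by (simp only: emeasure_empty zero_le)
    qed
  qed simp
  finally show ?thesis .
qed

end

lemma ennreal_cancel_right: "(a::ennreal) + x \<le> b + x \<Longrightarrow> x \<noteq> top \<Longrightarrow> a \<le> b"
  by (metis add.commute ennreal_add_left_cancel_le infinity_ennreal_def)

context ergodic
begin

text \<open>Over a long horizon \<open>T\<close> the strategy earns more than the rate
  \<open>\<kappa> + 2 * \<epsilon>\<close>, whereas by \<open>stopped_integral_le_mean\<close> its
  first segment earns at most the rate \<open>\<kappa>\<close>, up to \<open>\<epsilon> * T\<close>.
  The part after the first impulse therefore beats the rate \<open>\<kappa>\<close> in the mean and,
  after disintegration, for some frozen path. Leaving out the cost of the first impulse only
  improves the balance.\<close>

lemma block_exists:
  assumes strat: "is_strategy U V" and adm: "AE w in control_law P x V. (\<lambda>i. fst V i w) \<longlonglongrightarrow> \<infinity>"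
    and U: "compact U" and c: "continuous_on (UNIV \<times> U) (\<lambda>(x, a). c x a)"
    and g[measurable]: "g \<in> borel_measurable borel" and bd: "\<And>y. \<bar>g y\<bar> \<le> a" and a: "0 < a"
    and \<kappa>: "(\<integral>y. g y \<partial>\<mu>) \<le> \<kappa>" and rew: "ereal \<kappa> < reward P c g x V"
  shows "\<exists>\<omega>\<in>cadlag_paths. \<exists>t\<ge>0. \<exists>S\<ge>S0. fst V 0 (\<lambda>_. \<omega>) = ennreal t \<and> 0 < S \<and>
    ennreal ((\<kappa> + a) * S) + (\<Sum>n. \<integral>\<^sup>+w. imp_cost c V (t + S) (Suc n) w \<partial>strategy.law P V (return path_space \<omega>))
    \<le> (\<Sum>n. \<integral>\<^sup>+w. seg V (\<lambda>y. ennreal (g y + a)) (t + S) (Suc n) w \<partial>strategy.law P V (return path_space \<omega>))"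
proof -
  interpret strategy P U V by unfold_locales fact
  interpret L: strategy_law P U V "P x" by (rule strategy_law_P)
  interpret LP: prob_space "law (P x)" by (rule L.prob_space_law)
  define F where "F y = ennreal (g y + a)" for y
  have F[measurable]: "F \<in> borel_measurable borel" unfolding F_def by measurable
  have F_le: "F y \<le> ennreal (2 * a)" for y using bd[of y] unfolding F_def by (intro ennreal_leI) linarith
  obtain \<kappa>' where \<kappa>': "ereal \<kappa> < ereal \<kappa>'" "ereal \<kappa>' < reward P c g x V"
    using ereal_dense2[OF rew] by blast
  \<comment> \<open>One \<open>\<epsilon>\<close> pays for the first segment; the other is the
    surplus that forces the block to be long.\<close>
  define \<epsilon> where "\<epsilon> = (\<kappa>' - \<kappa>) / 2"
  have \<epsilon>: "0 < \<epsilon>" "\<kappa>' = \<kappa> + 2 * \<epsilon>" using \<kappa>' by (simp_all add: \<epsilon>_def field_simps)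
  have "- a \<le> (\<integral>y. g y \<partial>\<mu>)"
  proof -
    have "(\<integral>y. - a \<partial>\<mu>) \<le> (\<integral>y. g y \<partial>\<mu>)"
    proof (rule integral_mono)
      show "integrable \<mu> g"
        using bd by (intro \<mu>.integrable_const_bound[where B=a]) (auto simp: measurable_cong_sets[OF sets_\<mu> refl])
      show "- a \<le> g y" for y using bd[of y] by linarith
    qed simp
    then show ?thesis by (simp add: \<mu>.prob_space)
  qed
  then have la: "0 \<le> \<kappa> + a" and ma: "0 \<le> (\<integral>y. g y \<partial>\<mu>) + a" using \<kappa> by linarith+
  obtain T0 where T0: "\<And>T \<tau>. T0 \<le> T \<Longrightarrow> stopping_time path_filtration \<tau> \<Longrightarrow>
    (\<integral>\<^sup>+\<omega>. (\<integral>\<^sup>+s. ennreal (g (\<omega> s) + a) * indicator {s. 0 \<le> s \<and> s \<le> T \<and> ennreal s < \<tau> \<omega>} s \<partial>lborel) \<partial>P x)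
    \<le> (\<integral>\<^sup>+\<omega>. (\<integral>\<^sup>+s. ennreal ((\<integral>y. g y \<partial>\<mu>) + a) * indicator {s. 0 \<le> s \<and> s \<le> T \<and> ennreal s < \<tau> \<omega>} s \<partial>lborel) \<partial>P x)
      + ennreal (\<epsilon> * T)"
    using stopped_integral_le_mean[OF g bd a \<epsilon>(1), of x] by blast
  have "eventually (\<lambda>T. ereal \<kappa>' < ereal (1 / T) *
     (ereal (\<integral>w. (LINT s:{0..T}|lborel. g (controlled_process V w s)) \<partial>control_law P x V)
      - enn2ereal (\<integral>\<^sup>+w. total_cost c V T w \<partial>control_law P x V))) at_top"
    using \<kappa>'(2) unfolding reward_def by (rule less_LiminfD)
  \<comment> \<open>At a rate of at most \<open>2 * a\<close>, a surplus of
    \<open>\<epsilon> * T / 2\<close> needs time \<open>\<epsilon> * T / (4 * a)\<close>, which is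
    at least \<open>S0\<close> for this \<open>T\<close>.\<close>
  then obtain T where T: "max (max 1 T0) (4 * a * S0 / \<epsilon>) \<le> T" and rT: "ereal \<kappa>' < ereal (1 / T) *
     (ereal (\<integral>w. (LINT s:{0..T}|lborel. g (controlled_process V w s)) \<partial>control_law P x V)
      - enn2ereal (\<integral>\<^sup>+w. total_cost c V T w \<partial>control_law P x V))"
    unfolding eventually_at_top_linorder by (metis max.cobounded1 max.cobounded2)
  have T1: "0 < T" "T0 \<le> T" "4 * a * S0 / \<epsilon> \<le> T" using T by auto
  then have T_nn: "0 \<le> T" by simp
  define Z where "Z = (\<integral>\<^sup>+w. total_cost c V T w \<partial>law (P x))"
  have gain_fin: "L.gain g a T \<noteq> top"
    using L.gain_le[where g=g, OF bd T_nn] by (auto simp: top_unique)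
  have rT': "ereal \<kappa>' < ereal (1 / T) * (ereal (enn2real (L.gain g a T) - a * T) - enn2ereal Z)"
    using rT unfolding control_law_eq Z_def L.integral_controlled[OF g bd T_nn] .
  have gain_ge: "ennreal ((\<kappa> + a) * T) + ennreal (2 * \<epsilon> * T) + Z \<le> L.gain g a T"
  proof (cases Z)
    case (real z)
    then have "\<kappa>' < (enn2real (L.gain g a T) - a * T - z) / T" using rT' by (simp add: enn2ereal_ennreal)
    then have "\<kappa>' * T < enn2real (L.gain g a T) - a * T - z" using T1 by (simp add: field_simps)
    then have "(\<kappa> + a) * T + 2 * \<epsilon> * T + z \<le> enn2real (L.gain g a T)" using \<epsilon>(2) by (simp add: algebra_simps)
    then have "ennreal ((\<kappa> + a) * T + 2 * \<epsilon> * T + z) \<le> ennreal (enn2real (L.gain g a T))" by (rule ennreal_leI)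
    then show ?thesis using real la \<epsilon> T_nn gain_fin by (simp add: less_top)
  next
    \<comment> \<open>Infinite expected cost would make the right-hand side of \<open>rT'\<close>
      equal to \<open>-\<infinity>\<close>.\<close>
    case top
    then show ?thesis using rT' T1 by simp
  qed
  have "L.gain g a T = (\<integral>\<^sup>+w. (\<Sum>n. seg V F T n w) \<partial>law (P x))"
    unfolding L.gain_def
  proof (rule nn_integral_cong_AE)
    show "AE w in law (P x). (\<integral>\<^sup>+s. (if 0 \<le> s \<and> s < T then ennreal (g (controlled_process V w s) + a) else 0) \<partial>lborel)
        = (\<Sum>n. seg V F T n w)"
      using adm[unfolded control_law_eq] AE_space
    proof eventually_elim
      case (elim w)
      have "\<exists>n. ennreal s < \<tau> n w" for s
      proof -
        have "\<forall>\<^sub>F n in sequentially. ennreal s < \<tau> n w" using elim(1) by (rule order_tendstoD(1)) simp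
        then show ?thesis by (auto simp: eventually_sequentially)
      qed
      from suminf_seg_eq[OF _ F this] elim(2) show ?case unfolding F_def by (simp add: L.space_law)
    qed
  qed
  also have "\<dots> = (\<Sum>n. \<integral>\<^sup>+w. seg V F T n w \<partial>law (P x))"
    by (intro nn_integral_suminf L.measurable_from_law measurable_seg F)
  also have "\<dots> = (\<integral>\<^sup>+w. seg V F T 0 w \<partial>law (P x)) + (\<Sum>n. \<integral>\<^sup>+w. seg V F T (Suc n) w \<partial>law (P x))"
    by (rule suminf_ennreal_Suc)
  finally have gain_split: "L.gain g a T = (\<integral>\<^sup>+w. seg V F T 0 w \<partial>law (P x)) + (\<Sum>n. \<integral>\<^sup>+w. seg V F T (Suc n) w \<partial>law (P x))" .
  have Z_ge: "(\<Sum>n. \<integral>\<^sup>+w. imp_cost c V T (Suc n) w \<partial>law (P x)) \<le> Z"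
  proof -
    have "Z = (\<Sum>n. \<integral>\<^sup>+w. imp_cost c V T n w \<partial>law (P x))"
      unfolding Z_def total_cost_eq by (intro nn_integral_suminf L.measurable_from_law measurable_imp_cost[OF U c])
    also have "\<dots> = (\<integral>\<^sup>+w. imp_cost c V T 0 w \<partial>law (P x)) + (\<Sum>n. \<integral>\<^sup>+w. imp_cost c V T (Suc n) w \<partial>law (P x))"
      by (rule suminf_ennreal_Suc)
    finally show ?thesis by simp
  qed
  define \<tau>0 where "\<tau>0 \<omega> = \<tau> 0 (\<lambda>_. \<omega>)" for \<omega> :: "real \<Rightarrow> 'a"
  have \<tau>0_m[measurable]: "\<tau>0 \<in> borel_measurable (P x)"
    unfolding \<tau>0_def by (intro measurable_from_P measurable_compose[OF measurable_control_spaceI measurable_\<tau>]) simp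
  define r where "r \<omega> = ennreal T - \<tau>0 \<omega>" for \<omega>
  define l where "l \<omega> = (\<integral>\<^sup>+s. indicator {s. 0 \<le> s \<and> s \<le> T \<and> ennreal s < \<tau>0 \<omega>} s \<partial>lborel)" for \<omega>
  have l_eq: "l \<omega> = min (ennreal T) (\<tau>0 \<omega>)" for \<omega>
  proof -
    have "l \<omega> = emeasure lborel {s. 0 \<le> s \<and> s \<le> T \<and> ennreal s < \<tau>0 \<omega>}"
      unfolding l_def by (intro nn_integral_indicator) measurable
    also have "\<dots> = min (ennreal T) (\<tau>0 \<omega>)"
    proof (cases "ennreal T < \<tau>0 \<omega>")
      case True
      then have "{s. 0 \<le> s \<and> s \<le> T \<and> ennreal s < \<tau>0 \<omega>} = {0..T}" by (auto intro: le_less_trans[OF ennreal_leI])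
      then show ?thesis using less_imp_le[OF True] T_nn by (simp add: min_def)
    next
      case False
      then obtain t where t: "\<tau>0 \<omega> = ennreal t" "0 \<le> t" "t \<le> T"
        using T_nn by (cases "\<tau>0 \<omega>") (auto simp: not_less top_unique)
      then have "{s. 0 \<le> s \<and> s \<le> T \<and> ennreal s < \<tau>0 \<omega>} = {0..<t}" by (auto simp: ennreal_less_iff)
      then show ?thesis using t by (simp add: min_def)
    qed
    finally show ?thesis .
  qed
  have lr: "l \<omega> + r \<omega> = ennreal T" for \<omega>
    unfolding l_eq r_def by (cases "ennreal T \<le> \<tau>0 \<omega>") (auto simp: min_def add.commute diff_add_cancel_ennreal diff_eq_0_ennreal)
  have [measurable]: "l \<in> borel_measurable (P x)" "r \<in> borel_measurable (P x)"
    unfolding l_eq[abs_def] r_def[abs_def] by measurable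
  have Elr: "(\<integral>\<^sup>+\<omega>. l \<omega> \<partial>P x) + (\<integral>\<^sup>+\<omega>. r \<omega> \<partial>P x) = ennreal T"
    using lr prob_space.emeasure_space_1[OF prob_space_P[of x]] by (subst nn_integral_add[symmetric]) simp_all
  have seg0: "(\<integral>\<^sup>+w. seg V F T 0 w \<partial>law (P x)) \<le> ennreal (\<kappa> + a) * (\<integral>\<^sup>+\<omega>. l \<omega> \<partial>P x) + ennreal (\<epsilon> * T)"
  proof -
    have "(\<integral>\<^sup>+w. seg V F T 0 w \<partial>law (P x)) = (\<integral>\<^sup>+\<omega>. seg V F T 0 (\<lambda>_. \<omega>) \<partial>P x)"
      by (rule L.law_start[OF measurable_seg[OF F] seg_depends])
    also have "\<dots> \<le> (\<integral>\<^sup>+\<omega>. (\<integral>\<^sup>+s. ennreal (g (\<omega> s) + a) * indicator {s. 0 \<le> s \<and> s \<le> T \<and> ennreal s < \<tau>0 \<omega>} s \<partial>lborel) \<partial>P x)"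
      unfolding seg_def by (intro nn_integral_mono) (auto simp: in_seg_def F_def \<tau>0_def)
    also have "\<dots> \<le> (\<integral>\<^sup>+\<omega>. (\<integral>\<^sup>+s. ennreal ((\<integral>y. g y \<partial>\<mu>) + a) * indicator {s. 0 \<le> s \<and> s \<le> T \<and> ennreal s < \<tau>0 \<omega>} s \<partial>lborel) \<partial>P x)
      + ennreal (\<epsilon> * T)"
      by (rule T0[OF T1(2)]) (use stopping_time_first in \<open>simp add: \<tau>0_def[abs_def]\<close>)
    also have "(\<integral>\<^sup>+\<omega>. (\<integral>\<^sup>+s. ennreal ((\<integral>y. g y \<partial>\<mu>) + a) * indicator {s. 0 \<le> s \<and> s \<le> T \<and> ennreal s < \<tau>0 \<omega>} s \<partial>lborel) \<partial>P x)
       = ennreal ((\<integral>y. g y \<partial>\<mu>) + a) * (\<integral>\<^sup>+\<omega>. l \<omega> \<partial>P x)"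
    proof -
      have "(\<integral>\<^sup>+s. ennreal ((\<integral>y. g y \<partial>\<mu>) + a) * indicator {s. 0 \<le> s \<and> s \<le> T \<and> ennreal s < \<tau>0 \<omega>} s \<partial>lborel)
         = ennreal ((\<integral>y. g y \<partial>\<mu>) + a) * l \<omega>" for \<omega>
        unfolding l_def by (intro nn_integral_cmult) measurable
      then show ?thesis by (simp add: nn_integral_cmult)
    qed
    also have "ennreal ((\<integral>y. g y \<partial>\<mu>) + a) * (\<integral>\<^sup>+\<omega>. l \<omega> \<partial>P x) \<le> ennreal (\<kappa> + a) * (\<integral>\<^sup>+\<omega>. l \<omega> \<partial>P x)"
      using \<kappa> by (intro mult_right_mono ennreal_leI) auto
    finally show ?thesis by simp
  qed
  let ?El = "\<integral>\<^sup>+\<omega>. l \<omega> \<partial>P x" and ?Er = "\<integral>\<^sup>+\<omega>. r \<omega> \<partial>P x"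
  let ?A1 = "\<Sum>n. \<integral>\<^sup>+w. seg V F T (Suc n) w \<partial>law (P x)" and ?Z1 = "\<Sum>n. \<integral>\<^sup>+w. imp_cost c V T (Suc n) w \<partial>law (P x)"
  have main: "ennreal (\<kappa> + a) * ?Er + ?Z1 + ennreal (\<epsilon> * T) \<le> ?A1"
  proof (rule ennreal_cancel_right)
    have "?El \<le> ennreal T" using Elr by (metis le_iff_add)
    then have "?El \<noteq> top" by (auto simp: top_unique)
    then show "ennreal (\<kappa> + a) * ?El + ennreal (\<epsilon> * T) \<noteq> top" by (simp add: ennreal_mult_eq_top_iff)
    have "ennreal (\<kappa> + a) * ?Er + ?Z1 + ennreal (\<epsilon> * T) + (ennreal (\<kappa> + a) * ?El + ennreal (\<epsilon> * T))
       = ennreal (\<kappa> + a) * (?El + ?Er) + (ennreal (\<epsilon> * T) + ennreal (\<epsilon> * T)) + ?Z1"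
      by (simp add: distrib_left ac_simps)
    also have "\<dots> = ennreal ((\<kappa> + a) * T) + ennreal (2 * \<epsilon> * T) + ?Z1"
    proof -
      have "ennreal (\<epsilon> * T) + ennreal (\<epsilon> * T) = ennreal (\<epsilon> * T + \<epsilon> * T)"
        using \<epsilon> T_nn by (intro ennreal_plus[symmetric]) auto
      moreover have "ennreal (\<kappa> + a) * (?El + ?Er) = ennreal ((\<kappa> + a) * T)"
        using la T_nn by (simp only: Elr ennreal_mult)
      ultimately show ?thesis by (simp only:) (simp add: algebra_simps)
    qed
    also have "\<dots> \<le> ennreal ((\<kappa> + a) * T) + ennreal (2 * \<epsilon> * T) + Z"
      using Z_ge by (intro add_mono order_refl)
    also have "\<dots> \<le> (\<integral>\<^sup>+w. seg V F T 0 w \<partial>law (P x)) + ?A1" using gain_ge gain_split by simp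
    also have "\<dots> \<le> (ennreal (\<kappa> + a) * ?El + ennreal (\<epsilon> * T)) + ?A1" using seg0 by (intro add_mono order_refl)
    finally show "ennreal (\<kappa> + a) * ?Er + ?Z1 + ennreal (\<epsilon> * T) + (ennreal (\<kappa> + a) * ?El + ennreal (\<epsilon> * T))
      \<le> ?A1 + (ennreal (\<kappa> + a) * ?El + ennreal (\<epsilon> * T))" by (simp add: add.commute)
  qed
  define A where "A \<omega> = (\<Sum>n. \<integral>\<^sup>+w. seg V F T (Suc n) w \<partial>law (return path_space \<omega>))" for \<omega>
  define Zr where "Zr \<omega> = (\<Sum>n. \<integral>\<^sup>+w. imp_cost c V T (Suc n) w \<partial>law (return path_space \<omega>))" for \<omega>
  note ms = measurable_from_P[OF measurable_law_return[OF measurable_seg[OF F] seg_depends]]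
  note mi = measurable_from_P[OF measurable_law_return[OF measurable_imp_cost[OF U c] imp_cost_depends]]
  have [measurable]: "A \<in> borel_measurable (P x)" "Zr \<in> borel_measurable (P x)"
    unfolding A_def Zr_def using ms mi by (auto intro!: borel_measurable_suminf)
  have A_int: "?A1 = (\<integral>\<^sup>+\<omega>. A \<omega> \<partial>P x)"
    unfolding A_def using ms
    by (subst nn_integral_suminf) (auto simp: L.law_disintegrate[OF measurable_seg[OF F] seg_depends, symmetric])
  have Z_int: "?Z1 = (\<integral>\<^sup>+\<omega>. Zr \<omega> \<partial>P x)"
    unfolding Zr_def using mi
    by (subst nn_integral_suminf) (auto simp: L.law_disintegrate[OF measurable_imp_cost[OF U c] imp_cost_depends, symmetric])
  have A1_fin: "?A1 \<noteq> top" using gain_fin gain_split by (auto simp: top_unique)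
  \<comment> \<open>If this failed for every path, integration would contradict \<open>main\<close>,
    whose surplus is \<open>\<epsilon> * T\<close>; halving it makes the contradiction
    strict.\<close>
  have "\<exists>\<omega>\<in>cadlag_paths. ennreal (\<kappa> + a) * r \<omega> + Zr \<omega> + ennreal (\<epsilon> * T / 2) < A \<omega>"
  proof (rule ccontr)
    assume "\<not> ?thesis"
    then have "A \<omega> \<le> ennreal (\<kappa> + a) * r \<omega> + Zr \<omega> + ennreal (\<epsilon> * T / 2)" if "\<omega> \<in> cadlag_paths" for \<omega>
      using that by (auto simp: not_less)
    then have "(\<integral>\<^sup>+\<omega>. A \<omega> \<partial>P x) \<le> (\<integral>\<^sup>+\<omega>. ennreal (\<kappa> + a) * r \<omega> + Zr \<omega> + ennreal (\<epsilon> * T / 2) \<partial>P x)"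
      by (intro nn_integral_mono) (simp add: space_P)
    also have "\<dots> = ennreal (\<kappa> + a) * ?Er + ?Z1 + ennreal (\<epsilon> * T / 2)"
      using prob_space.emeasure_space_1[OF prob_space_P[of x]]
      by (simp add: nn_integral_add nn_integral_cmult Z_int)
    finally have le: "?A1 \<le> ennreal (\<kappa> + a) * ?Er + ?Z1 + ennreal (\<epsilon> * T / 2)" by (simp add: A_int)
    let ?B = "ennreal (\<kappa> + a) * ?Er + ?Z1"
    have "?B + ennreal (\<epsilon> * T) \<le> ?B + ennreal (\<epsilon> * T / 2)" using main le by (rule order_trans)
    moreover have "?B \<noteq> top" using main A1_fin by (auto simp: top_unique)
    ultimately have "ennreal (\<epsilon> * T) \<le> ennreal (\<epsilon> * T / 2)"
      by (simp only: ennreal_add_left_cancel_le infinity_ennreal_def) simp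
    then show False using \<epsilon>(1) T1(1) by (simp add: ennreal_le_iff)
  qed
  then obtain \<omega> where \<omega>: "\<omega> \<in> cadlag_paths" and good: "ennreal (\<kappa> + a) * r \<omega> + Zr \<omega> + ennreal (\<epsilon> * T / 2) < A \<omega>" by blast
  interpret D: strategy_law P U V "return path_space \<omega>" by (rule strategy_law_return[OF \<omega>])
  have "A \<omega> = (\<integral>\<^sup>+w. (\<Sum>n. seg V F T (Suc n) w) \<partial>law (return path_space \<omega>))"
    unfolding A_def by (intro nn_integral_suminf[symmetric] D.measurable_from_law measurable_seg F)
  also have "\<dots> \<le> (\<integral>\<^sup>+w. ennreal (2 * a) * r \<omega> \<partial>law (return path_space \<omega>))"
  proof (rule nn_integral_mono_AE)
    show "AE w in law (return path_space \<omega>). (\<Sum>n. seg V F T (Suc n) w) \<le> ennreal (2 * a) * r \<omega>"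
      using law_return_start[OF \<omega>] AE_space
    proof eventually_elim
      case (elim w)
      then show ?case using later_segs_le[OF _ F F_le _ T_nn, of w] a by (simp add: r_def \<tau>0_def D.space_law)
    qed
  qed
  also have "\<dots> = ennreal (2 * a) * r \<omega>"
    using prob_space.emeasure_space_1[OF D.prob_space_law] by simp
  finally have A_le: "A \<omega> \<le> ennreal (2 * a) * r \<omega>" .
  \<comment> \<open>The part after the first impulse earns at most \<open>2 * a\<close> per unit of
    time, so the surplus bounds its length from below.\<close>
  have "ennreal (\<epsilon> * T / 2) < ennreal (2 * a) * r \<omega>"
    using good A_le by (meson add_increasing le_less_trans less_le_trans order_refl zero_le)
  moreover from this have "r \<omega> \<noteq> 0" by auto
  then have "\<tau>0 \<omega> < ennreal T" by (metis r_def diff_eq_0_ennreal ennreal_less_top not_less)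
  then obtain t where t: "\<tau>0 \<omega> = ennreal t" "0 \<le> t" "t < T"
    by (cases "\<tau>0 \<omega>") (auto simp: ennreal_less_iff)
  moreover define S where "S = T - t"
  ultimately have rS: "r \<omega> = ennreal S" and "ennreal (\<epsilon> * T / 2) < ennreal (2 * a * S)"
    using a by (auto simp: r_def ennreal_minus ennreal_mult)
  then have "\<epsilon> * T / 2 < 2 * a * S" using \<epsilon> T_nn by (simp add: ennreal_less_iff)
  moreover have "S0 * (4 * a) \<le> \<epsilon> * T" using T1(3) \<epsilon> by (simp add: field_simps)
  ultimately have "S0 * (4 * a) \<le> S * (4 * a)" by (simp add: field_simps)
  then have S0: "S0 \<le> S" using a by simp
  have "ennreal ((\<kappa> + a) * S) + Zr \<omega> \<le> A \<omega>"
  proof -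
    have "ennreal ((\<kappa> + a) * S) = ennreal (\<kappa> + a) * r \<omega>"
      using la t by (simp add: rS S_def ennreal_mult)
    then have "ennreal ((\<kappa> + a) * S) + Zr \<omega> \<le> ennreal (\<kappa> + a) * r \<omega> + Zr \<omega> + ennreal (\<epsilon> * T / 2)"
      by simp
    from le_less_trans[OF this good] show ?thesis by (rule less_imp_le)
  qed
  moreover have "t + S = T" "0 < S" using t by (simp_all add: S_def)
  ultimately show ?thesis
    using \<omega> t S0 unfolding A_def Zr_def F_def \<tau>0_def by blast
qed

end

section \<open>Waiting for a cheap state\<close>

definition wait_time :: "(nat \<Rightarrow> real) \<Rightarrow> 'a set \<Rightarrow> real \<Rightarrow> (real \<Rightarrow> 'a) \<Rightarrow> ennreal" where
  "wait_time n G T \<omega> = (INF i. if \<omega> (T + n i) \<in> G then ennreal (n i) else top)"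

text \<open>Telescoping: the gap from \<open>n (k + 1)\<close> to \<open>n (k + 2)\<close> is waited
  through only if the checks 1 to \<open>k + 1\<close> all failed. The check with index 0 is ignored
  in the bound, which is why \<open>n 1\<close> is always paid. If no check ever succeeds, both
  sides are infinite because \<open>n\<close> is unbounded.\<close>

lemma wait_time_le:
  assumes n: "strict_mono n" "\<And>k. real k \<le> n k"
  shows "wait_time n G T \<omega> \<le> ennreal (n 1) +
    (\<Sum>k. ennreal (n (k + 2) - n (k + 1)) * indicator {\<omega>. \<forall>i\<in>{1..k + 1}. \<omega> (T + n i) \<in> - G} \<omega>)"
    (is "_ \<le> _ + (\<Sum>k. ?f k)")
proof -
  have n_nn: "0 \<le> n k" for k using n(2)[of k] by (rule order_trans[rotated]) simp
  have part: "ennreal (n (Suc N)) \<le> ennreal (n 1) + (\<Sum>k. ?f k)" if bad: "\<And>i. 1 \<le> i \<Longrightarrow> i \<le> N \<Longrightarrow> \<omega> (T + n i) \<notin> G" for N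
  proof -
    have "(\<Sum>k<N. n (k + 2) - n (k + 1)) = n (Suc N) - n 1" by (induction N) simp_all
    then have "ennreal (n (Suc N)) = ennreal (n 1) + ennreal (\<Sum>k<N. n (k + 2) - n (k + 1))"
      using n_nn strict_mono_less_eq[OF n(1), of 1 "Suc N"] by (simp add: ennreal_plus[symmetric] del: ennreal_plus)
    also have "ennreal (\<Sum>k<N. n (k + 2) - n (k + 1)) = (\<Sum>k<N. ennreal (n (k + 2) - n (k + 1)))"
      using n(1) by (intro sum_ennreal[symmetric]) (simp add: strict_mono_less_eq)
    also have "\<dots> = (\<Sum>k<N. ?f k)"
      using bad by (intro sum.cong refl) (auto simp: indicator_def)
    also have "\<dots> \<le> (\<Sum>k. ?f k)" by (intro sum_le_suminf) auto
    finally show ?thesis by (simp add: add_left_mono)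
  qed
  show ?thesis
  proof (cases "\<exists>i. \<omega> (T + n i) \<in> G")
    case True
    define i where "i = (LEAST i. \<omega> (T + n i) \<in> G)"
    have good: "\<omega> (T + n i) \<in> G" unfolding i_def using True by (rule LeastI_ex)
    have bad: "\<omega> (T + n j) \<notin> G" if "j < i" for j using that not_less_Least unfolding i_def by blast
    have "wait_time n G T \<omega> \<le> ennreal (n i)"
      unfolding wait_time_def by (rule INF_lower2[of i]) (simp_all add: good)
    also have "\<dots> \<le> ennreal (n 1) + (\<Sum>k. ?f k)"
    proof (cases i)
      case 0
      have "ennreal (n i) \<le> ennreal (n 1)" using n(1) 0 by (intro ennreal_leI) (simp add: strict_mono_less_eq)
      then show ?thesis by (simp add: add_increasing2)
    next
      case (Suc N)
      then show ?thesis using part[of N] bad by simp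
    qed
    finally show ?thesis .
  next
    case False
    have "ennreal (n 1) + (\<Sum>k. ?f k) = top"
    proof (rule ccontr)
      assume "ennreal (n 1) + (\<Sum>k. ?f k) \<noteq> top"
      then obtain r where r: "ennreal (n 1) + (\<Sum>k. ?f k) = ennreal r" "0 \<le> r"
        by (cases "ennreal (n 1) + (\<Sum>k. ?f k)" rule: ennreal_cases) auto
      obtain N :: nat where N: "r < real N" using reals_Archimedean2 by blast
      have "ennreal (n (Suc N)) \<le> ennreal r" using part[of N] False r by simp
      then have "n (Suc N) \<le> r" using r by (simp add: ennreal_le_iff)
      then show False using n(2)[of "Suc N"] N by simp
    qed
    then show ?thesis by simp
  qed
qed

lemma wait_time_attained:
  assumes "wait_time n G T \<omega> \<noteq> top" and n: "strict_mono n" "\<And>k. real k \<le> n k"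
  shows "\<exists>i. wait_time n G T \<omega> = ennreal (n i) \<and> \<omega> (T + n i) \<in> G"
proof -
  have ex: "\<exists>i. \<omega> (T + n i) \<in> G"
  proof (rule ccontr)
    assume "\<not> ?thesis"
    then have "wait_time n G T \<omega> = top" by (simp add: wait_time_def)
    with assms(1) show False by simp
  qed
  define i where "i = (LEAST i. \<omega> (T + n i) \<in> G)"
  have good: "\<omega> (T + n i) \<in> G" unfolding i_def using ex by (rule LeastI_ex)
  have "wait_time n G T \<omega> = ennreal (n i)"
  proof (rule antisym)
    show "wait_time n G T \<omega> \<le> ennreal (n i)"
      unfolding wait_time_def by (rule INF_lower2[of i]) (simp_all add: good)
    show "ennreal (n i) \<le> wait_time n G T \<omega>"
      unfolding wait_time_def
    proof (rule INF_greatest)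
      fix j
      have "i \<le> j" if "\<omega> (T + n j) \<in> G" unfolding i_def using that by (rule Least_le)
      then show "ennreal (n i) \<le> (if \<omega> (T + n j) \<in> G then ennreal (n j) else top)"
        using n(1) by (auto simp: strict_mono_less_eq intro!: ennreal_leI)
    qed
  qed
  with good show ?thesis by blast
qed

lemma measurable_wait_time:
  fixes X :: "'b \<Rightarrow> real \<Rightarrow> 'a::metric_space"
  assumes X: "X \<in> M \<rightarrow>\<^sub>M path_space" and t[measurable]: "t \<in> borel_measurable M" and G[measurable]: "G \<in> sets borel"
  shows "(\<lambda>x. wait_time n G (t x) (X x)) \<in> borel_measurable M"
proof -
  have [measurable]: "(\<lambda>x. X x (t x + n i)) \<in> M \<rightarrow>\<^sub>M borel" for i
    by (rule measurable_path_eval[OF X]) measurable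
  show ?thesis unfolding wait_time_def by measurable
qed

context strategy
begin

text \<open>Whether impulse \<open>j\<close> is the last one before \<open>T\<close> is revealed
  only by coordinate \<open>j + 1\<close>, so conditioning on it would spoil the law of that
  coordinate. The tail of the wait is therefore bounded on the larger event
  \<open>\<tau> j w \<le> ennreal T\<close>, for every \<open>j\<close>. On this event coordinate
  \<open>j + 1\<close> is a fresh process from a point of \<open>U\<close>, restarted
  \<open>T - \<tau> j\<close> earlier, and \<open>tail\<close> applies with this difference as
  \<open>s\<close>. The head \<open>n 1\<close> is paid only once, because the smaller events are
  disjoint.\<close>

lemma block_wait_le:
  assumes \<omega>: "\<omega> \<in> cadlag_paths" and T: "0 \<le> T"
    and n: "strict_mono n" "\<And>k. real k \<le> n k" and G: "G \<in> sets borel"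
    and tail: "\<And>y s. y \<in> U \<Longrightarrow> 0 \<le> s \<Longrightarrow> (\<Sum>k. ennreal (n (k + 2) - n (k + 1)) *
         emeasure (P y) {\<omega> \<in> cadlag_paths. \<forall>i\<in>{1..k + 1}. \<omega> (s + n i) \<in> - G}) \<le> ennreal \<epsilon>"
  shows "(\<Sum>j. \<integral>\<^sup>+w. (if \<tau> j w \<le> ennreal T \<and> ennreal T < \<tau> (Suc j) w then wait_time n G T (w (Suc j)) else 0)
      \<partial>law (return path_space \<omega>))
    \<le> ennreal (n 1) + ennreal \<epsilon> * (\<Sum>j. \<integral>\<^sup>+w. (if \<tau> j w \<le> ennreal T then 1 else 0) \<partial>law (return path_space \<omega>))"
proof -
  interpret D: strategy_law P U V "return path_space \<omega>" by (rule strategy_law_return[OF \<omega>])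
  let ?L = "law (return path_space \<omega>)"
  note [measurable] = measurable_\<tau>
  have n_nn: "0 \<le> n k" for k using n(2)[of k] by (rule order_trans[rotated]) simp
  define tl where "tl y = (\<Sum>k. ennreal (n (k + 2) - n (k + 1)) * indicator {\<omega>. \<forall>i\<in>{1..k + 1}. \<omega> (T + n i) \<in> - G} y)"
    for y :: "real \<Rightarrow> 'a"
  have ind_m: "(\<lambda>y. indicator {\<omega>. \<forall>i\<in>{1..k + 1}. \<omega> (s + n i) \<in> - G} y :: ennreal) \<in> borel_measurable path_space"
    if "0 \<le> s" for k s
  proof -
    have "{y \<in> space path_space. y (s + n i) \<in> - G} \<in> sets path_space" for i
      using measurable_sets[OF measurable_path_eval_const[of "s + n i"], of "- G"] that n_nn[of i] G
      by (simp add: vimage_def Int_def conj_commute)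
    then have "{y \<in> space path_space. \<forall>i\<in>{1..k + 1}. y (s + n i) \<in> - G} \<in> sets path_space"
      by (intro sets.sets_Collect_finite_All finite_atLeastAtMost)
    then have "(\<lambda>y. indicator {y \<in> space path_space. \<forall>i\<in>{1..k + 1}. y (s + n i) \<in> - G} y :: ennreal) \<in> borel_measurable path_space"
      by simp
    then show ?thesis
      by (rule measurable_cong[THEN iffD1, rotated]) (simp add: indicator_def)
  qed
  have tl_m[measurable]: "tl \<in> borel_measurable path_space"
    unfolding tl_def by (intro borel_measurable_suminf_order borel_measurable_times_ennreal borel_measurable_const ind_m T)
  have first: "(\<Sum>j. \<integral>\<^sup>+w. (if \<tau> j w \<le> ennreal T \<and> ennreal T < \<tau> (Suc j) w then ennreal (n 1) else 0) \<partial>?L) \<le> ennreal (n 1)"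
  proof -
    have [measurable]: "(\<lambda>w. \<tau> j w) \<in> borel_measurable ?L" for j by (rule D.measurable_from_law) (rule measurable_\<tau>)
    have "(\<Sum>j. \<integral>\<^sup>+w. (if \<tau> j w \<le> ennreal T \<and> ennreal T < \<tau> (Suc j) w then ennreal (n 1) else 0) \<partial>?L)
      = (\<integral>\<^sup>+w. (\<Sum>j. (if \<tau> j w \<le> ennreal T \<and> ennreal T < \<tau> (Suc j) w then ennreal (n 1) else 0)) \<partial>?L)"
      by (intro nn_integral_suminf[symmetric]) measurable
    also have "\<dots> \<le> (\<integral>\<^sup>+w. ennreal (n 1) \<partial>?L)"
    proof (intro nn_integral_mono)
      fix w assume "w \<in> space ?L"
      then have w: "w \<in> space control_space" by (simp add: D.space_law)
      show "(\<Sum>j. (if \<tau> j w \<le> ennreal T \<and> ennreal T < \<tau> (Suc j) w then ennreal (n 1) else 0)) \<le> ennreal (n 1)"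
      proof (cases "\<exists>j. \<tau> j w \<le> ennreal T \<and> ennreal T < \<tau> (Suc j) w")
        case True
        then obtain j where j: "\<tau> j w \<le> ennreal T" "ennreal T < \<tau> (Suc j) w" by blast
        have only: "i = j" if "\<tau> i w \<le> ennreal T \<and> ennreal T < \<tau> (Suc i) w" for i
        proof (rule ccontr)
          assume "i \<noteq> j"
          then consider "Suc i \<le> j" | "Suc j \<le> i" by linarith
          then show False
            using that j \<tau>_incr[OF w, of "Suc i" j] \<tau>_incr[OF w, of "Suc j" i]
            by cases (auto simp: not_less[symmetric] dest: order_trans less_le_trans le_less_trans)
        qed
        have "(if \<tau> i w \<le> ennreal T \<and> ennreal T < \<tau> (Suc i) w then ennreal (n 1) else 0)
            = (if i = j then ennreal (n 1) else 0)" for i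
        proof (cases "i = j")
          case False
          then have "\<not> (\<tau> i w \<le> ennreal T \<and> ennreal T < \<tau> (Suc i) w)" using only by blast
          then show ?thesis using False by (simp only: if_False)
        qed (simp add: j)
        then have "(\<Sum>i. (if \<tau> i w \<le> ennreal T \<and> ennreal T < \<tau> (Suc i) w then ennreal (n 1) else 0))
          = (\<Sum>i. (if i = j then ennreal (n 1) else 0))" by (simp only:)
        also have "\<dots> = ennreal (n 1)" by (subst suminf_finite[of "{j}"]) auto
        finally show ?thesis by simp
      next
        case False
        then have "(if \<tau> j w \<le> ennreal T \<and> ennreal T < \<tau> (Suc j) w then ennreal (n 1) else 0) = 0" for j by auto
        then show ?thesis by simp
      qed
    qed
    also have "\<dots> = ennreal (n 1)" using prob_space.emeasure_space_1[OF D.prob_space_law] by simp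
    finally show ?thesis .
  qed
  have second: "(\<integral>\<^sup>+w. (if \<tau> j w \<le> ennreal T then tl (w (Suc j)) else 0) \<partial>?L)
     \<le> ennreal \<epsilon> * (\<integral>\<^sup>+w. (if \<tau> j w \<le> ennreal T then 1 else 0) \<partial>?L)" for j
  proof -
    let ?F = "\<lambda>w. if \<tau> j w \<le> ennreal T then tl (w (Suc j)) else 0"
    have Fm: "?F \<in> borel_measurable control_space"
    proof -
      have [measurable]: "(\<lambda>w. tl (w (Suc j))) \<in> borel_measurable control_space"
        by (rule measurable_compose[OF measurable_control_coord tl_m])
      show ?thesis by measurable
    qed
    have dep: "depends_upto (Suc j) ?F"
      unfolding depends_upto_def
    proof (intro ballI impI)
      fix w w' :: "nat \<Rightarrow> real \<Rightarrow> 'a"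
      assume *: "w \<in> space control_space" "w' \<in> space control_space" "\<forall>i\<le>Suc j. w i = w' i"
      have "\<tau> j w = \<tau> j w'" using * by (intro depends_uptoD[OF \<tau>_depends]) auto
      moreover have "w (Suc j) = w' (Suc j)" using * by blast
      ultimately show "?F w = ?F w'" by (simp only:)
    qed
    have "(\<integral>\<^sup>+w. ?F w \<partial>?L) = (\<integral>\<^sup>+w. (\<integral>\<^sup>+\<omega>'. ?F (w(Suc j := \<omega>')) \<partial>kern j w) \<partial>?L)"
      by (rule D.law_step[OF Fm dep])
    also have "\<dots> \<le> (\<integral>\<^sup>+w. ennreal \<epsilon> * (if \<tau> j w \<le> ennreal T then 1 else 0) \<partial>?L)"
    proof (rule nn_integral_mono)
      fix w assume "w \<in> space ?L"
      then have w: "w \<in> space control_space" by (simp add: D.space_law)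
      have \<tau>_upd: "\<tau> j (w(Suc j := \<omega>')) = \<tau> j w" if "\<omega>' \<in> cadlag_paths" for \<omega>'
        using w that by (intro depends_uptoD[OF \<tau>_depends] control_space_upd) auto
      have spk: "space (kern j w) = cadlag_paths"
        using sets_eq_imp_space_eq[OF D.sets_kern[OF w]] by (simp add: space_path_space)
      have "(\<integral>\<^sup>+\<omega>'. ?F (w(Suc j := \<omega>')) \<partial>kern j w) = (\<integral>\<^sup>+\<omega>'. (if \<tau> j w \<le> ennreal T then tl \<omega>' else 0) \<partial>kern j w)"
        by (intro nn_integral_cong) (simp add: spk \<tau>_upd)
      also have "\<dots> \<le> ennreal \<epsilon> * (if \<tau> j w \<le> ennreal T then 1 else 0)"
      proof (cases "\<tau> j w \<le> ennreal T")
        case True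
        then obtain t where t: "\<tau> j w = ennreal t" "0 \<le> t" "t \<le> T"
          using T by (cases "\<tau> j w") (auto simp: top_unique)
        have "(\<integral>\<^sup>+\<omega>'. tl \<omega>' \<partial>kern j w) = (\<integral>\<^sup>+y. tl (paste t (w j) y) \<partial>P (\<xi> j w))"
          using nn_integral_kern[OF w tl_m, of j] t by simp
        also have "\<dots> = (\<integral>\<^sup>+y. (\<Sum>k. ennreal (n (k + 2) - n (k + 1)) *
            indicator {\<omega>. \<forall>i\<in>{1..k + 1}. \<omega> ((T - t) + n i) \<in> - G} y) \<partial>P (\<xi> j w))"
        proof -
          have "paste t (w j) y (T + n i) = y ((T - t) + n i)" for y i
            using t T n_nn[of i] by (simp add: paste_def algebra_simps)
          then have "tl (paste t (w j) y) = (\<Sum>k. ennreal (n (k + 2) - n (k + 1)) *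
              indicator {\<omega>. \<forall>i\<in>{1..k + 1}. \<omega> ((T - t) + n i) \<in> - G} y)" for y
            by (simp add: tl_def indicator_def)
          then show ?thesis by simp
        qed
        also have "\<dots> = (\<Sum>k. ennreal (n (k + 2) - n (k + 1)) *
            emeasure (P (\<xi> j w)) {\<omega> \<in> cadlag_paths. \<forall>i\<in>{1..k + 1}. \<omega> ((T - t) + n i) \<in> - G})"
        proof -
          have im: "(\<lambda>y. indicator {\<omega>. \<forall>i\<in>{1..k + 1}. \<omega> ((T - t) + n i) \<in> - G} y :: ennreal) \<in> borel_measurable (P (\<xi> j w))" for k
            using t by (intro measurable_from_P ind_m) simp
          have "(\<integral>\<^sup>+y. indicator {\<omega>. \<forall>i\<in>{1..k + 1}. \<omega> ((T - t) + n i) \<in> - G} y \<partial>P (\<xi> j w))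
             = emeasure (P (\<xi> j w)) {\<omega> \<in> cadlag_paths. \<forall>i\<in>{1..k + 1}. \<omega> ((T - t) + n i) \<in> - G}" for k
            using nn_integral_indicator'[of "{\<omega>. \<forall>i\<in>{1..k + 1}. \<omega> ((T - t) + n i) \<in> - G}" "P (\<xi> j w)"] im[of k]
            by (simp add: space_P Int_def conj_commute borel_measurable_indicator_iff)
          then show ?thesis using im by (simp add: nn_integral_suminf nn_integral_cmult)
        qed
        also have "\<dots> \<le> ennreal \<epsilon>" using t w by (intro tail \<xi>_in_U) auto
        finally show ?thesis using True by simp
      qed simp
      finally show "(\<integral>\<^sup>+\<omega>'. ?F (w(Suc j := \<omega>')) \<partial>kern j w) \<le> ennreal \<epsilon> * (if \<tau> j w \<le> ennreal T then 1 else 0)" .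
    qed
    also have "\<dots> = ennreal \<epsilon> * (\<integral>\<^sup>+w. (if \<tau> j w \<le> ennreal T then 1 else 0) \<partial>?L)"
      by (intro nn_integral_cmult D.measurable_from_law) measurable
    finally show ?thesis .
  qed
  have "(\<Sum>j. \<integral>\<^sup>+w. (if \<tau> j w \<le> ennreal T \<and> ennreal T < \<tau> (Suc j) w then wait_time n G T (w (Suc j)) else 0) \<partial>?L)
    \<le> (\<Sum>j. (\<integral>\<^sup>+w. (if \<tau> j w \<le> ennreal T \<and> ennreal T < \<tau> (Suc j) w then ennreal (n 1) else 0) \<partial>?L)
         + ennreal \<epsilon> * (\<integral>\<^sup>+w. (if \<tau> j w \<le> ennreal T then 1 else 0) \<partial>?L))"
  proof (intro suminf_le)
    fix j
    have [measurable]: "(\<lambda>w. tl (w (Suc j))) \<in> borel_measurable control_space"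
      by (rule measurable_compose[OF measurable_control_coord tl_m])
    have "(\<integral>\<^sup>+w. (if \<tau> j w \<le> ennreal T \<and> ennreal T < \<tau> (Suc j) w then wait_time n G T (w (Suc j)) else 0) \<partial>?L)
      \<le> (\<integral>\<^sup>+w. (if \<tau> j w \<le> ennreal T \<and> ennreal T < \<tau> (Suc j) w then ennreal (n 1) else 0)
            + (if \<tau> j w \<le> ennreal T then tl (w (Suc j)) else 0) \<partial>?L)"
      using wait_time_le[OF n, of G T] by (intro nn_integral_mono) (auto simp: tl_def)
    also have "\<dots> = (\<integral>\<^sup>+w. (if \<tau> j w \<le> ennreal T \<and> ennreal T < \<tau> (Suc j) w then ennreal (n 1) else 0) \<partial>?L)
        + (\<integral>\<^sup>+w. (if \<tau> j w \<le> ennreal T then tl (w (Suc j)) else 0) \<partial>?L)"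
      by (intro nn_integral_add D.measurable_from_law) measurable
    also have "\<dots> \<le> (\<integral>\<^sup>+w. (if \<tau> j w \<le> ennreal T \<and> ennreal T < \<tau> (Suc j) w then ennreal (n 1) else 0) \<partial>?L)
         + ennreal \<epsilon> * (\<integral>\<^sup>+w. (if \<tau> j w \<le> ennreal T then 1 else 0) \<partial>?L)"
      using second by (intro add_mono order_refl)
    finally show "(\<integral>\<^sup>+w. (if \<tau> j w \<le> ennreal T \<and> ennreal T < \<tau> (Suc j) w then wait_time n G T (w (Suc j)) else 0) \<partial>?L)
      \<le> (\<integral>\<^sup>+w. (if \<tau> j w \<le> ennreal T \<and> ennreal T < \<tau> (Suc j) w then ennreal (n 1) else 0) \<partial>?L)
         + ennreal \<epsilon> * (\<integral>\<^sup>+w. (if \<tau> j w \<le> ennreal T then 1 else 0) \<partial>?L)" .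
  qed auto
  also have "\<dots> = (\<Sum>j. \<integral>\<^sup>+w. (if \<tau> j w \<le> ennreal T \<and> ennreal T < \<tau> (Suc j) w then ennreal (n 1) else 0) \<partial>?L)
     + ennreal \<epsilon> * (\<Sum>j. \<integral>\<^sup>+w. (if \<tau> j w \<le> ennreal T then 1 else 0) \<partial>?L)"
    by (simp add: suminf_add[symmetric] summableI)
  also have "\<dots> \<le> ennreal (n 1) + ennreal \<epsilon> * (\<Sum>j. \<integral>\<^sup>+w. (if \<tau> j w \<le> ennreal T then 1 else 0) \<partial>?L)"
    by (intro add_mono first order_refl)
  finally show ?thesis .
qed

end

context strategy
begin

lemma later_segs_integral_le:
  assumes \<omega>: "\<omega> \<in> cadlag_paths" and F[measurable]: "F \<in> borel_measurable borel"
    and bd: "\<And>y. F y \<le> ennreal b" and b: "0 \<le> b" and T: "0 \<le> t" "0 \<le> S" and \<tau>0: "\<tau> 0 (\<lambda>_. \<omega>) = ennreal t"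
  shows "(\<Sum>n. \<integral>\<^sup>+w. seg V F (t + S) (Suc n) w \<partial>law (return path_space \<omega>)) \<le> ennreal (b * S)"
proof -
  interpret D: strategy_law P U V "return path_space \<omega>" by (rule strategy_law_return[OF \<omega>])
  have T': "0 \<le> t + S" using T by simp
  have "(\<Sum>n. \<integral>\<^sup>+w. seg V F (t + S) (Suc n) w \<partial>law (return path_space \<omega>))
      = (\<integral>\<^sup>+w. (\<Sum>n. seg V F (t + S) (Suc n) w) \<partial>law (return path_space \<omega>))"
    by (intro nn_integral_suminf[symmetric] D.measurable_from_law measurable_seg F)
  also have "\<dots> \<le> (\<integral>\<^sup>+w. ennreal (b * S) \<partial>law (return path_space \<omega>))"
  proof (rule nn_integral_mono_AE)
    show "AE w in law (return path_space \<omega>). (\<Sum>n. seg V F (t + S) (Suc n) w) \<le> ennreal (b * S)"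
      using law_return_start[OF \<omega>] AE_space
    proof eventually_elim
      case (elim w)
      have "ennreal (t + S) - ennreal t = ennreal S" using T by (simp add: ennreal_minus)
      then show ?case using later_segs_le[OF _ F bd b T', of w] elim b T
        by (simp add: \<tau>0 D.space_law ennreal_mult)
    qed
  qed
  also have "\<dots> = ennreal (b * S)"
    using prob_space.emeasure_space_1[OF D.prob_space_law] by simp
  finally show ?thesis .
qed

text \<open>Each impulse costs at least \<open>c1\<close>; the summand 1 accounts for impulse 0,
  whose cost is not in the sum.\<close>

lemma impulse_count_le:
  assumes \<omega>: "\<omega> \<in> cadlag_paths" and U: "compact U" and c: "continuous_on (UNIV \<times> U) (\<lambda>(x, a). c x a)"
    and c1: "0 < c1" "\<And>x e. e \<in> U \<Longrightarrow> c x e \<le> - c1" and b: "0 \<le> b"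
    and le: "(\<Sum>n. \<integral>\<^sup>+w. imp_cost c V T (Suc n) w \<partial>law (return path_space \<omega>)) \<le> ennreal b"
  shows "(\<Sum>j. \<integral>\<^sup>+w. (if \<tau> j w \<le> ennreal T then 1 else 0) \<partial>law (return path_space \<omega>)) \<le> ennreal (1 + b / c1)"
proof -
  interpret D: strategy_law P U V "return path_space \<omega>" by (rule strategy_law_return[OF \<omega>])
  let ?L = "law (return path_space \<omega>)"
  let ?N = "\<lambda>j. \<integral>\<^sup>+w. (if \<tau> j w \<le> ennreal T then 1 else 0) \<partial>?L"
  note [measurable] = D.measurable_from_law[OF measurable_\<tau>]
  have "ennreal c1 * ?N j \<le> (\<integral>\<^sup>+w. imp_cost c V T j w \<partial>?L)" for j
  proof -
    have "ennreal c1 * ?N j = (\<integral>\<^sup>+w. ennreal c1 * (if \<tau> j w \<le> ennreal T then 1 else 0) \<partial>?L)"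
      by (intro nn_integral_cmult[symmetric]) measurable
    also have "\<dots> \<le> (\<integral>\<^sup>+w. imp_cost c V T j w \<partial>?L)"
    proof (rule nn_integral_mono)
      fix w assume "w \<in> space ?L"
      then have "c (w j (enn2real (\<tau> j w))) (\<xi> j w) \<le> - c1" by (intro c1(2) \<xi>_in_U) (simp add: D.space_law)
      then show "ennreal c1 * (if \<tau> j w \<le> ennreal T then 1 else 0) \<le> imp_cost c V T j w"
        by (auto simp: imp_cost_def intro!: ennreal_leI)
    qed
    finally show ?thesis .
  qed
  then have "(\<Sum>j. ennreal c1 * ?N (Suc j)) \<le> (\<Sum>j. \<integral>\<^sup>+w. imp_cost c V T (Suc j) w \<partial>?L)"
    by (intro suminf_le) auto
  then have "ennreal c1 * (\<Sum>j. ?N (Suc j)) \<le> ennreal b" using le by simp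
  then have "ennreal (1 / c1) * (ennreal c1 * (\<Sum>j. ?N (Suc j))) \<le> ennreal (1 / c1) * ennreal b"
    by (intro mult_left_mono) auto
  moreover have "ennreal (1 / c1) * ennreal c1 = 1" using c1(1) by (simp add: ennreal_mult[symmetric])
  ultimately have 1: "(\<Sum>j. ?N (Suc j)) \<le> ennreal (b / c1)"
    using b c1(1) by (simp add: mult.assoc[symmetric] ennreal_mult[symmetric])
  have "?N 0 \<le> (\<integral>\<^sup>+w. 1 \<partial>?L)" by (intro nn_integral_mono) simp
  then have "?N 0 \<le> 1" using prob_space.emeasure_space_1[OF D.prob_space_law] by simp
  from add_mono[OF this 1] have "?N 0 + (\<Sum>j. ?N (Suc j)) \<le> 1 + ennreal (b / c1)" .
  then show ?thesis
    unfolding suminf_ennreal_Suc[of ?N] using b c1(1) by simp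
qed

end

locale impulse_problem = ergodic P \<mu> K h
  for P :: "'a::metric_space \<Rightarrow> (real \<Rightarrow> 'a) measure" and \<mu> K h +
  fixes U :: "'a set" and z :: 'a and c :: "'a \<Rightarrow> 'a \<Rightarrow> real" and c1 :: real
  assumes U: "compact U" and z: "z \<in> U"
    and c_cont: "continuous_on (UNIV \<times> U) (\<lambda>(x, a). c x a)"
    and c1: "0 < c1" and c_neg: "\<And>x e. e \<in> U \<Longrightarrow> c x e \<le> - c1"
    and c_tri: "\<And>x y y'. y \<in> U \<Longrightarrow> y' \<in> U \<Longrightarrow> c x y' + c y' y \<le> c x y"
begin

lemma measurable_c_const: "e \<in> U \<Longrightarrow> (\<lambda>x. c x e) \<in> borel_measurable borel"
  by (rule measurable_cost[OF U c_cont]) auto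

lemma good_block_exists:
  assumes strat: "is_strategy U V" and adm: "AE w in control_law P x V. (\<lambda>i. fst V i w) \<longlonglongrightarrow> \<infinity>"
    and g[measurable]: "g \<in> borel_measurable borel" and bd: "\<And>y. \<bar>g y\<bar> \<le> a" and a: "0 < a"
    and \<kappa>: "(\<integral>y. g y \<partial>\<mu>) \<le> \<kappa>" and rew: "ereal \<kappa> < reward P c g x V" and \<epsilon>: "0 < \<epsilon>"
  shows "\<exists>\<omega> t S n G. \<omega> \<in> cadlag_paths \<and> 0 \<le> t \<and> 1 \<le> S \<and> fst V 0 (\<lambda>_. \<omega>) = ennreal t \<and>
    strict_mono n \<and> (\<forall>k. real k \<le> n k) \<and> G \<in> sets borel \<and> (\<forall>y\<in>G. \<forall>e\<in>U. - c y e \<le> \<epsilon> * S) \<and>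
    ennreal ((\<kappa> + a) * S) + (\<Sum>j. \<integral>\<^sup>+w. imp_cost c V (t + S) (Suc j) w \<partial>strategy.law P V (return path_space \<omega>))
      \<le> (\<Sum>j. \<integral>\<^sup>+w. seg V (\<lambda>y. ennreal (g y + a)) (t + S) (Suc j) w \<partial>strategy.law P V (return path_space \<omega>)) \<and>
    (\<Sum>j. \<integral>\<^sup>+w. (if fst V j w \<le> ennreal (t + S) \<and> ennreal (t + S) < fst V (Suc j) w
        then wait_time n G (t + S) (w (Suc j)) else 0) \<partial>strategy.law P V (return path_space \<omega>)) \<le> ennreal (\<epsilon> * S)"
proof -
  interpret strategy P U V by unfold_locales fact
  \<comment> \<open>The expected number of impulses will be at most
    \<open>1 + 2 * a * S / c1\<close>, and
    \<open>\<epsilon>' * (2 * a * S / c1) = \<epsilon> * S / 2\<close>.\<close>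
  define \<epsilon>' where "\<epsilon>' = \<epsilon> * c1 / (4 * a)"
  have \<epsilon>': "0 < \<epsilon>'" using \<epsilon> c1 a by (simp add: \<epsilon>'_def)
  obtain n \<delta> where rt: "n 0 = 0 \<and> strict_mono n \<and> (\<forall>k. real k \<le> n k) \<and> 0 < \<delta> \<and>
    (\<forall>B\<in>sets borel. emeasure \<mu> B \<le> ennreal \<delta> \<longrightarrow> (\<forall>y\<in>U. \<forall>s\<ge>0.
      (\<Sum>k. ennreal (n (k + 2) - n (k + 1)) *
         emeasure (P y) {\<omega> \<in> cadlag_paths. \<forall>i\<in>{1..k + 1}. \<omega> (s + n i) \<in> B}) \<le> ennreal \<epsilon>'))"
    using recheck_times[OF U \<epsilon>'] by (elim exE)
  then have n: "strict_mono n" "\<And>k. real k \<le> n k" and \<delta>: "0 < \<delta>" by simp_all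
  have tail: "(\<Sum>k. ennreal (n (k + 2) - n (k + 1)) *
         emeasure (P y) {\<omega> \<in> cadlag_paths. \<forall>i\<in>{1..k + 1}. \<omega> (s + n i) \<in> B}) \<le> ennreal \<epsilon>'"
    if "B \<in> sets borel" "emeasure \<mu> B \<le> ennreal \<delta>" "y \<in> U" "0 \<le> s" for B y s
    using rt that by blast
  have n1: "0 \<le> n 1" using n(2)[of 1] by simp
  note [measurable] = measurable_c_const[OF z]
  have "(\<lambda>k. measure \<mu> {x \<in> space \<mu>. real k < - c x z}) \<longlonglongrightarrow> measure \<mu> (\<Inter>k. {x \<in> space \<mu>. real k < - c x z})"
    by (intro \<mu>.finite_Lim_measure_decseq) (auto simp: decseq_def sets_\<mu> space_\<mu>)
  also have "(\<Inter>k. {x \<in> space \<mu>. real k < - c x z}) = {}"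
    by (auto simp: not_less) (meson real_arch_simple not_less)
  finally have "(\<lambda>k. measure \<mu> {x \<in> space \<mu>. real k < - c x z}) \<longlonglongrightarrow> 0" by simp
  then have "\<forall>\<^sub>F k in sequentially. measure \<mu> {x \<in> space \<mu>. real k < - c x z} < \<delta>"
    using \<delta> by (intro order_tendstoD(2)) auto
  then obtain R :: nat where R: "measure \<mu> {x \<in> space \<mu>. real R < - c x z} < \<delta>"
    by (auto simp: eventually_sequentially)
  \<comment> \<open>Only the cost of jumping to \<open>z\<close> is controlled. By the inequality in
    (B1) a direct jump costs at most as much as the detour through \<open>z\<close>, and the costs
    from \<open>z\<close> are bounded since \<open>U\<close> is compact.\<close>
  define G where "G = {x. - c x z \<le> real R}"
  have G: "G \<in> sets borel" unfolding G_def by measurable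
  have "- G = {x. real R < - c x z}" by (auto simp: G_def)
  then have \<mu>G: "emeasure \<mu> (- G) \<le> ennreal \<delta>"
    using R by (auto simp: \<mu>.emeasure_eq_measure space_\<mu> intro!: ennreal_leI)
  have "continuous_on U (\<lambda>e. (\<lambda>(x, a). c x a) (z, e))"
    by (rule continuous_on_compose2[OF c_cont]) (auto intro!: continuous_intros)
  then have "compact ((\<lambda>e. c z e) ` U)" using U by (intro compact_continuous_image) auto
  then obtain Cz where "\<forall>e\<in>U. \<bar>c z e\<bar> \<le> Cz"
    by (auto dest!: compact_imp_bounded simp: bounded_iff)
  then have Cz: "\<bar>c z e\<bar> \<le> Cz" if "e \<in> U" for e using that by blast
  have Gc: "- c y e \<le> real R + Cz" if "y \<in> G" "e \<in> U" for y e
    using c_tri[OF that(2) z, of y] Cz[OF that(2)] that(1) by (auto simp: G_def)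
  \<comment> \<open>The recheck times and \<open>G\<close> are fixed before the block, so its length
    can be taken large compared with them: the fixed part \<open>n 1 + \<epsilon>'\<close> of the
    wait is at most \<open>\<epsilon> * S / 2\<close>, and a jump from \<open>G\<close> costs at
    most \<open>\<epsilon> * S\<close>.\<close>
  define S0 where "S0 = Max {1, 2 * (n 1 + \<epsilon>') / \<epsilon>, (real R + Cz) / \<epsilon>}"
  obtain \<omega> t S where \<omega>: "\<omega> \<in> cadlag_paths" and t: "0 \<le> t" and S: "S0 \<le> S" "0 < S" and \<tau>0: "\<tau> 0 (\<lambda>_. \<omega>) = ennreal t"
    and B1: "ennreal ((\<kappa> + a) * S) + (\<Sum>j. \<integral>\<^sup>+w. imp_cost c V (t + S) (Suc j) w \<partial>law (return path_space \<omega>))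
    \<le> (\<Sum>j. \<integral>\<^sup>+w. seg V (\<lambda>y. ennreal (g y + a)) (t + S) (Suc j) w \<partial>law (return path_space \<omega>))"
    using block_exists[OF strat adm U c_cont g bd a \<kappa> rew, of S0] by blast
  have S1: "1 \<le> S" "2 * (n 1 + \<epsilon>') / \<epsilon> \<le> S" "(real R + Cz) / \<epsilon> \<le> S"
    using S(1) unfolding S0_def by simp_all
  have seg_le: "(\<Sum>j. \<integral>\<^sup>+w. seg V (\<lambda>y. ennreal (g y + a)) (t + S) (Suc j) w \<partial>law (return path_space \<omega>)) \<le> ennreal (2 * a * S)"
  proof (rule later_segs_integral_le[OF \<omega> _ _ _ t _ \<tau>0])
    show "ennreal (g y + a) \<le> ennreal (2 * a)" for y using bd[of y] by (intro ennreal_leI) linarith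
  qed (use S a in auto)
  have "(\<Sum>j. \<integral>\<^sup>+w. imp_cost c V (t + S) (Suc j) w \<partial>law (return path_space \<omega>)) \<le> ennreal (2 * a * S)"
    using B1 seg_le by (meson add_increasing order_trans order_refl zero_le)
  from impulse_count_le[OF \<omega> U c_cont c1 c_neg _ this] a S
  have count: "(\<Sum>j. \<integral>\<^sup>+w. (if \<tau> j w \<le> ennreal (t + S) then 1 else 0) \<partial>law (return path_space \<omega>)) \<le> ennreal (1 + 2 * a * S / c1)"
    by simp
  have tS: "0 \<le> t + S" using t S by simp
  have "- G \<in> sets borel" using G by simp
  from block_wait_le[OF \<omega> tS n G tail[OF this \<mu>G]]
  have "(\<Sum>j. \<integral>\<^sup>+w. (if \<tau> j w \<le> ennreal (t + S) \<and> ennreal (t + S) < \<tau> (Suc j) w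
        then wait_time n G (t + S) (w (Suc j)) else 0) \<partial>law (return path_space \<omega>))
    \<le> ennreal (n 1) + ennreal \<epsilon>' * (\<Sum>j. \<integral>\<^sup>+w. (if \<tau> j w \<le> ennreal (t + S) then 1 else 0) \<partial>law (return path_space \<omega>))" .
  also have "\<dots> \<le> ennreal (n 1) + ennreal \<epsilon>' * ennreal (1 + 2 * a * S / c1)"
    using count by (intro add_mono mult_left_mono order_refl) auto
  also have "\<dots> = ennreal (n 1 + \<epsilon>' * (1 + 2 * a * S / c1))"
    using n1 \<epsilon>' a S c1 by (simp add: ennreal_mult[symmetric] ennreal_plus[symmetric] del: ennreal_plus)
  also have "\<dots> \<le> ennreal (\<epsilon> * S)"
  proof (rule ennreal_leI)
    have half: "\<epsilon>' * (2 * a * S / c1) = \<epsilon> * S / 2" using a c1 by (simp add: \<epsilon>'_def field_simps)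
    have "n 1 + \<epsilon>' \<le> \<epsilon> * S / 2" using S1(2) \<epsilon> by (simp add: field_simps)
    then have "(n 1 + \<epsilon>') + \<epsilon>' * (2 * a * S / c1) \<le> \<epsilon> * S / 2 + \<epsilon> * S / 2" unfolding half by (rule add_right_mono)
    then show "n 1 + \<epsilon>' * (1 + 2 * a * S / c1) \<le> \<epsilon> * S"
      by (simp only: distrib_left mult_1_right add.assoc field_sum_of_halves)
  qed
  finally have B2: "(\<Sum>j. \<integral>\<^sup>+w. (if \<tau> j w \<le> ennreal (t + S) \<and> ennreal (t + S) < \<tau> (Suc j) w
        then wait_time n G (t + S) (w (Suc j)) else 0) \<partial>law (return path_space \<omega>)) \<le> ennreal (\<epsilon> * S)" .
  have B3: "- c y e \<le> \<epsilon> * S" if "y \<in> G" "e \<in> U" for y e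
    using Gc[OF that] S1(3) \<epsilon> by (simp add: field_simps)
  show ?thesis
    using \<omega> t S1(1) \<tau>0 n G B1 B2 B3 by blast
qed

end

section \<open>Concatenation of blocks\<close>

text \<open>Galmarino's test replaces measurability with respect to the filtrations by a pointwise
  condition, which suits a strategy that is defined by recursion.\<close>

lemma is_strategyI:
  fixes V :: "'a::metric_space strategy"
  assumes \<tau>: "\<And>i. fst V i \<in> borel_measurable control_space"
    and \<xi>: "\<And>i. snd V i \<in> control_space \<rightarrow>\<^sub>M borel"
    and U: "\<And>i w. w \<in> space control_space \<Longrightarrow> snd V i w \<in> U"
    and mono: "\<And>i w. w \<in> space control_space \<Longrightarrow> fst V i w \<le> fst V (Suc i) w"
    and nonant: "\<And>i w w' t. w \<in> space control_space \<Longrightarrow> w' \<in> space control_space \<Longrightarrow>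
      agree (Suc i) t w w' \<Longrightarrow> fst V i w \<le> t \<Longrightarrow> fst V i w' = fst V i w \<and> snd V i w' = snd V i w"
  shows "is_strategy U V"
proof -
  have st: "stopping_time (control_filtration (Suc i)) (fst V i)" for i
  proof (rule stopping_timeI)
    fix t
    have "{w \<in> space control_space. fst V i w \<le> t} \<in> sets control_space"
      using \<tau>[of i] by measurable
    then have "{w \<in> space control_space. fst V i w \<le> t} \<in> sets (control_filtration (Suc i) t)"
    proof (rule control_filtrationI)
      fix w w' assume "w \<in> {w \<in> space control_space. fst V i w \<le> t}" "w' \<in> space control_space" "agree (Suc i) t w w'"
      then show "w' \<in> {w \<in> space control_space. fst V i w \<le> t}" using nonant[of w w' i t] by auto
    qed
    then show "Measurable.pred (control_filtration (Suc i) t) (\<lambda>w. fst V i w \<le> t)"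
      by (simp add: pred_def space_control_filtration)
  qed
  moreover have "snd V i \<in> filtration.pre_sigma (space control_space) (control_filtration (Suc i)) (fst V i) \<rightarrow>\<^sub>M borel" for i
  proof -
    interpret filtration "space control_space" "control_filtration (Suc i)" by (rule control_filtration_locale)
    show ?thesis
    proof (rule measurableI)
      fix B :: "'a set" assume "B \<in> sets borel"
      then have B: "snd V i -` B \<inter> space control_space \<in> sets control_space" by (rule measurable_sets[OF \<xi>])
      show "snd V i -` B \<inter> space (pre_sigma (fst V i)) \<in> sets (pre_sigma (fst V i))"
      proof (rule sets_pre_sigmaI[OF st])
        fix t
        have "{w \<in> space control_space. fst V i w \<le> t} \<in> sets control_space"
          using \<tau>[of i] by measurable
        from sets.Int[OF B this]
        have "{w \<in> snd V i -` B \<inter> space control_space. fst V i w \<le> t} \<in> sets control_space"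
          by (rule back_subst[where P="\<lambda>A. A \<in> sets control_space"]) auto
        then have "{w \<in> snd V i -` B \<inter> space control_space. fst V i w \<le> t} \<in> sets (control_filtration (Suc i) t)"
        proof (rule control_filtrationI)
          fix w w' assume "w \<in> {w \<in> snd V i -` B \<inter> space control_space. fst V i w \<le> t}"
            "w' \<in> space control_space" "agree (Suc i) t w w'"
          then show "w' \<in> {w \<in> snd V i -` B \<inter> space control_space. fst V i w \<le> t}"
            using nonant[of w w' i t] by auto
        qed
        then show "{w \<in> snd V i -` B \<inter> space (pre_sigma (fst V i)). fst V i w \<le> t} \<in> sets (control_filtration (Suc i) t)"
          by (simp add: space_pre_sigma)
      qed
    qed simp
  qed
  ultimately show ?thesis
    using U mono by (simp add: is_strategy_def split_beta)
qed

lemma agree_top_eq: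
  assumes "agree n top w w'" "w \<in> space control_space" "w' \<in> space control_space" "i < n"
  shows "w i = w' i"
proof
  fix s
  have "w i \<in> cadlag_paths" "w' i \<in> cadlag_paths" using assms(2,3) by (auto simp: space_control_space)
  then show "w i s = w' i s"
    using assms(1,4) cadlag_extensional[of "w i" s] cadlag_extensional[of "w' i" s]
    by (cases "s < 0") (auto simp: agree_def)
qed

section \<open>The concatenated strategy as a recursion on states\<close>

locale block_sequence = markov P for P :: "'a::metric_space \<Rightarrow> (real \<Rightarrow> 'a) measure" +
  fixes U :: "'a set" and Vs :: "nat \<Rightarrow> 'a strategy" and om :: "nat \<Rightarrow> real \<Rightarrow> 'a"
    and t S :: "nat \<Rightarrow> real" and nn :: "nat \<Rightarrow> nat \<Rightarrow> real" and G :: "nat \<Rightarrow> 'a set"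
  assumes strat: "\<And>k. is_strategy U (Vs k)" and om: "\<And>k. om k \<in> cadlag_paths"
    and t: "\<And>k. 0 \<le> t k" and S: "\<And>k. 1 \<le> S k"
    and start: "\<And>k. fst (Vs k) 0 (\<lambda>_. om k) = ennreal (t k)"
    and nn: "\<And>k. strict_mono (nn k)" "\<And>k i. real i \<le> nn k i" and G: "\<And>k. G k \<in> sets borel"
begin

sublocale blk: strategy P U "Vs k" for k by unfold_locales (rule strat)

definition entry :: "nat \<Rightarrow> 'a" where "entry k = snd (Vs k) 0 (\<lambda>_. om k)"

text \<open>The coordinates seen by the strategy \<open>Vs k\<close> in a block that starts at time \<open>B\<close> with
  coordinate \<open>m\<close>: the frozen path \<open>om k\<close> comes first, and time is shifted by \<open>t k - B\<close>.\<close>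

definition inner :: "nat \<Rightarrow> nat \<Rightarrow> ennreal \<Rightarrow> (nat \<Rightarrow> real \<Rightarrow> 'a) \<Rightarrow> nat \<Rightarrow> real \<Rightarrow> 'a" where
  "inner k m B w = (\<lambda>j. case j of 0 \<Rightarrow> om k | Suc i \<Rightarrow> paste (t k) (om k) (shift (enn2real B) (w (m + i))))"

text \<open>In the clock of \<open>Vs k\<close> the block occupies the times from \<open>t k\<close>
  to \<open>t k + S k\<close>. Position \<open>j\<close> is followed by impulse
  \<open>Suc j\<close>, since impulse 0 of \<open>Vs k\<close> is the one that opens the
  block.\<close>

definition in_block :: "nat \<Rightarrow> nat \<Rightarrow> (nat \<Rightarrow> real \<Rightarrow> 'a) \<Rightarrow> bool" where
  "in_block k j v \<longleftrightarrow> fst (Vs k) (Suc j) v \<le> ennreal (t k + S k)"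

text \<open>The time of the impulse that opens the next block; it is infinite if no check
  succeeds.\<close>

definition block_end :: "nat \<Rightarrow> ennreal \<Rightarrow> (real \<Rightarrow> 'a) \<Rightarrow> ennreal" where
  "block_end k B \<omega> = B + ennreal (S k) + wait_time (nn k) (G k) (S k) (shift (enn2real B) \<omega>)"

text \<open>\<open>st n w = (k, m, B)\<close>: impulse \<open>n + 1\<close> belongs to block \<open>k\<close>, which starts at time \<open>B\<close> with
  coordinate \<open>m\<close>.  Impulse 0 takes place at time 0 and precedes all blocks.\<close>

primrec st :: "nat \<Rightarrow> (nat \<Rightarrow> real \<Rightarrow> 'a) \<Rightarrow> nat \<times> nat \<times> ennreal" where
  "st 0 w = (0, 1, 0)"
| "st (Suc n) w = (case st n w of (k, m, B) \<Rightarrow>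
     if in_block k (Suc n - m) (inner k m B w) then (k, m, B)
     else (Suc k, Suc (Suc n), block_end k B (w (Suc n))))"

definition stk :: "nat \<Rightarrow> (nat \<Rightarrow> real \<Rightarrow> 'a) \<Rightarrow> nat" where "stk n w = fst (st n w)"
definition stm :: "nat \<Rightarrow> (nat \<Rightarrow> real \<Rightarrow> 'a) \<Rightarrow> nat" where "stm n w = fst (snd (st n w))"
definition stB :: "nat \<Rightarrow> (nat \<Rightarrow> real \<Rightarrow> 'a) \<Rightarrow> ennreal" where "stB n w = snd (snd (st n w))"
text \<open>Position 0 belongs to the coordinate that begins with the opening impulse of the
  block.\<close>

definition pos :: "nat \<Rightarrow> (nat \<Rightarrow> real \<Rightarrow> 'a) \<Rightarrow> nat" where "pos n w = Suc n - stm n w"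
definition inn :: "nat \<Rightarrow> (nat \<Rightarrow> real \<Rightarrow> 'a) \<Rightarrow> nat \<Rightarrow> real \<Rightarrow> 'a" where
  "inn n w = inner (stk n w) (stm n w) (stB n w) w"
definition going :: "nat \<Rightarrow> (nat \<Rightarrow> real \<Rightarrow> 'a) \<Rightarrow> bool" where
  "going n w = in_block (stk n w) (pos n w) (inn n w)"

lemma st_0: "stk 0 w = 0" "stm 0 w = 1" "stB 0 w = 0"
  by (simp_all add: stk_def stm_def stB_def)

lemma st_Suc:
  "stk (Suc n) w = (if going n w then stk n w else Suc (stk n w))"
  "stm (Suc n) w = (if going n w then stm n w else Suc (Suc n))"
  "stB (Suc n) w = (if going n w then stB n w else block_end (stk n w) (stB n w) (w (Suc n)))"
  by (auto simp: stk_def stm_def stB_def going_def inn_def pos_def split: prod.splits)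

text \<open>The clock of \<open>Vs k\<close> shows \<open>t k\<close> when the block starts. The
  truncated subtraction loses nothing, because no impulse of \<open>Vs k\<close> comes before
  \<open>t k\<close> (see \<open>impulse_time_ge\<close>).\<close>

primrec tau :: "nat \<Rightarrow> (nat \<Rightarrow> real \<Rightarrow> 'a) \<Rightarrow> ennreal" where
  "tau 0 w = 0"
| "tau (Suc n) w = (if going n w
     then stB n w + (fst (Vs (stk n w)) (Suc (pos n w)) (inn n w) - ennreal (t (stk n w)))
     else block_end (stk n w) (stB n w) (w (Suc n)))"

primrec xi :: "nat \<Rightarrow> (nat \<Rightarrow> real \<Rightarrow> 'a) \<Rightarrow> 'a" where
  "xi 0 w = entry 0"
| "xi (Suc n) w = (if going n w then snd (Vs (stk n w)) (Suc (pos n w)) (inn n w)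
     else entry (Suc (stk n w)))"

definition Vopt :: "'a strategy" where "Vopt = (tau, xi)"

lemma stm_bounds: "1 \<le> stm n w \<and> stm n w \<le> Suc n"
  by (induction n) (auto simp: st_0 st_Suc)

lemma inner_space:
  assumes "w \<in> space control_space" shows "inner k m B w \<in> space control_space"
  using assms om t by (auto simp: space_control_space inner_def intro!: paste_cadlag shift_cadlag split: nat.splits)

lemma inn_space: "w \<in> space control_space \<Longrightarrow> inn n w \<in> space control_space"
  by (simp add: inn_def inner_space)

lemma entry_in_U: "entry k \<in> U"
  unfolding entry_def using om by (intro blk.\<xi>_in_U) (simp add: space_control_space)

lemma block_start_time:
  assumes "v \<in> space control_space" "v 0 = om k" shows "fst (Vs k) 0 v = ennreal (t k)" "snd (Vs k) 0 v = entry k"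
  using depends_uptoD[OF blk.\<tau>_depends[of 0 k] assms(1), of "\<lambda>_. om k"]
    depends_uptoD[OF blk.\<xi>_depends[of 0 k] assms(1), of "\<lambda>_. om k"] assms om
  by (simp_all add: start entry_def space_control_space)

lemma inner_0: "inner k m B w 0 = om k" by (simp add: inner_def)

lemma inner_Suc: "inner k m B w (Suc i) = paste (t k) (om k) (shift (enn2real B) (w (m + i)))"
  by (simp add: inner_def)

lemma tau_ge_stB:
  assumes "w \<in> space control_space" shows "stB n w \<le> tau n w"
  by (cases n) (auto simp: st_0 st_Suc)

lemma measurable_block_end:
  assumes B: "B \<in> borel_measurable M" and X: "X \<in> M \<rightarrow>\<^sub>M path_space"
  shows "(\<lambda>x. block_end k (B x) (X x)) \<in> borel_measurable M"
proof -
  have [measurable]: "(\<lambda>x. wait_time (nn k) (G k) (S k) (shift (enn2real (B x)) (X x))) \<in> borel_measurable M"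
    by (intro measurable_wait_time measurable_shift X G borel_measurable_enn2real B) auto
  note [measurable] = B
  show ?thesis unfolding block_end_def by measurable
qed

lemma measurable_inner:
  assumes B: "B \<in> borel_measurable control_space"
  shows "(\<lambda>w. inner k m (B w) w) \<in> control_space \<rightarrow>\<^sub>M control_space"
proof (rule measurable_control_spaceI)
  fix i
  show "(\<lambda>w. inner k m (B w) w i) \<in> control_space \<rightarrow>\<^sub>M path_space"
  proof (cases i)
    case 0 then show ?thesis using om by (simp add: inner_0 space_path_space)
  next
    case (Suc j)
    have "(\<lambda>w. paste (t k) (om k) (shift (enn2real (B w)) (w (m + j)))) \<in> control_space \<rightarrow>\<^sub>M path_space"
      using om t by (intro measurable_paste measurable_shift measurable_control_coord borel_measurable_enn2real B)
        (simp_all add: space_path_space)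
    then show ?thesis by (simp add: Suc inner_Suc)
  qed
qed

text \<open>The discrete part of the state takes countably many values, so a function selected by it
  is pieced together from countably many measurable ones.\<close>

lemma measurable_state_compose:
  assumes k: "K \<in> M \<rightarrow>\<^sub>M count_space UNIV" and m: "L \<in> M \<rightarrow>\<^sub>M count_space UNIV"
    and f: "\<And>k m. f k m \<in> M \<rightarrow>\<^sub>M N"
  shows "(\<lambda>w. f (K w :: nat) (L w :: nat) w) \<in> M \<rightarrow>\<^sub>M N"
proof -
  have "(\<lambda>w. f k (L w) w) \<in> M \<rightarrow>\<^sub>M N" for k
    by (rule measurable_compose_countable[where f="\<lambda>m w. f k m w", OF f m])
  then show ?thesis
    by (rule measurable_compose_countable[where f="\<lambda>k w. f k (L w) w", OF _ k])
qed

lemma measurable_going_from: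
  assumes k: "stk n \<in> control_space \<rightarrow>\<^sub>M count_space UNIV" and m: "stm n \<in> control_space \<rightarrow>\<^sub>M count_space UNIV"
    and B: "stB n \<in> borel_measurable control_space"
  shows "Measurable.pred control_space (going n)"
proof -
  have "Measurable.pred control_space (\<lambda>w. in_block k (Suc n - m) (inner k m (stB n w) w))" for k m
  proof -
    have [measurable]: "(\<lambda>w. fst (Vs k) (Suc (Suc n - m)) (inner k m (stB n w) w)) \<in> borel_measurable control_space"
      by (rule measurable_compose[OF measurable_inner[OF B] blk.measurable_\<tau>])
    show ?thesis unfolding in_block_def by measurable
  qed
  from measurable_state_compose[where f="\<lambda>k m w. in_block k (Suc n - m) (inner k m (stB n w) w)", OF k m this]
  show ?thesis by (simp add: going_def[abs_def] inn_def pos_def)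
qed

lemma measurable_state:
  "stk n \<in> control_space \<rightarrow>\<^sub>M count_space UNIV \<and> stm n \<in> control_space \<rightarrow>\<^sub>M count_space UNIV \<and>
   stB n \<in> borel_measurable control_space"
proof (induction n)
  case 0 then show ?case by (simp add: st_0[abs_def])
next
  case (Suc n)
  then have k[measurable]: "stk n \<in> control_space \<rightarrow>\<^sub>M count_space UNIV"
    and m[measurable]: "stm n \<in> control_space \<rightarrow>\<^sub>M count_space UNIV"
    and B[measurable]: "stB n \<in> borel_measurable control_space" by auto
  note [measurable] = measurable_going_from[OF k m B]
  have [measurable]: "(\<lambda>w. block_end (stk n w) (stB n w) (w (Suc n))) \<in> borel_measurable control_space"
    using measurable_block_end[OF B measurable_control_coord]
    by (rule measurable_compose_countable[where f="\<lambda>k w. block_end k (stB n w) (w (Suc n))", OF _ k])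
  show ?case unfolding st_Suc[abs_def] by measurable
qed

lemma measurable_stk: "stk n \<in> control_space \<rightarrow>\<^sub>M count_space UNIV"
  and measurable_stm: "stm n \<in> control_space \<rightarrow>\<^sub>M count_space UNIV"
  and measurable_stB: "stB n \<in> borel_measurable control_space"
  using measurable_state by auto

lemma measurable_going: "Measurable.pred control_space (going n)"
  by (rule measurable_going_from[OF measurable_stk measurable_stm measurable_stB])

lemma measurable_tau: "tau n \<in> borel_measurable control_space"
proof (cases n)
  case 0 then show ?thesis by (simp add: tau.simps(1)[abs_def])
next
  case (Suc n)
  note [measurable] = measurable_going[of n] measurable_stB[of n]
  have [measurable]: "(\<lambda>w. block_end (stk n w) (stB n w) (w (Suc n))) \<in> borel_measurable control_space"
    using measurable_block_end[OF measurable_stB measurable_control_coord]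
    by (rule measurable_compose_countable[where f="\<lambda>k w. block_end k (stB n w) (w (Suc n))", OF _ measurable_stk])
  have "(\<lambda>w. fst (Vs k) (Suc (Suc n - m)) (inner k m (stB n w) w) - ennreal (t k)) \<in> borel_measurable control_space" for k m
    by (intro borel_measurable_minus_ennreal measurable_compose[OF measurable_inner[OF measurable_stB] blk.measurable_\<tau>]) simp
  from measurable_state_compose[where f="\<lambda>k m w. fst (Vs k) (Suc (Suc n - m)) (inner k m (stB n w) w) - ennreal (t k)",
      OF measurable_stk[of n] measurable_stm[of n] this]
  have [measurable]: "(\<lambda>w. fst (Vs (stk n w)) (Suc (pos n w)) (inn n w) - ennreal (t (stk n w))) \<in> borel_measurable control_space"
    by (simp add: inn_def pos_def)
  show ?thesis unfolding Suc tau.simps(2)[abs_def] by measurable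
qed

lemma measurable_xi: "xi n \<in> control_space \<rightarrow>\<^sub>M borel"
proof (cases n)
  case 0 then show ?thesis by (simp add: xi.simps(1)[abs_def])
next
  case (Suc n)
  note [measurable] = measurable_going[of n]
  have [measurable]: "(\<lambda>w. entry (Suc (stk n w))) \<in> control_space \<rightarrow>\<^sub>M borel"
    by (rule measurable_compose[OF measurable_stk]) simp
  have "(\<lambda>w. snd (Vs k) (Suc (Suc n - m)) (inner k m (stB n w) w)) \<in> control_space \<rightarrow>\<^sub>M borel" for k m
    by (rule measurable_compose[OF measurable_inner[OF measurable_stB] blk.measurable_\<xi>])
  from measurable_state_compose[where f="\<lambda>k m w. snd (Vs k) (Suc (Suc n - m)) (inner k m (stB n w) w)",
      OF measurable_stk[of n] measurable_stm[of n] this]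
  have [measurable]: "(\<lambda>w. snd (Vs (stk n w)) (Suc (pos n w)) (inn n w)) \<in> control_space \<rightarrow>\<^sub>M borel"
    by (simp add: inn_def pos_def)
  show ?thesis unfolding Suc xi.simps(2)[abs_def] by measurable
qed

lemma xi_in_U: "w \<in> space control_space \<Longrightarrow> xi n w \<in> U"
  by (cases n) (auto simp: entry_in_U inn_space intro: blk.\<xi>_in_U)

text \<open>The delicate case is the last impulse inside a block: by \<open>in_block\<close> it
  comes at most \<open>S k\<close> after the start of the block, hence not after
  \<open>block_end\<close>.\<close>

lemma tau_mono:
  assumes w: "w \<in> space control_space"
  shows "tau n w \<le> tau (Suc n) w"
proof (cases n)
  case 0 then show ?thesis by simp
next
  case (Suc i)
  show ?thesis
  proof (cases "going i w")
    case True
    have eq: "stk (Suc i) w = stk i w" "stm (Suc i) w = stm i w" "stB (Suc i) w = stB i w" using True by (simp_all add: st_Suc)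
    then have inn: "inn (Suc i) w = inn i w" by (simp add: inn_def)
    have pos: "pos (Suc i) w = Suc (pos i w)" using stm_bounds[of i w] by (simp add: pos_def eq Suc_diff_le)
    let ?k = "stk i w" and ?j = "pos i w" and ?v = "inn i w"
    have tau: "tau n w = stB i w + (fst (Vs ?k) (Suc ?j) ?v - ennreal (t ?k))" using True Suc by simp
    show ?thesis
    proof (cases "going (Suc i) w")
      case g: True
      have "fst (Vs ?k) (Suc ?j) ?v \<le> fst (Vs ?k) (Suc (Suc ?j)) ?v"
        using w by (intro blk.\<tau>_mono inn_space)
      then show ?thesis using g Suc tau by (simp add: eq inn pos ennreal_minus_mono add_left_mono)
    next
      case g: False
      have "fst (Vs ?k) (Suc ?j) ?v \<le> ennreal (t ?k + S ?k)" using True by (simp add: going_def in_block_def)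
      then have "fst (Vs ?k) (Suc ?j) ?v - ennreal (t ?k) \<le> ennreal (t ?k + S ?k) - ennreal (t ?k)"
        by (rule ennreal_minus_mono) simp
      also have "\<dots> = ennreal (S ?k)" using t[of ?k] S[of ?k] by (simp add: ennreal_minus)
      finally show ?thesis using g Suc tau by (simp add: eq block_end_def add.assoc add_left_mono add_increasing2)
    qed
  next
    case False
    then have "tau n w = stB (Suc i) w" using Suc by (simp add: st_Suc)
    also have "\<dots> \<le> tau (Suc n) w" using Suc by (simp add: block_end_def add.assoc)
    finally show ?thesis .
  qed
qed

lemma inner_agree:
  assumes ag: "agree (Suc n) r w w'" and B: "B = ennreal b" "0 \<le> b" "B \<le> r" and m: "m + j \<le> n"
  shows "agree (Suc (Suc j)) (ennreal (t k) + (r - B)) (inner k m B w) (inner k m B w')"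
  unfolding agree_def
proof (intro allI impI)
  fix i and s :: real assume i: "i < Suc (Suc j)" and s: "0 \<le> s" "ennreal s \<le> ennreal (t k) + (r - B)"
  show "inner k m B w i s = inner k m B w' i s"
  proof (cases i)
    case 0 then show ?thesis by (simp add: inner_0)
  next
    case (Suc i')
    have "w (m + i') (s - t k + b) = w' (m + i') (s - t k + b)" if st: "\<not> s < t k"
    proof -
      have "ennreal (s - t k + b) \<le> r"
      proof (cases r)
        case (real q)
        then have "b \<le> q" using B by simp
        then have "ennreal (t k) + (r - B) = ennreal (t k + (q - b))"
          using real B t[of k] by (simp add: ennreal_minus ennreal_plus[symmetric] del: ennreal_plus)
        with s(2) have "ennreal s \<le> ennreal (t k + (q - b))" by (simp only:)
        moreover have "0 \<le> t k + (q - b)" using \<open>b \<le> q\<close> t[of k] by simp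
        ultimately have "s \<le> t k + (q - b)" by (simp only: ennreal_le_iff)
        then show ?thesis using real by (simp add: ennreal_leI)
      qed simp
      then show ?thesis using ag st B i m Suc by (simp add: agree_def)
    qed
    then show ?thesis using s t[of k] B(1,2) by (auto simp: Suc inner_Suc paste_def shift_def)
  qed
qed

text \<open>A finite wait ends at a check, and the checks up to this one read the path no later than
  \<open>block_end\<close>. The earlier checks fail for both paths.\<close>

lemma block_end_agree:
  assumes ag: "\<And>s. 0 \<le> s \<Longrightarrow> ennreal s \<le> r \<Longrightarrow> \<omega> s = \<omega>' s" and le: "block_end k B \<omega> \<le> r" and fin: "block_end k B \<omega> \<noteq> top"
  shows "block_end k B \<omega>' = block_end k B \<omega>"
proof -
  let ?n = "nn k" and ?W = "\<lambda>\<omega>. wait_time (nn k) (G k) (S k) (shift (enn2real B) \<omega>)"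
  have n_nn: "0 \<le> ?n i" for i using nn(2)[of i k] by (rule order_trans[rotated]) simp
  have "B \<noteq> top" using fin by (auto simp: block_end_def)
  then obtain b where b: "B = ennreal b" "0 \<le> b" by (cases B) auto
  have "?W \<omega> \<noteq> top" using fin by (auto simp: block_end_def)
  from wait_time_attained[OF this nn(1) nn(2)]
  obtain i where i: "?W \<omega> = ennreal (?n i)" "shift (enn2real B) \<omega> (S k + ?n i) \<in> G k" by blast
  have i': "wait_time (nn k) (G k) (S k) (shift b \<omega>) = ennreal (?n i)" using i(1) b by simp
  have same: "shift b \<omega>' (S k + ?n j) = shift b \<omega> (S k + ?n j)" if "j \<le> i" for j
  proof -
    have "?n j \<le> ?n i" using nn(1)[of k] that by (simp add: strict_mono_less_eq)
    then have "ennreal (S k + ?n j + b) \<le> ennreal (b + S k + ?n i)" by (intro ennreal_leI) simp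
    also have "\<dots> = block_end k B \<omega>" using b S[of k] n_nn[of i] by (simp add: block_end_def i')
    finally show ?thesis using ag[of "S k + ?n j + b"] le S[of k] n_nn[of j] b by (simp add: shift_def)
  qed
  have "?W \<omega>' = ennreal (?n i)"
  proof (rule antisym)
    show "?W \<omega>' \<le> ennreal (?n i)"
      unfolding wait_time_def by (rule INF_lower2[of i]) (use i same[of i] b in simp_all)
    show "ennreal (?n i) \<le> ?W \<omega>'"
      unfolding wait_time_def
    proof (rule INF_greatest)
      fix j
      show "ennreal (?n i) \<le> (if shift (enn2real B) \<omega>' (S k + ?n j) \<in> G k then ennreal (?n j) else top)"
      proof (cases "i \<le> j")
        case True then show ?thesis using nn(1)[of k] by (auto simp: strict_mono_less_eq intro!: ennreal_leI)
      next
        case False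
        have "shift b \<omega> (S k + ?n j) \<notin> G k"
        proof
          assume "shift b \<omega> (S k + ?n j) \<in> G k"
          then have "?W \<omega> \<le> ennreal (?n j)" unfolding wait_time_def using b by (intro INF_lower2[of j]) auto
          then have "?n i \<le> ?n j" using i n_nn by (simp add: ennreal_le_iff)
          then show False using False nn(1)[of k] by (simp add: strict_mono_less_eq)
        qed
        then show ?thesis using same[of j] False b by simp
      qed
    qed
  qed
  then show ?thesis using i by (simp add: block_end_def)
qed

text \<open>An impulse inside a block inherits the property from \<open>Vs k\<close> through
  \<open>inner_agree\<close>. That a block does not continue is known \<open>S k\<close> after its
  start, which is not later than the impulse opening the next block. The state is carried along
  because it decides which of the two cases applies.\<close>

lemma nonanticipating:
  assumes w: "w \<in> space control_space" "w' \<in> space control_space"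
    and "agree (Suc n) r w w'" "tau n w \<le> r"
  shows "st n w' = st n w \<and> tau n w' = tau n w \<and> xi n w' = xi n w"
  using assms(3,4)
proof (induction n arbitrary: r)
  case 0 then show ?case by simp
next
  case (Suc n)
  have ag: "agree (Suc n) r w w'" using Suc.prems(1) by (auto simp: agree_def)
  have "tau n w \<le> r" using tau_mono[OF w(1), of n] Suc.prems(2) by (rule order_trans)
  from Suc.IH[OF ag this] have st: "st n w' = st n w" by simp
  have "tau n w = tau n w" ..
  let ?k = "stk n w" and ?m = "stm n w" and ?B = "stB n w" and ?j = "pos n w"
  have eq: "stk n w' = ?k" "stm n w' = ?m" "stB n w' = ?B" "pos n w' = ?j"
    by (simp_all add: stk_def stm_def stB_def pos_def st)
  let ?v = "inner ?k ?m ?B w" and ?v' = "inner ?k ?m ?B w'"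
  have inn: "inn n w = ?v" "inn n w' = ?v'" by (simp_all add: inn_def eq)
  have v: "?v \<in> space control_space" "?v' \<in> space control_space" using w by (simp_all add: inner_space)
  show ?case
  proof (cases "stB n w = top")
    \<comment> \<open>A block that starts at infinity forces \<open>r = top\<close>, so that the
      coordinates agree entirely; both inner configurations are then built with the same value
      \<open>enn2real top = 0\<close>.\<close>
    case True
    have "going n w \<Longrightarrow> tau (Suc n) w = top" "\<not> going n w \<Longrightarrow> tau (Suc n) w = top"
      using True by (simp_all add: block_end_def)
    then have "r = top" using Suc.prems(2) by (cases "going n w") (simp_all add: top_unique del: tau.simps)
    then have all: "w i = w' i" if "i \<le> Suc n" for i
      using agree_top_eq[OF _ w, of "Suc (Suc n)" i] Suc.prems(1) that by simp
    have "?v i = ?v' i" if "i \<le> Suc ?j" for i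
      using that stm_bounds[of n w] by (cases i) (auto simp: inner_0 inner_Suc pos_def intro!: arg_cong[where f="\<lambda>x. paste _ _ (shift _ x)"] all)
    then have "fst (Vs ?k) (Suc ?j) ?v = fst (Vs ?k) (Suc ?j) ?v'" "snd (Vs ?k) (Suc ?j) ?v = snd (Vs ?k) (Suc ?j) ?v'"
      using v by (auto intro!: depends_uptoD[OF blk.\<tau>_depends] depends_uptoD[OF blk.\<xi>_depends])
    moreover from this have "going n w' = going n w" by (simp add: going_def in_block_def eq inn)
    moreover have "w' (Suc n) = w (Suc n)" using all[of "Suc n"] by simp
    ultimately show ?thesis using st by (simp add: eq inn prod_eq_iff stk_def[symmetric] stm_def[symmetric] stB_def[symmetric] st_Suc del: st.simps)
  next
    case False
    then obtain b where b: "?B = ennreal b" "0 \<le> b" by (cases ?B) auto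
    have Br: "?B \<le> r" using tau_ge_stB[OF w(1), of n] \<open>tau n w \<le> r\<close> by (rule order_trans)
    have mj: "?m + ?j \<le> Suc n" using stm_bounds[of n w] by (simp add: pos_def)
    note agi = inner_agree[OF Suc.prems(1) b Br mj]
    have k0: "ennreal (t ?k) \<le> fst (Vs ?k) (Suc ?j) ?v"
      using block_start_time(1)[OF v(1) inner_0] blk.\<tau>_incr[OF v(1), of 0 "Suc ?j" ?k] by simp
    show ?thesis
    proof (cases "going n w")
      case True
      have "fst (Vs ?k) (Suc ?j) ?v \<le> ennreal (t ?k) + (r - ?B)"
      proof -
        have "?B + (fst (Vs ?k) (Suc ?j) ?v - ennreal (t ?k)) \<le> r" using Suc.prems(2) True by (simp add: inn)
        then have "fst (Vs ?k) (Suc ?j) ?v - ennreal (t ?k) \<le> r - ?B"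
          by (simp add: ennreal_le_minus_iff add.commute)
        then have "ennreal (t ?k) + (fst (Vs ?k) (Suc ?j) ?v - ennreal (t ?k)) \<le> ennreal (t ?k) + (r - ?B)"
          by (rule add_left_mono)
        then show ?thesis using k0 by (simp add: add_diff_inverse_ennreal)
      qed
      from blk.\<tau>_nonanticipating[OF v agi this] blk.\<xi>_nonanticipating[OF v agi this]
      have same: "fst (Vs ?k) (Suc ?j) ?v' = fst (Vs ?k) (Suc ?j) ?v" "snd (Vs ?k) (Suc ?j) ?v' = snd (Vs ?k) (Suc ?j) ?v" .
      then have "going n w'" using True by (simp add: going_def in_block_def eq inn)
      then show ?thesis using True same st
        by (simp add: eq inn prod_eq_iff stk_def[symmetric] stm_def[symmetric] stB_def[symmetric] st_Suc del: st.simps)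
    next
      case g: False
      have be: "block_end ?k ?B (w (Suc n)) \<le> r" using Suc.prems(2) g by simp
      have Sr: "ennreal (t ?k + S ?k) \<le> ennreal (t ?k) + (r - ?B)"
      proof -
        have "?B + ennreal (S ?k) \<le> r" using be by (rule order_trans[rotated]) (simp add: block_end_def)
        then have "ennreal (S ?k) \<le> r - ?B"
          by (simp add: ennreal_le_minus_iff add.commute)
        then show ?thesis using t[of ?k] S[of ?k] by (simp add: add_left_mono)
      qed
      \<comment> \<open>A stopping time transfers only from a configuration in which it is at most
        the horizon, so the argument runs from \<open>w'\<close> back to \<open>w\<close>.\<close>
      have g': "\<not> going n w'"
      proof
        assume "going n w'"
        then have le: "fst (Vs ?k) (Suc ?j) ?v' \<le> ennreal (t ?k + S ?k)" by (simp add: going_def in_block_def eq inn)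
        have "agree (Suc (Suc ?j)) (ennreal (t ?k + S ?k)) ?v' ?v"
          using agi Sr by (auto simp: agree_def dest: order_trans)
        from blk.\<tau>_nonanticipating[OF v(2,1) this le] le have "going n w" by (simp add: going_def in_block_def inn)
        with g show False by simp
      qed
      have "block_end ?k ?B (w' (Suc n)) = block_end ?k ?B (w (Suc n))"
      proof (cases "block_end ?k ?B (w (Suc n)) = top")
        case True
        then have "r = top" using be by (simp add: top_unique)
        then have "w (Suc n) = w' (Suc n)"
          using agree_top_eq[OF _ w, of "Suc (Suc n)" "Suc n"] Suc.prems(1) by simp
        then show ?thesis by simp
      next
        case False
        show ?thesis
          by (rule block_end_agree[OF _ be False]) (use Suc.prems(1) in \<open>auto simp: agree_def\<close>)
      qed
      then show ?thesis using g g' st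
        by (simp add: eq prod_eq_iff stk_def[symmetric] stm_def[symmetric] stB_def[symmetric] st_Suc del: st.simps)
    qed
  qed
qed

lemma is_strategy_Vopt: "is_strategy U Vopt"
  unfolding Vopt_def
  by (rule is_strategyI) (simp_all add: measurable_tau measurable_xi xi_in_U tau_mono nonanticipating del: tau.simps xi.simps)

sublocale opt: strategy P U Vopt by unfold_locales (rule is_strategy_Vopt)

end

lemma suminf_ennreal_swap: "(\<Sum>i. \<Sum>j. f i j) = (\<Sum>j. \<Sum>i. f i j :: ennreal)"
  using nn_integral_suminf[of "\<lambda>i j. f i j" "count_space (UNIV :: nat set)"]
  by (simp add: nn_integral_count_space_nat)

text \<open>Rearrangement as for the Cauchy product; in \<open>ennreal\<close> no convergence has to
  be checked. It separates the opening impulse of a block from the position in the block.\<close>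

lemma suminf_ennreal_triangle:
  "(\<Sum>n. \<Sum>i\<le>n. f i (n - i)) = (\<Sum>i. \<Sum>j. f i j :: ennreal)"
proof -
  have "(\<Sum>i\<le>n. f i (n - i)) = (\<Sum>i. if i \<le> n then f i (n - i) else 0)" for n
    by (subst suminf_finite[of "{..n}"]) auto
  then have "(\<Sum>n. \<Sum>i\<le>n. f i (n - i)) = (\<Sum>i. \<Sum>n. if i \<le> n then f i (n - i) else 0)"
    by (simp only:) (rule suminf_ennreal_swap)
  moreover have "(\<Sum>n. if i \<le> n then f i (n - i) else 0) = (\<Sum>j. f i j)" for i
    using suminf_offset[OF summableI, of "\<lambda>n. if i \<le> n then f i (n - i) else 0" i] by simp
  ultimately show ?thesis by (simp only:)
qed

section \<open>Blocks seen inside the concatenated strategy\<close>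

context block_sequence
begin

abbreviation lawk :: "nat \<Rightarrow> (nat \<Rightarrow> real \<Rightarrow> 'a) measure" where
  "lawk k \<equiv> strategy.law P (Vs k) (return path_space (om k))"

abbreviation alive :: "nat \<Rightarrow> nat \<Rightarrow> (nat \<Rightarrow> real \<Rightarrow> 'a) \<Rightarrow> bool" where
  "alive k j v \<equiv> fst (Vs k) j v \<le> ennreal (t k + S k)"

lemma strategy_law_blk: "strategy_law P U (Vs k) (return path_space (om k))"
  by (rule blk.strategy_law_return[OF om])

lemma start_impulse: "stm n w = Suc n \<Longrightarrow> tau n w = stB n w \<and> xi n w = entry (stk n w)"
  using stm_bounds[of "n - 1" w] by (cases n) (auto simp: st_0 st_Suc split: if_splits)

lemma alive_mono:
  assumes "v \<in> space control_space" "alive k j v" "i \<le> j" shows "alive k i v"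
  using blk.\<tau>_incr[OF assms(1,3), of k] assms(2) by (rule order_trans)

lemma alive_0: "v \<in> space control_space \<Longrightarrow> v 0 = om k \<Longrightarrow> alive k 0 v"
  using t[of k] S[of k] by (auto simp: block_start_time intro!: ennreal_leI)

lemma inn_0: "inn n w 0 = om (stk n w)" by (simp add: inn_def inner_0)

text \<open>With its converse \<open>state_back\<close> this says that impulse \<open>n + j\<close>
  belongs to the block opened by impulse \<open>n\<close> exactly as long as position
  \<open>j\<close> is alive.\<close>

lemma state_alive:
  assumes w: "w \<in> space control_space" and m: "stm n w = Suc n" and "alive (stk n w) j (inn n w)"
  shows "st (n + j) w = st n w"
  using assms(3)
proof (induction j)
  case 0 show ?case by simp
next
  case (Suc j)
  have "st (n + j) w = st n w"
    using alive_mono[OF inn_space[OF w] Suc.prems, of j] by (intro Suc.IH) simp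
  then have eq: "stk (n + j) w = stk n w" "stm (n + j) w = Suc n" "stB (n + j) w = stB n w" "inn (n + j) w = inn n w"
    using m by (simp_all add: stk_def stm_def stB_def inn_def)
  have "going (n + j) w" using Suc.prems by (simp add: going_def in_block_def eq pos_def)
  then have "st (Suc (n + j)) w = st (n + j) w"
    by (simp add: prod_eq_iff stk_def[symmetric] stm_def[symmetric] stB_def[symmetric] st_Suc del: st.simps)
  then show ?case using \<open>st (n + j) w = st n w\<close> by simp
qed

lemma state_back:
  assumes w: "w \<in> space control_space"
  shows "stm n w = Suc i \<Longrightarrow> i \<le> n \<and> st i w = st n w \<and> alive (stk n w) (n - i) (inn n w)"
proof (induction n)
  case 0
  then show ?case using alive_0[OF inn_space[OF w, of 0] inn_0] by (simp add: st_0)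
next
  case (Suc n)
  show ?case
  proof (cases "going n w")
    case True
    then have st: "st (Suc n) w = st n w"
      by (simp add: prod_eq_iff stk_def[symmetric] stm_def[symmetric] stB_def[symmetric] st_Suc del: st.simps)
    then have eq: "stk (Suc n) w = stk n w" "stm (Suc n) w = stm n w" "stB (Suc n) w = stB n w" "inn (Suc n) w = inn n w"
      by (simp_all add: stk_def stm_def stB_def inn_def del: st.simps)
    have IH: "i \<le> n \<and> st i w = st n w \<and> alive (stk n w) (n - i) (inn n w)"
      using Suc.prems by (intro Suc.IH) (simp add: eq)
    have "pos n w = n - i" using Suc.prems by (simp add: pos_def eq)
    then have "alive (stk n w) (Suc n - i) (inn n w)"
      using True IH by (simp add: going_def in_block_def Suc_diff_le)
    then show ?thesis using IH st eq by (simp del: st.simps)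
  next
    case False
    then have "i = Suc n" using Suc.prems by (simp add: st_Suc)
    then show ?thesis using alive_0[OF inn_space[OF w] inn_0] by simp
  qed
qed

lemma st_depends:
  assumes "w \<in> space control_space" "w' \<in> space control_space" "\<And>i. i \<le> n \<Longrightarrow> w i = w' i"
  shows "st n w = st n w'"
proof -
  have "agree (Suc n) top w' w" using assms(3) by (simp add: agree_def)
  from nonanticipating[OF assms(2,1) this] show ?thesis by simp
qed

lemma inn_depends:
  assumes w: "w \<in> space control_space" "w' \<in> space control_space" and eq: "\<And>i. i \<le> n + j \<Longrightarrow> w i = w' i"
    and m: "stm n w = Suc n" and i: "i \<le> j"
  shows "inn n w i = inn n w' i"
proof -
  have st: "st n w = st n w'" using w eq by (intro st_depends) auto
  then have "stk n w' = stk n w" "stm n w' = stm n w" "stB n w' = stB n w" by (simp_all add: stk_def stm_def stB_def)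
  then show ?thesis using i eq by (cases i) (auto simp: inn_def inner_0 inner_Suc m)
qed

lemma inn_upd:
  assumes w: "w \<in> space control_space" and \<omega>: "\<omega> \<in> cadlag_paths" and m: "stm n w = Suc n"
  shows "inn n (w(Suc (n + j) := \<omega>)) =
    (inn n w)(Suc j := paste (t (stk n w)) (om (stk n w)) (shift (enn2real (stB n w)) \<omega>))"
proof
  fix i
  have "st n (w(Suc (n + j) := \<omega>)) = st n w"
    using w \<omega> by (intro st_depends control_space_upd) auto
  then have "stk n (w(Suc (n + j) := \<omega>)) = stk n w" "stm n (w(Suc (n + j) := \<omega>)) = stm n w" "stB n (w(Suc (n + j) := \<omega>)) = stB n w"
    by (simp_all add: stk_def stm_def stB_def)
  then show "inn n (w(Suc (n + j) := \<omega>)) i =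
    ((inn n w)(Suc j := paste (t (stk n w)) (om (stk n w)) (shift (enn2real (stB n w)) \<omega>))) i"
    by (cases i) (auto simp: inn_def inner_0 inner_Suc m)
qed

lemma measurable_inn: "inn n \<in> control_space \<rightarrow>\<^sub>M control_space"
  using measurable_state_compose[where f="\<lambda>k m w. inner k m (stB n w) w",
      OF measurable_stk[of n] measurable_stm[of n] measurable_inner[OF measurable_stB]]
  by (simp add: inn_def[abs_def])

text \<open>Where \<open>d\<close> vanishes the inner coordinates do not matter. Elsewhere the block
  is opened by impulse \<open>n\<close>, so that inner coordinate \<open>Suc i\<close> is made of
  outer coordinate \<open>Suc n + i\<close>.\<close>

lemma start_fun_depends:
  assumes d: "depends_upto n d" and dm: "\<And>w. w \<in> space control_space \<Longrightarrow> d w \<noteq> 0 \<Longrightarrow> stm n w = Suc n"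
    and X: "depends_upto j X"
  shows "depends_upto (n + j) (\<lambda>w. d w * X (inn n w) :: ennreal)"
  unfolding depends_upto_def
proof (intro ballI impI)
  fix w w' :: "nat \<Rightarrow> real \<Rightarrow> 'a"
  assume w: "w \<in> space control_space" "w' \<in> space control_space" and eq: "\<forall>i\<le>n + j. w i = w' i"
  have d_eq: "d w = d w'" using w eq by (intro depends_uptoD[OF d]) auto
  show "d w * X (inn n w) = d w' * X (inn n w')"
  proof (cases "d w = 0")
    case False
    have "X (inn n w) = X (inn n w')"
      using w eq dm[OF w(1) False] by (intro depends_uptoD[OF X] inn_space inn_depends[OF w, where j=j]) auto
    then show ?thesis using d_eq by simp
  qed (simp add: d_eq[symmetric])
qed

text \<open>A block that starts under the strategy \<^const>\<open>Vopt\<close> is distributed like the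
  corresponding strategy under the law conditioned on its first path.\<close>

lemma embedding:
  assumes \<nu>: "strategy_law P U Vopt \<nu>"
    and d[measurable]: "d \<in> borel_measurable control_space" "depends_upto n d"
    and dD: "\<And>w. w \<in> space control_space \<Longrightarrow> d w \<noteq> 0 \<Longrightarrow> stm n w = Suc n \<and> stk n w = k \<and> stB n w \<noteq> top"
    and H: "H \<in> borel_measurable control_space" "depends_upto (Suc j) H"
  shows "(\<integral>\<^sup>+w. d w * (if alive k j (inn n w) then H (inn n w) else 0) \<partial>strategy.law P Vopt \<nu>)
     = (\<integral>\<^sup>+w. d w \<partial>strategy.law P Vopt \<nu>) * (\<integral>\<^sup>+v. (if alive k j v then H v else 0) \<partial>lawk k)"
  using H
proof (induction j arbitrary: H)
  interpret O: strategy_law P U Vopt \<nu> by (rule \<nu>)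
  interpret D: strategy_law P U "Vs k" "return path_space (om k)" by (rule strategy_law_blk)
  let ?L = "opt.law \<nu>"
  have dm: "d \<in> borel_measurable ?L" by (rule O.measurable_from_law) (rule d)
  have d_upd: "d (w(Suc i := \<omega>')) = d w" if "w \<in> space control_space" "\<omega>' \<in> cadlag_paths" "n \<le> i" for w \<omega>' i
    using that by (intro depends_uptoD[OF d(2)] control_space_upd) auto
  have space_kern: "space (opt.kern i w) = cadlag_paths" if "w \<in> space control_space" for i w
    using sets_eq_imp_space_eq[OF O.sets_kern[OF that]] by (simp add: space_path_space)
  have Xm: "(\<lambda>w. X (inn n w)) \<in> borel_measurable control_space" if "X \<in> borel_measurable control_space" for X :: "_ \<Rightarrow> ennreal"
    by (rule measurable_compose[OF measurable_inn that])
  have al_m: "(\<lambda>v. if alive k i v then X v else 0) \<in> borel_measurable control_space"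
    if [measurable]: "X \<in> borel_measurable control_space" for X :: "_ \<Rightarrow> ennreal" and i
  proof -
    note [measurable] = blk.measurable_\<tau>[of k i]
    show ?thesis by measurable
  qed
  have al_dep: "depends_upto (max i i') (\<lambda>v. if alive k i v then X v else (0 :: ennreal))"
    if "depends_upto i' X" for X i i'
    unfolding depends_upto_def
  proof (intro ballI impI)
    fix w w' :: "nat \<Rightarrow> real \<Rightarrow> 'a"
    assume *: "w \<in> space control_space" "w' \<in> space control_space" "\<forall>l\<le>max i i'. w l = w' l"
    then have "fst (Vs k) i w = fst (Vs k) i w'" "X w = X w'"
      by (auto intro!: depends_uptoD[OF blk.\<tau>_depends] depends_uptoD[OF that])
    then show "(if alive k i w then X w else 0) = (if alive k i w' then X w' else 0)" by simp
  qed
  {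
    case 0
    have om_sp: "(\<lambda>_. om k) \<in> space control_space" using om by (simp add: space_control_space)
    define R where "R = (\<integral>\<^sup>+y. H ((\<lambda>_. om k)(Suc 0 := paste (t k) (om k) y)) \<partial>P (entry k))"
    have st0: "fst (Vs k) 0 (\<lambda>_. om k) = ennreal (t k)" "snd (Vs k) 0 (\<lambda>_. om k) = entry k"
      using block_start_time[OF om_sp] by simp_all
    have H1m: "(\<lambda>\<omega>'. H ((\<lambda>_. om k)(Suc 0 := \<omega>'))) \<in> borel_measurable path_space"
      by (rule measurable_compose[OF measurable_control_upd 0(1)]) (use om_sp in simp_all)
    have "(\<integral>\<^sup>+v. (if alive k 0 v then H v else 0) \<partial>lawk k) = (\<integral>\<^sup>+v. H v \<partial>lawk k)"
    proof (rule nn_integral_cong_AE)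
      show "AE v in lawk k. (if alive k 0 v then H v else 0) = H v"
        using blk.law_return_start[OF om, of k k]
      proof eventually_elim
        case (elim v)
        then have "alive k 0 v" using st0 t[of k] S[of k] by (auto intro!: ennreal_leI)
        then show ?case by simp
      qed
    qed
    also have "\<dots> = (\<integral>\<^sup>+v. (\<integral>\<^sup>+\<omega>'. H (v(Suc 0 := \<omega>')) \<partial>blk.kern k 0 v) \<partial>lawk k)"
      by (rule D.law_step[OF 0(1) 0(2)])
    also have "\<dots> = (\<integral>\<^sup>+\<omega>. (\<integral>\<^sup>+\<omega>'. H ((\<lambda>_. \<omega>)(Suc 0 := \<omega>')) \<partial>blk.kern k 0 (\<lambda>_. \<omega>)) \<partial>return path_space (om k))"
      by (rule D.law_start[OF D.measurable_step[OF 0(1)] D.step_depends[OF 0(2)]])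
    also have "\<dots> = (\<integral>\<^sup>+\<omega>'. H ((\<lambda>_. om k)(Suc 0 := \<omega>')) \<partial>blk.kern k 0 (\<lambda>_. om k))"
    proof (rule nn_integral_return)
      show "om k \<in> space path_space" using om by (simp add: space_path_space)
      show "(\<lambda>\<omega>. \<integral>\<^sup>+\<omega>'. H ((\<lambda>_. \<omega>)(Suc 0 := \<omega>')) \<partial>blk.kern k 0 (\<lambda>_. \<omega>)) \<in> borel_measurable path_space"
        by (rule measurable_compose[OF measurable_control_spaceI D.measurable_step[OF 0(1)]]) simp
    qed
    also have "\<dots> = R"
      unfolding R_def using blk.nn_integral_kern[OF om_sp H1m, of k 0] st0 t[of k] by simp
    finally have rhs: "(\<integral>\<^sup>+v. (if alive k 0 v then H v else 0) \<partial>lawk k) = R" .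
    have "(\<integral>\<^sup>+w. d w * (if alive k 0 (inn n w) then H (inn n w) else 0) \<partial>?L) = (\<integral>\<^sup>+w. d w * H (inn n w) \<partial>?L)"
    proof (rule nn_integral_cong)
      fix w assume "w \<in> space ?L"
      then have w: "w \<in> space control_space" by (simp add: O.space_law)
      show "d w * (if alive k 0 (inn n w) then H (inn n w) else 0) = d w * H (inn n w)"
      proof (cases "d w = 0")
        case False
        then have "alive k 0 (inn n w)" using dD[OF w] alive_0[OF inn_space[OF w], of n k] inn_0[of n w] by simp
        then show ?thesis by simp
      qed simp
    qed
    also have "\<dots> = (\<integral>\<^sup>+w. (\<integral>\<^sup>+\<omega>'. d (w(Suc n := \<omega>')) * H (inn n (w(Suc n := \<omega>'))) \<partial>opt.kern n w) \<partial>?L)"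
    proof (rule O.law_step)
      show "(\<lambda>w. d w * H (inn n w)) \<in> borel_measurable control_space"
        by (intro borel_measurable_times_ennreal d Xm 0)
      show "depends_upto (Suc n) (\<lambda>w. d w * H (inn n w))"
        using start_fun_depends[OF d(2) _ 0(2)] dD by simp
    qed
    also have "\<dots> = (\<integral>\<^sup>+w. d w * R \<partial>?L)"
    proof (rule nn_integral_cong)
      fix w assume "w \<in> space ?L"
      then have w: "w \<in> space control_space" by (simp add: O.space_law)
      have "(\<integral>\<^sup>+\<omega>'. d (w(Suc n := \<omega>')) * H (inn n (w(Suc n := \<omega>'))) \<partial>opt.kern n w)
         = (\<integral>\<^sup>+\<omega>'. d w * H (inn n (w(Suc n := \<omega>'))) \<partial>opt.kern n w)"
        using d_upd[OF w] by (intro nn_integral_cong) (simp add: space_kern[OF w])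
      also have "\<dots> = d w * R"
      proof (cases "d w = 0")
        case False
        from dD[OF w this] have m: "stm n w = Suc n" and k: "stk n w = k" and Bf: "stB n w \<noteq> top" by auto
        then obtain b where b: "stB n w = ennreal b" "0 \<le> b" by (cases "stB n w") auto
        have imp: "tau n w = ennreal b" "xi n w = entry k" using start_impulse[OF m] b k by simp_all
        have Hm: "(\<lambda>\<omega>'. d w * H (inn n (w(Suc n := \<omega>')))) \<in> borel_measurable path_space"
          by (intro borel_measurable_times_ennreal measurable_compose[OF measurable_control_upd Xm[OF 0(1)]]) (use w in simp_all)
        have "(\<integral>\<^sup>+\<omega>'. d w * H (inn n (w(Suc n := \<omega>'))) \<partial>opt.kern n w)
          = (\<integral>\<^sup>+y. d w * H (inn n (w(Suc n := paste b (w n) y))) \<partial>P (entry k))"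
          using opt.nn_integral_kern[OF w Hm, of n] imp b by (simp add: Vopt_def)
        also have "\<dots> = (\<integral>\<^sup>+y. d w * H ((\<lambda>_. om k)(Suc 0 := paste (t k) (om k) y)) \<partial>P (entry k))"
        proof (rule nn_integral_cong)
          fix y assume "y \<in> space (P (entry k))"
          then have y: "y \<in> cadlag_paths" by (simp add: space_P)
          have p: "paste b (w n) y \<in> cadlag_paths" using b w y by (intro paste_cadlag) (auto simp: space_control_space)
          \<comment> \<open>Shifting by the start \<open>b\<close> of the block removes everything
            before the opening impulse, so the block sees only the fresh path
            \<open>y\<close>.\<close>
          have "inn n (w(Suc n := paste b (w n) y)) = (inn n w)(Suc 0 := paste (t k) (om k) y)"
            using inn_upd[OF w p m, of 0] b k y by (simp add: shift_paste_same)
          moreover have "H ((inn n w)(Suc 0 := paste (t k) (om k) y)) = H ((\<lambda>_. om k)(Suc 0 := paste (t k) (om k) y))"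
            using inn_space[OF w] om_sp y t[of k] om[of k] inn_0[of n w] k
            by (intro depends_uptoD[OF 0(2)] control_space_upd paste_cadlag) (auto simp: le_Suc_eq)
          ultimately show "d w * H (inn n (w(Suc n := paste b (w n) y))) = d w * H ((\<lambda>_. om k)(Suc 0 := paste (t k) (om k) y))"
            by simp
        qed
        also have "\<dots> = d w * R"
          unfolding R_def
          by (intro nn_integral_cmult measurable_from_P measurable_compose[OF measurable_paste H1m])
             (use om t in \<open>simp_all add: space_path_space\<close>)
        finally show ?thesis .
      qed simp
      finally show "(\<integral>\<^sup>+\<omega>'. d (w(Suc n := \<omega>')) * H (inn n (w(Suc n := \<omega>'))) \<partial>opt.kern n w) = d w * R" .
    qed
    also have "\<dots> = (\<integral>\<^sup>+w. d w \<partial>?L) * R" by (rule nn_integral_multc[OF dm])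
    finally show ?case unfolding rhs .
  next
    case (Suc j)
    let ?N = "Suc (n + j)"
    define H' where "H' v = (\<integral>\<^sup>+\<omega>'. H (v(Suc (Suc j) := \<omega>')) \<partial>blk.kern k (Suc j) v)" for v
    have H'm: "H' \<in> borel_measurable control_space" unfolding H'_def by (rule D.measurable_step[OF Suc.prems(1)])
    have H'd: "depends_upto (Suc j) H'" unfolding H'_def by (rule D.step_depends[OF Suc.prems(2)])
    \<comment> \<open>\<open>H'\<close> integrates out the last coordinate. The condition
      \<open>alive k (Suc j)\<close> is absorbed into \<open>H''\<close>; the weaker
      \<open>alive k j\<close> can then be restored outside, which is the form required by the
      induction hypothesis.\<close>
    define H'' where "H'' v = (if alive k (Suc j) v then H' v else 0)" for v
    have H''m: "H'' \<in> borel_measurable control_space" unfolding H''_def by (rule al_m[OF H'm])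
    have H''d: "depends_upto (Suc j) H''" unfolding H''_def using al_dep[OF H'd, of "Suc j"] by simp
    have al_upd: "alive k (Suc j) (v(Suc (Suc j) := \<omega>')) \<longleftrightarrow> alive k (Suc j) v"
      if "v \<in> space control_space" "\<omega>' \<in> cadlag_paths" for v \<omega>'
    proof -
      have "fst (Vs k) (Suc j) (v(Suc (Suc j) := \<omega>')) = fst (Vs k) (Suc j) v"
        using that by (intro depends_uptoD[OF blk.\<tau>_depends] control_space_upd) auto
      then show ?thesis by simp
    qed
    have collapse: "(if alive k j v then H'' v else 0) = (if alive k (Suc j) v then H' v else 0)"
      if "v \<in> space control_space" for v
      using alive_mono[OF that, of k "Suc j" j] by (auto simp: H''_def)
    have "(\<integral>\<^sup>+v. (if alive k (Suc j) v then H v else 0) \<partial>lawk k)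
      = (\<integral>\<^sup>+v. (\<integral>\<^sup>+\<omega>'. (if alive k (Suc j) (v(Suc (Suc j) := \<omega>')) then H (v(Suc (Suc j) := \<omega>')) else 0) \<partial>blk.kern k (Suc j) v) \<partial>lawk k)"
      using al_dep[OF Suc.prems(2), of "Suc j"] by (intro D.law_step al_m Suc.prems) simp
    also have "\<dots> = (\<integral>\<^sup>+v. (if alive k j v then H'' v else 0) \<partial>lawk k)"
    proof (rule nn_integral_cong)
      fix v assume "v \<in> space (lawk k)"
      then have v: "v \<in> space control_space" by (simp add: D.space_law)
      have sk: "space (blk.kern k (Suc j) v) = cadlag_paths"
        using sets_eq_imp_space_eq[OF D.sets_kern[OF v]] by (simp add: space_path_space)
      have "(\<integral>\<^sup>+\<omega>'. (if alive k (Suc j) (v(Suc (Suc j) := \<omega>')) then H (v(Suc (Suc j) := \<omega>')) else 0) \<partial>blk.kern k (Suc j) v)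
        = (\<integral>\<^sup>+\<omega>'. (if alive k (Suc j) v then H (v(Suc (Suc j) := \<omega>')) else 0) \<partial>blk.kern k (Suc j) v)"
        by (intro nn_integral_cong) (simp add: sk al_upd[OF v])
      also have "\<dots> = (if alive k j v then H'' v else 0)"
        unfolding collapse[OF v] H'_def by simp
      finally show "(\<integral>\<^sup>+\<omega>'. (if alive k (Suc j) (v(Suc (Suc j) := \<omega>')) then H (v(Suc (Suc j) := \<omega>')) else 0) \<partial>blk.kern k (Suc j) v)
         = (if alive k j v then H'' v else 0)" .
    qed
    finally have rhs: "(\<integral>\<^sup>+v. (if alive k (Suc j) v then H v else 0) \<partial>lawk k) = (\<integral>\<^sup>+v. (if alive k j v then H'' v else 0) \<partial>lawk k)" .
    let ?\<Phi> = "\<lambda>w. d w * (if alive k (Suc j) (inn n w) then H (inn n w) else 0)"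
    have "(\<integral>\<^sup>+w. ?\<Phi> w \<partial>?L) = (\<integral>\<^sup>+w. (\<integral>\<^sup>+\<omega>'. ?\<Phi> (w(Suc ?N := \<omega>')) \<partial>opt.kern ?N w) \<partial>?L)"
    proof (rule O.law_step)
      show "?\<Phi> \<in> borel_measurable control_space"
        by (intro borel_measurable_times_ennreal d Xm[OF al_m[OF Suc.prems(1)]])
      show "depends_upto (Suc ?N) ?\<Phi>"
        using start_fun_depends[OF d(2) _ al_dep[OF Suc.prems(2), of "Suc j"]] dD by simp
    qed
    also have "\<dots> = (\<integral>\<^sup>+w. d w * (if alive k j (inn n w) then H'' (inn n w) else 0) \<partial>?L)"
    proof (rule nn_integral_cong)
      fix w assume "w \<in> space ?L"
      then have w: "w \<in> space control_space" by (simp add: O.space_law)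
      let ?v = "inn n w"
      have v: "?v \<in> space control_space" by (rule inn_space[OF w])
      show "(\<integral>\<^sup>+\<omega>'. ?\<Phi> (w(Suc ?N := \<omega>')) \<partial>opt.kern ?N w) = d w * (if alive k j ?v then H'' ?v else 0)"
      proof (cases "d w = 0")
        case True
        have "(\<integral>\<^sup>+\<omega>'. ?\<Phi> (w(Suc ?N := \<omega>')) \<partial>opt.kern ?N w) = (\<integral>\<^sup>+\<omega>'. 0 \<partial>opt.kern ?N w)"
          using d_upd[OF w, of _ ?N] True by (intro nn_integral_cong) (simp add: space_kern[OF w])
        then show ?thesis using True by simp
      next
        case False
        from dD[OF w this] have m: "stm n w = Suc n" and k: "stk n w = k" and Bf: "stB n w \<noteq> top" by auto
        then obtain b where b: "stB n w = ennreal b" "0 \<le> b" by (cases "stB n w") auto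
        have upd: "inn n (w(Suc ?N := \<omega>')) = ?v(Suc (Suc j) := paste (t k) (om k) (shift b \<omega>'))"
          if "\<omega>' \<in> cadlag_paths" for \<omega>'
          using inn_upd[OF w that m, of "Suc j"] b k by simp
        have pc: "paste (t k) (om k) (shift b \<omega>') \<in> cadlag_paths" if "\<omega>' \<in> cadlag_paths" for \<omega>'
          using that b t om by (intro paste_cadlag shift_cadlag)
        have "(\<integral>\<^sup>+\<omega>'. ?\<Phi> (w(Suc ?N := \<omega>')) \<partial>opt.kern ?N w)
          = (\<integral>\<^sup>+\<omega>'. d w * (if alive k (Suc j) ?v then H (inn n (w(Suc ?N := \<omega>'))) else 0) \<partial>opt.kern ?N w)"
          using d_upd[OF w, of _ ?N] al_upd[OF v pc] by (intro nn_integral_cong) (simp add: space_kern[OF w] upd)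
        also have "\<dots> = d w * (if alive k (Suc j) ?v then H' ?v else 0)"
        proof (cases "alive k (Suc j) ?v")
          case True
          have ge: "ennreal (t k) \<le> fst (Vs k) (Suc j) ?v"
            using blk.\<tau>_incr[OF v, of 0 "Suc j" k] block_start_time(1)[OF v, of k] inn_0[of n w] k by simp
          obtain q where q: "fst (Vs k) (Suc j) ?v = ennreal q" "0 \<le> q"
            using True by (cases "fst (Vs k) (Suc j) ?v") (auto simp: top_unique)
          have qt: "t k \<le> q" using ge q t[of k] by simp
          have "st (n + j) w = st n w"
            using state_alive[OF w m, of j] alive_mono[OF v True, of j] k by simp
          then have eq: "stk (n + j) w = k" "stm (n + j) w = Suc n" "stB (n + j) w = ennreal b" "inn (n + j) w = ?v"
            using m k b by (simp_all add: stk_def stm_def stB_def inn_def)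
          then have ps: "pos (n + j) w = j" by (simp add: pos_def)
          have "going (n + j) w" using True by (simp add: going_def in_block_def eq ps)
          then have imp: "tau ?N w = ennreal (b + (q - t k))" "xi ?N w = snd (Vs k) (Suc j) ?v"
            using b q qt t[of k] by (simp_all add: eq ps ennreal_minus ennreal_plus[symmetric] del: ennreal_plus)
          have Hm: "(\<lambda>\<omega>'. H (inn n (w(Suc ?N := \<omega>')))) \<in> borel_measurable path_space"
            by (intro measurable_compose[OF measurable_control_upd Xm[OF Suc.prems(1)]]) (use w in simp_all)
          have Hm2: "(\<lambda>\<omega>'. H (?v(Suc (Suc j) := \<omega>'))) \<in> borel_measurable path_space"
            by (intro measurable_compose[OF measurable_control_upd Suc.prems(1)]) (use v in simp_all)
          have "(\<integral>\<^sup>+\<omega>'. d w * H (inn n (w(Suc ?N := \<omega>'))) \<partial>opt.kern ?N w)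
            = d w * (\<integral>\<^sup>+\<omega>'. H (inn n (w(Suc ?N := \<omega>'))) \<partial>opt.kern ?N w)"
            using Hm by (intro nn_integral_cmult) (simp add: measurable_cong_sets[OF O.sets_kern[OF w] refl])
          also have "(\<integral>\<^sup>+\<omega>'. H (inn n (w(Suc ?N := \<omega>'))) \<partial>opt.kern ?N w)
            = (\<integral>\<^sup>+y. H (inn n (w(Suc ?N := paste (b + (q - t k)) (w ?N) y))) \<partial>P (snd (Vs k) (Suc j) ?v))"
          proof -
            have "tau ?N w \<noteq> top" "enn2real (tau ?N w) = b + (q - t k)" unfolding imp(1) using b qt by (simp_all del: ennreal_plus)
            then show ?thesis
              using opt.nn_integral_kern[OF w Hm, of ?N] imp(2) by (simp add: Vopt_def del: tau.simps xi.simps)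
          qed
          also have "\<dots> = (\<integral>\<^sup>+y. H (?v(Suc (Suc j) := paste q (?v (Suc j)) y)) \<partial>P (snd (Vs k) (Suc j) ?v))"
          proof (rule nn_integral_cong)
            fix y assume "y \<in> space (P (snd (Vs k) (Suc j) ?v))"
            then have y: "y \<in> cadlag_paths" by (simp add: space_P)
            have p: "paste (b + (q - t k)) (w ?N) y \<in> cadlag_paths"
              using b w y qt by (intro paste_cadlag) (auto simp: space_control_space)
            have "?v (Suc j) = paste (t k) (om k) (shift b (w ?N))"
              by (simp add: inn_def inner_Suc m k b)
            \<comment> \<open>A restart of the outer coordinate at time \<open>b + (q - t k)\<close>
              is a restart of the inner coordinate at time \<open>q\<close>.\<close>
            then have "paste (t k) (om k) (shift b (paste (b + (q - t k)) (w ?N) y)) = paste q (?v (Suc j)) y"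
              using shift_paste[of b "q - t k" "w ?N" y] paste_paste[of "t k" "q - t k" "om k" "shift b (w ?N)" y] b qt t[of k] by simp
            then show "H (inn n (w(Suc ?N := paste (b + (q - t k)) (w ?N) y))) = H (?v(Suc (Suc j) := paste q (?v (Suc j)) y))"
              by (simp add: upd[OF p])
          qed
          also have "\<dots> = H' ?v"
            unfolding H'_def using blk.nn_integral_kern[OF v Hm2, of k "Suc j"] q by simp
          finally show ?thesis using True by (simp only: if_True)
        qed simp
        also have "\<dots> = d w * (if alive k j ?v then H'' ?v else 0)" by (simp only: collapse[OF v])
        finally show ?thesis .
      qed
    qed
    also have "\<dots> = (\<integral>\<^sup>+w. d w \<partial>?L) * (\<integral>\<^sup>+v. (if alive k j v then H'' v else 0) \<partial>lawk k)"
      by (rule Suc.IH[OF H''m H''d])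
    finally show ?case unfolding rhs .
  }
qed

end

section \<open>Accounting for the concatenated strategy\<close>

context block_sequence
begin

text \<open>The sum of \<open>\<phi>\<close> over the impulses \<open>1, 2, \<dots>\<close> whose block starts by time \<open>T\<close>; the arguments of \<open>\<phi>\<close> are
  the number of the block, the position in it, and the coordinates seen by its strategy.\<close>

definition Bsum :: "real \<Rightarrow> (nat \<Rightarrow> nat \<Rightarrow> (nat \<Rightarrow> real \<Rightarrow> 'a) \<Rightarrow> ennreal) \<Rightarrow> (nat \<Rightarrow> real \<Rightarrow> 'a) \<Rightarrow> ennreal" where
  "Bsum T \<phi> w = (\<Sum>n. if stB n w \<le> ennreal T then \<phi> (stk n w) (pos n w) (inn n w) else 0)"

definition starts :: "real \<Rightarrow> nat \<Rightarrow> nat \<Rightarrow> (nat \<Rightarrow> real \<Rightarrow> 'a) \<Rightarrow> ennreal" where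
  "starts T i k w = (if stm i w = Suc i \<and> stk i w = k \<and> stB i w \<le> ennreal T then 1 else 0)"

text \<open>\<^term>\<open>\<Sum>i. starts T i k w\<close> is 0 or 1, so this is the probability that block \<open>k\<close> starts by time \<open>T\<close>.\<close>

definition visits :: "(real \<Rightarrow> 'a) measure \<Rightarrow> real \<Rightarrow> nat \<Rightarrow> ennreal" where
  "visits \<nu> T k = (\<Sum>i. \<integral>\<^sup>+w. starts T i k w \<partial>strategy.law P Vopt \<nu>)"

definition block_mean :: "(nat \<Rightarrow> nat \<Rightarrow> (nat \<Rightarrow> real \<Rightarrow> 'a) \<Rightarrow> ennreal) \<Rightarrow> nat \<Rightarrow> ennreal" where
  "block_mean \<phi> k = (\<Sum>j. \<integral>\<^sup>+v. (if alive k j v then \<phi> k j v else 0) \<partial>lawk k)"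

lemma measurable_starts: "starts T i k \<in> borel_measurable control_space"
proof -
  note [measurable] = measurable_stm[of i] measurable_stk[of i] measurable_stB[of i]
  show ?thesis unfolding starts_def[abs_def] by measurable
qed

lemma starts_depends: "depends_upto i (starts T i k)"
  unfolding depends_upto_def
proof (intro ballI impI)
  fix w w' :: "nat \<Rightarrow> real \<Rightarrow> 'a"
  assume "w \<in> space control_space" "w' \<in> space control_space" "\<forall>l\<le>i. w l = w' l"
  then have "st i w = st i w'" by (intro st_depends) auto
  then show "starts T i k w = starts T i k w'" by (simp add: starts_def stm_def stk_def stB_def)
qed

text \<open>For each \<open>n\<close> only the impulse \<open>i\<close> that opened the current
  block contributes: by \<open>state_alive\<close>, any other opening impulse whose block were alive
  at position \<open>n - i\<close> would have opened the current block too.\<close>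

lemma Bsum_decompose:
  assumes w: "w \<in> space control_space"
  shows "Bsum T \<phi> w = (\<Sum>n. \<Sum>i\<le>n. \<Sum>k. starts T i k w *
    (if alive k (n - i) (inn i w) then \<phi> k (n - i) (inn i w) else 0))"
  unfolding Bsum_def
proof (intro suminf_cong)
  fix n
  define a where "a i = (if stm i w = Suc i \<and> stB i w \<le> ennreal T \<and> alive (stk i w) (n - i) (inn i w)
    then \<phi> (stk i w) (n - i) (inn i w) else 0)" for i
  have a: "(\<Sum>k. starts T i k w * (if alive k (n - i) (inn i w) then \<phi> k (n - i) (inn i w) else 0)) = a i" for i
    by (subst suminf_finite[of "{stk i w}"]) (auto simp: starts_def a_def)
  obtain i0 where i0: "stm n w = Suc i0" using stm_bounds[of n w] by (cases "stm n w") auto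
  from state_back[OF w this] have le: "i0 \<le> n" and st: "st i0 w = st n w" and al: "alive (stk n w) (n - i0) (inn n w)" by auto
  have eq: "stk i0 w = stk n w" "stm i0 w = Suc i0" "stB i0 w = stB n w" "inn i0 w = inn n w"
    using st i0 by (simp_all add: stk_def stm_def stB_def inn_def)
  have zero: "a i = 0" if "i \<le> n" "i \<noteq> i0" for i
  proof (rule ccontr)
    assume "a i \<noteq> 0"
    then have "stm i w = Suc i" "alive (stk i w) (n - i) (inn i w)" by (auto simp: a_def split: if_splits)
    from state_alive[OF w this] that have "st n w = st i w" by simp
    then have "stm n w = Suc i" using \<open>stm i w = Suc i\<close> by (simp add: stm_def)
    then show False using i0 that by simp
  qed
  have "(\<Sum>i\<le>n. a i) = a i0"
    using le zero by (subst sum.remove[of _ i0]) auto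
  also have "\<dots> = (if stB n w \<le> ennreal T then \<phi> (stk n w) (pos n w) (inn n w) else 0)"
    using al i0 le by (simp add: a_def eq pos_def)
  finally show "(if stB n w \<le> ennreal T then \<phi> (stk n w) (pos n w) (inn n w) else 0)
     = (\<Sum>i\<le>n. \<Sum>k. starts T i k w * (if alive k (n - i) (inn i w) then \<phi> k (n - i) (inn i w) else 0))"
    by (simp add: a)
qed

text \<open>By \<open>embedding\<close> every summand factors into the probability of a start and a
  mean under the law of the block alone; the sums over opening impulses and positions then
  separate.\<close>

lemma Bsum_integral:
  assumes \<nu>: "strategy_law P U Vopt \<nu>"
    and \<phi>: "\<And>k j. \<phi> k j \<in> borel_measurable control_space" "\<And>k j. depends_upto (Suc j) (\<phi> k j)"
  shows "(\<integral>\<^sup>+w. Bsum T \<phi> w \<partial>strategy.law P Vopt \<nu>) = (\<Sum>k. visits \<nu> T k * block_mean \<phi> k)"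
proof -
  interpret O: strategy_law P U Vopt \<nu> by (rule \<nu>)
  let ?L = "opt.law \<nu>"
  let ?f = "\<lambda>i j k w. starts T i k w * (if alive k j (inn i w) then \<phi> k j (inn i w) else 0)"
  have fm: "?f i j k \<in> borel_measurable ?L" for i j k
  proof (rule O.measurable_from_law)
    have [measurable]: "(\<lambda>w. fst (Vs k) j (inn i w)) \<in> borel_measurable control_space"
      "(\<lambda>w. \<phi> k j (inn i w)) \<in> borel_measurable control_space"
      by (rule measurable_compose[OF measurable_inn] blk.measurable_\<tau> \<phi>)+
    note [measurable] = measurable_starts[of T i k]
    show "?f i j k \<in> borel_measurable control_space" by measurable
  qed
  define p where "p i k = (\<integral>\<^sup>+w. starts T i k w \<partial>?L)" for i k
  define a where "a k j = (\<integral>\<^sup>+v. (if alive k j v then \<phi> k j v else 0) \<partial>lawk k)" for k j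
  have f_int: "(\<integral>\<^sup>+w. ?f i j k w \<partial>?L) = p i k * a k j" for i j k
    unfolding p_def a_def
    by (rule embedding[OF \<nu> measurable_starts starts_depends _ \<phi>]) (auto simp: starts_def top_unique split: if_splits)
  have "(\<integral>\<^sup>+w. Bsum T \<phi> w \<partial>?L) = (\<integral>\<^sup>+w. (\<Sum>n. \<Sum>i\<le>n. \<Sum>k. ?f i (n - i) k w) \<partial>?L)"
    by (intro nn_integral_cong Bsum_decompose) (simp add: O.space_law)
  also have "\<dots> = (\<Sum>n. \<integral>\<^sup>+w. (\<Sum>i\<le>n. \<Sum>k. ?f i (n - i) k w) \<partial>?L)"
    by (intro nn_integral_suminf borel_measurable_sum borel_measurable_suminf_order fm)
  also have "\<dots> = (\<Sum>n. \<Sum>i\<le>n. \<Sum>k. p i k * a k (n - i))"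
  proof (intro suminf_cong)
    fix n
    have "(\<integral>\<^sup>+w. (\<Sum>i\<le>n. \<Sum>k. ?f i (n - i) k w) \<partial>?L) = (\<Sum>i\<le>n. \<integral>\<^sup>+w. (\<Sum>k. ?f i (n - i) k w) \<partial>?L)"
      by (intro nn_integral_sum borel_measurable_suminf_order fm)
    also have "\<dots> = (\<Sum>i\<le>n. \<Sum>k. p i k * a k (n - i))"
      by (intro sum.cong refl) (simp only: nn_integral_suminf[OF fm] f_int)
    finally show "(\<integral>\<^sup>+w. (\<Sum>i\<le>n. \<Sum>k. ?f i (n - i) k w) \<partial>?L) = (\<Sum>i\<le>n. \<Sum>k. p i k * a k (n - i))" .
  qed
  also have "\<dots> = (\<Sum>i. \<Sum>j. \<Sum>k. p i k * a k j)"
    by (rule suminf_ennreal_triangle[of "\<lambda>i j. \<Sum>k. p i k * a k j"])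
  also have "\<dots> = (\<Sum>i. \<Sum>k. \<Sum>j. p i k * a k j)"
    by (intro suminf_cong suminf_ennreal_swap)
  also have "\<dots> = (\<Sum>k. \<Sum>i. \<Sum>j. p i k * a k j)" by (rule suminf_ennreal_swap)
  also have "\<dots> = (\<Sum>k. visits \<nu> T k * block_mean \<phi> k)"
    by (simp add: visits_def block_mean_def p_def a_def)
  finally show ?thesis .
qed

lemma stk_mono: "i \<le> n \<Longrightarrow> stk i w \<le> stk n w"
  by (rule lift_Suc_mono_le[of "\<lambda>n. stk n w"]) (auto simp: st_Suc)

lemma stk_start: "stm (Suc n) w = Suc (Suc n) \<Longrightarrow> stk (Suc n) w = Suc (stk n w)"
  using stm_bounds[of n w] by (auto simp: st_Suc split: if_splits)

text \<open>The block number increases at every start, so no block starts twice.\<close>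

lemma visits_le_1:
  assumes \<nu>: "strategy_law P U Vopt \<nu>"
  shows "visits \<nu> T k \<le> 1"
proof -
  interpret O: strategy_law P U Vopt \<nu> by (rule \<nu>)
  have "visits \<nu> T k = (\<integral>\<^sup>+w. (\<Sum>i. starts T i k w) \<partial>opt.law \<nu>)"
    unfolding visits_def by (intro nn_integral_suminf[symmetric] O.measurable_from_law measurable_starts)
  also have "\<dots> \<le> (\<integral>\<^sup>+w. 1 \<partial>opt.law \<nu>)"
  proof (intro nn_integral_mono)
    fix w
    have uniq: "\<not> i < n" if "starts T i k w \<noteq> 0" "starts T n k w \<noteq> 0" for i n
    proof
      assume "i < n"
      then obtain n' where n': "n = Suc n'" "i \<le> n'" by (cases n) auto
      have "stk n w = Suc (stk n' w)" "stk i w = k" "stk n w = k"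
        using that stk_start[of n' w] n' by (auto simp: starts_def split: if_splits)
      with stk_mono[OF n'(2), of w] show False by simp
    qed
    show "(\<Sum>i. starts T i k w) \<le> 1"
    proof (cases "\<exists>i. starts T i k w \<noteq> 0")
      case True
      then obtain i where i: "starts T i k w \<noteq> 0" ..
      have "(\<Sum>i. starts T i k w) = (\<Sum>j\<in>{i}. starts T j k w)"
        using uniq[OF i] uniq[OF _ i] by (intro suminf_finite) (auto, metis linorder_neqE_nat)
      then show ?thesis by (simp add: starts_def)
    qed simp
  qed
  also have "\<dots> = 1" using prob_space.emeasure_space_1[OF O.prob_space_law] by simp
  finally show ?thesis .
qed

lemma stB_ge:
  "ennreal (\<Sum>i<stk n w. S i) \<le> stB n w"
proof (induction n)
  case 0 then show ?case by (simp add: st_0)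
next
  case (Suc n)
  show ?case
  proof (cases "going n w")
    case True then show ?thesis using Suc by (simp add: st_Suc)
  next
    case False
    have S_nn: "0 \<le> S i" for i using S[of i] by simp
    have "ennreal (\<Sum>i<stk (Suc n) w. S i) = ennreal (\<Sum>i<stk n w. S i) + ennreal (S (stk n w))"
      using False S_nn by (simp add: st_Suc sum_nonneg)
    also have "\<dots> \<le> stB n w + ennreal (S (stk n w))" by (intro add_right_mono Suc)
    also have "\<dots> \<le> stB (Suc n) w" using False by (simp add: st_Suc block_end_def)
    finally show ?thesis .
  qed
qed

lemma visits_eq_0:
  assumes "T < (\<Sum>i<k. S i)" "0 \<le> T"
  shows "visits \<nu> T k = 0"
proof -
  have "starts T i k w = 0" for i w
  proof (rule ccontr)
    assume "starts T i k w \<noteq> 0"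
    then have "stk i w = k" "stB i w \<le> ennreal T" by (auto simp: starts_def split: if_splits)
    then have "ennreal (\<Sum>i<k. S i) \<le> ennreal T" using stB_ge[of i w] by (auto intro: order_trans)
    then show False using assms by (simp add: ennreal_le_iff)
  qed
  then show ?thesis by (simp add: visits_def)
qed

section \<open>Pathwise comparison of costs, gains and time\<close>

lemma tau_pos:
  assumes w: "w \<in> space control_space"
  shows "tau n w = stB n w + (fst (Vs (stk n w)) (pos n w) (inn n w) - ennreal (t (stk n w)))"
proof (cases "stm n w = Suc n")
  case True
  then show ?thesis
    using start_impulse[OF True] block_start_time(1)[OF inn_space[OF w] inn_0] by (simp add: pos_def)
next
  case False
  then obtain i where i: "n = Suc i" using stm_bounds[of n w] by (cases n) auto
  have g: "going i w" using False i by (auto simp: st_Suc split: if_splits)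
  then have eq: "stk n w = stk i w" "stm n w = stm i w" "stB n w = stB i w" "inn n w = inn i w"
    by (simp_all add: i st_Suc inn_def)
  have "pos n w = Suc (pos i w)" using stm_bounds[of i w] eq(2) unfolding i by (simp add: pos_def Suc_diff_le del: st.simps)
  then show ?thesis using g eq i by simp
qed

lemma coord_shift:
  assumes "stB n w = ennreal b" "0 \<le> b" "b \<le> r"
  shows "inn n w (Suc (pos n w)) (r - b + t (stk n w)) = w (Suc n) r"
proof -
  have "stm n w + pos n w = Suc n" using stm_bounds[of n w] by (simp add: pos_def)
  then show ?thesis using assms t[of "stk n w"] by (simp add: inn_def inner_Suc paste_def shift_def)
qed

lemma impulse_time_ge:
  assumes w: "w \<in> space control_space"
  shows "ennreal (t (stk n w)) \<le> fst (Vs (stk n w)) j (inn n w)"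
  using blk.\<tau>_incr[OF inn_space[OF w, of n], of 0 j "stk n w"]
    block_start_time(1)[OF inn_space[OF w, of n] inn_0] by simp

text \<open>After \<open>b + S (stk n w)\<close> the outer strategy waits while the inner one may go
  on jumping, hence the bound on \<open>r\<close>.\<close>

lemma in_seg_transfer:
  assumes w: "w \<in> space control_space" and B: "stB n w = ennreal b" "0 \<le> b"
    and r: "r < b + S (stk n w)"
  shows "in_seg Vopt (Suc n) w r \<longleftrightarrow> b \<le> r \<and> in_seg (Vs (stk n w)) (Suc (pos n w)) (inn n w) (r - b + t (stk n w))"
proof -
  let ?k = "stk n w" and ?j = "pos n w" and ?v = "inn n w"
  let ?\<tau> = "\<lambda>j. fst (Vs ?k) j ?v"
  have t0: "0 \<le> t ?k" by (rule t)
  have key: "ennreal b + (\<tau>' - ennreal (t ?k)) \<le> ennreal r \<longleftrightarrow> b \<le> r \<and> \<tau>' \<le> ennreal (r - b + t ?k)"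
    if ge: "ennreal (t ?k) \<le> \<tau>'" and r0: "0 \<le> r" for \<tau>'
  proof (cases \<tau>')
    case (real q)
    then have q: "t ?k \<le> q" using ge t0 by simp
    then have "ennreal b + (\<tau>' - ennreal (t ?k)) = ennreal (b + (q - t ?k))"
      using real B t0 by (simp add: ennreal_minus)
    then have "ennreal b + (\<tau>' - ennreal (t ?k)) \<le> ennreal r \<longleftrightarrow> b + (q - t ?k) \<le> r"
      using r0 by (simp only: ennreal_le_iff)
    also have "\<dots> \<longleftrightarrow> b \<le> r \<and> q \<le> r - b + t ?k" using q by auto
    also have "\<dots> \<longleftrightarrow> b \<le> r \<and> \<tau>' \<le> ennreal (r - b + t ?k)"
      using real t0 by (auto simp: ennreal_le_iff simp del: ennreal_plus)
    finally show ?thesis .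
  next
    case top
    then show ?thesis by (simp add: top_unique)
  qed
  show ?thesis
  proof (cases "0 \<le> r \<and> b \<le> r")
    case False
    then have "\<not> (seg_start Vopt (Suc n) w \<le> ennreal r \<and> 0 \<le> r)"
      using tau_ge_stB[OF w, of n] B by (auto simp: seg_start_def Vopt_def dest: order_trans[of "ennreal b"])
    then show ?thesis using False B by (auto simp: in_seg_def)
  next
    case True
    let ?s = "r - b + t ?k"
    have s: "0 \<le> ?s" "?s < t ?k + S ?k" using True t0 r by simp_all
    have start: "tau n w \<le> ennreal r \<longleftrightarrow> ?\<tau> ?j \<le> ennreal ?s"
      using key[OF impulse_time_ge[OF w, of n ?j]] True by (simp add: tau_pos[OF w] B)
    have "ennreal r < tau (Suc n) w \<longleftrightarrow> ennreal ?s < ?\<tau> (Suc ?j)"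
    proof (cases "going n w")
      case g: True
      then show ?thesis
        using key[OF impulse_time_ge[OF w, of n "Suc ?j"]] True by (simp add: B not_le[symmetric])
    next
      case g: False
      have "ennreal ?s \<le> ennreal (t ?k + S ?k)" using s by (intro ennreal_leI) simp
      moreover have "ennreal (t ?k + S ?k) < ?\<tau> (Suc ?j)" using g by (simp add: going_def in_block_def)
      ultimately have 1: "ennreal ?s < ?\<tau> (Suc ?j)" by (rule le_less_trans)
      have "ennreal r < ennreal b + ennreal (S ?k)"
        using r True B S[of ?k] by (simp add: ennreal_plus[symmetric] ennreal_less_iff del: ennreal_plus)
      also have "\<dots> \<le> tau (Suc n) w" using g by (simp add: block_end_def B)
      finally show ?thesis using 1 by simp
    qed
    then show ?thesis using start True s(1) by (simp add: in_seg_def seg_start_def Vopt_def del: tau.simps)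
  qed
qed

text \<open>An impulse inside a block costs what the inner strategy pays. An impulse that opens the
  next block is made from a state in \<open>G k\<close>, because a finite wait ends at a successful
  check.\<close>

lemma total_cost_le_Bsum:
  assumes w: "w \<in> space control_space" and T: "0 \<le> T"
    and \<rho>: "\<And>k y e. y \<in> G k \<Longrightarrow> e \<in> U \<Longrightarrow> - c y e \<le> \<rho> k"
  shows "total_cost c Vopt T w \<le> imp_cost c Vopt T 0 w + Bsum T (\<lambda>k j v.
    imp_cost c (Vs k) (t k + S k) (Suc j) v + (if in_block k j v then 0 else ennreal (\<rho> k))) w"
proof -
  have "imp_cost c Vopt T (Suc n) w \<le> (if stB n w \<le> ennreal T
      then imp_cost c (Vs (stk n w)) (t (stk n w) + S (stk n w)) (Suc (pos n w)) (inn n w)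
        + (if in_block (stk n w) (pos n w) (inn n w) then 0 else ennreal (\<rho> (stk n w))) else 0)" for n
  proof (cases "tau (Suc n) w \<le> ennreal T")
    case False then show ?thesis by (simp add: imp_cost_def Vopt_def del: tau.simps)
  next
    case le: True
    let ?k = "stk n w" and ?j = "pos n w" and ?v = "inn n w"
    have "stB n w \<le> tau (Suc n) w" using tau_ge_stB[OF w] tau_mono[OF w] by (rule order_trans)
    then have BT: "stB n w \<le> ennreal T" using le by (rule order_trans)
    then obtain b where B: "stB n w = ennreal b" "0 \<le> b" by (cases "stB n w") (auto simp: top_unique)
    have "ennreal (- c (w (Suc n) (enn2real (tau (Suc n) w))) (xi (Suc n) w))
      \<le> imp_cost c (Vs ?k) (t ?k + S ?k) (Suc ?j) ?v + (if in_block ?k ?j ?v then 0 else ennreal (\<rho> ?k))"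
    proof (cases "going n w")
      case g: True
      then obtain q where q: "fst (Vs ?k) (Suc ?j) ?v = ennreal q" "0 \<le> q"
        by (cases "fst (Vs ?k) (Suc ?j) ?v") (auto simp: going_def in_block_def top_unique)
      have tq: "t ?k \<le> q" using impulse_time_ge[OF w, of n "Suc ?j"] q t[of ?k] by simp
      have "tau (Suc n) w = ennreal (b + (q - t ?k))" using g q B t[of ?k] tq by (simp add: ennreal_minus)
      then have "enn2real (tau (Suc n) w) = b + (q - t ?k)" using B tq by (simp del: tau.simps ennreal_plus)
      moreover have "w (Suc n) (b + (q - t ?k)) = ?v (Suc ?j) q"
        using coord_shift[OF B, of "b + (q - t ?k)"] tq by simp
      ultimately show ?thesis
        using g q by (simp add: imp_cost_def going_def in_block_def del: tau.simps)
    next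
      case g: False
      then have te: "tau (Suc n) w = ennreal b + ennreal (S ?k) + wait_time (nn ?k) (G ?k) (S ?k) (shift b (w (Suc n)))"
        using B by (simp add: block_end_def)
      then have "wait_time (nn ?k) (G ?k) (S ?k) (shift b (w (Suc n))) \<noteq> top" using le by (auto simp: top_unique)
      from wait_time_attained[OF this nn] obtain i where
        i: "wait_time (nn ?k) (G ?k) (S ?k) (shift b (w (Suc n))) = ennreal (nn ?k i)"
          "shift b (w (Suc n)) (S ?k + nn ?k i) \<in> G ?k" by blast
      have ni: "0 \<le> nn ?k i" using nn(2)[of i ?k] by linarith
      have "tau (Suc n) w = ennreal (b + S ?k + nn ?k i)" using te i ni B S[of ?k] by simp
      then have "enn2real (tau (Suc n) w) = b + S ?k + nn ?k i" using B ni S[of ?k] by (simp del: tau.simps)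
      moreover have "w (Suc n) (b + S ?k + nn ?k i) \<in> G ?k"
        using i(2) ni S[of ?k] by (simp add: shift_def ac_simps)
      ultimately have "- c (w (Suc n) (enn2real (tau (Suc n) w))) (xi (Suc n) w) \<le> \<rho> ?k"
        by (intro \<rho> xi_in_U w) (simp_all del: tau.simps)
      then show ?thesis using g
        by (auto simp: going_def simp del: tau.simps xi.simps intro!: ennreal_leI add_increasing)
    qed
    then show ?thesis using le BT by (simp add: imp_cost_def Vopt_def del: tau.simps xi.simps)
  qed
  then show ?thesis
    unfolding total_cost_eq Bsum_def
    by (subst suminf_ennreal_Suc) (intro add_left_mono suminf_le summableI)
qed

text \<open>Substitution of the inner time \<open>r - b + t k\<close> for the outer time
  \<open>r\<close>, by \<open>in_seg_transfer\<close> and \<open>coord_shift\<close>.\<close>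

lemma block_seg_eq:
  assumes w: "w \<in> space control_space" and B: "stB n w = ennreal b" "0 \<le> b"
    and F: "F \<in> borel_measurable borel"
  shows "seg (Vs (stk n w)) F (t (stk n w) + S (stk n w)) (Suc (pos n w)) (inn n w) =
    (\<integral>\<^sup>+r. (if in_seg Vopt (Suc n) w r \<and> r < b + S (stk n w) then F (w (Suc n) r) else 0) \<partial>lborel)"
proof -
  let ?k = "stk n w" and ?j = "pos n w" and ?v = "inn n w"
  let ?f = "\<lambda>s. if s < t ?k + S ?k \<and> in_seg (Vs ?k) (Suc ?j) ?v s then F (?v (Suc ?j) s) else 0"
  have "?v (Suc ?j) \<in> cadlag_paths" using inn_space[OF w, of n] by (auto simp: space_control_space)
  then have "?v (Suc ?j) \<in> borel_measurable borel"
    using measurable_path_eval[of "\<lambda>_. ?v (Suc ?j)" borel "\<lambda>s. s"] by (simp add: space_path_space)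
  note [measurable] = measurable_compose[OF this F]
  have [measurable]: "Measurable.pred borel (in_seg (Vs ?k) (Suc ?j) ?v)"
    unfolding in_seg_def[abs_def] by measurable
  have "seg (Vs ?k) F (t ?k + S ?k) (Suc ?j) ?v = (\<integral>\<^sup>+r. ?f ((t ?k - b) + 1 * r) \<partial>lborel)"
    unfolding seg_def by (subst nn_integral_real_affine[where c=1 and t="t ?k - b"]) simp_all
  also have "\<dots> = (\<integral>\<^sup>+r. (if in_seg Vopt (Suc n) w r \<and> r < b + S ?k then F (w (Suc n) r) else 0) \<partial>lborel)"
  proof (rule nn_integral_cong)
    fix r
    have eq: "(t ?k - b) + 1 * r = r - b + t ?k" by simp
    show "?f ((t ?k - b) + 1 * r) = (if in_seg Vopt (Suc n) w r \<and> r < b + S ?k then F (w (Suc n) r) else 0)"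
    proof (cases "r < b + S ?k")
      case True
      have "in_seg (Vs ?k) (Suc ?j) ?v (r - b + t ?k) \<Longrightarrow> b \<le> r"
        using impulse_time_ge[OF w, of n ?j] t[of ?k]
        by (auto simp: in_seg_def seg_start_def ennreal_le_iff dest: order_trans simp del: ennreal_plus)
      then have "in_seg Vopt (Suc n) w r \<longleftrightarrow> in_seg (Vs ?k) (Suc ?j) ?v (r - b + t ?k)"
        "in_seg Vopt (Suc n) w r \<Longrightarrow> b \<le> r"
        using in_seg_transfer[OF w B True] by blast+
      then show ?thesis unfolding eq using True coord_shift[OF B, of r] by auto
    qed (simp add: eq)
  qed
  finally show ?thesis .
qed

text \<open>Since \<open>F\<close> takes nonnegative values, the waits can be left out. A block
  begun by time \<open>T\<close> may run past \<open>T\<close>, but by at most its own length, which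
  \<open>Sm\<close> bounds.\<close>

lemma Bsum_seg_le:
  assumes w: "w \<in> space control_space" and F[measurable]: "F \<in> borel_measurable borel"
    and bd: "\<And>y. F y \<le> ennreal b" and T: "0 \<le> T" and Sm: "\<And>k. (\<Sum>i<k. S i) \<le> T \<Longrightarrow> S k \<le> Sm"
  shows "Bsum T (\<lambda>k j. seg (Vs k) F (t k + S k) (Suc j)) w \<le>
    (\<integral>\<^sup>+s. (if 0 \<le> s \<and> s < T then F (controlled_process Vopt w s) else 0) \<partial>lborel) + ennreal b * ennreal Sm"
proof -
  define f where "f n r = (case n of 0 \<Rightarrow> 0 | Suc n \<Rightarrow>
    if stB n w \<le> ennreal T \<and> r < enn2real (stB n w) + S (stk n w) then F (w (Suc n) r) else 0)" for n r
  define H where "H r = (if 0 \<le> r \<and> r < T then F (controlled_process Vopt w r) else 0)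
    + ennreal b * indicator {T..<T + Sm} r" for r
  have wm: "w n \<in> borel_measurable borel" for n
    using measurable_path_eval[of "\<lambda>_. w n" borel "\<lambda>s. s"] w by (simp add: space_control_space space_path_space)
  have Xm[measurable]: "controlled_process Vopt w \<in> borel_measurable borel"
    using measurable_compose[OF _ opt.measurable_controlled, of "\<lambda>s. (w, s)" borel] w by simp
  have summand: "(if stB n w \<le> ennreal T then seg (Vs (stk n w)) F (t (stk n w) + S (stk n w)) (Suc (pos n w)) (inn n w) else 0)
    = (\<integral>\<^sup>+r. (if in_seg Vopt (Suc n) w r then f (Suc n) r else 0) \<partial>lborel)" for n
  proof (cases "stB n w \<le> ennreal T")
    case True
    then obtain b where B: "stB n w = ennreal b" "0 \<le> b" by (cases "stB n w") (auto simp: top_unique)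
    show ?thesis using True
      by (simp add: block_seg_eq[OF w B F] f_def B) (auto simp: f_def B intro!: nn_integral_cong)
  qed (simp add: f_def cong: if_cong)
  have "Bsum T (\<lambda>k j. seg (Vs k) F (t k + S k) (Suc j)) w =
    (\<Sum>n. \<integral>\<^sup>+r. (if in_seg Vopt (Suc n) w r then f (Suc n) r else 0) \<partial>lborel)"
    unfolding Bsum_def by (simp only: summand)
  also have "\<dots> \<le> (\<Sum>n. \<integral>\<^sup>+r. (if in_seg Vopt n w r then f n r else 0) \<partial>lborel)"
    by (subst (2) suminf_ennreal_Suc) simp
  also have "\<dots> \<le> (\<integral>\<^sup>+r. H r \<partial>lborel)"
  proof (rule opt.suminf_segwise[OF w])
    show "f n \<in> borel_measurable borel" for n
      using measurable_compose[OF wm F] by (cases n) (simp_all add: f_def[abs_def])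
    show "H \<in> borel_measurable borel" unfolding H_def by measurable
    fix n r assume isg: "in_seg Vopt n w r"
    show "f n r \<le> H r"
    proof (cases n)
      case (Suc m)
      show ?thesis
      proof (cases "stB m w \<le> ennreal T \<and> r < enn2real (stB m w) + S (stk m w)")
        case True
        then have "ennreal (\<Sum>i<stk m w. S i) \<le> ennreal T" using stB_ge[of m w] by (auto intro: order_trans)
        then have "S (stk m w) \<le> Sm" using T by (intro Sm) (simp add: ennreal_le_iff)
        moreover have "enn2real (stB m w) \<le> T" using True T by (simp add: enn2real_leI)
        ultimately have "r < T + Sm" using True by linarith
        then show ?thesis
          using isg opt.controlled_in_seg[OF w isg] bd True
          by (auto simp: f_def Suc H_def in_seg_def indicator_def)
      qed (auto simp: f_def Suc)
    qed (simp add: f_def)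
  qed
  also have "\<dots> = (\<integral>\<^sup>+s. (if 0 \<le> s \<and> s < T then F (controlled_process Vopt w s) else 0) \<partial>lborel)
      + ennreal b * emeasure lborel {T..<T + Sm}"
    unfolding H_def by (subst nn_integral_add) (auto simp: nn_integral_cmult)
  also have "emeasure lborel {T..<T + Sm} \<le> ennreal Sm"
    by (cases "0 \<le> Sm") auto
  finally show ?thesis by (simp add: add_left_mono mult_left_mono)
qed

lemma nn_integral_interval_le:
  assumes "0 \<le> p"
  shows "(\<integral>\<^sup>+r. (if p \<le> r \<and> ennreal r < ennreal p + W then 1 else 0) \<partial>lborel) \<le> W"
proof (cases W)
  case (real q)
  have "(\<integral>\<^sup>+r. (if p \<le> r \<and> ennreal r < ennreal p + W then 1 else 0) \<partial>lborel) \<le> (\<integral>\<^sup>+r. indicator {p..p + q} r \<partial>lborel)"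
    using assms real by (intro nn_integral_mono)
      (auto simp: indicator_def ennreal_plus[symmetric] ennreal_less_iff simp del: ennreal_plus)
  then show ?thesis using real by simp
qed simp

text \<open>Every time before \<open>T\<close> lies in a block begun by \<open>T\<close> or in the
  wait after such a block. As the waits are short in the mean, this later bounds the total length of
  the visited blocks from below.\<close>

lemma time_le_Bsum:
  assumes w: "w \<in> space control_space" and cover: "\<And>r. 0 \<le> r \<Longrightarrow> r < T \<Longrightarrow> \<exists>n. ennreal r < tau n w"
  shows "ennreal T \<le> Bsum T (\<lambda>k j v. seg (Vs k) (\<lambda>_. 1) (t k + S k) (Suc j) v +
    (if in_block k j v then 0 else wait_time (nn k) (G k) (t k + S k) (v (Suc j)))) w"
proof -
  define p where "p n = enn2real (stB n w) + S (stk n w)" for n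
  define W where "W n = wait_time (nn (stk n w)) (G (stk n w)) (t (stk n w) + S (stk n w)) (inn n w (Suc (pos n w)))" for n
  define a where "a n r = (if in_seg Vopt (Suc n) w r \<and> r < p n then 1 else 0 :: ennreal)
    + (if going n w then 0 else if p n \<le> r \<and> ennreal r < ennreal (p n) + W n then 1 else 0)" for n r
  define q where "q n r = (if stB n w \<le> ennreal T then a n r else 0)" for n r
  have [measurable]: "Measurable.pred borel (in_seg Vopt n w)" for n
    unfolding in_seg_def[abs_def] by measurable
  have p0: "0 \<le> p n" for n using S[of "stk n w"] by (simp add: p_def)
  have summand: "(\<integral>\<^sup>+r. q n r \<partial>lborel) \<le> (if stB n w \<le> ennreal T then
      seg (Vs (stk n w)) (\<lambda>_. 1) (t (stk n w) + S (stk n w)) (Suc (pos n w)) (inn n w) +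
      (if in_block (stk n w) (pos n w) (inn n w) then 0 else W n) else 0)" for n
  proof (cases "stB n w \<le> ennreal T")
    case True
    then obtain b where B: "stB n w = ennreal b" "0 \<le> b" by (cases "stB n w") (auto simp: top_unique)
    have "(\<integral>\<^sup>+r. a n r \<partial>lborel) =
      (\<integral>\<^sup>+r. (if in_seg Vopt (Suc n) w r \<and> r < p n then 1 else 0) \<partial>lborel) +
      (\<integral>\<^sup>+r. (if going n w then 0 else if p n \<le> r \<and> ennreal r < ennreal (p n) + W n then 1 else 0) \<partial>lborel)"
      unfolding a_def by (rule nn_integral_add) measurable
    also have "\<dots> \<le> seg (Vs (stk n w)) (\<lambda>_. 1) (t (stk n w) + S (stk n w)) (Suc (pos n w)) (inn n w)
      + (if going n w then 0 else W n)"
    proof (rule add_mono)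
      show "(\<integral>\<^sup>+r. (if in_seg Vopt (Suc n) w r \<and> r < p n then 1 else 0) \<partial>lborel)
        \<le> seg (Vs (stk n w)) (\<lambda>_. 1) (t (stk n w) + S (stk n w)) (Suc (pos n w)) (inn n w)"
        using block_seg_eq[OF w B, of "\<lambda>_. 1"] B by (simp add: p_def)
      show "(\<integral>\<^sup>+r. (if going n w then 0 else if p n \<le> r \<and> ennreal r < ennreal (p n) + W n then 1 else 0) \<partial>lborel)
        \<le> (if going n w then 0 else W n)"
        using nn_integral_interval_le[OF p0, of n "W n"] by (cases "going n w") simp_all
    qed
    finally have "(\<integral>\<^sup>+r. a n r \<partial>lborel) \<le> seg (Vs (stk n w)) (\<lambda>_. 1) (t (stk n w) + S (stk n w)) (Suc (pos n w)) (inn n w)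
      + (if going n w then 0 else W n)" .
    then show ?thesis unfolding q_def going_def using True by (simp only: if_True)
  qed (simp add: q_def)
  have "ennreal T \<le> (\<integral>\<^sup>+r. indicator {0..<T} r \<partial>lborel)" by (cases "0 \<le> T") (auto simp: ennreal_neg)
  also have "\<dots> \<le> (\<integral>\<^sup>+r. (\<Sum>n. q n r) \<partial>lborel)"
  proof (rule nn_integral_mono)
    fix r :: real
    show "indicator {0..<T} r \<le> (\<Sum>n. q n r)"
    proof (cases "0 \<le> r \<and> r < T")
      case r: True
      then obtain n where "ennreal r < tau n w" using cover by blast
      then obtain m where m: "in_seg Vopt m w r" using opt.in_seg_exists[of r n w] r by (auto simp: Vopt_def)
      \<comment> \<open>Segment 0 is empty because impulse 0 takes place at time 0.\<close>
      obtain n where n: "m = Suc n" using m by (cases m) (auto simp: in_seg_def Vopt_def)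
      let ?k = "stk n w" and ?j = "pos n w" and ?v = "inn n w"
      have lo: "tau n w \<le> ennreal r" and up: "ennreal r < tau (Suc n) w"
        using m by (simp_all add: n in_seg_def seg_start_def Vopt_def del: tau.simps)
      then have "stB n w \<le> ennreal r" using tau_ge_stB[OF w, of n] by (auto intro: order_trans)
      then obtain b where B: "stB n w = ennreal b" "0 \<le> b" "b \<le> r"
        using r by (cases "stB n w") (auto simp: top_unique ennreal_le_iff)
      have BT: "stB n w \<le> ennreal T" using B r by (auto intro!: ennreal_leI)
      have "1 \<le> a n r"
      proof (cases "r < p n")
        case True then show ?thesis using m by (simp add: a_def n)
      next
        case False
        have ng: "\<not> going n w"
        proof
          assume g: "going n w"
          then have "tau (Suc n) w \<le> ennreal b + (ennreal (t ?k + S ?k) - ennreal (t ?k))"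
            using B by (auto simp: going_def in_block_def intro!: add_left_mono ennreal_minus_mono)
          also have "\<dots> = ennreal (p n)" using t[of ?k] S[of ?k] B by (simp add: p_def ennreal_minus ennreal_plus[symmetric] del: ennreal_plus)
          also have "\<dots> \<le> ennreal r" using False by (intro ennreal_leI) simp
          finally show False using up by simp
        qed
        have "W n = wait_time (nn ?k) (G ?k) (S ?k) (shift b (w (Suc n)))"
        proof -
          have "inn n w (Suc ?j) (t ?k + S ?k + nn ?k i) = shift b (w (Suc n)) (S ?k + nn ?k i)" for i
          proof -
            have "0 \<le> nn ?k i" using nn(2)[of i ?k] by linarith
            then show ?thesis
              using coord_shift[OF B(1,2), of "b + S ?k + nn ?k i"] S[of ?k] by (simp add: shift_def algebra_simps)
          qed
          then show ?thesis by (simp add: W_def wait_time_def)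
        qed
        then have "tau (Suc n) w = ennreal (p n) + W n"
          using ng B S[of ?k] by (simp add: block_end_def p_def)
        then show ?thesis using up ng False by (simp add: a_def)
      qed
      then have "1 \<le> q n r" using BT by (simp add: q_def)
      also have "q n r \<le> (\<Sum>n. q n r)" using sum_le_suminf[of "\<lambda>n. q n r" "{n}"] by simp
      finally show ?thesis using r by simp
    qed (auto simp: indicator_def)
  qed
  also have "\<dots> = (\<Sum>n. \<integral>\<^sup>+r. q n r \<partial>lborel)"
    unfolding q_def a_def by (intro nn_integral_suminf) measurable
  also have "\<dots> \<le> (\<Sum>n. (if stB n w \<le> ennreal T then
      seg (Vs (stk n w)) (\<lambda>_. 1) (t (stk n w) + S (stk n w)) (Suc (pos n w)) (inn n w) +
      (if in_block (stk n w) (pos n w) (inn n w) then 0 else W n) else 0))"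
    by (intro suminf_le summableI summand)
  also have "\<dots> = Bsum T (\<lambda>k j v. seg (Vs k) (\<lambda>_. 1) (t k + S k) (Suc j) v +
    (if in_block k j v then 0 else wait_time (nn k) (G k) (t k + S k) (v (Suc j)))) w"
    unfolding Bsum_def W_def ..
  finally show ?thesis .
qed

lemma measurable_Bsum:
  assumes \<phi>: "\<And>k j. \<phi> k j \<in> borel_measurable control_space"
  shows "Bsum T \<phi> \<in> borel_measurable control_space"
proof -
  have "(\<lambda>w. \<phi> k (Suc n - m) (inn n w)) \<in> borel_measurable control_space" for k m n
    by (rule measurable_compose[OF measurable_inn \<phi>])
  from measurable_state_compose[where f="\<lambda>k m w. \<phi> k (Suc n - m) (inn n w)" for n,
      OF measurable_stk measurable_stm this]
  have [measurable]: "(\<lambda>w. \<phi> (stk n w) (pos n w) (inn n w)) \<in> borel_measurable control_space" for n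
    by (simp add: pos_def)
  note [measurable] = measurable_stB
  show ?thesis unfolding Bsum_def[abs_def] by measurable
qed

section \<open>Expected costs, gains and time\<close>

definition block_gain :: "('a \<Rightarrow> ennreal) \<Rightarrow> nat \<Rightarrow> ennreal" where
  "block_gain F k = (\<Sum>j. \<integral>\<^sup>+v. seg (Vs k) F (t k + S k) (Suc j) v \<partial>lawk k)"

definition block_cost :: "('a \<Rightarrow> 'a \<Rightarrow> real) \<Rightarrow> nat \<Rightarrow> ennreal" where
  "block_cost c k = (\<Sum>j. \<integral>\<^sup>+v. imp_cost c (Vs k) (t k + S k) (Suc j) v \<partial>lawk k)"

definition block_wait :: "nat \<Rightarrow> ennreal" where
  "block_wait k = (\<Sum>j. \<integral>\<^sup>+v. (if fst (Vs k) j v \<le> ennreal (t k + S k) \<and> ennreal (t k + S k) < fst (Vs k) (Suc j) v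
     then wait_time (nn k) (G k) (t k + S k) (v (Suc j)) else 0) \<partial>lawk k)"

lemma measurable_alive: "Measurable.pred control_space (alive k j)"
proof -
  note [measurable] = blk.measurable_\<tau>[of k j]
  show ?thesis by measurable
qed

lemma measurable_in_block: "Measurable.pred control_space (in_block k j)"
  unfolding in_block_def[abs_def] by (rule measurable_alive)

lemma in_block_depends:
  assumes "w \<in> space control_space" "w' \<in> space control_space" "\<forall>i\<le>Suc j. w i = w' i"
  shows "in_block k j w = in_block k j w'"
  using depends_uptoD[OF blk.\<tau>_depends[of "Suc j" k] assms(1,2)] assms(3) by (simp add: in_block_def)

lemma block_mean_add:
  assumes [measurable]: "\<And>j. \<phi> k j \<in> borel_measurable control_space" "\<And>j. \<psi> k j \<in> borel_measurable control_space"
  shows "block_mean (\<lambda>k j v. \<phi> k j v + \<psi> k j v) k = block_mean \<phi> k + block_mean \<psi> k"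
proof -
  interpret D: strategy_law P U "Vs k" "return path_space (om k)" by (rule strategy_law_blk)
  have "(\<integral>\<^sup>+v. (if alive k j v then \<phi> k j v + \<psi> k j v else 0) \<partial>lawk k) =
    (\<integral>\<^sup>+v. (if alive k j v then \<phi> k j v else 0) \<partial>lawk k) + (\<integral>\<^sup>+v. (if alive k j v then \<psi> k j v else 0) \<partial>lawk k)" for j
  proof -
    note [measurable] = measurable_alive[of k j]
    have "(\<integral>\<^sup>+v. (if alive k j v then \<phi> k j v + \<psi> k j v else 0) \<partial>lawk k) =
      (\<integral>\<^sup>+v. (if alive k j v then \<phi> k j v else 0) + (if alive k j v then \<psi> k j v else 0) \<partial>lawk k)"
      by (intro nn_integral_cong) simp
    also have "\<dots> = (\<integral>\<^sup>+v. (if alive k j v then \<phi> k j v else 0) \<partial>lawk k) + (\<integral>\<^sup>+v. (if alive k j v then \<psi> k j v else 0) \<partial>lawk k)"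
      by (intro nn_integral_add D.measurable_from_law) measurable
    finally show ?thesis .
  qed
  then show ?thesis by (simp add: block_mean_def suminf_add[OF summableI summableI])
qed

lemma block_mean_cost_le: "block_mean (\<lambda>k j. imp_cost c (Vs k) (t k + S k) (Suc j)) k \<le> block_cost c k"
  unfolding block_mean_def block_cost_def by (intro suminf_le summableI nn_integral_mono) simp

lemma block_mean_wait_le:
  "block_mean (\<lambda>k j v. if in_block k j v then 0 else wait_time (nn k) (G k) (t k + S k) (v (Suc j))) k \<le> block_wait k"
  unfolding block_mean_def block_wait_def in_block_def
  by (intro suminf_le summableI nn_integral_mono) (auto simp: not_le not_less)

lemma block_gain_eq: "block_mean (\<lambda>k j. seg (Vs k) F (t k + S k) (Suc j)) k = block_gain F k"
proof -
  have "(if alive k j v then seg (Vs k) F (t k + S k) (Suc j) v else 0) = seg (Vs k) F (t k + S k) (Suc j) v" for j v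
  proof (cases "alive k j v")
    case False
    have "\<not> (s < t k + S k \<and> in_seg (Vs k) (Suc j) v s)" for s
    proof
      assume s: "s < t k + S k \<and> in_seg (Vs k) (Suc j) v s"
      then have "fst (Vs k) j v \<le> ennreal s" by (simp add: in_seg_def seg_start_def)
      also have "ennreal s \<le> ennreal (t k + S k)" using s by (intro ennreal_leI) simp
      finally show False using False by simp
    qed
    then have "seg (Vs k) F (t k + S k) (Suc j) v = 0" unfolding seg_def by (simp only: if_False nn_integral_0_iff_AE) simp
    then show ?thesis by simp
  qed simp
  then show ?thesis by (simp add: block_mean_def block_gain_def)
qed

text \<open>At most one position is alive without being followed by an impulse inside the block,
  namely the last one.\<close>

lemma block_mean_exit_le: "block_mean (\<lambda>k j v. if in_block k j v then 0 else r k) k \<le> r k"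
proof -
  interpret D: strategy_law P U "Vs k" "return path_space (om k)" by (rule strategy_law_blk)
  let ?f = "\<lambda>j v. if alive k j v then if in_block k j v then 0 else r k else 0"
  have "block_mean (\<lambda>k j v. if in_block k j v then 0 else r k) k = (\<integral>\<^sup>+v. (\<Sum>j. ?f j v) \<partial>lawk k)"
    unfolding block_mean_def
  proof (intro nn_integral_suminf[symmetric] D.measurable_from_law)
    fix j
    note [measurable] = measurable_alive[of k j] measurable_in_block[of k j]
    show "?f j \<in> borel_measurable control_space" by measurable
  qed
  also have "\<dots> \<le> (\<integral>\<^sup>+v. r k \<partial>lawk k)"
  proof (rule nn_integral_mono)
    fix v assume "v \<in> space (lawk k)"
    then have v: "v \<in> space control_space" by (simp add: D.space_law)
    have uniq: "\<not> i < j" if "?f i v \<noteq> 0" "?f j v \<noteq> 0" for i j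
    proof
      assume "i < j"
      then have "alive k (Suc i) v" using that alive_mono[OF v, of k j "Suc i"] by (auto split: if_splits)
      then show False using that by (auto simp: in_block_def split: if_splits)
    qed
    show "(\<Sum>j. ?f j v) \<le> r k"
    proof (cases "\<exists>i. ?f i v \<noteq> 0")
      case True
      then obtain i where i: "?f i v \<noteq> 0" ..
      have "(\<Sum>j. ?f j v) = (\<Sum>j\<in>{i}. ?f j v)"
      proof (rule suminf_finite)
        fix j assume "j \<notin> {i}"
        then have "i < j \<or> j < i" by auto
        then show "?f j v = 0" using uniq[OF i, of j] uniq[OF _ i, of j] by blast
      qed simp
      then show ?thesis by auto
    next
      case False
      then have "(\<lambda>j. ?f j v) = (\<lambda>_. 0)" by blast
      then show ?thesis by simp
    qed
  qed
  also have "\<dots> = r k" using prob_space.emeasure_space_1[OF D.prob_space_law] by simp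
  finally show ?thesis .
qed

lemma opt_cost_le:
  assumes \<nu>: "strategy_law P U Vopt \<nu>" and U: "compact U" and c: "continuous_on (UNIV \<times> U) (\<lambda>(x, a). c x a)"
    and T: "0 \<le> T" and \<rho>: "\<And>k y e. y \<in> G k \<Longrightarrow> e \<in> U \<Longrightarrow> - c y e \<le> \<rho> k"
  shows "strategy_law.cost P Vopt \<nu> c T \<le> (\<integral>\<^sup>+w. imp_cost c Vopt T 0 w \<partial>strategy.law P Vopt \<nu>)
    + (\<Sum>k. visits \<nu> T k * (block_cost c k + ennreal (\<rho> k)))"
proof -
  interpret O: strategy_law P U Vopt \<nu> by (rule \<nu>)
  let ?a = "\<lambda>k j. imp_cost c (Vs k) (t k + S k) (Suc j)" and ?b = "\<lambda>k j v. if in_block k j v then 0 else ennreal (\<rho> k)"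
  let ?\<phi> = "\<lambda>k j v. ?a k j v + ?b k j v"
  have a: "?a k j \<in> borel_measurable control_space" for k j by (rule blk.measurable_imp_cost[OF U c])
  have b: "?b k j \<in> borel_measurable control_space" for k j
  proof -
    note [measurable] = measurable_in_block[of k j]
    show ?thesis by measurable
  qed
  have \<phi>m: "?\<phi> k j \<in> borel_measurable control_space" for k j
    using a b by (rule borel_measurable_add)
  have \<phi>d: "depends_upto (Suc j) (?\<phi> k j)" for k j
    unfolding depends_upto_def
  proof (intro ballI impI)
    fix w w' :: "nat \<Rightarrow> real \<Rightarrow> 'a"
    assume *: "w \<in> space control_space" "w' \<in> space control_space" "\<forall>l\<le>Suc j. w l = w' l"
    have "in_block k j w = in_block k j w'" by (rule in_block_depends[OF *])
    moreover have "?a k j w = ?a k j w'" using * by (intro depends_uptoD[OF blk.imp_cost_depends]) auto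
    ultimately show "?\<phi> k j w = ?\<phi> k j w'" by (simp only:)
  qed
  have im: "imp_cost c Vopt T 0 \<in> borel_measurable (opt.law \<nu>)"
    by (intro O.measurable_from_law opt.measurable_imp_cost U c)
  have "O.cost c T \<le> (\<integral>\<^sup>+w. imp_cost c Vopt T 0 w + Bsum T ?\<phi> w \<partial>opt.law \<nu>)"
    unfolding O.cost_def by (intro nn_integral_mono total_cost_le_Bsum[OF _ T \<rho>]) (simp_all add: O.space_law)
  also have "\<dots> = (\<integral>\<^sup>+w. imp_cost c Vopt T 0 w \<partial>opt.law \<nu>) + (\<integral>\<^sup>+w. Bsum T ?\<phi> w \<partial>opt.law \<nu>)"
    using O.measurable_from_law[OF measurable_Bsum[OF \<phi>m]] by (intro nn_integral_add[OF im])
  also have "(\<integral>\<^sup>+w. Bsum T ?\<phi> w \<partial>opt.law \<nu>) = (\<Sum>k. visits \<nu> T k * block_mean ?\<phi> k)"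
    by (rule Bsum_integral[OF \<nu> \<phi>m \<phi>d])
  also have "\<dots> \<le> (\<Sum>k. visits \<nu> T k * (block_cost c k + ennreal (\<rho> k)))"
  proof (intro suminf_le summableI mult_left_mono)
    fix k
    show "block_mean ?\<phi> k \<le> block_cost c k + ennreal (\<rho> k)"
      unfolding block_mean_add[of ?a k ?b, OF a b] using block_mean_cost_le[of c k] block_mean_exit_le[of "\<lambda>k. ennreal (\<rho> k)" k] by (rule add_mono)
  qed simp
  finally show ?thesis by (simp add: add_left_mono)
qed

lemma opt_gain_ge:
  assumes \<nu>: "strategy_law P U Vopt \<nu>" and g[measurable]: "g \<in> borel_measurable borel" and bd: "\<And>y. \<bar>g y\<bar> \<le> a"
    and T: "0 \<le> T" and Sm: "\<And>k. (\<Sum>i<k. S i) \<le> T \<Longrightarrow> S k \<le> Sm"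
  shows "(\<Sum>k. visits \<nu> T k * block_gain (\<lambda>y. ennreal (g y + a)) k)
    \<le> strategy_law.gain P Vopt \<nu> g a T + ennreal (2 * a * Sm)"
proof -
  interpret O: strategy_law P U Vopt \<nu> by (rule \<nu>)
  interpret prob_space "opt.law \<nu>" by (rule O.prob_space_law)
  let ?F = "\<lambda>y. ennreal (g y + a)"
  let ?\<phi> = "\<lambda>k j. seg (Vs k) ?F (t k + S k) (Suc j)"
  have a: "0 \<le> a" using bd[of undefined] by linarith
  have F: "?F \<in> borel_measurable borel" by measurable
  have Fb: "?F y \<le> ennreal (2 * a)" for y using bd[of y] by (intro ennreal_leI) linarith
  have "(\<Sum>k. visits \<nu> T k * block_gain ?F k) = (\<integral>\<^sup>+w. Bsum T ?\<phi> w \<partial>opt.law \<nu>)"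
    by (subst Bsum_integral[OF \<nu> blk.measurable_seg[OF F] blk.seg_depends]) (simp add: block_gain_eq)
  also have "\<dots> \<le> (\<integral>\<^sup>+w. (\<integral>\<^sup>+s. (if 0 \<le> s \<and> s < T then ?F (controlled_process Vopt w s) else 0) \<partial>lborel)
      + ennreal (2 * a) * ennreal Sm \<partial>opt.law \<nu>)"
    by (intro nn_integral_mono Bsum_seg_le[OF _ F Fb T Sm]) (simp_all add: O.space_law)
  also have "\<dots> = O.gain g a T + ennreal (2 * a) * ennreal Sm"
    using O.measurable_path_gain[OF g] by (subst nn_integral_add) (simp_all add: O.gain_def emeasure_space_1)
  also have "ennreal (2 * a) * ennreal Sm = ennreal (2 * a * Sm)"
    using a by (cases "0 \<le> Sm") (simp_all add: ennreal_mult ennreal_neg mult_nonneg_nonpos)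
  finally show ?thesis .
qed

lemma opt_time_le:
  assumes \<nu>: "strategy_law P U Vopt \<nu>"
    and cover: "AE w in strategy.law P Vopt \<nu>. \<forall>r. \<exists>n. ennreal r < tau n w"
  shows "ennreal T \<le> (\<Sum>k. visits \<nu> T k * (ennreal (S k) + block_wait k))"
proof -
  interpret O: strategy_law P U Vopt \<nu> by (rule \<nu>)
  interpret prob_space "opt.law \<nu>" by (rule O.prob_space_law)
  let ?a = "\<lambda>k j. seg (Vs k) (\<lambda>_. 1) (t k + S k) (Suc j)"
    and ?b = "\<lambda>k j v. if in_block k j v then 0 else wait_time (nn k) (G k) (t k + S k) (v (Suc j))"
  let ?\<phi> = "\<lambda>k j v. ?a k j v + ?b k j v"
  have a: "?a k j \<in> borel_measurable control_space" for k j by (rule blk.measurable_seg) simp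
  have b: "?b k j \<in> borel_measurable control_space" for k j
  proof -
    have [measurable]: "(\<lambda>v. wait_time (nn k) (G k) (t k + S k) (v (Suc j))) \<in> borel_measurable control_space"
      by (intro measurable_wait_time measurable_control_coord G) simp
    note [measurable] = measurable_in_block[of k j]
    show ?thesis by measurable
  qed
  have \<phi>m: "?\<phi> k j \<in> borel_measurable control_space" for k j
    using a b by (rule borel_measurable_add)
  have \<phi>d: "depends_upto (Suc j) (?\<phi> k j)" for k j
    unfolding depends_upto_def
  proof (intro ballI impI)
    fix w w' :: "nat \<Rightarrow> real \<Rightarrow> 'a"
    assume *: "w \<in> space control_space" "w' \<in> space control_space" "\<forall>l\<le>Suc j. w l = w' l"
    have "in_block k j w = in_block k j w'" by (rule in_block_depends[OF *])
    moreover have "?a k j w = ?a k j w'" using * by (intro depends_uptoD[OF blk.seg_depends]) auto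
    moreover have "w (Suc j) = w' (Suc j)" using * by blast
    ultimately show "?\<phi> k j w = ?\<phi> k j w'" by (simp only:)
  qed
  have len: "block_gain (\<lambda>_. 1) k \<le> ennreal (S k)" for k
    using blk.later_segs_integral_le[OF om, of "\<lambda>_. 1" 1 "t k" "S k" k k] t[of k] S[of k] start[of k]
    by (simp add: block_gain_def)
  have "ennreal T = (\<integral>\<^sup>+w. ennreal T \<partial>opt.law \<nu>)" by (simp add: emeasure_space_1)
  also have "\<dots> \<le> (\<integral>\<^sup>+w. Bsum T ?\<phi> w \<partial>opt.law \<nu>)"
  proof (rule nn_integral_mono_AE)
    show "AE w in opt.law \<nu>. ennreal T \<le> Bsum T ?\<phi> w"
      using cover AE_space by eventually_elim (intro time_le_Bsum, simp_all add: O.space_law)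
  qed
  also have "\<dots> = (\<Sum>k. visits \<nu> T k * block_mean ?\<phi> k)"
    by (rule Bsum_integral[OF \<nu> \<phi>m \<phi>d])
  also have "\<dots> \<le> (\<Sum>k. visits \<nu> T k * (ennreal (S k) + block_wait k))"
  proof (intro suminf_le summableI mult_left_mono)
    fix k
    have "block_mean ?a k \<le> ennreal (S k)" unfolding block_gain_eq by (rule len)
    then show "block_mean ?\<phi> k \<le> ennreal (S k) + block_wait k"
      unfolding block_mean_add[of ?a k ?b, OF a b] using block_mean_wait_le[of k] by (rule add_mono)
  qed simp
  finally show ?thesis .
qed

end

text \<open>If each block is short compared with the time elapsed before it, then up to a constant
  neither the overrun of the last block nor the accumulated errors \<open>\<epsilon> k * S k\<close>
  exceed \<open>\<delta> * T\<close>. The finitely many \<open>k\<close> with large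
  \<open>\<epsilon> k\<close> go into the constant. The offset \<open>D\<close> leaves room for the
  first block, before which no time has elapsed.\<close>

lemma slow_growth:
  fixes S \<epsilon> :: "nat \<Rightarrow> real"
  assumes S: "\<And>k. 0 \<le> S k" and \<epsilon>: "\<And>k. 0 \<le> \<epsilon> k" "\<epsilon> \<longlonglongrightarrow> 0" and D: "0 \<le> D"
    and le: "\<And>k. S k \<le> \<epsilon> k * (D + (\<Sum>i<k. S i))" and \<delta>: "0 < \<delta>"
  shows "\<exists>A. \<forall>T\<ge>0. (\<forall>k. (\<Sum>i<k. S i) \<le> T \<longrightarrow> S k \<le> A + \<delta> * T) \<and>
    (\<forall>N. (\<Sum>k<N. if (\<Sum>i<k. S i) \<le> T then \<epsilon> k * S k else 0) \<le> A + \<delta> * T)"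
proof -
  \<comment> \<open>The errors add up to at most \<open>d\<close> times the length of the blocks
    begun by \<open>T\<close>, which is about \<open>(1 + d) * T\<close>; with
    \<open>d \<le> 1\<close> this is at most \<open>2 * d * T\<close>.\<close>
  define d where "d = min (\<delta> / 2) 1"
  have d: "0 < d" "d \<le> 1" "2 * d \<le> \<delta>" using \<delta> by (auto simp: d_def)
  obtain K where K: "\<And>k. K \<le> k \<Longrightarrow> \<epsilon> k \<le> d"
    using order_tendstoD(2)[OF \<epsilon>(2) d(1)] by (auto simp: eventually_sequentially intro: less_imp_le)
  define A1 where "A1 = (\<Sum>k<K. S k) + d * D"
  define A0 where "A0 = (\<Sum>k<K. \<epsilon> k * S k)"
  have A: "0 \<le> A1" "0 \<le> A0" using S \<epsilon> D d by (auto simp: A1_def A0_def intro!: sum_nonneg add_nonneg_nonneg)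
  have step: "S k \<le> A1 + d * T" if T: "0 \<le> T" "(\<Sum>i<k. S i) \<le> T" for k T
  proof (cases "k < K")
    case True
    have "S k \<le> (\<Sum>k<K. S k)" using True S by (intro member_le_sum) auto
    moreover have "0 \<le> d * D" "0 \<le> d * T" using D d T by auto
    ultimately show ?thesis by (simp add: A1_def)
  next
    case False
    have "S k \<le> \<epsilon> k * (D + (\<Sum>i<k. S i))" by (rule le)
    also have "\<dots> \<le> d * (D + T)" using K[of k] False D T S d by (intro mult_mono add_mono) (auto intro!: add_nonneg_nonneg sum_nonneg)
    also have "\<dots> \<le> A1 + d * T" using S by (auto simp: A1_def algebra_simps intro!: sum_nonneg)
    finally show ?thesis .
  qed
  have total: "(\<Sum>k<N. if (\<Sum>i<k. S i) \<le> T then S k else 0) \<le> T + A1 + d * T" if T: "0 \<le> T" for T N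
  proof (induction N)
    case 0 then show ?case using T A d by simp
  next
    case (Suc N)
    show ?case
    proof (cases "(\<Sum>i<N. S i) \<le> T")
      case True
      have "(\<Sum>i<k. S i) \<le> T" if "k < Suc N" for k
        using sum_mono2[of "{..<N}" "{..<k}" S] that S True by fastforce
      then have "(\<Sum>k<Suc N. if (\<Sum>i<k. S i) \<le> T then S k else 0) = (\<Sum>k<Suc N. S k)"
        by (intro sum.cong) auto
      also have "\<dots> \<le> T + (A1 + d * T)" using True step[OF T True] by simp
      finally show ?thesis by simp
    qed (use Suc in simp)
  qed
  have "(\<Sum>k<N. if (\<Sum>i<k. S i) \<le> T then \<epsilon> k * S k else 0) \<le> A0 + d * (T + A1 + d * T)" if T: "0 \<le> T" for T N
  proof -
    have "(\<Sum>k<N. if (\<Sum>i<k. S i) \<le> T then \<epsilon> k * S k else 0)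
      \<le> (\<Sum>k<N. (if k < K then \<epsilon> k * S k else 0) + d * (if (\<Sum>i<k. S i) \<le> T then S k else 0))"
    proof (intro sum_mono)
      fix k
      show "(if (\<Sum>i<k. S i) \<le> T then \<epsilon> k * S k else 0)
        \<le> (if k < K then \<epsilon> k * S k else 0) + d * (if (\<Sum>i<k. S i) \<le> T then S k else 0)"
        using K[of k] S[of k] \<epsilon>(1)[of k] d mult_right_mono[of "\<epsilon> k" d "S k"] by (cases "k < K") auto
    qed
    also have "\<dots> = (\<Sum>k<N. if k < K then \<epsilon> k * S k else 0) + d * (\<Sum>k<N. if (\<Sum>i<k. S i) \<le> T then S k else 0)"
      by (simp add: sum.distrib sum_distrib_left)
    also have "(\<Sum>k<N. if k < K then \<epsilon> k * S k else 0) \<le> A0"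
    proof -
      have "(\<Sum>k<N. if k < K then \<epsilon> k * S k else 0) = (\<Sum>k\<in>{..<N} \<inter> {k. k < K}. \<epsilon> k * S k)"
        by (simp add: sum.inter_restrict)
      also have "\<dots> \<le> A0" unfolding A0_def using S \<epsilon> by (intro sum_mono2) auto
      finally show ?thesis .
    qed
    also have "d * (\<Sum>k<N. if (\<Sum>i<k. S i) \<le> T then S k else 0) \<le> d * (T + A1 + d * T)"
      using total[OF T] d by (intro mult_left_mono) auto
    finally show ?thesis by simp
  qed
  moreover have "A0 + d * (T + A1 + d * T) \<le> (A0 + A1) + \<delta> * T" if T: "0 \<le> T" for T
  proof -
    have "d * A1 \<le> A1" "d * (d * T) \<le> d * T" "2 * d * T \<le> \<delta> * T"
      using d T A mult_right_mono[of d 1] mult_right_mono[of "2 * d" \<delta> T] by auto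
    then show ?thesis by (simp add: algebra_simps)
  qed
  moreover have "S k \<le> (A0 + A1) + \<delta> * T" if "0 \<le> T" "(\<Sum>i<k. S i) \<le> T" for k T
    using step[OF that] A mult_right_mono[of d \<delta> T] d that by linarith
  ultimately show ?thesis by (intro exI[of _ "A0 + A1"]) (meson order_trans)
qed

section \<open>Value of the concatenated strategy\<close>

locale optimal_blocks = block_sequence P U Vs om t S nn G
  for P :: "'a::metric_space \<Rightarrow> (real \<Rightarrow> 'a) measure" and U Vs om t S nn G +
  fixes c :: "'a \<Rightarrow> 'a \<Rightarrow> real" and c1 a \<Lambda> D :: real and g :: "'a \<Rightarrow> real" and \<epsilon> \<kappa> :: "nat \<Rightarrow> real"
  assumes U: "compact U" and c_cont: "continuous_on (UNIV \<times> U) (\<lambda>(x, a). c x a)"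
    and c1: "0 < c1" and c_neg: "\<And>x e. e \<in> U \<Longrightarrow> c x e \<le> - c1"
    and g[measurable]: "g \<in> borel_measurable borel" and bd: "\<And>y. \<bar>g y\<bar> \<le> a"
    and \<epsilon>: "\<And>k. 0 \<le> \<epsilon> k" "\<epsilon> \<longlonglongrightarrow> 0" and D: "0 \<le> D"
    and growth: "\<And>k. S k \<le> \<epsilon> k * (D + (\<Sum>i<k. S i))"
    and cheap: "\<And>k y e. y \<in> G k \<Longrightarrow> e \<in> U \<Longrightarrow> - c y e \<le> \<epsilon> k * S k"
    and good: "\<And>k. ennreal ((\<kappa> k + a) * S k) + block_cost c k \<le> block_gain (\<lambda>y. ennreal (g y + a)) k"
    and wait: "\<And>k. block_wait k \<le> ennreal (\<epsilon> k * S k)"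
    and \<kappa>: "\<And>k. \<Lambda> - \<epsilon> k \<le> \<kappa> k" "\<And>k. - a \<le> \<kappa> k" and \<Lambda>: "- a \<le> \<Lambda>"
begin

definition visit :: "'a \<Rightarrow> real \<Rightarrow> nat \<Rightarrow> real" where "visit x T k = enn2real (visits (P x) T k)"

lemma visits_eq: "visits (P x) T k = ennreal (visit x T k)" "0 \<le> visit x T k" "visit x T k \<le> 1"
proof -
  have le: "visits (P x) T k \<le> 1" by (rule visits_le_1[OF opt.strategy_law_P])
  then show "visits (P x) T k = ennreal (visit x T k)"
    by (auto simp: visit_def ennreal_enn2real_if top_unique)
  show "0 \<le> visit x T k" by (simp add: visit_def)
  show "visit x T k \<le> 1" unfolding visit_def using le by (intro enn2real_leI) simp_all
qed

lemma S_sum_ge: "real k \<le> (\<Sum>i<k. S i)"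
  using sum_mono[of "{..<k}" "\<lambda>_. 1" S] S by simp

lemma visit_eq_0: "0 \<le> T \<Longrightarrow> T < (\<Sum>i<k. S i) \<Longrightarrow> visit x T k = 0"
  by (simp add: visit_def visits_eq_0)

text \<open>Blocks have length at least 1, so no block with number \<open>N\<close> or higher starts
  by time \<open>T\<close>, and the series is a finite sum.\<close>

lemma suminf_visits:
  assumes T: "0 \<le> T" "T < real N" and X: "\<And>k. X k = ennreal (r k)" "\<And>k. 0 \<le> r k"
  shows "(\<Sum>k. visits (P x) T k * X k) = ennreal (\<Sum>k<N. visit x T k * r k)"
proof -
  have "visits (P x) T k = 0" if "k \<notin> {..<N}" for k
    using that T S_sum_ge[of k] by (intro visits_eq_0) auto
  then have "(\<Sum>k. visits (P x) T k * X k) = (\<Sum>k<N. visits (P x) T k * X k)"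
    by (intro suminf_finite) auto
  also have "\<dots> = (\<Sum>k<N. ennreal (visit x T k * r k))"
    by (intro sum.cong refl) (simp add: visits_eq(1) X ennreal_mult[OF visits_eq(2) X(2)])
  also have "\<dots> = ennreal (\<Sum>k<N. visit x T k * r k)"
    using visits_eq(2) X(2) by (intro sum_ennreal) simp
  finally show ?thesis .
qed

lemma block_cost_finite: "block_cost c k \<noteq> top"
proof -
  have Fb: "ennreal (g y + a) \<le> ennreal (2 * a)" for y using bd[of y] by (intro ennreal_leI) linarith
  have a: "0 \<le> 2 * a" using bd[of undefined] by linarith
  have "block_gain (\<lambda>y. ennreal (g y + a)) k \<le> ennreal (2 * a * S k)"
    unfolding block_gain_def
    by (rule blk.later_segs_integral_le[OF om _ Fb a t _ start]) (use S[of k] in simp_all)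
  then have "block_cost c k \<le> ennreal (2 * a * S k)"
    using good[of k] by (meson order_trans add_increasing order_refl zero_le)
  then show ?thesis by (auto simp: top_unique)
qed

definition bc :: "nat \<Rightarrow> real" where "bc k = enn2real (block_cost c k)"

lemma block_cost_eq: "block_cost c k = ennreal (bc k)" "0 \<le> bc k"
  using block_cost_finite[of k] by (simp_all add: bc_def ennreal_enn2real_if)

text \<open>Impulse 0 takes place at time 0, hence from the initial state. This is the only cost
  that depends on the initial state, and it is finite.\<close>

lemma first_cost:
  assumes T: "0 \<le> T"
  shows "(\<integral>\<^sup>+w. imp_cost c Vopt T 0 w \<partial>control_law P x Vopt) = ennreal (- c x (entry 0))"
proof -
  interpret O: strategy_law P U Vopt "P x" by (rule opt.strategy_law_P)
  interpret Px: prob_space "P x" by (rule prob_space_P)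
  have "(\<integral>\<^sup>+w. imp_cost c Vopt T 0 w \<partial>control_law P x Vopt) = (\<integral>\<^sup>+\<omega>. imp_cost c Vopt T 0 (\<lambda>_. \<omega>) \<partial>P x)"
    unfolding opt.control_law_eq
    by (intro O.law_start opt.measurable_imp_cost opt.imp_cost_depends U c_cont)
  also have "\<dots> = (\<integral>\<^sup>+\<omega>. ennreal (- c x (entry 0)) \<partial>P x)"
    using start_P[of x] by (intro nn_integral_cong_AE) (auto simp: imp_cost_def Vopt_def elim: eventually_mono)
  finally show ?thesis by (simp add: Px.emeasure_space_1)
qed

lemma cost_bound:
  assumes T: "0 \<le> T" "T < real N"
  shows "(\<integral>\<^sup>+w. total_cost c Vopt T w \<partial>control_law P x Vopt)
    \<le> ennreal (- c x (entry 0) + (\<Sum>k<N. visit x T k * (bc k + \<epsilon> k * S k)))"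
proof -
  interpret O: strategy_law P U Vopt "P x" by (rule opt.strategy_law_P)
  have \<epsilon>S: "0 \<le> \<epsilon> k * S k" for k using \<epsilon>(1)[of k] S[of k] by simp
  have c0: "0 \<le> - c x (entry 0)" using c_neg[OF entry_in_U[of 0], of x] c1 by simp
  have "O.cost c T \<le> ennreal (- c x (entry 0)) + (\<Sum>k. visits (P x) T k * (block_cost c k + ennreal (\<epsilon> k * S k)))"
    using opt_cost_le[OF opt.strategy_law_P[of x] U c_cont T(1) cheap] first_cost[OF T(1), of x]
    by (simp add: opt.control_law_eq)
  also have "(\<Sum>k. visits (P x) T k * (block_cost c k + ennreal (\<epsilon> k * S k)))
    = ennreal (\<Sum>k<N. visit x T k * (bc k + \<epsilon> k * S k))"
    using T block_cost_eq \<epsilon>S by (intro suminf_visits) (simp_all add: ennreal_plus)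
  also have "ennreal (- c x (entry 0)) + \<dots> = ennreal (- c x (entry 0) + (\<Sum>k<N. visit x T k * (bc k + \<epsilon> k * S k)))"
    using c0 \<epsilon>S visits_eq(2) block_cost_eq(2) by (intro ennreal_plus[symmetric] sum_nonneg) simp_all
  finally show ?thesis by (simp add: O.cost_def opt.control_law_eq)
qed

text \<open>Each impulse costs at least \<open>c1\<close>, so a finite expected cost up to time
  \<open>m\<close> leaves only finitely many impulses by \<open>m\<close>, almost surely. There is
  no circularity: unlike \<open>opt_time_le\<close>, the estimate \<open>cost_bound\<close> does not
  presuppose that the impulse times tend to infinity.\<close>

lemma Vopt_cover: "AE w in control_law P x Vopt. \<forall>r. \<exists>n. ennreal r < tau n w"
proof -
  interpret O: strategy_law P U Vopt "P x" by (rule opt.strategy_law_P)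
  have "AE w in control_law P x Vopt. total_cost c Vopt (real m) w \<noteq> \<infinity>" for m
  proof (rule nn_integral_PInf_AE)
    have "imp_cost c Vopt (real m) n \<in> borel_measurable (control_law P x Vopt)" for n
      unfolding opt.control_law_eq by (intro O.measurable_from_law opt.measurable_imp_cost U c_cont)
    then show "total_cost c Vopt (real m) \<in> borel_measurable (control_law P x Vopt)"
      unfolding total_cost_eq[abs_def] by (intro borel_measurable_suminf_order)
    show "(\<integral>\<^sup>+w. total_cost c Vopt (real m) w \<partial>control_law P x Vopt) \<noteq> \<infinity>"
      using cost_bound[of "real m" "Suc m" x] by (auto simp: top_unique)
  qed
  then have "AE w in control_law P x Vopt. \<forall>m. total_cost c Vopt (real m) w \<noteq> \<infinity>"
    by (simp add: AE_all_countable)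
  then show ?thesis
    using AE_space
  proof eventually_elim
    case (elim w)
    then have w: "w \<in> space control_space" by (simp add: opt.control_law_eq O.space_law)
    show ?case
    proof (rule ccontr)
      assume "\<not> ?case"
      then obtain r where r: "\<And>n. tau n w \<le> ennreal r" by (auto simp: not_less)
      obtain m :: nat where m: "r \<le> real m" using real_arch_simple by blast
      have "ennreal c1 \<le> imp_cost c Vopt (real m) n w" for n
      proof -
        have "tau n w \<le> ennreal (real m)" using r[of n] m by (rule order_trans[OF _ ennreal_leI])
        moreover have "c y (xi n w) \<le> - c1" for y by (intro c_neg xi_in_U w)
        ultimately show ?thesis
          by (auto simp: imp_cost_def Vopt_def simp del: tau.simps xi.simps intro!: ennreal_leI simp: le_minus_iff)
      qed
      then have "(\<Sum>n. ennreal c1) \<le> total_cost c Vopt (real m) w"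
        unfolding total_cost_eq by (intro suminf_le summableI)
      moreover have "(\<Sum>n :: nat. ennreal c1) = \<infinity>"
      proof (rule ccontr)
        assume "(\<Sum>n :: nat. ennreal c1) \<noteq> \<infinity>"
        then have "summable (\<lambda>_ :: nat. c1)" using c1 by (intro summable_suminf_not_top) simp_all
        then show False using c1 by (simp only: summable_const_iff)
      qed
      ultimately show False using elim by (simp add: top_unique)
    qed
  qed
qed

lemma Vopt_admissible: "admissible P U x Vopt"
  unfolding admissible_def
proof (intro conjI is_strategy_Vopt)
  interpret O: strategy_law P U Vopt "P x" by (rule opt.strategy_law_P)
  show "AE w in control_law P x Vopt. (\<lambda>i. fst Vopt i w) \<longlonglongrightarrow> \<infinity>"
    using Vopt_cover AE_space
  proof eventually_elim
    case (elim w)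
    then have w: "w \<in> space control_space" by (simp add: opt.control_law_eq O.space_law)
    show ?case unfolding infinity_ennreal_def
    proof (rule order_tendstoI)
      fix y :: ennreal assume "y < top"
      then obtain r where r: "y = ennreal r" by (cases y) auto
      obtain n where "ennreal r < tau n w" using elim by blast
      then have "y < tau i w" if "n \<le> i" for i
        using opt.\<tau>_incr[OF w that] r by (simp add: Vopt_def less_le_trans del: tau.simps)
      then show "\<forall>\<^sub>F i in sequentially. y < fst Vopt i w"
        by (auto simp: eventually_sequentially Vopt_def simp del: tau.simps)
    qed simp
  qed
qed

text \<open>Time, gain and cost are all sums over blocks with the same weights
  \<open>visit x T k\<close>. The estimate of time bounds the weighted length of the blocks from
  below, \<open>good\<close> converts length into gain beyond the inner costs, and
  \<open>slow_growth\<close> makes the remaining errors small compared with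
  \<open>T\<close>.\<close>

lemma Vopt_value_bound:
  assumes \<delta>: "0 < \<delta>"
  shows "\<exists>A. \<forall>T\<ge>0. \<exists>Y Z. 0 \<le> Z \<and>
    (\<integral>w. (LINT s:{0..T}|lborel. g (controlled_process Vopt w s)) \<partial>control_law P x Vopt) = Y \<and>
    (\<integral>\<^sup>+w. total_cost c Vopt T w \<partial>control_law P x Vopt) = ennreal Z \<and> \<Lambda> * T - \<delta> * T - A \<le> Y - Z"
proof -
  interpret O: strategy_law P U Vopt "P x" by (rule opt.strategy_law_P)
  have a0: "0 \<le> a" using bd[of undefined] by linarith
  \<comment> \<open>The sum of the error coefficients of \<open>R\<close>:
    \<open>\<Lambda> + a\<close> for the time lost in waits, \<open>2 * a\<close> for the overrun at
    \<open>T\<close>, 1 for the amount by which \<open>\<kappa> k\<close> falls short of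
    \<open>\<Lambda>\<close>, and 1 for the impulses that open the later blocks.\<close>
  define b where "b = \<Lambda> + 3 * a + 2"
  have b: "0 < b" using a0 \<Lambda> by (simp add: b_def)
  have S0: "0 \<le> S k" for k using S[of k] by simp
  have "0 < \<delta> / b" using \<delta> b by simp
  from slow_growth[OF S0 \<epsilon> D growth this] obtain A where A:
    "\<And>T k. 0 \<le> T \<Longrightarrow> (\<Sum>i<k. S i) \<le> T \<Longrightarrow> S k \<le> A + \<delta> / b * T"
    "\<And>T N. 0 \<le> T \<Longrightarrow> (\<Sum>k<N. if (\<Sum>i<k. S i) \<le> T then \<epsilon> k * S k else 0) \<le> A + \<delta> / b * T"
    by blast
  let ?c0 = "- c x (entry 0)"
  have \<epsilon>S: "0 \<le> \<epsilon> k * S k" for k using \<epsilon>(1)[of k] S0[of k] by simp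
  have main: "\<exists>Y Z. 0 \<le> Z \<and>
    (\<integral>w. (LINT s:{0..T}|lborel. g (controlled_process Vopt w s)) \<partial>control_law P x Vopt) = Y \<and>
    (\<integral>\<^sup>+w. total_cost c Vopt T w \<partial>control_law P x Vopt) = ennreal Z \<and> \<Lambda> * T - \<delta> * T - (b * A + ?c0) \<le> Y - Z"
    if T: "0 \<le> T" for T
  proof -
    obtain N :: nat where N: "T < real N" using reals_Archimedean2 by blast
    define q where "q k = visit x T k" for k
    have q: "0 \<le> q k" "q k \<le> 1" for k using visits_eq by (simp_all add: q_def)
    define R where "R = A + \<delta> / b * T"
    define Y where "Y = enn2real (O.gain g a T)"
    define Z where "Z = enn2real (O.cost c T)"
    have c0: "0 \<le> ?c0" using c_neg[OF entry_in_U[of 0], of x] c1 by simp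
    have cost_le: "O.cost c T \<le> ennreal (?c0 + (\<Sum>k<N. q k * (bc k + \<epsilon> k * S k)))"
      using cost_bound[OF T N, of x] by (simp add: O.cost_def opt.control_law_eq q_def)
    have nn: "0 \<le> ?c0 + (\<Sum>k<N. q k * (bc k + \<epsilon> k * S k))"
      using c0 \<epsilon>S q block_cost_eq(2) by (intro add_nonneg_nonneg sum_nonneg) simp_all
    have Z: "O.cost c T = ennreal Z" "0 \<le> Z" "Z \<le> ?c0 + (\<Sum>k<N. q k * (bc k + \<epsilon> k * S k))"
      using cost_le nn unfolding Z_def by (auto simp: ennreal_enn2real_if top_unique intro: enn2real_leI)
    have Y: "O.gain g a T = ennreal Y" "0 \<le> Y"
      using O.gain_le[of g a T, OF bd T] by (auto simp: Y_def ennreal_enn2real_if top_unique)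
    have R0: "0 \<le> R" using A(1)[OF T, of 0] S[of 0] T by (simp add: R_def)
    have \<kappa>S: "0 \<le> (\<kappa> k + a) * S k" for k using \<kappa>(2)[of k] S0[of k] by simp
    have "ennreal (\<Sum>k<N. q k * ((\<kappa> k + a) * S k + bc k)) = (\<Sum>k. visits (P x) T k * (ennreal ((\<kappa> k + a) * S k) + block_cost c k))"
      unfolding q_def using T N block_cost_eq \<kappa>S
      by (intro suminf_visits[symmetric]) (simp_all add: ennreal_plus)
    also have "\<dots> \<le> (\<Sum>k. visits (P x) T k * block_gain (\<lambda>y. ennreal (g y + a)) k)"
      by (intro suminf_le summableI mult_left_mono good) simp
    also have "\<dots> \<le> O.gain g a T + ennreal (2 * a * R)"
      unfolding R_def by (rule opt_gain_ge[OF opt.strategy_law_P g bd T A(1)[OF T]])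
    also have "\<dots> = ennreal (Y + 2 * a * R)" using Y a0 R0 by simp
    finally have gain: "(\<Sum>k<N. q k * ((\<kappa> k + a) * S k + bc k)) \<le> Y + 2 * a * R"
      using Y a0 R0 by (simp add: ennreal_le_iff del: ennreal_plus)
    have "ennreal T \<le> (\<Sum>k. visits (P x) T k * (ennreal (S k) + block_wait k))"
      by (rule opt_time_le[OF opt.strategy_law_P Vopt_cover[of x, unfolded opt.control_law_eq]])
    also have "\<dots> \<le> (\<Sum>k. visits (P x) T k * ennreal (S k + \<epsilon> k * S k))"
      using wait S0 \<epsilon>S by (intro suminf_le summableI mult_left_mono) (simp_all add: add_left_mono)
    also have "\<dots> = ennreal (\<Sum>k<N. q k * (S k + \<epsilon> k * S k))"
      unfolding q_def using T N S0 \<epsilon>S by (intro suminf_visits) auto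
    finally have "ennreal T \<le> ennreal (\<Sum>k<N. q k * (S k + \<epsilon> k * S k))" .
    moreover have "0 \<le> (\<Sum>k<N. q k * (S k + \<epsilon> k * S k))" using q S0 \<epsilon>S by (intro sum_nonneg) simp
    ultimately have time: "T \<le> (\<Sum>k<N. q k * S k) + (\<Sum>k<N. q k * (\<epsilon> k * S k))"
      by (simp add: ennreal_le_iff ring_distribs sum.distrib)
    have err: "(\<Sum>k<N. q k * (\<epsilon> k * S k)) \<le> R"
    proof -
      have "(\<Sum>k<N. q k * (\<epsilon> k * S k)) \<le> (\<Sum>k<N. if (\<Sum>i<k. S i) \<le> T then \<epsilon> k * S k else 0)"
      proof (intro sum_mono)
        fix k
        show "q k * (\<epsilon> k * S k) \<le> (if (\<Sum>i<k. S i) \<le> T then \<epsilon> k * S k else 0)"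
          using visit_eq_0[OF T, of k x] q[of k] \<epsilon>S[of k] mult_right_mono[of "q k" 1 "\<epsilon> k * S k"]
          by (auto simp: q_def)
      qed
      then show ?thesis using A(2)[OF T, of N] by (simp add: R_def)
    qed
    have "(\<Lambda> + a) * (\<Sum>k<N. q k * S k) - (\<Sum>k<N. q k * (\<epsilon> k * S k)) \<le> (\<Sum>k<N. q k * ((\<kappa> k + a) * S k))"
    proof -
      have "(\<Lambda> + a) * (\<Sum>k<N. q k * S k) - (\<Sum>k<N. q k * (\<epsilon> k * S k)) = (\<Sum>k<N. q k * ((\<Lambda> - \<epsilon> k + a) * S k))"
        by (simp add: sum_distrib_left sum_subtractf[symmetric]) (intro sum.cong refl, simp add: algebra_simps)
      also have "\<dots> \<le> (\<Sum>k<N. q k * ((\<kappa> k + a) * S k))"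
        using \<kappa>(1) q S0 by (intro sum_mono mult_left_mono mult_right_mono add_right_mono) auto
      finally show ?thesis .
    qed
    moreover have "(\<Lambda> + a) * (T - R) \<le> (\<Lambda> + a) * (\<Sum>k<N. q k * S k)"
      using time err \<Lambda> by (intro mult_left_mono) auto
    ultimately have "(\<Lambda> + a) * (T - R) - R \<le> (\<Sum>k<N. q k * ((\<kappa> k + a) * S k))" using err by linarith
    \<comment> \<open>The inner costs \<open>bc\<close> also occur in the upper bound for
      \<open>Z\<close> with the same weights, so they cancel in \<open>Y - Z\<close>.\<close>
    then have "(\<Lambda> + a) * (T - R) - R - 2 * a * R + (\<Sum>k<N. q k * bc k) \<le> Y"
      using gain by (simp add: distrib_left sum.distrib)
    moreover have "Z \<le> ?c0 + (\<Sum>k<N. q k * bc k) + R"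
      using Z(3) err by (simp add: ring_distribs sum.distrib)
    ultimately have "(\<Lambda> + a) * (T - R) - 2 * R - 2 * a * R - ?c0 \<le> Y - Z" by linarith
    moreover have "b * R = b * A + \<delta> * T" using b by (simp add: R_def ring_distribs)
    ultimately have "\<Lambda> * T - \<delta> * T - (b * A + ?c0) \<le> (Y - a * T) - Z"
      by (simp add: b_def algebra_simps)
    then show ?thesis
      using Z O.integral_controlled[OF g bd T]
      by (intro exI[of _ "Y - a * T"] exI[of _ Z]) (simp add: opt.control_law_eq O.cost_def Y_def)
  qed
  then show ?thesis by (intro exI[of _ "b * A + ?c0"]) blast
qed

lemma Vopt_reward: "ereal \<Lambda> \<le> reward P c g x Vopt"
  unfolding reward_def le_Liminf_iff
proof (intro allI impI)
  fix y assume "y < ereal \<Lambda>"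
  from ereal_dense2[OF this] obtain r where r: "y < ereal r" "r < \<Lambda>" by auto
  define \<delta> where "\<delta> = (\<Lambda> - r) / 2"
  have \<delta>: "0 < \<delta>" using r by (simp add: \<delta>_def)
  from Vopt_value_bound[OF this, of x] obtain A where A: "\<And>T. 0 \<le> T \<Longrightarrow> \<exists>Y Z. 0 \<le> Z \<and>
    (\<integral>w. (LINT s:{0..T}|lborel. g (controlled_process Vopt w s)) \<partial>control_law P x Vopt) = Y \<and>
    (\<integral>\<^sup>+w. total_cost c Vopt T w \<partial>control_law P x Vopt) = ennreal Z \<and> \<Lambda> * T - \<delta> * T - A \<le> Y - Z"
    by blast
  show "\<forall>\<^sub>F T in at_top. y < ereal (1 / T) * (ereal (\<integral>w. (LINT s:{0..T}|lborel. g (controlled_process Vopt w s)) \<partial>control_law P x Vopt)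
      - enn2ereal (\<integral>\<^sup>+w. total_cost c Vopt T w \<partial>control_law P x Vopt))"
    using eventually_ge_at_top[of "max 1 (A / \<delta>)"]
  proof eventually_elim
    case (elim T)
    then have T: "0 < T" "A \<le> \<delta> * T" using \<delta> by (auto simp: field_simps)
    obtain Y Z where YZ: "0 \<le> Z"
      "(\<integral>w. (LINT s:{0..T}|lborel. g (controlled_process Vopt w s)) \<partial>control_law P x Vopt) = Y"
      "(\<integral>\<^sup>+w. total_cost c Vopt T w \<partial>control_law P x Vopt) = ennreal Z" "\<Lambda> * T - \<delta> * T - A \<le> Y - Z"
      using A[of T] T by auto
    have "r * T = \<Lambda> * T - \<delta> * T - \<delta> * T" by (simp add: \<delta>_def field_simps)
    then have "r * T \<le> Y - Z" using YZ(4) T(2) by linarith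
    then have "r \<le> 1 / T * (Y - Z)" using T by (simp add: field_simps)
    then have "ereal r \<le> ereal (1 / T) * (ereal Y - enn2ereal (ennreal Z))" using YZ(1) by simp
    then show ?case using r(1) unfolding YZ by (rule less_le_trans[rotated])
  qed
qed

end

lemma slow_index:
  fixes u :: "nat \<Rightarrow> nat"
  shows "\<exists>m :: nat \<Rightarrow> nat. filterlim m at_top sequentially \<and> (\<forall>k. m k = 0 \<or> u (m k) \<le> k)"
proof -
  define A where "A k = {p. p \<le> k \<and> (p = 0 \<or> u p \<le> k)}" for k
  have fin: "finite (A k)" for k by (rule finite_subset[of _ "{..k}"]) (auto simp: A_def)
  have ne: "0 \<in> A k" for k by (simp add: A_def)
  have "Max (A k) \<in> A k" for k using Max_in[OF fin, of k] ne by blast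
  then have "\<forall>k. Max (A k) = 0 \<or> u (Max (A k)) \<le> k" by (auto simp: A_def)
  moreover have "filterlim (\<lambda>k. Max (A k)) at_top sequentially"
    unfolding filterlim_at_top
  proof
    fix p
    have "p \<le> Max (A k)" if "max p (u p) \<le> k" for k
      using that by (intro Max_ge fin) (simp add: A_def)
    then show "\<forall>\<^sub>F k in sequentially. p \<le> Max (A k)" by (rule eventually_sequentiallyI)
  qed
  ultimately show ?thesis by blast
qed

section \<open>Choice of the blocks\<close>

context impulse_problem
begin

definition good_block :: "('a \<Rightarrow> real) \<Rightarrow> real \<Rightarrow> real \<Rightarrow> real \<Rightarrow> 'a strategy \<Rightarrow> (real \<Rightarrow> 'a) \<Rightarrow>
    real \<Rightarrow> real \<Rightarrow> (nat \<Rightarrow> real) \<Rightarrow> 'a set \<Rightarrow> bool" where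
  "good_block g a \<kappa> \<epsilon> V \<omega> t S n G \<longleftrightarrow> is_strategy U V \<and> \<omega> \<in> cadlag_paths \<and> 0 \<le> t \<and> 1 \<le> S \<and>
    fst V 0 (\<lambda>_. \<omega>) = ennreal t \<and>
    strict_mono n \<and> (\<forall>k. real k \<le> n k) \<and> G \<in> sets borel \<and> (\<forall>y\<in>G. \<forall>e\<in>U. - c y e \<le> \<epsilon> * S) \<and>
    ennreal ((\<kappa> + a) * S) + (\<Sum>j. \<integral>\<^sup>+w. imp_cost c V (t + S) (Suc j) w \<partial>strategy.law P V (return path_space \<omega>))
      \<le> (\<Sum>j. \<integral>\<^sup>+w. seg V (\<lambda>y. ennreal (g y + a)) (t + S) (Suc j) w \<partial>strategy.law P V (return path_space \<omega>)) \<and>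
    (\<Sum>j. \<integral>\<^sup>+w. (if fst V j w \<le> ennreal (t + S) \<and> ennreal (t + S) < fst V (Suc j) w
        then wait_time n G (t + S) (w (Suc j)) else 0) \<partial>strategy.law P V (return path_space \<omega>)) \<le> ennreal (\<epsilon> * S)"

lemma good_block_of_value:
  assumes g: "g \<in> borel_measurable borel" and bd: "\<And>y. \<bar>g y\<bar> \<le> a" and a: "0 < a"
    and \<kappa>: "(\<integral>y. g y \<partial>\<mu>) \<le> \<kappa>" and lt: "ereal \<kappa> < (SUP x. opt_value P U c g x)" and \<epsilon>: "0 < \<epsilon>"
  shows "\<exists>V \<omega> t S n G. good_block g a \<kappa> \<epsilon> V \<omega> t S n G"
proof -
  obtain x V where V: "admissible P U x V" "ereal \<kappa> < reward P c g x V"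
    using lt by (auto simp: less_SUP_iff opt_value_def)
  then have "is_strategy U V" "AE w in control_law P x V. (\<lambda>i. fst V i w) \<longlonglongrightarrow> \<infinity>"
    by (auto simp: admissible_def)
  from good_block_exists[OF this g bd a \<kappa> V(2) \<epsilon>] \<open>is_strategy U V\<close>
  show ?thesis unfolding good_block_def by blast
qed

text \<open>After the shift by \<open>a\<close>, a block of length \<open>S\<close> earns at most
  \<open>2 * a * S\<close>. This is what makes the supremum of the values a real number.\<close>

lemma good_block_rate_le:
  assumes g: "g \<in> borel_measurable borel" and bd: "\<And>y. \<bar>g y\<bar> \<le> a" and blk: "good_block g a \<kappa> \<epsilon> V \<omega> t S n G"
  shows "\<kappa> \<le> a"
proof -
  interpret strategy P U V by unfold_locales (use blk in \<open>simp add: good_block_def\<close>)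
  have a: "0 \<le> 2 * a" using bd[of undefined] by linarith
  have S: "1 \<le> S" using blk by (simp add: good_block_def)
  have Fb: "ennreal (g y + a) \<le> ennreal (2 * a)" for y using bd[of y] by (intro ennreal_leI) linarith
  have Fm: "(\<lambda>y. ennreal (g y + a)) \<in> borel_measurable borel" using g by measurable
  have "(\<Sum>j. \<integral>\<^sup>+w. seg V (\<lambda>y. ennreal (g y + a)) (t + S) (Suc j) w \<partial>law (return path_space \<omega>)) \<le> ennreal (2 * a * S)"
    using blk by (intro later_segs_integral_le Fm Fb a) (simp_all add: good_block_def)
  then have "ennreal ((\<kappa> + a) * S) \<le> ennreal (2 * a * S)"
    using blk unfolding good_block_def by (meson order_trans add_increasing2 order_refl zero_le)
  then have "(\<kappa> + a) * S \<le> 2 * a * S" using a S by (simp add: ennreal_le_iff)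
  then show ?thesis using S by simp
qed

lemma optimal_strategy_exists:
  assumes g: "g \<in> borel_measurable borel" and bd: "\<And>y. \<bar>g y\<bar> \<le> a" and a: "0 < a"
    and gt: "ereal (\<integral>y. g y \<partial>\<mu>) < (SUP x. opt_value P U c g x)"
  shows "\<exists>\<Lambda> V. is_strategy U V \<and> (\<forall>w. fst V 0 w = 0) \<and>
    (\<forall>x. admissible P U x V \<and> reward P c g x V = ereal \<Lambda> \<and> opt_value P U c g x = ereal \<Lambda>)"
proof -
  let ?m = "\<integral>y. g y \<partial>\<mu>"
  let ?L = "SUP x. opt_value P U c g x"
  have m: "- a \<le> ?m"
  proof -
    have "integrable \<mu> g"
      using g bd by (intro \<mu>.integrable_const_bound[of _ a]) (auto simp: measurable_cong_sets[OF sets_\<mu> refl])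
    then have "(\<integral>y. - a \<partial>\<mu>) \<le> ?m" using bd by (intro integral_mono) (auto simp: abs_le_iff minus_le_iff)
    then show ?thesis using \<mu>.prob_space by simp
  qed
  have "?L \<le> ereal a"
  proof (rule ccontr)
    assume "\<not> ?L \<le> ereal a"
    then have "ereal (max ?m a) < ?L" using gt by (auto simp: max_def)
    then obtain r where r: "ereal (max ?m a) < ereal r" "ereal r < ?L" using ereal_dense2 by blast
    from good_block_of_value[OF g bd a _ r(2), of 1] r(1) obtain V \<omega> t S n G where "good_block g a r 1 V \<omega> t S n G" by auto
    from good_block_rate_le[OF g bd this] r(1) show False by simp
  qed
  then obtain \<Lambda> where \<Lambda>: "?L = ereal \<Lambda>" using gt by (cases ?L) auto
  \<comment> \<open>The maximum with \<open>?m\<close> provides the lower bound on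
    \<open>\<kappa>\<close> that \<open>good_block_of_value\<close> asks for, and it stays below
    \<open>\<Lambda>\<close> because \<open>gt\<close> is strict.\<close>
  define \<kappa> where "\<kappa> p = max ?m (\<Lambda> - 1 / (real p + 1))" for p :: nat
  have "\<exists>V \<omega> t S n G. good_block g a (\<kappa> p) (1 / (real p + 1)) V \<omega> t S n G" for p
    using gt by (intro good_block_of_value g bd a) (auto simp: \<Lambda> \<kappa>_def max_def)
  then have "\<forall>p. \<exists>V \<omega> t S n G. good_block g a (\<kappa> p) (1 / (real p + 1)) V \<omega> t S n G" by blast
  from choice[OF this] obtain Vp where "\<forall>p. \<exists>\<omega> t S n G. good_block g a (\<kappa> p) (1 / (real p + 1)) (Vp p) \<omega> t S n G" ..
  from choice[OF this] obtain \<omega>p where "\<forall>p. \<exists>t S n G. good_block g a (\<kappa> p) (1 / (real p + 1)) (Vp p) (\<omega>p p) t S n G" ..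
  from choice[OF this] obtain tp where "\<forall>p. \<exists>S n G. good_block g a (\<kappa> p) (1 / (real p + 1)) (Vp p) (\<omega>p p) (tp p) S n G" ..
  from choice[OF this] obtain Sp where "\<forall>p. \<exists>n G. good_block g a (\<kappa> p) (1 / (real p + 1)) (Vp p) (\<omega>p p) (tp p) (Sp p) n G" ..
  from choice[OF this] obtain np where "\<forall>p. \<exists>G. good_block g a (\<kappa> p) (1 / (real p + 1)) (Vp p) (\<omega>p p) (tp p) (Sp p) (np p) G" ..
  from choice[OF this] obtain Gp where
    blk: "\<And>p. good_block g a (\<kappa> p) (1 / (real p + 1)) (Vp p) (\<omega>p p) (tp p) (Sp p) (np p) (Gp p)" by blast
  \<comment> \<open>Block \<open>p > 0\<close> is used only from index \<open>(p + 1) * Sp p\<close>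
    on. By then at least this much time has elapsed, since every block has length at least 1, so
    block \<open>p\<close> takes at most the fraction \<open>1 / (p + 1)\<close> of the elapsed
    time.\<close>
  obtain m :: "nat \<Rightarrow> nat" where m: "filterlim m at_top sequentially"
    "\<And>k. m k = 0 \<or> nat \<lceil>(real (m k) + 1) * Sp (m k)\<rceil> \<le> k"
    using slow_index[of "\<lambda>p. nat \<lceil>(real p + 1) * Sp p\<rceil>"] by blast
  have Sp: "1 \<le> Sp p" for p using blk[of p] by (simp add: good_block_def)
  interpret B: block_sequence P U "\<lambda>k. Vp (m k)" "\<lambda>k. \<omega>p (m k)" "\<lambda>k. tp (m k)" "\<lambda>k. Sp (m k)" "\<lambda>k. np (m k)" "\<lambda>k. Gp (m k)"
    by unfold_locales (use blk in \<open>auto simp: good_block_def\<close>)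
  \<comment> \<open>The offset \<open>Sp 0\<close> makes the growth condition hold for the indices
    with \<open>m k = 0\<close>, which are subject to no delay.\<close>
  interpret O: optimal_blocks P U "\<lambda>k. Vp (m k)" "\<lambda>k. \<omega>p (m k)" "\<lambda>k. tp (m k)" "\<lambda>k. Sp (m k)" "\<lambda>k. np (m k)" "\<lambda>k. Gp (m k)"
    c c1 a \<Lambda> "Sp 0" g "\<lambda>k. 1 / (real (m k) + 1)" "\<lambda>k. \<kappa> (m k)"
  proof unfold_locales
    show "(\<lambda>k. 1 / (real (m k) + 1)) \<longlonglongrightarrow> 0"
      by (rule filterlim_compose[OF _ m(1), of "\<lambda>p. 1 / (real p + 1)"])
         (use LIMSEQ_inverse_real_of_nat in \<open>simp add: inverse_eq_divide add.commute\<close>)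
    fix k
    have sum: "real k \<le> (\<Sum>i<k. Sp (m i))" using sum_mono[of "{..<k}" "\<lambda>_. 1" "\<lambda>i. Sp (m i)"] Sp by simp
    have "(real (m k) + 1) * Sp (m k) \<le> Sp 0 + (\<Sum>i<k. Sp (m i))"
    proof (cases "m k = 0")
      case True then show ?thesis using sum by simp
    next
      case False
      then have "(real (m k) + 1) * Sp (m k) \<le> real k" using m(2)[of k] by linarith
      then show ?thesis using sum Sp[of 0] by linarith
    qed
    then show "Sp (m k) \<le> 1 / (real (m k) + 1) * (Sp 0 + (\<Sum>i<k. Sp (m i)))" by (simp add: field_simps)
    show "ennreal ((\<kappa> (m k) + a) * Sp (m k)) + B.block_cost c k \<le> B.block_gain (\<lambda>y. ennreal (g y + a)) k"
      "B.block_wait k \<le> ennreal (1 / (real (m k) + 1) * Sp (m k))"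
      using blk[of "m k"] by (simp_all add: good_block_def B.block_cost_def B.block_gain_def B.block_wait_def del: ennreal_plus)
    show "\<Lambda> - 1 / (real (m k) + 1) \<le> \<kappa> (m k)" by (simp add: \<kappa>_def)
    show "- a \<le> \<kappa> (m k)" using \<open>- a \<le> ?m\<close> by (simp add: \<kappa>_def)
    show "- a \<le> \<Lambda>" using \<open>- a \<le> ?m\<close> gt \<Lambda> by simp
    show "0 \<le> Sp 0" using Sp[of 0] by simp
    fix y e assume "y \<in> Gp (m k)" "e \<in> U"
    then show "- c y e \<le> 1 / (real (m k) + 1) * Sp (m k)" using blk[of "m k"] by (simp add: good_block_def)
  qed (use U c_cont c1 c_neg g bd in auto)
  have "reward P c g x B.Vopt = ereal \<Lambda> \<and> opt_value P U c g x = ereal \<Lambda>" for x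
  proof -
    have "reward P c g x B.Vopt \<le> opt_value P U c g x"
      unfolding opt_value_def using O.Vopt_admissible by (intro SUP_upper) simp
    moreover have "opt_value P U c g x \<le> ?L" by (rule SUP_upper) simp
    ultimately show ?thesis using O.Vopt_reward[of x] unfolding \<Lambda> by auto
  qed
  then show ?thesis
    using O.Vopt_admissible B.is_strategy_Vopt by (intro exI[of _ \<Lambda>] exI[of _ B.Vopt]) (simp add: B.Vopt_def)
qed

end

section \<open>Controlled occupation times\<close>

lemma occupation_time_le:
  "occupation_time A \<sigma> \<omega> \<le> \<sigma>"
proof (cases \<sigma>)
  case (real q)
  have "occupation_time A \<sigma> \<omega> \<le> (\<integral>\<^sup>+s. indicator {0..q} s \<partial>lborel)"
    unfolding occupation_time_def using real
    by (intro nn_integral_mono) (auto simp: indicator_def ennreal_le_iff)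
  then show ?thesis using real by simp
qed simp

context strategy
begin

text \<open>For fixed coordinates up to \<open>n\<close> this is a stopping time of the restarted path, to which condition (C) applies.\<close>

definition seg_length :: "real \<Rightarrow> nat \<Rightarrow> (nat \<Rightarrow> real \<Rightarrow> 'a) \<Rightarrow> (real \<Rightarrow> 'a) \<Rightarrow> ennreal" where
  "seg_length T n w \<omega> = min (\<tau> (Suc n) (w(Suc n := paste (enn2real (\<tau> n w)) (w n) \<omega>))) (ennreal T) - \<tau> n w"

text \<open>The coordinates up to \<open>n\<close> are fixed, so paths that agree up to
  \<open>s\<close> give configurations that agree up to \<open>s + t\<close>;
  \<open>\<tau>_nonanticipating\<close> then applies to impulse \<open>n + 1\<close>.\<close>

lemma stopping_time_seg_length:
  assumes w: "w \<in> space control_space" and t: "\<tau> n w = ennreal t" "0 \<le> t"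
  shows "stopping_time path_filtration (seg_length T n w)"
proof (rule stopping_time_pathI)
  have "(\<lambda>\<omega>. w(Suc n := paste t (w n) \<omega>)) \<in> path_space \<rightarrow>\<^sub>M control_space"
    using w t by (intro measurable_control_upd measurable_paste) (auto simp: space_control_space space_path_space)
  from measurable_compose[OF this measurable_\<tau>]
  have [measurable]: "(\<lambda>\<omega>. \<tau> (Suc n) (w(Suc n := paste t (w n) \<omega>))) \<in> borel_measurable path_space" .
  show "seg_length T n w \<in> borel_measurable path_space"
    unfolding seg_length_def[abs_def] using t by simp
  fix \<omega> \<omega>' s
  assume \<omega>: "\<omega> \<in> cadlag_paths" "\<omega>' \<in> cadlag_paths" and le: "seg_length T n w \<omega> \<le> s"
    and eq: "\<And>r. 0 \<le> r \<Longrightarrow> ennreal r \<le> s \<Longrightarrow> \<omega> r = \<omega>' r"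
  let ?u = "\<lambda>\<omega>. w(Suc n := paste t (w n) \<omega>)"
  have wn: "w n \<in> cadlag_paths" using w by (auto simp: space_control_space)
  have u: "?u \<omega> \<in> space control_space" "?u \<omega>' \<in> space control_space"
    using \<omega> wn t by (auto intro!: control_space_upd w paste_cadlag)
  have "min (\<tau> (Suc n) (?u \<omega>)) (ennreal T) \<le> s + ennreal t"
    using le t by (simp add: seg_length_def ennreal_minus_le_iff add.commute)
  moreover have "\<tau> (Suc n) (?u \<omega>') \<le> s + ennreal t" if le': "\<tau> (Suc n) (?u \<omega>) \<le> s + ennreal t"
  proof -
    have "agree (Suc (Suc n)) (s + ennreal t) (?u \<omega>) (?u \<omega>')"
      unfolding agree_def
    proof (intro allI impI)
      fix i r assume r: "0 \<le> r" "ennreal r \<le> s + ennreal t"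
      show "?u \<omega> i r = ?u \<omega>' i r"
      proof (cases "i = Suc n \<and> t \<le> r")
        case True
        then have "ennreal (r - t) \<le> s" using r t by (simp add: ennreal_minus[symmetric] ennreal_minus_le_iff add.commute)
        then show ?thesis using True eq[of "r - t"] by (simp add: paste_def)
      qed (auto simp: paste_def)
    qed
    from \<tau>_nonanticipating[OF u this le'] le' show ?thesis by (simp only:)
  qed
  ultimately have "min (\<tau> (Suc n) (?u \<omega>')) (ennreal T) \<le> s + ennreal t"
    by (auto simp: min_le_iff_disj)
  then show "seg_length T n w \<omega>' \<le> s"
    using t by (simp add: seg_length_def ennreal_minus_le_iff add.commute)
qed

lemma seg_restart:
  assumes w: "w \<in> space control_space" and t: "\<tau> n w = ennreal t" "0 \<le> t" and \<omega>: "\<omega> \<in> cadlag_paths"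
    and F: "F \<in> borel_measurable borel"
  shows "seg V F T (Suc n) (w(Suc n := paste t (w n) \<omega>)) =
    (\<integral>\<^sup>+r. (if 0 \<le> r \<and> ennreal r < seg_length T n w \<omega> then F (\<omega> r) else 0) \<partial>lborel)"
proof -
  let ?u = "w(Suc n := paste t (w n) \<omega>)"
  let ?f = "\<lambda>s. if s < T \<and> in_seg V (Suc n) ?u s then F (paste t (w n) \<omega> s) else 0"
  have wn: "w n \<in> cadlag_paths" using w by (auto simp: space_control_space)
  have p: "paste t (w n) \<omega> \<in> cadlag_paths" using \<omega> wn t by (intro paste_cadlag)
  have u: "?u \<in> space control_space" by (rule control_space_upd[OF w p])
  have \<tau>n: "\<tau> n ?u = ennreal t" using depends_uptoD[OF \<tau>_depends[of n] u w] t by simp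
  have "paste t (w n) \<omega> \<in> borel_measurable borel"
    using measurable_path_eval[of "\<lambda>_. paste t (w n) \<omega>" borel "\<lambda>s. s"] p by (simp add: space_path_space)
  note [measurable] = measurable_compose[OF this F]
  have [measurable]: "Measurable.pred borel (in_seg V (Suc n) ?u)"
    unfolding in_seg_def[abs_def] by measurable
  have fm: "?f \<in> borel_measurable borel" by measurable
  have "seg V F T (Suc n) ?u = (\<integral>\<^sup>+r. ?f (t + 1 * r) \<partial>lborel)"
    unfolding seg_def fun_upd_same by (subst nn_integral_real_affine[OF fm, where c=1 and t=t]) simp_all
  also have "\<dots> = (\<integral>\<^sup>+r. (if 0 \<le> r \<and> ennreal r < seg_length T n w \<omega> then F (\<omega> r) else 0) \<partial>lborel)"
  proof (rule nn_integral_cong)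
    fix r
    show "?f (t + 1 * r) = (if 0 \<le> r \<and> ennreal r < seg_length T n w \<omega> then F (\<omega> r) else 0)"
    proof (cases "0 \<le> r")
      case True
      have "ennreal r < seg_length T n w \<omega> \<longleftrightarrow> ennreal (t + r) < \<tau> (Suc n) ?u \<and> ennreal (t + r) < ennreal T"
        using t True by (simp add: seg_length_def less_diff_eq_ennreal ennreal_plus[symmetric] add.commute del: ennreal_plus)
      moreover have "ennreal (t + r) < ennreal T \<longleftrightarrow> t + r < T" using t True by (intro ennreal_less_iff) simp
      moreover have "ennreal t \<le> ennreal (t + r)" using True by (intro ennreal_leI) simp
      moreover have "paste t (w n) \<omega> (t + r) = \<omega> r" using t True by (simp add: paste_def)
      ultimately show ?thesis using True t
        by (auto simp: in_seg_def seg_start_def \<tau>n simp del: ennreal_plus)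
    next
      case False
      then have "\<not> (0 \<le> t + r \<and> ennreal t \<le> ennreal (t + r))" using t by (auto simp: ennreal_le_iff)
      then have "\<not> in_seg V (Suc n) ?u (t + 1 * r)" by (auto simp: in_seg_def seg_start_def \<tau>n simp del: ennreal_plus)
      then show ?thesis using False by simp
    qed
  qed
  finally show ?thesis .
qed

end

context strategy_law
begin

text \<open>Given the coordinates up to \<open>n\<close>, the next segment is a fresh process from a
  point of \<open>U\<close>, observed up to the stopping time \<open>seg_length\<close>, which is at
  most \<open>T\<close> and so has finite mean. Mean 0 is excluded by the hypothesis
  \<open>e\<close>, but then the occupation time has mean 0 as well.\<close>

lemma seg_indicator_le:
  assumes A[measurable]: "A \<in> sets borel"
    and e: "\<And>y \<sigma>. y \<in> U \<Longrightarrow> stopping_time path_filtration \<sigma> \<Longrightarrow> 0 < (\<integral>\<^sup>+\<omega>. \<sigma> \<omega> \<partial>P y) \<Longrightarrow> (\<integral>\<^sup>+\<omega>. \<sigma> \<omega> \<partial>P y) < \<infinity> \<Longrightarrow>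
      (\<integral>\<^sup>+\<omega>. occupation_time A (\<sigma> \<omega>) \<omega> \<partial>P y) / (\<integral>\<^sup>+\<omega>. \<sigma> \<omega> \<partial>P y) \<le> e"
  shows "(\<integral>\<^sup>+w. seg V (indicator A) T (Suc n) w \<partial>law \<nu>) \<le> e * (\<integral>\<^sup>+w. seg V (\<lambda>_. 1) T (Suc n) w \<partial>law \<nu>)"
proof -
  let ?A = "indicator A :: 'a \<Rightarrow> ennreal"
  have F[measurable]: "?A \<in> borel_measurable borel" by simp
  have one: "(\<lambda>_. 1 :: ennreal) \<in> borel_measurable (borel :: 'a measure)" by simp
  note mA = measurable_seg[OF F, of T "Suc n"] and m1 = measurable_seg[OF one, of T "Suc n"]
  have step: "(\<integral>\<^sup>+\<omega>. seg V ?A T (Suc n) (w(Suc n := \<omega>)) \<partial>kern n w)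
      \<le> e * (\<integral>\<^sup>+\<omega>. seg V (\<lambda>_. 1) T (Suc n) (w(Suc n := \<omega>)) \<partial>kern n w)"
    if w: "w \<in> space control_space" for w
  proof -
    have upd: "(\<lambda>\<omega>. w(Suc n := \<omega>)) \<in> path_space \<rightarrow>\<^sub>M control_space"
      by (intro measurable_control_upd) (use w in simp_all)
    note kA = nn_integral_kern[OF w measurable_compose[OF upd mA], of n]
      and k1 = nn_integral_kern[OF w measurable_compose[OF upd m1], of n]
    show ?thesis
    proof (cases "\<tau> n w = \<infinity>")
      case True
      have wn: "w n \<in> cadlag_paths" using w by (auto simp: space_control_space)
      have "\<tau> n (w(Suc n := w n)) = \<infinity>"
        using depends_uptoD[OF \<tau>_depends[of n] control_space_upd[OF w wn] w] True by simp
      then have "seg V ?A T (Suc n) (w(Suc n := w n)) = 0"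
        by (simp add: seg_def in_seg_def seg_start_def top_unique cong: if_cong)
      then show ?thesis unfolding kA using True by simp
    next
      case False
      then obtain t where t: "\<tau> n w = ennreal t" "0 \<le> t" by (cases "\<tau> n w") auto
      let ?\<sigma> = "seg_length T n w" and ?y = "\<xi> n w"
      have st: "stopping_time path_filtration ?\<sigma>" by (rule stopping_time_seg_length[OF w t])
      have y: "?y \<in> U" by (rule \<xi>_in_U[OF w])
      interpret Py: prob_space "P ?y" by (rule prob_space_P)
      have occ: "(\<integral>\<^sup>+r. (if 0 \<le> r \<and> ennreal r < ?\<sigma> \<omega> then ?A (\<omega> r) else 0) \<partial>lborel) \<le> occupation_time A (?\<sigma> \<omega>) \<omega>" for \<omega>
        unfolding occupation_time_def by (intro nn_integral_mono) (auto simp: indicator_def)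
      have len: "(\<integral>\<^sup>+r. (if 0 \<le> r \<and> ennreal r < ?\<sigma> \<omega> then 1 else 0) \<partial>lborel) = ?\<sigma> \<omega>" for \<omega>
      proof (cases "?\<sigma> \<omega>")
        case (real q)
        have "(\<integral>\<^sup>+r. (if 0 \<le> r \<and> ennreal r < ?\<sigma> \<omega> then 1 else 0) \<partial>lborel) = (\<integral>\<^sup>+r. indicator {0..<q} r \<partial>lborel)"
          using real by (intro nn_integral_cong) (auto simp: indicator_def ennreal_less_iff)
        then show ?thesis using real by simp
      next
        case top
        have "?\<sigma> \<omega> \<le> ennreal T" unfolding seg_length_def by (rule order_trans[OF diff_le_self_ennreal]) simp
        then show ?thesis using top by (simp add: top_unique)
      qed
      have eq: "(\<integral>\<^sup>+\<omega>. seg V F T (Suc n) (w(Suc n := \<omega>)) \<partial>kern n w)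
        = (\<integral>\<^sup>+\<omega>. (\<integral>\<^sup>+r. (if 0 \<le> r \<and> ennreal r < ?\<sigma> \<omega> then F (\<omega> r) else 0) \<partial>lborel) \<partial>P ?y)"
        if F: "F \<in> borel_measurable borel" for F
      proof -
        have "(\<integral>\<^sup>+\<omega>. seg V F T (Suc n) (w(Suc n := \<omega>)) \<partial>kern n w)
          = (\<integral>\<^sup>+\<omega>. seg V F T (Suc n) (w(Suc n := paste t (w n) \<omega>)) \<partial>P ?y)"
          using nn_integral_kern[OF w measurable_compose[OF upd measurable_seg[OF F, of T "Suc n"]], of n] False t by simp
        also have "\<dots> = (\<integral>\<^sup>+\<omega>. (\<integral>\<^sup>+r. (if 0 \<le> r \<and> ennreal r < ?\<sigma> \<omega> then F (\<omega> r) else 0) \<partial>lborel) \<partial>P ?y)"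
          by (intro nn_integral_cong seg_restart[OF w t _ F]) (simp add: space_P)
        finally show ?thesis .
      qed
      have le_occ: "(\<integral>\<^sup>+\<omega>. seg V ?A T (Suc n) (w(Suc n := \<omega>)) \<partial>kern n w) \<le> (\<integral>\<^sup>+\<omega>. occupation_time A (?\<sigma> \<omega>) \<omega> \<partial>P ?y)"
        unfolding eq[OF F] by (intro nn_integral_mono occ)
      have eq1: "(\<integral>\<^sup>+\<omega>. seg V (\<lambda>_. 1) T (Suc n) (w(Suc n := \<omega>)) \<partial>kern n w) = (\<integral>\<^sup>+\<omega>. ?\<sigma> \<omega> \<partial>P ?y)"
        unfolding eq[OF one] by (simp only: len)
      show ?thesis
      proof (cases "(\<integral>\<^sup>+\<omega>. ?\<sigma> \<omega> \<partial>P ?y) = 0")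
        case True
        have "(\<integral>\<^sup>+\<omega>. occupation_time A (?\<sigma> \<omega>) \<omega> \<partial>P ?y) \<le> (\<integral>\<^sup>+\<omega>. ?\<sigma> \<omega> \<partial>P ?y)"
          by (intro nn_integral_mono occupation_time_le)
        then show ?thesis using le_occ True by simp
      next
        case False
        have "(\<integral>\<^sup>+\<omega>. ?\<sigma> \<omega> \<partial>P ?y) \<le> (\<integral>\<^sup>+\<omega>. ennreal T \<partial>P ?y)"
          unfolding seg_length_def by (intro nn_integral_mono order_trans[OF diff_le_self_ennreal]) simp
        then have fin: "(\<integral>\<^sup>+\<omega>. ?\<sigma> \<omega> \<partial>P ?y) < \<infinity>" by (simp add: Py.emeasure_space_1 le_less_trans)
        have pos: "0 < (\<integral>\<^sup>+\<omega>. ?\<sigma> \<omega> \<partial>P ?y)" using False by (simp add: zero_less_iff_neq_zero)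
        have "(\<integral>\<^sup>+\<omega>. occupation_time A (?\<sigma> \<omega>) \<omega> \<partial>P ?y) =
          (\<integral>\<^sup>+\<omega>. occupation_time A (?\<sigma> \<omega>) \<omega> \<partial>P ?y) / (\<integral>\<^sup>+\<omega>. ?\<sigma> \<omega> \<partial>P ?y) * (\<integral>\<^sup>+\<omega>. ?\<sigma> \<omega> \<partial>P ?y)"
          using False fin by (simp add: ennreal_divide_times mult_divide_eq_ennreal)
        also have "\<dots> \<le> e * (\<integral>\<^sup>+\<omega>. ?\<sigma> \<omega> \<partial>P ?y)"
          by (intro mult_right_mono e y st pos fin) simp
        finally show ?thesis using le_occ unfolding eq1 by (rule order_trans[rotated])
      qed
    qed
  qed
  have "(\<integral>\<^sup>+w. seg V ?A T (Suc n) w \<partial>law \<nu>) = (\<integral>\<^sup>+w. (\<integral>\<^sup>+\<omega>. seg V ?A T (Suc n) (w(Suc n := \<omega>)) \<partial>kern n w) \<partial>law \<nu>)"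
    by (rule law_step[OF mA seg_depends])
  also have "\<dots> \<le> (\<integral>\<^sup>+w. e * (\<integral>\<^sup>+\<omega>. seg V (\<lambda>_. 1) T (Suc n) (w(Suc n := \<omega>)) \<partial>kern n w) \<partial>law \<nu>)"
    using step by (intro nn_integral_mono) (simp add: space_law)
  also have "\<dots> = e * (\<integral>\<^sup>+w. (\<integral>\<^sup>+\<omega>. seg V (\<lambda>_. 1) T (Suc n) (w(Suc n := \<omega>)) \<partial>kern n w) \<partial>law \<nu>)"
    by (intro nn_integral_cmult measurable_from_law measurable_step m1)
  also have "\<dots> = e * (\<integral>\<^sup>+w. seg V (\<lambda>_. 1) T (Suc n) w \<partial>law \<nu>)"
    by (simp only: law_step[OF m1 seg_depends])
  finally show ?thesis .
qed

text \<open>Segment 0 is the only one that need not start in \<open>U\<close>, and it is empty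
  because \<open>\<tau> 0 w = 0\<close>. On the others \<open>seg_indicator_le\<close> applies, and
  their lengths add up to \<open>T\<close>.\<close>

lemma controlled_occupation_le:
  assumes A[measurable]: "A \<in> sets borel"
    and e: "\<And>y \<sigma>. y \<in> U \<Longrightarrow> stopping_time path_filtration \<sigma> \<Longrightarrow> 0 < (\<integral>\<^sup>+\<omega>. \<sigma> \<omega> \<partial>P y) \<Longrightarrow> (\<integral>\<^sup>+\<omega>. \<sigma> \<omega> \<partial>P y) < \<infinity> \<Longrightarrow>
      (\<integral>\<^sup>+\<omega>. occupation_time A (\<sigma> \<omega>) \<omega> \<partial>P y) / (\<integral>\<^sup>+\<omega>. \<sigma> \<omega> \<partial>P y) \<le> e"
    and \<tau>0: "\<And>w. \<tau> 0 w = 0" and adm: "AE w in law \<nu>. (\<lambda>i. \<tau> i w) \<longlonglongrightarrow> \<infinity>"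
  shows "(\<integral>\<^sup>+w. (\<integral>\<^sup>+s. (if 0 \<le> s \<and> s < T then indicator A (controlled_process V w s) else 0) \<partial>lborel) \<partial>law \<nu>)
    \<le> e * ennreal T"
proof -
  interpret L: prob_space "law \<nu>" by (rule prob_space_law)
  have whole: "(\<integral>\<^sup>+w. (\<integral>\<^sup>+s. (if 0 \<le> s \<and> s < T then F (controlled_process V w s) else 0) \<partial>lborel) \<partial>law \<nu>)
    = (\<Sum>n. \<integral>\<^sup>+w. seg V F T (Suc n) w \<partial>law \<nu>)" if F: "F \<in> borel_measurable borel" for F :: "'a \<Rightarrow> ennreal"
  proof -
    have "(\<integral>\<^sup>+w. (\<integral>\<^sup>+s. (if 0 \<le> s \<and> s < T then F (controlled_process V w s) else 0) \<partial>lborel) \<partial>law \<nu>)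
      = (\<integral>\<^sup>+w. (\<Sum>n. seg V F T (Suc n) w) \<partial>law \<nu>)"
    proof (rule nn_integral_cong_AE)
      show "AE w in law \<nu>. (\<integral>\<^sup>+s. (if 0 \<le> s \<and> s < T then F (controlled_process V w s) else 0) \<partial>lborel)
        = (\<Sum>n. seg V F T (Suc n) w)"
        using adm AE_space
      proof eventually_elim
        case (elim w)
        then have w: "w \<in> space control_space" by (simp add: space_law)
        have "\<exists>n. ennreal s < \<tau> n w" for s
          using order_tendstoD(1)[OF elim(1), of "ennreal s"] by (auto simp: eventually_sequentially)
        from suminf_seg_eq[OF w F this]
        have "(\<integral>\<^sup>+s. (if 0 \<le> s \<and> s < T then F (controlled_process V w s) else 0) \<partial>lborel) = (\<Sum>n. seg V F T n w)" by simp
        also have "\<dots> = seg V F T 0 w + (\<Sum>n. seg V F T (Suc n) w)" by (rule suminf_ennreal_Suc)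
        also have "seg V F T 0 w = 0" by (simp add: seg_def in_seg_def \<tau>0 cong: if_cong)
        finally show ?case by simp
      qed
    qed
    also have "\<dots> = (\<Sum>n. \<integral>\<^sup>+w. seg V F T (Suc n) w \<partial>law \<nu>)"
      by (intro nn_integral_suminf measurable_from_law measurable_seg F)
    finally show ?thesis .
  qed
  have "(\<Sum>n. \<integral>\<^sup>+w. seg V (indicator A) T (Suc n) w \<partial>law \<nu>)
    \<le> (\<Sum>n. e * (\<integral>\<^sup>+w. seg V (\<lambda>_. 1) T (Suc n) w \<partial>law \<nu>))"
    by (intro suminf_le summableI seg_indicator_le A e)
  also have "\<dots> = e * (\<integral>\<^sup>+w. (\<integral>\<^sup>+s. (if 0 \<le> s \<and> s < T then 1 else 0) \<partial>lborel) \<partial>law \<nu>)"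
    by (subst whole[of "\<lambda>_. 1"]) simp_all
  also have "(\<integral>\<^sup>+s. (if 0 \<le> s \<and> s < T then 1 else 0) \<partial>lborel) = (\<integral>\<^sup>+s. indicator {0..<T} s \<partial>lborel)"
    by (intro nn_integral_cong) (auto simp: indicator_def)
  also have "\<dots> = ennreal T" by (cases "0 \<le> T") (auto simp: ennreal_neg)
  finally show ?thesis by (subst whole) (simp_all add: L.emeasure_space_1)
qed

section \<open>Comparison of two payoffs under the same strategy\<close>

lemma gain_diff_le:
  assumes g1: "g1 \<in> borel_measurable borel" and g2: "g2 \<in> borel_measurable borel" and A[measurable]: "A \<in> sets borel"
    and bd: "\<And>y. \<bar>g2 y\<bar> \<le> a" and b: "0 \<le> b" and le: "\<And>y. g1 y \<le> g2 y + b * indicator A y"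
  shows "gain g1 a T \<le> gain g2 a T +
    ennreal b * (\<integral>\<^sup>+w. (\<integral>\<^sup>+s. (if 0 \<le> s \<and> s < T then indicator A (controlled_process V w s) else 0) \<partial>lborel) \<partial>law \<nu>)"
proof -
  let ?X = "controlled_process V"
  let ?O = "\<lambda>w. \<integral>\<^sup>+s. (if 0 \<le> s \<and> s < T then indicator A (?X w s) else 0) \<partial>lborel"
  let ?Y = "\<lambda>w. \<integral>\<^sup>+s. (if 0 \<le> s \<and> s < T then ennreal (g2 (?X w s) + a) else 0) \<partial>lborel"
  have O: "?O \<in> borel_measurable (law \<nu>)"
  proof -
    have "?O = (\<lambda>w. \<integral>\<^sup>+s. (if 0 \<le> s \<and> s < T then ennreal (indicator A (?X w s) + 0) else 0) \<partial>lborel)"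
      by (intro ext nn_integral_cong) (simp add: ennreal_indicator)
    then show ?thesis using measurable_path_gain[of "indicator A" T 0] by (simp only:) simp
  qed
  have "gain g1 a T \<le> (\<integral>\<^sup>+w. ?Y w + ennreal b * ?O w \<partial>law \<nu>)"
    unfolding gain_def
  proof (rule nn_integral_mono)
    fix w assume "w \<in> space (law \<nu>)"
    then have w: "w \<in> space control_space" by (simp add: space_law)
    have [measurable]: "?X w \<in> borel_measurable borel"
      using measurable_compose[OF _ measurable_controlled, of "\<lambda>s. (w, s)" borel] w by simp
    note [measurable] = g2
    have "(\<integral>\<^sup>+s. (if 0 \<le> s \<and> s < T then ennreal (g1 (?X w s) + a) else 0) \<partial>lborel)
      \<le> (\<integral>\<^sup>+s. (if 0 \<le> s \<and> s < T then ennreal (g2 (?X w s) + a) else 0)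
        + ennreal b * (if 0 \<le> s \<and> s < T then indicator A (?X w s) else 0) \<partial>lborel)"
    proof (intro nn_integral_mono)
      fix s
      have "ennreal (g1 (?X w s) + a) \<le> ennreal ((g2 (?X w s) + a) + b * indicator A (?X w s))"
        using le[of "?X w s"] by (intro ennreal_leI) simp
      also have "\<dots> = ennreal (g2 (?X w s) + a) + ennreal b * indicator A (?X w s)"
        using bd[of "?X w s"] b by (subst ennreal_plus) (auto simp: ennreal_mult ennreal_indicator[symmetric] abs_le_iff)
      finally show "(if 0 \<le> s \<and> s < T then ennreal (g1 (?X w s) + a) else 0)
        \<le> (if 0 \<le> s \<and> s < T then ennreal (g2 (?X w s) + a) else 0)
          + ennreal b * (if 0 \<le> s \<and> s < T then indicator A (?X w s) else 0)" by simp
    qed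
    also have "\<dots> = ?Y w + ennreal b * ?O w"
      by (subst nn_integral_add) (simp_all add: nn_integral_cmult)
    finally show "(\<integral>\<^sup>+s. (if 0 \<le> s \<and> s < T then ennreal (g1 (?X w s) + a) else 0) \<partial>lborel) \<le> ?Y w + ennreal b * ?O w" .
  qed
  also have "\<dots> = gain g2 a T + (\<integral>\<^sup>+w. ennreal b * ?O w \<partial>law \<nu>)"
    unfolding gain_def by (rule nn_integral_add[OF measurable_path_gain[OF g2]])
      (intro borel_measurable_times_ennreal O borel_measurable_const)
  also have "(\<integral>\<^sup>+w. ennreal b * ?O w \<partial>law \<nu>) = ennreal b * (\<integral>\<^sup>+w. ?O w \<partial>law \<nu>)"
    by (rule nn_integral_cmult[OF O])
  finally show ?thesis .
qed

end

lemma ereal_scaled_diff_le: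
  assumes T: "0 < T" and le: "I \<le> J + d * T"
  shows "ereal (1 / T) * (ereal I - C) \<le> ereal (1 / T) * (ereal J - C) + ereal d"
proof (cases C)
  case (real r)
  have "(I - r) / T \<le> (J + d * T - r) / T" using T le by (intro divide_right_mono) auto
  also have "\<dots> = (J - r) / T + d" using T by (simp add: add_divide_distrib diff_divide_distrib)
  finally show ?thesis using real by simp
qed (use T in auto)

text \<open>The costs are the same for both payoffs, so the payoffs can differ by \<open>b\<close>
  only during the proportion \<open>e\<close> of time spent in \<open>A\<close>.\<close>

lemma (in strategy) reward_diff_le:
  assumes g1: "g1 \<in> borel_measurable borel" and g2: "g2 \<in> borel_measurable borel" and A: "A \<in> sets borel"
    and bd1: "\<And>y. \<bar>g1 y\<bar> \<le> a" and bd2: "\<And>y. \<bar>g2 y\<bar> \<le> a"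
    and b: "0 \<le> b" and le: "\<And>y. g1 y \<le> g2 y + b * indicator A y"
    and e: "\<And>y \<sigma>. y \<in> U \<Longrightarrow> stopping_time path_filtration \<sigma> \<Longrightarrow> 0 < (\<integral>\<^sup>+\<omega>. \<sigma> \<omega> \<partial>P y) \<Longrightarrow> (\<integral>\<^sup>+\<omega>. \<sigma> \<omega> \<partial>P y) < \<infinity> \<Longrightarrow>
      (\<integral>\<^sup>+\<omega>. occupation_time A (\<sigma> \<omega>) \<omega> \<partial>P y) / (\<integral>\<^sup>+\<omega>. \<sigma> \<omega> \<partial>P y) \<le> ennreal e"
    and e0: "0 \<le> e" and \<tau>0: "\<And>w. \<tau> 0 w = 0" and adm: "admissible P U x V"
  shows "reward P c g1 x V \<le> reward P c g2 x V + ereal (b * e)"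
proof -
  interpret L: strategy_law P U V "P x" by (rule strategy_law_P)
  let ?C = "\<lambda>T. enn2ereal (\<integral>\<^sup>+w. total_cost c V T w \<partial>control_law P x V)"
  let ?v = "\<lambda>g T. ereal (1 / T) * (ereal (\<integral>w. (LINT s:{0..T}|lborel. g (controlled_process V w s)) \<partial>control_law P x V) - ?C T)"
  have le_v: "?v g1 T \<le> ?v g2 T + ereal (b * e)" if T: "0 < T" for T
  proof -
    have adm': "AE w in law (P x). (\<lambda>i. \<tau> i w) \<longlonglongrightarrow> \<infinity>" using adm unfolding admissible_def control_law_eq by blast
    have "L.gain g1 a T \<le> L.gain g2 a T + ennreal b * (ennreal e * ennreal T)"
    proof (rule order_trans[OF L.gain_diff_le[OF g1 g2 A bd2 b le, of T]], intro add_left_mono mult_left_mono)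
      show "(\<integral>\<^sup>+w. (\<integral>\<^sup>+s. (if 0 \<le> s \<and> s < T then indicator A (controlled_process V w s) else 0) \<partial>lborel) \<partial>law (P x))
        \<le> ennreal e * ennreal T"
        by (rule L.controlled_occupation_le[OF A _ \<tau>0 adm']) (rule e)
    qed simp
    moreover have "L.gain g2 a T = ennreal (enn2real (L.gain g2 a T))"
      using L.gain_le[of g2 a T, OF bd2] T by (intro ennreal_enn2real[symmetric]) (simp add: le_less_trans)
    moreover have "ennreal b * (ennreal e * ennreal T) = ennreal (b * e * T)"
      using b e0 T by (simp add: ennreal_mult mult.assoc)
    ultimately have "L.gain g1 a T \<le> ennreal (enn2real (L.gain g2 a T)) + ennreal (b * e * T)" by metis
    then have "L.gain g1 a T \<le> ennreal (enn2real (L.gain g2 a T) + b * e * T)"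
      using b e0 T by (simp add: ennreal_plus)
    then have "enn2real (L.gain g1 a T) \<le> enn2real (L.gain g2 a T) + b * e * T"
      using b e0 T by (intro enn2real_leI) simp_all
    then have "(\<integral>w. (LINT s:{0..T}|lborel. g1 (controlled_process V w s)) \<partial>control_law P x V)
      \<le> (\<integral>w. (LINT s:{0..T}|lborel. g2 (controlled_process V w s)) \<partial>control_law P x V) + b * e * T"
      using L.integral_controlled[OF g1 bd1, of T] L.integral_controlled[OF g2 bd2, of T] T by (simp add: control_law_eq)
    then show ?thesis by (rule ereal_scaled_diff_le[OF T])
  qed
  have "reward P c g1 x V \<le> Liminf at_top (\<lambda>T. ?v g2 T + ereal (b * e))"
    unfolding reward_def
    by (intro Liminf_mono eventually_mono[OF eventually_gt_at_top[of 0]] le_v)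
  also have "\<dots> = reward P c g2 x V + ereal (b * e)"
    unfolding reward_def by (rule Liminf_add_ereal_right) simp_all
  finally show ?thesis .
qed

section \<open>Truncated payoffs and the theorem\<close>

lemma proximity_bounds: "0 \<le> proximity A x" "proximity A x \<le> 1"
  by (auto simp: proximity_def infdist_nonneg)

lemma measurable_proximity: "proximity A \<in> borel_measurable borel"
proof -
  have "continuous_on UNIV (proximity A)"
    unfolding proximity_def[abs_def] by (cases "A = {}") (auto intro!: continuous_intros)
  then show ?thesis by (rule borel_measurable_continuous_onI)
qed

text \<open>Inside the ball the first proximity is 1; the second is 0 because the complement of the
  ball with radius \<open>N + 1\<close> is at distance at least 1.\<close>

lemma truncated_eq:
  assumes "x \<in> ball z (real N)"
  shows "truncated f z \<eta> N x = f x"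
proof -
  have "infdist x (ball z (real N)) = 0" "ball z (real N) \<noteq> {}" using assms infdist_zero[OF assms] by blast+
  then have "proximity (ball z (real N)) x = 1" by (simp add: proximity_def)
  moreover have "proximity (- ball z (real N + 1)) x = 0"
  proof (cases "- ball z (real N + 1) = {}")
    case False
    have "1 \<le> infdist x (- ball z (real N + 1))"
      unfolding infdist_notempty[OF False]
    proof (rule cINF_greatest[OF False])
      fix y assume "y \<in> - ball z (real N + 1)"
      then show "1 \<le> dist x y" using assms dist_triangle[of z y x] by (simp add: not_less)
    qed
    then show ?thesis by (simp add: proximity_def)
  qed (simp add: proximity_def)
  ultimately show ?thesis by (simp add: truncated_def)
qed

lemma abs_truncated_le:
  assumes "\<bar>f x\<bar> \<le> a"
  shows "\<bar>truncated f z \<eta> N x\<bar> \<le> a + \<bar>\<eta>\<bar>"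
proof -
  have "\<bar>f x * proximity (ball z (real N)) x\<bar> \<le> a * 1" "\<bar>\<eta> * proximity (- ball z (real N + 1)) x\<bar> \<le> \<bar>\<eta>\<bar> * 1"
    unfolding abs_mult abs_of_nonneg[OF proximity_bounds(1)]
    using assms by (intro mult_mono proximity_bounds; simp)+
  then show ?thesis unfolding truncated_def by linarith
qed

lemma measurable_truncated:
  "f \<in> borel_measurable borel \<Longrightarrow> truncated f z \<eta> N \<in> borel_measurable borel"
  unfolding truncated_def[abs_def]
  by (intro borel_measurable_add borel_measurable_times measurable_proximity borel_measurable_const)

lemma truncated_integral_tendsto:
  assumes \<mu>: "prob_space \<mu>" "sets \<mu> = sets borel" and f: "f \<in> borel_measurable borel" and bd: "\<And>x. \<bar>f x\<bar> \<le> a"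
  shows "(\<lambda>N. \<integral>x. truncated f z \<eta> N x \<partial>\<mu>) \<longlonglongrightarrow> (\<integral>x. f x \<partial>\<mu>)"
proof (rule integral_dominated_convergence[where w="\<lambda>_. a + \<bar>\<eta>\<bar>"])
  interpret prob_space \<mu> by (rule \<mu>)
  show "integrable \<mu> (\<lambda>_. a + \<bar>\<eta>\<bar>)" by simp
  show "AE x in \<mu>. (\<lambda>N. truncated f z \<eta> N x) \<longlonglongrightarrow> f x"
  proof (rule AE_I2)
    fix x
    obtain N0 :: nat where "dist z x < real N0" using reals_Archimedean2 by blast
    then have "\<forall>\<^sub>F N in sequentially. truncated f z \<eta> N x = f x"
      by (intro eventually_sequentiallyI[of N0] truncated_eq) simp
    then show "(\<lambda>N. truncated f z \<eta> N x) \<longlonglongrightarrow> f x" by (rule tendsto_eventually)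
  qed
  show "AE x in \<mu>. norm (truncated f z \<eta> N x) \<le> a + \<bar>\<eta>\<bar>" for N
    using abs_truncated_le[where f=f, OF bd] by simp
qed (simp_all add: measurable_cong_sets[OF \<mu>(2) refl] f measurable_truncated)

text \<open>Otherwise the nonnegative function \<open>?s - f\<close> would have integral 0, and
  \<open>f\<close> would equal its norm almost surely.\<close>

lemma integral_less_SUP_abs:
  assumes \<mu>: "prob_space \<mu>" "sets \<mu> = sets borel" and f: "f \<in> borel_measurable borel"
    and bdd: "bdd_above (range (\<lambda>x. \<bar>f x\<bar>))" and nc: "\<nexists>k. AE x in \<mu>. f x = k"
  shows "(\<integral>x. f x \<partial>\<mu>) < (SUP x. \<bar>f x\<bar> :: real)"
proof (rule ccontr)
  interpret prob_space \<mu> by (rule \<mu>)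
  let ?s = "SUP x. \<bar>f x\<bar>"
  assume nless: "\<not> (\<integral>x. f x \<partial>\<mu>) < ?s"
  have le: "\<bar>f x\<bar> \<le> ?s" for x using bdd by (rule cSUP_upper[rotated]) simp
  have fi: "integrable \<mu> f"
    using f le by (intro integrable_const_bound[of _ ?s]) (auto simp: measurable_cong_sets[OF \<mu>(2) refl])
  have nn: "0 \<le> ?s - f x" for x using le[of x] by simp
  have "(\<integral>x. ?s - f x \<partial>\<mu>) = ?s - (\<integral>x. f x \<partial>\<mu>)" using fi by (simp add: prob_space)
  moreover have "0 \<le> (\<integral>x. ?s - f x \<partial>\<mu>)" by (intro Bochner_Integration.integral_nonneg nn)
  ultimately have "(\<integral>x. ?s - f x \<partial>\<mu>) = 0" using nless by simp
  then have "AE x in \<mu>. ?s - f x = 0"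
    using integral_nonneg_eq_0_iff_AE[of \<mu> "\<lambda>x. ?s - f x"] fi nn by simp
  then have "AE x in \<mu>. f x = ?s" by (auto elim: eventually_mono)
  with nc show False by blast
qed

theorem theorem8:
  fixes P :: "'a::metric_space \<Rightarrow> (real \<Rightarrow> 'a) measure"
    and U :: "'a set" and z :: 'a
    and f :: "'a \<Rightarrow> real" and c :: "'a \<Rightarrow> 'a \<Rightarrow> real"
    and \<mu> :: "'a measure"
  assumes "locally compact (UNIV :: 'a set)"
    and "markov_process P"
    and "compact U" and "z \<in> U"
    and "continuous_on UNIV f" and "bounded (range f)"
    and "continuous_on (UNIV \<times> U) (\<lambda>(x, a). c x a)"
    and "cond_A1 P" and "cond_A2 P \<mu>"
    and "cond_B1 c U" and "cond_B2 P c U" and "cond_B3 P U"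
    and "cond_C P U z"
    and "\<nexists>k. AE x in \<mu>. f x = k"
    and "\<exists>y. opt_value P U c f y > ereal (\<integral>x. f x \<partial>\<mu>)"
  shows "(\<exists>k. \<forall>x. opt_value P U c f x = k) \<and>
    (\<exists>\<eta>. (\<integral>x. f x \<partial>\<mu>) < \<eta> \<and> \<eta> < (SUP x. \<bar>f x\<bar>) \<and>
      (\<forall>\<epsilon>>0. \<exists>N>0. \<exists>V. \<forall>x.
         admissible P U x V \<and>
         reward P c (truncated f z \<eta> N) x V = opt_value P U c (truncated f z \<eta> N) x \<and>
         reward P c f x V \<ge> opt_value P U c f x - ereal \<epsilon>))"
proof -
  obtain K h where eb: "ergodic_bound P \<mu> K h" and uK: "\<And>\<Gamma> A. compact \<Gamma> \<Longrightarrow> (\<And>T. 0 \<le> T \<Longrightarrow> A T \<in> sets (path_filtration (ennreal T))) \<Longrightarrow>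
           ((\<lambda>T::real. SUP x\<in>\<Gamma>. emeasure (P x) (A T)) \<longlongrightarrow> 0) at_top \<Longrightarrow>
           ((\<lambda>T. SUP x\<in>\<Gamma>. \<integral>\<^sup>+\<omega>\<in>A T. ennreal (K (\<omega> T)) \<partial>P x) \<longlongrightarrow> 0) at_top"
    using \<open>cond_A2 P \<mu>\<close> unfolding cond_A2_def by blast
  obtain c0 where c0: "c0 < 0" "\<And>x e. e \<in> U \<Longrightarrow> c x e \<le> c0"
    and tri: "\<And>x y y'. y \<in> U \<Longrightarrow> y' \<in> U \<Longrightarrow> c x y' + c y' y \<le> c x y"
    using \<open>cond_B1 c U\<close> unfolding cond_B1_def by blast
  interpret I: impulse_problem P \<mu> K h U z c "- c0"
    by unfold_locales (use assms(2-4,7) eb uK c0 tri in auto)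
  have prob: "prob_space \<mu>" by (rule I.\<mu>.prob_space_axioms)
  have fm: "f \<in> borel_measurable borel" using assms(5) by (rule borel_measurable_continuous_onI)
  let ?s = "SUP x. \<bar>f x\<bar>" and ?m = "\<integral>x. f x \<partial>\<mu>"
  have bdd: "bdd_above (range (\<lambda>x. \<bar>f x\<bar>))"
    using assms(6) by (auto simp: bounded_iff bdd_above_def)
  have fs: "\<bar>f x\<bar> \<le> ?s" for x using bdd by (rule cSUP_upper[rotated]) simp
  \<comment> \<open>The midpoint of an interval that is nonempty by
    \<open>integral_less_SUP_abs\<close>; it is chosen before \<open>\<epsilon>\<close>.\<close>
  define \<eta> where "\<eta> = (?m + ?s) / 2"
  have \<eta>: "?m < \<eta>" "\<eta> < ?s"
    using integral_less_SUP_abs[OF prob I.sets_\<mu> fm bdd assms(14)] by (simp_all add: \<eta>_def)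
  \<comment> \<open>One bound for \<open>f\<close> and all its truncations; the summand 1 makes it
    positive.\<close>
  define a where "a = ?s + \<bar>\<eta>\<bar> + 1"
  have a: "0 < a" using fs[of undefined] by (simp add: a_def)
  have f_le: "\<bar>f x\<bar> \<le> a" for x using fs[of x] by (simp add: a_def)
  let ?g = "truncated f z \<eta>"
  have gm: "?g N \<in> borel_measurable borel" for N by (rule measurable_truncated[OF fm])
  have g_le: "\<bar>?g N x\<bar> \<le> a" for N x using abs_truncated_le[where f=f and z=z and \<eta>=\<eta> and N=N, OF fs[of x]] by (simp add: a_def)
  \<comment> \<open>The payoffs agree inside the ball, and two functions bounded by \<open>a\<close>
    differ by at most \<open>2 * a\<close> outside.\<close>
  have diff: "f x \<le> ?g N x + 2 * a * indicator (- ball z (real N)) x"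
    "?g N x \<le> f x + 2 * a * indicator (- ball z (real N)) x" for N x
    using f_le[of x] g_le[of N x] truncated_eq[of x z N f \<eta>] by (auto simp: indicator_def abs_le_iff)
  have value_le: "opt_value P U c g x \<le> (SUP x. opt_value P U c g x)" for g x by (rule SUP_upper) simp
  obtain y where "ereal ?m < opt_value P U c f y" using assms(15) by blast
  then have "ereal ?m < (SUP x. opt_value P U c f x)" using value_le[of f y] by (rule less_le_trans)
  from I.optimal_strategy_exists[OF fm f_le a this] obtain \<Lambda> V0 where V0: "is_strategy U V0" "\<And>w. fst V0 0 w = 0"
    "\<And>x. admissible P U x V0" "\<And>x. reward P c f x V0 = ereal \<Lambda>" "\<And>x. opt_value P U c f x = ereal \<Lambda>" by blast
  have \<Lambda>: "?m < \<Lambda>" using \<open>ereal ?m < opt_value P U c f y\<close> V0(5)[of y] by simp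
  have "\<exists>N>0. \<exists>V. \<forall>x. admissible P U x V \<and> reward P c (?g N) x V = opt_value P U c (?g N) x \<and>
         reward P c f x V \<ge> opt_value P U c f x - ereal \<epsilon>" if \<epsilon>: "0 < \<epsilon>" for \<epsilon>
  proof -
    \<comment> \<open>The comparison of \<open>f\<close> with \<open>f_N\<close> is used twice, for
      the value and for the strategy, hence \<open>2 * \<delta> \<le> \<epsilon>\<close>. A third of
      the gap keeps the truncated problem in the scope of \<open>optimal_strategy_exists\<close>:
      its value is at least \<open>\<Lambda> - \<delta>\<close>, whereas its mean is below
      \<open>?m + \<delta>\<close>.\<close>
    define \<delta> where "\<delta> = min (\<epsilon> / 2) ((\<Lambda> - ?m) / 3)"
    have \<delta>: "0 < \<delta>" "2 * \<delta> \<le> \<epsilon>" "3 * \<delta> \<le> \<Lambda> - ?m" using \<epsilon> \<Lambda> by (auto simp: \<delta>_def min_def)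
    let ?e = "\<lambda>N. SUP x\<in>U. SUP \<tau>\<in>{\<tau>. stopping_time path_filtration \<tau> \<and>
                   0 < (\<integral>\<^sup>+\<omega>. \<tau> \<omega> \<partial>P x) \<and> (\<integral>\<^sup>+\<omega>. \<tau> \<omega> \<partial>P x) < \<infinity>}.
          (\<integral>\<^sup>+\<omega>. occupation_time (- ball z (real N)) (\<tau> \<omega>) \<omega> \<partial>P x) / (\<integral>\<^sup>+\<omega>. \<tau> \<omega> \<partial>P x)"
    have "\<forall>\<^sub>F N in sequentially. ?e N < ennreal (\<delta> / (2 * a))"
      using \<open>cond_C P U z\<close> \<delta> a unfolding cond_C_def by (intro order_tendstoD(2)) auto
    moreover have "\<forall>\<^sub>F N in sequentially. (\<integral>x. ?g N x \<partial>\<mu>) < ?m + \<delta>"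
      using truncated_integral_tendsto[OF prob I.sets_\<mu> fm fs] \<delta> by (intro order_tendstoD(2)) auto
    moreover have "\<forall>\<^sub>F N :: nat in sequentially. 0 < N" by (rule eventually_gt_at_top)
    ultimately have "\<forall>\<^sub>F N in sequentially. ?e N < ennreal (\<delta> / (2 * a)) \<and> (\<integral>x. ?g N x \<partial>\<mu>) < ?m + \<delta> \<and> 0 < N"
      by eventually_elim simp
    then obtain N where N: "?e N < ennreal (\<delta> / (2 * a))" "(\<integral>x. ?g N x \<partial>\<mu>) < ?m + \<delta>" "0 < N"
      by (auto dest: eventually_happens)
    have e: "(\<integral>\<^sup>+\<omega>. occupation_time (- ball z (real N)) (\<sigma> \<omega>) \<omega> \<partial>P y) / (\<integral>\<^sup>+\<omega>. \<sigma> \<omega> \<partial>P y) \<le> ennreal (\<delta> / (2 * a))"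
      if "y \<in> U" "stopping_time path_filtration \<sigma>" "0 < (\<integral>\<^sup>+\<omega>. \<sigma> \<omega> \<partial>P y)" "(\<integral>\<^sup>+\<omega>. \<sigma> \<omega> \<partial>P y) < \<infinity>" for y \<sigma>
      by (rule order_trans[OF _ less_imp_le[OF N(1)]])
         (rule SUP_upper2[OF that(1)], rule SUP_upper, use that in simp)
    have ball: "- ball z (real N) \<in> sets borel" by simp
    have e0: "0 \<le> \<delta> / (2 * a)" "0 \<le> 2 * a" and eq: "2 * a * (\<delta> / (2 * a)) = \<delta>" using \<delta> a by simp_all
    have close: "reward P c f x V \<le> reward P c (?g N) x V + ereal \<delta>" "reward P c (?g N) x V \<le> reward P c f x V + ereal \<delta>"
      if V: "is_strategy U V" "\<And>w. fst V 0 w = 0" "admissible P U x V" for x V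
    proof -
      interpret strategy P U V by unfold_locales (rule V)
      show "reward P c f x V \<le> reward P c (?g N) x V + ereal \<delta>"
        using reward_diff_le[OF fm gm ball f_le g_le e0(2) diff(1) e e0(1) V(2,3), of c] unfolding eq .
      show "reward P c (?g N) x V \<le> reward P c f x V + ereal \<delta>"
        using reward_diff_le[OF gm fm ball g_le f_le e0(2) diff(2) e e0(1) V(2,3), of c] unfolding eq .
    qed
    have gN: "ereal \<Lambda> \<le> opt_value P U c (?g N) x + ereal \<delta>" for x
    proof -
      have "reward P c (?g N) x V0 \<le> opt_value P U c (?g N) x"
        unfolding opt_value_def using V0(3) by (intro SUP_upper) simp
      then show ?thesis
        using close(1)[OF V0(1,2,3), of x] unfolding V0(4) by (meson add_right_mono order_trans)
    qed
    have "ereal (\<integral>x. ?g N x \<partial>\<mu>) < opt_value P U c (?g N) z"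
    proof (cases "opt_value P U c (?g N) z")
      case (real r)
      then show ?thesis using gN[of z] N(2) \<delta> by simp
    qed (use gN[of z] in auto)
    then have "ereal (\<integral>x. ?g N x \<partial>\<mu>) < (SUP x. opt_value P U c (?g N) x)" using value_le by (rule less_le_trans)
    from I.optimal_strategy_exists[OF gm g_le a this] obtain r V where V: "is_strategy U V" "\<And>w. fst V 0 w = 0"
      "\<And>x. admissible P U x V" "\<And>x. reward P c (?g N) x V = ereal r" "\<And>x. opt_value P U c (?g N) x = ereal r" by blast
    have "\<Lambda> \<le> r + \<delta>" using gN[of z] unfolding V(5) by simp
    then have "ereal \<Lambda> - ereal \<epsilon> \<le> reward P c f x V" for x
      using close(2)[OF V(1,2,3), of x] \<delta> unfolding V(4)
      by (cases "reward P c f x V") auto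
    then show ?thesis using N(3) V(3,4,5) V0(5) by (intro exI[of _ N] conjI exI[of _ V]) auto
  qed
  then show ?thesis using \<eta> V0(5) by blast
qed

end
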